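(* There exists a sequence of unknotted closed polygonal curves $\{K_n\}_{n\ge 1}$ in $\mathbb{R}^3$ having the following properties. (1) $K_n$ contains at most $24n+40$ edges. (2) Any embedded, piecewise-smooth disk spanning $K_n$ intersects the $y$-axis in at least $2^{n-1}$ points. (3) Any embedded PL triangulated disk $D_n$ bounded by $K_n$ contains at least $2^{n-1}$ triangles. (4) Each $K_n$ has length one, and there exists a constant $r_0 > 0$ independent of $n$ such that each $K_n$ is disjoint from the solid cylinder $Cyl(r_0)$ of radius $r_0$ around the $y$-axis.
   Context: Coordinates on $\mathbb{R}^3$ are $(x,y,z)$, and $Cyl(r_0)=\{(x,y,z): x^2+z^2\le r_0^2\}$. A closed polygonal curve is an embedded piecewise-linear simple closed curve in $\mathbb{R}^3$; it is unknotted if it is the boundary of an embedded PL disk in $\mathbb{R}^3$. A disk spans (is bounded by) a closed curve if its boundary is that curve. An embedded PL triangulated disk is an embedded disk that is a finite simplicial complex made of flat triangles. *)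

theory Defs
  imports "HOL-Analysis.Analysis"
begin

fun polygonal_path :: "'a::real_normed_vector list \<Rightarrow> real \<Rightarrow> 'a" where
  "polygonal_path [] = linepath 0 0"
| "polygonal_path [a] = linepath a a"
| "polygonal_path [a, b] = linepath a b"
| "polygonal_path (a # b # c # vs) = linepath a b +++ polygonal_path (b # c # vs)"

text \<open>A closed polygonal curve is given by the cyclic list of its vertices, without
  repeating the first one at the end.\<close>

definition closed_polygon_path :: "'a::real_normed_vector list \<Rightarrow> real \<Rightarrow> 'a" where
  "closed_polygon_path vs = polygonal_path (vs @ [hd vs])"

text \<open>Lists with fewer than three vertices, or with repeated vertices, are excluded because
  the corresponding path is not simple.\<close>

definition closed_polygonal_curve :: "'a::real_normed_vector list \<Rightarrow> bool" where
  "closed_polygonal_curve vs \<longleftrightarrow>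
     simple_path (closed_polygon_path vs) \<and>
     pathfinish (closed_polygon_path vs) = pathstart (closed_polygon_path vs)"

definition polygon_carrier :: "'a::real_normed_vector list \<Rightarrow> 'a set" where
  "polygon_carrier vs = path_image (closed_polygon_path vs)"

definition polygon_edges :: "'a list \<Rightarrow> ('a \<times> 'a) list" where
  "polygon_edges vs = zip vs (rotate1 vs)"

definition polygon_length :: "'a::real_normed_vector list \<Rightarrow> real" where
  "polygon_length vs = (\<Sum>(a, b)\<leftarrow>polygon_edges vs. dist a b)"

text \<open>The boundary of a disk is the image of the unit circle; by invariance of domain it does
  not depend on the chosen homeomorphism.\<close>

definition disk_bounded_by :: "'a::topological_space set \<Rightarrow> 'a set \<Rightarrow> bool" where
  "disk_bounded_by D K \<longleftrightarrow>
     (\<exists>f g. homeomorphism (cball (0::real^2) 1) D f g \<and> f ` sphere 0 1 = K)"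

definition PL_triangulated_disk_bounded_by ::
  "'a::euclidean_space set set \<Rightarrow> 'a set \<Rightarrow> bool" where
  "PL_triangulated_disk_bounded_by \<T> K \<longleftrightarrow>
     simplicial_complex \<T> \<and> disk_bounded_by (\<Union>\<T>) K"

definition triangles :: "'a::euclidean_space set set \<Rightarrow> 'a set set" where
  "triangles \<T> = {T \<in> \<T>. 2 simplex T}"

definition unknotted :: "(real^3) set \<Rightarrow> bool" where
  "unknotted K \<longleftrightarrow> (\<exists>\<T>. PL_triangulated_disk_bounded_by \<T> K)"

primrec Ck_on :: "nat \<Rightarrow> ('a::real_normed_vector \<Rightarrow> 'b::real_normed_vector) \<Rightarrow> 'a set \<Rightarrow> bool" where
  "Ck_on 0 f U \<longleftrightarrow> continuous_on U f"
| "Ck_on (Suc k) f U \<longleftrightarrow>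
     (\<forall>x\<in>U. f differentiable at x) \<and>
     (\<forall>v. Ck_on k (\<lambda>x. frechet_derivative f (at x) v) U)"

text \<open>Meant for open \<open>U\<close> in a finite-dimensional space.\<close>

definition smooth_on_open :: "('a::real_normed_vector \<Rightarrow> 'b::real_normed_vector) \<Rightarrow> 'a set \<Rightarrow> bool" where
  "smooth_on_open f U \<longleftrightarrow> (\<forall>k. Ck_on k f U)"

definition smooth_immersion_on :: "('a::real_normed_vector \<Rightarrow> 'b::real_normed_vector) \<Rightarrow> 'a set \<Rightarrow> bool" where
  "smooth_immersion_on f T \<longleftrightarrow>
     (\<exists>U F. open U \<and> T \<subseteq> U \<and> smooth_on_open F U \<and>
        (\<forall>x\<in>T. F x = f x \<and> inj (frechet_derivative F (at x))))"

text \<open>An embedded piecewise-smooth disk is the image of a topological embedding \<open>f\<close> of a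
  triangulated planar disk that is, on each closed triangle, a smooth immersion up to the
  boundary.  As every triangulated disk has a straight-line planar realization,
  taking the domain in the plane is no restriction.\<close>

definition piecewise_smooth_disk_bounded_by :: "(real^3) set \<Rightarrow> (real^3) set \<Rightarrow> bool" where
  "piecewise_smooth_disk_bounded_by D K \<longleftrightarrow>
     (\<exists>(\<T> :: (real^2) set set) B (f :: real^2 \<Rightarrow> real^3) g.
        PL_triangulated_disk_bounded_by \<T> B \<and>
        homeomorphism (\<Union>\<T>) D f g \<and> f ` B = K \<and>
        (\<forall>T\<in>triangles \<T>. smooth_immersion_on f T))"

definition y_axis :: "(real^3) set" where
  "y_axis = {p. p $ 1 = 0 \<and> p $ 3 = 0}"

definition Cyl :: "real \<Rightarrow> (real^3) set" where
  "Cyl r = {p. (p $ 1)\<^sup>2 + (p $ 3)\<^sup>2 \<le> r\<^sup>2}"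

end

theory Submission
  imports Defs "HOL-Combinatorics.Perm"
begin

text \<open>
  The curve consists of three almost vertical strands and a fourth one that winds many times around two of them, in the
  same way above and below the middle level; in the middle, a slanted line, which a final shear turns into the
  \<open>y\<close>-axis, passes behind two strands and in front of the other two.  Undoing the windings from the middle outwards by
  shears shows that the curve is unknotted.

  For the lower bound, the meridians of the curve and of the line are represented by permutations in such a way that a
  meridian of the line moves at most three points.  Walking once along the curve, close to it and inside a spanning disk
  that meets the line in \<open>m\<close> points, gives a product of \<open>m\<close> conjugates of such meridians, up to a meridian of the curve,
  so it moves at most \<open>3 m\<close> points.  On the other hand the labels of the strands wind up to elements of dihedral type
  whose indices solve a Pell equation, and the commutator that represents the longitude moves exponentially many points.
  No fundamental group is needed: the representation is given by a locally defined cocycle on pairs of points.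

  A triangle meets a line that is generic among the parallels of the axis in at most one point, so the number of triangles
  of a spanning disk is bounded below as well.
\<close>

section \<open>Local systems and their holonomy\<close>

lemmas group_normal = diff_conv_add_uminus minus_add add.assoc minus_minus minus_add_cancel
  add_minus_cancel left_minus right_minus add_0_left add_0_right minus_zero

lemma Bolzano_subintervals [consumes 1, case_names trans local]:
  fixes P :: "real \<Rightarrow> real \<Rightarrow> bool"
  assumes "a \<le> b"
    and trans: "\<And>c d e. a \<le> c \<Longrightarrow> c \<le> d \<Longrightarrow> d \<le> e \<Longrightarrow> e \<le> b \<Longrightarrow> P c d \<Longrightarrow> P d e \<Longrightarrow> P c e"
    and local: "\<And>x. x \<in> {a..b} \<Longrightarrow>
      \<exists>U. open U \<and> x \<in> U \<and> (\<forall>c d. a \<le> c \<and> c \<le> x \<and> x \<le> d \<and> d \<le> b \<and> {c..d} \<subseteq> U \<longrightarrow> P c d)"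
  shows "P a b"
proof -
  define Q where "Q c d \<longleftrightarrow> (a \<le> c \<and> d \<le> b \<longrightarrow> P c d)" for c d
  have "Q a b"
    using assms(1)
  proof (induction rule: Bolzano)
    case (trans c d e)
    then show ?case using assms(2)[of c d e] by (auto simp: Q_def)
  next
    case (local x)
    then obtain U where U: "open U" "x \<in> U"
      "\<And>c d. a \<le> c \<Longrightarrow> c \<le> x \<Longrightarrow> x \<le> d \<Longrightarrow> d \<le> b \<Longrightarrow> {c..d} \<subseteq> U \<Longrightarrow> P c d"
      using assms(3)[of x] by auto
    obtain \<delta> where "\<delta> > 0" "ball x \<delta> \<subseteq> U" using U(1,2) by (meson openE)
    moreover have "Q c d" if "c \<le> x" "x \<le> d" "d - c < \<delta>" for c d
    proof -
      have "{c..d} \<subseteq> ball x \<delta>" using that by (auto simp: dist_real_def)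
      then show ?thesis using U(3)[of c d] that \<open>ball x \<delta> \<subseteq> U\<close> by (auto simp: Q_def)
    qed
    ultimately show ?case by blast
  qed
  then show ?thesis by (simp add: Q_def)
qed

lemma connected_eventually_equivalence:
  fixes R :: "'b::topological_space \<Rightarrow> 'b \<Rightarrow> bool"
  assumes "connected S" "a \<in> S" "b \<in> S"
    and sym: "\<And>x y. R x y \<Longrightarrow> R y x" and trans: "\<And>x y z. R x y \<Longrightarrow> R y z \<Longrightarrow> R x z"
    and local: "\<And>x. x \<in> S \<Longrightarrow> \<forall>\<^sub>F y in nhds x. y \<in> S \<longrightarrow> R x y"
  shows "R a b"
proof (rule connected_equivalence_relation[OF assms(1-3)])
  fix x assume "x \<in> S"
  then obtain U where "open U" "x \<in> U" "\<forall>y\<in>U. y \<in> S \<longrightarrow> R x y"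
    using local[of x] unfolding eventually_nhds by blast
  then show "\<exists>T. openin (top_of_set S) T \<and> x \<in> T \<and> (\<forall>y\<in>T. R x y)"
    using \<open>x \<in> S\<close> by (intro exI[of _ "S \<inter> U"]) auto
qed (use sym trans in blast)+

lemma continuous_on_eventually_nhds:
  assumes "continuous_on T f" "s \<in> T" "\<forall>\<^sub>F y in nhds (f s). P y"
  shows "\<forall>\<^sub>F t in nhds s. t \<in> T \<longrightarrow> P (f t)"
proof -
  obtain B where B: "open B" "f s \<in> B" "\<forall>y\<in>B. P y"
    using assms(3) unfolding eventually_nhds by blast
  obtain U where "open U" "s \<in> U" "\<forall>t\<in>T. t \<in> U \<longrightarrow> f t \<in> B"
    using assms(1,2) B(1,2) unfolding continuous_on_topological by blast
  then show ?thesis using B(3) unfolding eventually_nhds by blast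
qed

text \<open>Off \<open>L\<close>, \<open>\<phi>\<close> is a flat connection; at a point of \<open>L\<close> it is one only up to the group \<open>H p\<close> of local meridians.\<close>

locale local_system =
  fixes \<phi> :: "'a::topological_space \<Rightarrow> 'a \<Rightarrow> 'g::group_add"
    and H :: "'a \<Rightarrow> 'g set" and L :: "'a set"
  assumes cocycle: "\<forall>\<^sub>F p' in nhds p. \<forall>\<^sub>F q in nhds p'. q \<notin> L \<longrightarrow> \<phi> p p' + \<phi> p' q - \<phi> p q \<in> H p"
    and trivial_off_L: "p \<notin> L \<Longrightarrow> H p = {0}"
    and subgroup_zero: "0 \<in> H p"
    and subgroup_add: "a \<in> H p \<Longrightarrow> b \<in> H p \<Longrightarrow> a + b \<in> H p"
    and subgroup_minus: "a \<in> H p \<Longrightarrow> - a \<in> H p"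
    and potential_self: "\<phi> p p = 0"
begin

definition chart :: "'a \<Rightarrow> 'a set" where
  "chart p = interior {p'. \<forall>\<^sub>F q in nhds p'. q \<notin> L \<longrightarrow> \<phi> p p' + \<phi> p' q - \<phi> p q \<in> H p}"

lemma eventually_chart: "\<forall>\<^sub>F p' in nhds p. p' \<in> chart p"
  using cocycle[of p] by (auto simp: chart_def eventually_nhds interior_def)

lemma chart_cocycle:
  "p' \<in> chart p \<Longrightarrow> \<forall>\<^sub>F q in nhds p'. q \<notin> L \<longrightarrow> \<phi> p p' + \<phi> p' q - \<phi> p q \<in> H p"
  using interior_subset unfolding chart_def by fastforce

lemma subgroup_translate:
  assumes "a \<in> H p" "b \<in> H p"
  shows "(\<lambda>h. a + h + b) ` H p = H p"
proof (intro equalityI subsetI)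
  fix h assume "h \<in> H p"
  then have "- a + h + - b \<in> H p" using assms by (intro subgroup_add subgroup_minus)
  moreover have "h = a + (- a + h + - b) + b" by (simp only: group_normal)
  ultimately show "h \<in> (\<lambda>h. a + h + b) ` H p" by blast
qed (use assms subgroup_add in auto)

definition parallel :: "('b::topological_space \<Rightarrow> 'a) \<Rightarrow> 'b set \<Rightarrow> ('b \<Rightarrow> 'g) \<Rightarrow> bool" where
  "parallel \<gamma> T k \<longleftrightarrow> (\<forall>s\<in>T. \<forall>\<^sub>F t in nhds s. t \<in> T \<longrightarrow> k t = k s + \<phi> (\<gamma> s) (\<gamma> t))"

definition clear :: "('b::topological_space \<Rightarrow> 'a) \<Rightarrow> 'b set \<Rightarrow> bool" where
  "clear \<gamma> T \<longleftrightarrow> continuous_on T \<gamma> \<and> \<gamma> ` T \<inter> L = {}"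

lemma clear_subset: "clear \<gamma> T \<Longrightarrow> S \<subseteq> T \<Longrightarrow> clear \<gamma> S"
  unfolding clear_def by (meson continuous_on_subset disjoint_iff image_mono subsetD)

lemma clear_compose: "clear \<gamma> T \<Longrightarrow> continuous_on S e \<Longrightarrow> e ` S \<subseteq> T \<Longrightarrow> clear (\<lambda>s. \<gamma> (e s)) S"
  unfolding clear_def by (auto intro: continuous_on_compose2)

lemma parallel_subset:
  assumes "parallel \<gamma> T k" "S \<subseteq> T"
  shows "parallel \<gamma> S k"
  unfolding parallel_def
proof
  fix s assume "s \<in> S"
  then have "\<forall>\<^sub>F t in nhds s. t \<in> T \<longrightarrow> k t = k s + \<phi> (\<gamma> s) (\<gamma> t)"
    using assms unfolding parallel_def by blast
  then show "\<forall>\<^sub>F t in nhds s. t \<in> S \<longrightarrow> k t = k s + \<phi> (\<gamma> s) (\<gamma> t)"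
    by eventually_elim (use assms(2) in blast)
qed

lemma parallel_cong: "parallel \<gamma> T k \<Longrightarrow> (\<And>t. t \<in> T \<Longrightarrow> k' t = k t) \<Longrightarrow> parallel \<gamma> T k'"
  unfolding parallel_def by (simp cong: imp_cong)

lemma parallel_shift: "parallel \<gamma> T k \<Longrightarrow> parallel \<gamma> T (\<lambda>t. c + k t)"
  by (simp add: parallel_def add.assoc)

lemma parallel_compose:
  assumes "parallel \<gamma> T k" "continuous_on S e" "e ` S \<subseteq> T"
  shows "parallel (\<lambda>s. \<gamma> (e s)) S (\<lambda>s. k (e s))"
  unfolding parallel_def
proof
  fix s assume s: "s \<in> S"
  then have "\<forall>\<^sub>F t in nhds (e s). t \<in> T \<longrightarrow> k t = k (e s) + \<phi> (\<gamma> (e s)) (\<gamma> t)"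
    using assms unfolding parallel_def by blast
  from continuous_on_eventually_nhds[OF assms(2) s this]
  show "\<forall>\<^sub>F t in nhds s. t \<in> S \<longrightarrow> k (e t) = k (e s) + \<phi> (\<gamma> (e s)) (\<gamma> (e t))"
    by eventually_elim (use assms(3) in blast)
qed

lemma parallel_unique:
  assumes "parallel \<gamma> T k" "parallel \<gamma> T k'" "connected T" "s \<in> T" "t \<in> T"
  shows "k t - k' t = k s - k' s"
proof (rule connected_eventually_equivalence[OF assms(3,4,5)])
  fix x assume "x \<in> T"
  then have "\<forall>\<^sub>F y in nhds x. y \<in> T \<longrightarrow> k y = k x + \<phi> (\<gamma> x) (\<gamma> y)"
    "\<forall>\<^sub>F y in nhds x. y \<in> T \<longrightarrow> k' y = k' x + \<phi> (\<gamma> x) (\<gamma> y)"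
    using assms(1,2) unfolding parallel_def by blast+
  then show "\<forall>\<^sub>F y in nhds x. y \<in> T \<longrightarrow> k y - k' y = k x - k' x"
    by eventually_elim (intro impI, drule (1) mp, drule (1) mp, simp only: group_normal)
qed simp_all

lemma parallel_Un:
  assumes "parallel \<gamma> S k" "parallel \<gamma> T k" "closed S" "closed T"
  shows "parallel \<gamma> (S \<union> T) k"
proof -
  have part: "\<forall>\<^sub>F t in nhds s. t \<in> C \<longrightarrow> k t = k s + \<phi> (\<gamma> s) (\<gamma> t)" if "parallel \<gamma> C k" "closed C" for C s
  proof (cases "s \<in> C")
    case False
    then have "\<forall>\<^sub>F t in nhds s. t \<in> - C" using that(2) by (intro eventually_nhds_in_open) auto
    then show ?thesis by eventually_elim simp
  qed (use that(1) in \<open>simp add: parallel_def\<close>)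
  show ?thesis
    unfolding parallel_def
  proof
    fix s
    from part[OF assms(1,3)] part[OF assms(2,4)]
    show "\<forall>\<^sub>F t in nhds s. t \<in> S \<union> T \<longrightarrow> k t = k s + \<phi> (\<gamma> s) (\<gamma> t)"
      by eventually_elim blast
  qed
qed

lemma parallel_glue:
  assumes "parallel \<gamma> S k" "parallel \<gamma> T l" "closed S" "closed T" "connected (S \<inter> T)"
  shows "\<exists>m. parallel \<gamma> (S \<union> T) m"
proof -
  obtain c where c: "k t = c + l t" if "t \<in> S \<inter> T" for t
  proof (cases "S \<inter> T = {}")
    case False
    then obtain s where s: "s \<in> S \<inter> T" by blast
    have "k t = k s - l s + l t" if "t \<in> S \<inter> T" for t
    proof -
      have "k t - l t = k s - l s"
        using assms(1,2) s that by (intro parallel_unique[OF _ _ assms(5)]) (auto elim: parallel_subset)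
      then show ?thesis by (metis diff_add_cancel)
    qed
    then show ?thesis by (rule that)
  qed (use that in blast)
  define m where "m t = (if t \<in> S then k t else c + l t)" for t
  have "parallel \<gamma> S m" by (rule parallel_cong[OF assms(1)]) (simp add: m_def)
  moreover have "parallel \<gamma> T m"
    by (rule parallel_cong[OF parallel_shift[OF assms(2), of c]]) (use c in \<open>auto simp: m_def\<close>)
  ultimately show ?thesis using assms(3,4) by (blast intro: parallel_Un)
qed

lemma clear_chart_cocycle:
  assumes "clear \<gamma> T" "s \<in> T" "\<gamma> s \<in> chart p"
  shows "\<forall>\<^sub>F t in nhds s. t \<in> T \<longrightarrow> \<phi> p (\<gamma> s) + \<phi> (\<gamma> s) (\<gamma> t) - \<phi> p (\<gamma> t) \<in> H p"
proof -
  have "\<forall>\<^sub>F t in nhds s. t \<in> T \<longrightarrow> \<gamma> t \<notin> L \<longrightarrow> \<phi> p (\<gamma> s) + \<phi> (\<gamma> s) (\<gamma> t) - \<phi> p (\<gamma> t) \<in> H p"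
    using assms by (intro continuous_on_eventually_nhds chart_cocycle) (auto simp: clear_def)
  then show ?thesis
    by eventually_elim (use assms(1) in \<open>auto simp: clear_def\<close>)
qed

lemma parallel_in_chart:
  assumes "clear \<gamma> T" "\<gamma> ` T \<subseteq> chart p" "p \<notin> L"
  shows "parallel \<gamma> T (\<lambda>t. \<phi> p (\<gamma> t))"
  unfolding parallel_def
proof
  fix s assume "s \<in> T"
  then have "\<forall>\<^sub>F t in nhds s. t \<in> T \<longrightarrow> \<phi> p (\<gamma> s) + \<phi> (\<gamma> s) (\<gamma> t) - \<phi> p (\<gamma> t) \<in> H p"
    using assms(1,2) by (intro clear_chart_cocycle) auto
  then show "\<forall>\<^sub>F t in nhds s. t \<in> T \<longrightarrow> \<phi> p (\<gamma> t) = \<phi> p (\<gamma> s) + \<phi> (\<gamma> s) (\<gamma> t)"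
    by eventually_elim (simp add: trivial_off_L[OF assms(3)])
qed

lemma parallel_coset:
  assumes "clear \<gamma> T" "\<gamma> ` T \<subseteq> chart p" "connected T" "parallel \<gamma> T k" "s \<in> T" "t \<in> T"
  shows "\<exists>h\<in>H p. k t = k s - \<phi> p (\<gamma> s) + h + \<phi> p (\<gamma> t)"
proof -
  define d where "d x = k x - \<phi> p (\<gamma> x)" for x
  have "- d s + d t \<in> H p"
  proof (rule connected_eventually_equivalence[OF assms(3,5,6)])
    fix x assume x: "x \<in> T"
    have "\<forall>\<^sub>F y in nhds x. y \<in> T \<longrightarrow> \<phi> p (\<gamma> x) + \<phi> (\<gamma> x) (\<gamma> y) - \<phi> p (\<gamma> y) \<in> H p"
      using assms(2) x by (intro clear_chart_cocycle[OF assms(1) x]) auto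
    moreover have "\<forall>\<^sub>F y in nhds x. y \<in> T \<longrightarrow> k y = k x + \<phi> (\<gamma> x) (\<gamma> y)"
      using assms(4) x unfolding parallel_def by blast
    ultimately show "\<forall>\<^sub>F y in nhds x. y \<in> T \<longrightarrow> - d x + d y \<in> H p"
      by eventually_elim (intro impI, drule (1) mp, drule (1) mp, simp only: d_def group_normal)
  next
    show "- d y + d x \<in> H p" if "- d x + d y \<in> H p" for x y
      using subgroup_minus[OF that] by (simp only: group_normal)
    show "- d x + d z \<in> H p" if "- d x + d y \<in> H p" "- d y + d z \<in> H p" for x y z
      using subgroup_add[OF that] by (simp only: group_normal)
  qed
  moreover have "k t = k s - \<phi> p (\<gamma> s) + (- d s + d t) + \<phi> p (\<gamma> t)"
    unfolding d_def by (simp only: group_normal)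
  ultimately show ?thesis by blast
qed

lemma parallel_append_strips:
  fixes \<gamma> :: "'b::t1_space \<times> 'c::t1_space \<Rightarrow> 'a"
  assumes "parallel \<gamma> (S \<times> C) k" "parallel \<gamma> (T \<times> C) l" "S \<inter> T = {d}"
    and "closed S" "closed T" "closed C" "connected C"
  shows "\<exists>m. parallel \<gamma> ((S \<union> T) \<times> C) m"
proof -
  have "(S \<times> C) \<inter> (T \<times> C) = {d} \<times> C" using assms(3) by blast
  then have "connected ((S \<times> C) \<inter> (T \<times> C))" using assms(7) by (simp add: connected_Times)
  from parallel_glue[OF assms(1,2) _ _ this] show ?thesis
    using assms(4-6) by (simp add: closed_Times Sigma_Un_distrib1)
qed

lemma parallel_append_strips_snd:
  fixes \<gamma> :: "'b::t1_space \<times> 'c::t1_space \<Rightarrow> 'a"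
  assumes "parallel \<gamma> (C \<times> S) k" "parallel \<gamma> (C \<times> T) l" "S \<inter> T = {d}"
    and "closed S" "closed T" "closed C" "connected C"
  shows "\<exists>m. parallel \<gamma> (C \<times> (S \<union> T)) m"
proof -
  have "(C \<times> S) \<inter> (C \<times> T) = C \<times> {d}" using assms(3) by blast
  then have "connected ((C \<times> S) \<inter> (C \<times> T))" using assms(7) by (simp add: connected_Times)
  from parallel_glue[OF assms(1,2) _ _ this] show ?thesis
    using assms(4-6) by (simp add: closed_Times Sigma_Un_distrib2)
qed

lemma parallel_exists_near:
  fixes F :: "'b::topological_space \<times> 'c::topological_space \<Rightarrow> 'a"
  assumes "clear F (S \<times> T)" "x \<in> S" "y \<in> T"
  obtains U V where "open U" "open V" "x \<in> U" "y \<in> V"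
    "\<And>S' T'. S' \<subseteq> S \<inter> U \<Longrightarrow> T' \<subseteq> T \<inter> V \<Longrightarrow> \<exists>k. parallel F (S' \<times> T') k"
proof -
  define p where "p = F (x, y)"
  have "p \<notin> L" using assms unfolding clear_def p_def by blast
  have "\<forall>\<^sub>F z in nhds (x, y). z \<in> S \<times> T \<longrightarrow> F z \<in> chart p"
    using assms by (intro continuous_on_eventually_nhds) (auto simp: clear_def p_def eventually_chart)
  then obtain W where W: "open W" "(x, y) \<in> W" "\<forall>z\<in>W. z \<in> S \<times> T \<longrightarrow> F z \<in> chart p"
    unfolding eventually_nhds by blast
  obtain U V where UV: "open U" "open V" "(x, y) \<in> U \<times> V" "U \<times> V \<subseteq> W"
    using open_prod_elim[OF W(1,2)] .
  have "\<exists>k. parallel F (S' \<times> T') k" if "S' \<subseteq> S \<inter> U" "T' \<subseteq> T \<inter> V" for S' T'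
  proof -
    have "clear F (S' \<times> T')" using that by (intro clear_subset[OF assms(1)]) auto
    moreover have "F ` (S' \<times> T') \<subseteq> chart p" using that UV(4) W(3) by blast
    ultimately show ?thesis using parallel_in_chart \<open>p \<notin> L\<close> by blast
  qed
  then show ?thesis using that UV by blast
qed

lemma parallel_exists_thin_rectangle:
  fixes F :: "real \<times> real \<Rightarrow> 'a"
  assumes "clear F ({x1..x2} \<times> {y1..y2})" "x \<in> {x1..x2}" "y1 \<le> y2"
  shows "\<exists>U. open U \<and> x \<in> U \<and> (\<forall>c d. {c..d} \<subseteq> {x1..x2} \<inter> U \<longrightarrow> (\<exists>k. parallel F ({c..d} \<times> {y1..y2}) k))"
  using assms(3)
proof (induction rule: Bolzano_subintervals)
  case (trans e f g)
  then obtain U V where UV: "open U" "x \<in> U" "open V" "x \<in> V"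
    "\<And>c d. {c..d} \<subseteq> {x1..x2} \<inter> U \<Longrightarrow> \<exists>k. parallel F ({c..d} \<times> {e..f}) k"
    "\<And>c d. {c..d} \<subseteq> {x1..x2} \<inter> V \<Longrightarrow> \<exists>k. parallel F ({c..d} \<times> {f..g}) k"
    by blast
  have "\<exists>k. parallel F ({c..d} \<times> {e..g}) k" if cd: "{c..d} \<subseteq> {x1..x2} \<inter> (U \<inter> V)" for c d
  proof -
    have "{e..f} \<union> {f..g} = {e..g}" "{e..f} \<inter> {f..g} = {f}" using trans by auto
    moreover obtain k l where "parallel F ({c..d} \<times> {e..f}) k" "parallel F ({c..d} \<times> {f..g}) l"
      using UV(5)[of c d] UV(6)[of c d] cd by auto
    ultimately show ?thesis
      using parallel_append_strips_snd[of F "{c..d}" "{e..f}" k "{f..g}" l f] by auto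
  qed
  then show ?case using UV by (intro exI[of _ "U \<inter> V"]) auto
next
  case (local y)
  obtain U V where "open U" "open V" "x \<in> U" "y \<in> V"
    "\<And>S' T'. S' \<subseteq> {x1..x2} \<inter> U \<Longrightarrow> T' \<subseteq> {y1..y2} \<inter> V \<Longrightarrow> \<exists>k. parallel F (S' \<times> T') k"
    using parallel_exists_near[OF assms(1,2) local] by metis
  then show ?case
    by (intro exI[of _ V] conjI allI impI exI[of _ U]) auto
qed

lemma parallel_exists_rectangle:
  fixes F :: "real \<times> real \<Rightarrow> 'a"
  assumes "clear F ({x1..x2} \<times> {y1..y2})" "x1 \<le> x2" "y1 \<le> y2"
  shows "\<exists>k. parallel F ({x1..x2} \<times> {y1..y2}) k"
  using assms(2)
proof (induction rule: Bolzano_subintervals)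
  case (trans c d e)
  then have "{c..d} \<union> {d..e} = {c..e}" "{c..d} \<inter> {d..e} = {d}" by auto
  with trans(5,6) show ?case
    using parallel_append_strips[of F "{c..d}" "{y1..y2}" _ "{d..e}"] by (metis closed_real_atLeastAtMost connected_Icc)
next
  case (local x)
  obtain U where "open U" "x \<in> U" "\<forall>c d. {c..d} \<subseteq> {x1..x2} \<inter> U \<longrightarrow> (\<exists>k. parallel F ({c..d} \<times> {y1..y2}) k)"
    using parallel_exists_thin_rectangle[OF assms(1) local assms(3)] by blast
  then show ?case by (intro exI[of _ U]) auto
qed

lemma parallel_exists:
  fixes \<gamma> :: "real \<Rightarrow> 'a"
  assumes "clear \<gamma> {a..b}" "a \<le> b"
  shows "\<exists>k. parallel \<gamma> {a..b} k"
proof -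
  have "clear (\<lambda>z. \<gamma> (fst z)) ({a..b} \<times> {0..0 :: real})"
    using assms(1) by (rule clear_compose) (auto intro!: continuous_intros)
  then obtain k where "parallel (\<lambda>z. \<gamma> (fst z)) ({a..b} \<times> {0..0 :: real}) k"
    using parallel_exists_rectangle assms(2) by blast
  then have "parallel (\<lambda>t. \<gamma> (fst (t, 0 :: real))) {a..b} (\<lambda>t. k (t, 0))"
    by (rule parallel_compose) (auto intro!: continuous_intros)
  then show ?thesis by auto
qed

definition transport :: "(real \<Rightarrow> 'a) \<Rightarrow> real \<Rightarrow> real \<Rightarrow> 'g" where
  "transport \<gamma> a b = (let k = SOME k. parallel \<gamma> {a..b} k in - k a + k b)"

lemma transport_parallel:
  assumes "a \<le> b" "parallel \<gamma> {a..b} k"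
  shows "k b = k a + transport \<gamma> a b"
proof -
  define l where "l = (SOME k. parallel \<gamma> {a..b} k)"
  have "parallel \<gamma> {a..b} l"
    unfolding l_def using someI[of "parallel \<gamma> {a..b}"] assms(2) by simp
  then have "k b - l b = k a - l a"
    using assms by (intro parallel_unique) auto
  then have "k b = k a - l a + l b" by (metis diff_add_cancel)
  then show ?thesis
    by (simp only: transport_def l_def Let_def group_normal)
qed

lemma transport_split:
  assumes "clear \<gamma> {a..c}" "a \<le> b" "b \<le> c"
  shows "transport \<gamma> a c = transport \<gamma> a b + transport \<gamma> b c"
proof -
  obtain k where k: "parallel \<gamma> {a..c} k"
    using parallel_exists[of \<gamma> a c] assms by auto
  have "parallel \<gamma> {a..b} k" "parallel \<gamma> {b..c} k" using assms by (auto intro: parallel_subset[OF k])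
  then have "k c = k a + transport \<gamma> a c" "k b = k a + transport \<gamma> a b" "k c = k b + transport \<gamma> b c"
    using transport_parallel k assms by auto
  then show ?thesis by (simp add: add.assoc)
qed

lemma transport_coset:
  assumes "clear \<gamma> {a..b}" "a \<le> b" "\<gamma> ` {a..b} \<subseteq> chart p"
  shows "\<exists>h\<in>H p. transport \<gamma> a b = - \<phi> p (\<gamma> a) + h + \<phi> p (\<gamma> b)"
proof -
  obtain k where k: "parallel \<gamma> {a..b} k"
    using parallel_exists assms by blast
  obtain h where "h \<in> H p" "k b = k a - \<phi> p (\<gamma> a) + h + \<phi> p (\<gamma> b)"
    using parallel_coset[OF assms(1,3) _ k, of a b] assms(2) by auto
  then have "k a + transport \<gamma> a b = k a + (- \<phi> p (\<gamma> a) + h + \<phi> p (\<gamma> b))"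
    using transport_parallel[OF assms(2) k] by (simp only: group_normal)
  then show ?thesis using \<open>h \<in> H p\<close> by (meson add_left_cancel)
qed

text \<open>The rectangle is traversed counterclockwise, starting from its lower left corner.\<close>

definition holonomy :: "(real \<times> real \<Rightarrow> 'a) \<Rightarrow> real \<Rightarrow> real \<Rightarrow> real \<Rightarrow> real \<Rightarrow> 'g" where
  "holonomy F x1 x2 y1 y2 =
     transport (\<lambda>x. F (x, y1)) x1 x2 + transport (\<lambda>y. F (x2, y)) y1 y2
     - transport (\<lambda>x. F (x, y2)) x1 x2 - transport (\<lambda>y. F (x1, y)) y1 y2"

lemma holonomy_swap: "holonomy (F \<circ> prod.swap) y1 y2 x1 x2 = - holonomy F x1 x2 y1 y2"
  unfolding holonomy_def by (simp only: group_normal o_def swap_simp)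

lemma holonomy_split:
  assumes "clear (\<lambda>x. F (x, y1)) {x1..x3}" "clear (\<lambda>x. F (x, y2)) {x1..x3}" "x1 \<le> x2" "x2 \<le> x3"
  shows "holonomy F x1 x3 y1 y2 =
    transport (\<lambda>x. F (x, y1)) x1 x2 + holonomy F x2 x3 y1 y2 - transport (\<lambda>x. F (x, y1)) x1 x2 + holonomy F x1 x2 y1 y2"
  unfolding holonomy_def transport_split[OF assms(1,3,4)] transport_split[OF assms(2,3,4)]
  by (simp only: group_normal)

lemma holonomy_eq_0:
  assumes "clear F ({x1..x2} \<times> {y1..y2})" "x1 \<le> x2" "y1 \<le> y2"
  shows "holonomy F x1 x2 y1 y2 = 0"
proof -
  obtain k where k: "parallel F ({x1..x2} \<times> {y1..y2}) k"
    using parallel_exists_rectangle[OF assms] by blast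
  have horizontal: "transport (\<lambda>x. F (x, y)) x1 x2 = - k (x1, y) + k (x2, y)" if "y \<in> {y1..y2}" for y
  proof -
    have "parallel (\<lambda>x. F (x, y)) {x1..x2} (\<lambda>x. k (x, y))"
      using k by (rule parallel_compose) (use that in \<open>auto intro!: continuous_intros\<close>)
    from transport_parallel[OF assms(2) this] show ?thesis by (simp only: group_normal)
  qed
  have vertical: "transport (\<lambda>y. F (x, y)) y1 y2 = - k (x, y1) + k (x, y2)" if "x \<in> {x1..x2}" for x
  proof -
    have "parallel (\<lambda>y. F (x, y)) {y1..y2} (\<lambda>y. k (x, y))"
      using k by (rule parallel_compose) (use that in \<open>auto intro!: continuous_intros\<close>)
    from transport_parallel[OF assms(3) this] show ?thesis by (simp only: group_normal)
  qed
  have "y1 \<in> {y1..y2}" "y2 \<in> {y1..y2}" "x1 \<in> {x1..x2}" "x2 \<in> {x1..x2}" using assms(2,3) by auto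
  then show ?thesis
    unfolding holonomy_def by (simp only: horizontal vertical group_normal)
qed

lemma holonomy_coset:
  assumes "clear (\<lambda>x. F (x, y1)) {x1..x2}" "clear (\<lambda>x. F (x, y2)) {x1..x2}"
    and "clear (\<lambda>y. F (x1, y)) {y1..y2}" "clear (\<lambda>y. F (x2, y)) {y1..y2}"
    and "x1 \<le> x2" "y1 \<le> y2" and chart: "F ` ({x1..x2} \<times> {y1..y2}) \<subseteq> chart p"
  shows "\<exists>h\<in>H p. holonomy F x1 x2 y1 y2 = - \<phi> p (F (x1, y1)) + h + \<phi> p (F (x1, y1))"
proof -
  have sides: "(\<lambda>x. F (x, y1)) ` {x1..x2} \<subseteq> chart p" "(\<lambda>x. F (x, y2)) ` {x1..x2} \<subseteq> chart p"
    "(\<lambda>y. F (x1, y)) ` {y1..y2} \<subseteq> chart p" "(\<lambda>y. F (x2, y)) ` {y1..y2} \<subseteq> chart p"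
    using chart assms(5,6) by auto
  obtain b where b: "b \<in> H p" "transport (\<lambda>x. F (x, y1)) x1 x2 = - \<phi> p (F (x1, y1)) + b + \<phi> p (F (x2, y1))"
    using transport_coset[OF assms(1,5) sides(1)] by blast
  obtain t where t: "t \<in> H p" "transport (\<lambda>x. F (x, y2)) x1 x2 = - \<phi> p (F (x1, y2)) + t + \<phi> p (F (x2, y2))"
    using transport_coset[OF assms(2,5) sides(2)] by blast
  obtain l where l: "l \<in> H p" "transport (\<lambda>y. F (x1, y)) y1 y2 = - \<phi> p (F (x1, y1)) + l + \<phi> p (F (x1, y2))"
    using transport_coset[OF assms(3,6) sides(3)] by blast
  obtain r where r: "r \<in> H p" "transport (\<lambda>y. F (x2, y)) y1 y2 = - \<phi> p (F (x2, y1)) + r + \<phi> p (F (x2, y2))"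
    using transport_coset[OF assms(4,6) sides(4)] by blast
  have "b + r + - t + - l \<in> H p"
    by (intro subgroup_add subgroup_minus b t l r)
  moreover have "holonomy F x1 x2 y1 y2 = - \<phi> p (F (x1, y1)) + (b + r + - t + - l) + \<phi> p (F (x1, y1))"
    unfolding holonomy_def b(2) t(2) l(2) r(2) by (simp only: group_normal)
  ultimately show ?thesis by blast
qed

definition coset :: "'g \<Rightarrow> 'a \<Rightarrow> 'a \<Rightarrow> 'g set" where
  "coset c p q = (\<lambda>h. c + h + \<phi> p q) ` H p"

lemma transport_coset_image:
  assumes "clear \<gamma> {a..b}" "a \<le> b" "\<gamma> ` {a..b} \<subseteq> chart p"
  shows "(\<lambda>z. z + transport \<gamma> a b) ` coset c p (\<gamma> a) = coset c p (\<gamma> b)"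
proof -
  obtain g where g: "g \<in> H p" "transport \<gamma> a b = - \<phi> p (\<gamma> a) + g + \<phi> p (\<gamma> b)"
    using transport_coset[OF assms] by blast
  have "(\<lambda>z. z + transport \<gamma> a b) ` coset c p (\<gamma> a) = (\<lambda>h. c + h + \<phi> p (\<gamma> b)) ` (\<lambda>h. 0 + h + g) ` H p"
    unfolding coset_def image_image g(2) by (simp only: group_normal)
  also have "(\<lambda>h. 0 + h + g) ` H p = H p"
    by (rule subgroup_translate[OF subgroup_zero g(1)])
  finally show ?thesis by (simp only: coset_def)
qed

lemma holonomy_coset_loop:
  assumes bottom: "(\<lambda>z. z + transport (\<lambda>x. F (x, y1)) x1 x2) ` coset b p (F (x1, y1)) = coset d q (F (x2, y1))"
    and right: "(\<lambda>z. z + transport (\<lambda>y. F (x2, y)) y1 y2) ` coset d q (F (x2, y1)) = coset d q (F (x2, y2))"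
    and top: "(\<lambda>z. z + transport (\<lambda>x. F (x, y2)) x1 x2) ` coset t p (F (x1, y2)) = coset d q (F (x2, y2))"
    and left: "(\<lambda>z. z + transport (\<lambda>y. F (x1, y)) y1 y2) ` coset t p (F (x1, y1)) = coset t p (F (x1, y2))"
  shows "\<exists>h\<in>H p. holonomy F x1 x2 y1 y2 = - \<phi> p (F (x1, y1)) + (- b + t + h) + \<phi> p (F (x1, y1))"
proof -
  let ?bottom = "transport (\<lambda>x. F (x, y1)) x1 x2" and ?right = "transport (\<lambda>y. F (x2, y)) y1 y2"
    and ?top = "transport (\<lambda>x. F (x, y2)) x1 x2" and ?left = "transport (\<lambda>y. F (x1, y)) y1 y2"
  define z where "z = b + 0 + \<phi> p (F (x1, y1))"
  have "z \<in> coset b p (F (x1, y1))"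
    unfolding z_def coset_def using subgroup_zero by blast
  then have "z + ?bottom + ?right \<in> coset d q (F (x2, y2))"
    unfolding right[symmetric] bottom[symmetric] by blast
  then obtain z' where "z' \<in> coset t p (F (x1, y1))" "z + ?bottom + ?right = z' + ?left + ?top"
    unfolding top[symmetric] left[symmetric] by blast
  then obtain h where h: "h \<in> H p" "z + ?bottom + ?right = t + h + \<phi> p (F (x1, y1)) + ?left + ?top"
    unfolding coset_def by blast
  have "?bottom + ?right = - z + (z + ?bottom + ?right)" by (simp only: group_normal)
  then have "holonomy F x1 x2 y1 y2 = - z + (t + h + \<phi> p (F (x1, y1)) + ?left + ?top) - ?top - ?left"
    unfolding holonomy_def h(2) by simp
  also have "\<dots> = - \<phi> p (F (x1, y1)) + (- b + t + h) + \<phi> p (F (x1, y1))"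
    unfolding z_def by (simp only: group_normal)
  finally show ?thesis using h(1) by blast
qed

definition compatible :: "'a \<Rightarrow> 'g \<Rightarrow> 'a \<Rightarrow> 'g \<Rightarrow> bool" where
  "compatible p c p' c' \<longleftrightarrow> p' \<in> chart p \<and> c' \<in> coset c p p' \<and> H p' = (\<lambda>h. - \<phi> p p' + h + \<phi> p p') ` H p"

lemma coset_rebase:
  assumes "compatible p c p' c'"
  shows "\<forall>\<^sub>F q in nhds p'. q \<notin> L \<longrightarrow> coset c' p' q = coset c p q"
proof -
  have "p' \<in> chart p" and conj: "H p' = (\<lambda>h. - \<phi> p p' + h + \<phi> p p') ` H p"
    using assms by (auto simp: compatible_def)
  obtain a where a: "a \<in> H p" "c' = c + a + \<phi> p p'"
    using assms unfolding compatible_def coset_def by blast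
  from chart_cocycle[OF \<open>p' \<in> chart p\<close>] show ?thesis
  proof (eventually_elim, intro impI)
    fix q assume "q \<notin> L" "q \<notin> L \<longrightarrow> \<phi> p p' + \<phi> p' q - \<phi> p q \<in> H p"
    define b where "b = \<phi> p p' + \<phi> p' q - \<phi> p q"
    have b: "b \<in> H p" using \<open>q \<notin> L\<close> \<open>q \<notin> L \<longrightarrow> _\<close> b_def by blast
    have "coset c' p' q = (\<lambda>h. c + h + \<phi> p q) ` (\<lambda>h. a + h + b) ` H p"
      unfolding coset_def conj image_image a(2) b_def by (simp only: group_normal)
    then show "coset c' p' q = coset c p q"
      unfolding subgroup_translate[OF a(1) b] by (simp only: coset_def)
  qed
qed

end

section \<open>Counting the points where a disk meets the axis\<close>

text \<open>The group at a point of the axis \<open>A\<close> is generated by a meridian and has norm at most \<open>M\<close>; along the curve \<open>K\<close> the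
  groups are conjugate.\<close>

locale meridian_system = local_system \<phi> H "K \<union> A"
  for \<phi> :: "'a::topological_space \<Rightarrow> 'a \<Rightarrow> 'g::group_add" and H K A +
  fixes N :: "'g \<Rightarrow> nat" and M :: nat
  assumes norm_zero: "N 0 = 0"
    and norm_add: "N (a + b) \<le> N a + N b"
    and norm_minus: "N (- a) = N a"
    and norm_conj: "N (- c + a + c) = N a"
    and norm_meridian: "p \<in> A \<Longrightarrow> h \<in> H p \<Longrightarrow> N h \<le> M"
    and curve_conj: "p \<in> K \<Longrightarrow> \<forall>\<^sub>F p' in nhds p. p' \<in> K \<longrightarrow> H p' = (\<lambda>h. - \<phi> p p' + h + \<phi> p p') ` H p"
begin

lemma norm_conj': "N (c + a - c) = N a"
  using norm_conj[of "- c" a] by simp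

definition punctures :: "(real \<times> real \<Rightarrow> 'a) \<Rightarrow> real \<Rightarrow> real \<Rightarrow> real \<Rightarrow> real \<Rightarrow> (real \<times> real) set" where
  "punctures F x1 x2 y1 y2 = {z \<in> {x1..x2} \<times> {y1..y2}. F z \<in> A}"

definition punctured_rectangle :: "(real \<times> real \<Rightarrow> 'a) \<Rightarrow> real \<Rightarrow> real \<Rightarrow> real \<Rightarrow> real \<Rightarrow> bool" where
  "punctured_rectangle F x1 x2 y1 y2 \<longleftrightarrow> x1 \<le> x2 \<and> y1 \<le> y2 \<and>
     continuous_on ({x1..x2} \<times> {y1..y2}) F \<and> F ` ({x1..x2} \<times> {y1..y2}) \<inter> K = {} \<and>
     finite (punctures F x1 x2 y1 y2) \<and> punctures F x1 x2 y1 y2 \<subseteq> {x1<..<x2} \<times> {y1<..<y2}"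

lemma punctures_swap: "punctures (F \<circ> prod.swap) y1 y2 x1 x2 = prod.swap ` punctures F x1 x2 y1 y2"
  by (force simp: punctures_def)

lemma punctured_rectangle_swap:
  assumes "punctured_rectangle F x1 x2 y1 y2"
  shows "punctured_rectangle (F \<circ> prod.swap) y1 y2 x1 x2"
proof -
  have "continuous_on ({y1..y2} \<times> {x1..x2}) (F \<circ> prod.swap)"
    using assms unfolding punctured_rectangle_def
    by (intro continuous_on_compose continuous_intros) (auto elim: continuous_on_subset)
  moreover have "(F \<circ> prod.swap) ` ({y1..y2} \<times> {x1..x2}) = F ` ({x1..x2} \<times> {y1..y2})"
    unfolding image_comp[symmetric] product_swap ..
  ultimately show ?thesis
    using assms unfolding punctured_rectangle_def punctures_swap by auto
qed

lemma punctured_rectangle_sides: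
  assumes "punctured_rectangle F x1 x2 y1 y2"
  shows "clear (\<lambda>x. F (x, y1)) {x1..x2}" "clear (\<lambda>x. F (x, y2)) {x1..x2}"
    "clear (\<lambda>y. F (x1, y)) {y1..y2}" "clear (\<lambda>y. F (x2, y)) {y1..y2}"
proof -
  have side: "clear (\<lambda>t. F (e t)) T"
    if "e ` T \<subseteq> {x1..x2} \<times> {y1..y2} - {x1<..<x2} \<times> {y1<..<y2}" "continuous_on T e" for e and T :: "real set"
    unfolding clear_def
  proof
    show "continuous_on T (\<lambda>t. F (e t))"
      using that assms unfolding punctured_rectangle_def by (auto intro: continuous_on_compose2)
    have "F z \<notin> K \<union> A" if "z \<in> {x1..x2} \<times> {y1..y2} - {x1<..<x2} \<times> {y1<..<y2}" for z
      using that assms unfolding punctured_rectangle_def punctures_def by blast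
    then show "(\<lambda>t. F (e t)) ` T \<inter> (K \<union> A) = {}" using that(1) by blast
  qed
  show "clear (\<lambda>x. F (x, y1)) {x1..x2}" "clear (\<lambda>x. F (x, y2)) {x1..x2}"
    "clear (\<lambda>y. F (x1, y)) {y1..y2}" "clear (\<lambda>y. F (x2, y)) {y1..y2}"
    by (rule side; use assms in \<open>auto simp: punctured_rectangle_def intro!: continuous_intros\<close>)+
qed

lemma punctured_rectangle_split:
  assumes "punctured_rectangle F x1 x3 y1 y2" "x1 \<le> x2" "x2 \<le> x3" "\<And>y. y \<in> {y1..y2} \<Longrightarrow> F (x2, y) \<notin> A"
  shows "punctured_rectangle F x1 x2 y1 y2" "punctured_rectangle F x2 x3 y1 y2"
    "N (holonomy F x1 x3 y1 y2) \<le> N (holonomy F x1 x2 y1 y2) + N (holonomy F x2 x3 y1 y2)"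
    "card (punctures F x1 x3 y1 y2) = card (punctures F x1 x2 y1 y2) + card (punctures F x2 x3 y1 y2)"
proof -
  have union: "punctures F x1 x3 y1 y2 = punctures F x1 x2 y1 y2 \<union> punctures F x2 x3 y1 y2"
    using assms(2,3) unfolding punctures_def by auto
  have off: "x1 < x \<and> x < x3 \<and> x \<noteq> x2 \<and> y1 < y \<and> y < y2" if "(x, y) \<in> punctures F x1 x3 y1 y2" for x y
  proof -
    have "x \<noteq> x2" using that assms(4) unfolding punctures_def by auto
    then show ?thesis using that assms(1) unfolding punctured_rectangle_def by auto
  qed
  have "x1 < x \<and> x < x2 \<and> y1 < y \<and> y < y2" if "(x, y) \<in> punctures F x1 x2 y1 y2" for x y
    using off[of x y] that unfolding union by (simp add: punctures_def)
  moreover have "x2 < x \<and> x < x3 \<and> y1 < y \<and> y < y2" if "(x, y) \<in> punctures F x2 x3 y1 y2" for x y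
    using off[of x y] that unfolding union by (simp add: punctures_def)
  ultimately have "punctures F x1 x2 y1 y2 \<subseteq> {x1<..<x2} \<times> {y1<..<y2}"
    "punctures F x2 x3 y1 y2 \<subseteq> {x2<..<x3} \<times> {y1<..<y2}"
    by auto
  moreover have "{x1..x2} \<times> {y1..y2} \<subseteq> {x1..x3} \<times> {y1..y2}" "{x2..x3} \<times> {y1..y2} \<subseteq> {x1..x3} \<times> {y1..y2}"
    using assms(2,3) by auto
  ultimately show parts: "punctured_rectangle F x1 x2 y1 y2" "punctured_rectangle F x2 x3 y1 y2"
    using assms(1-3) continuous_on_subset unfolding punctured_rectangle_def union by blast+
  show "N (holonomy F x1 x3 y1 y2) \<le> N (holonomy F x1 x2 y1 y2) + N (holonomy F x2 x3 y1 y2)"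
    unfolding holonomy_split[OF punctured_rectangle_sides(1,2)[OF assms(1)] assms(2,3)]
    using norm_add norm_conj' by (metis add.commute)
  have "x = x2" if "(x, y) \<in> punctures F x1 x2 y1 y2" "(x, y) \<in> punctures F x2 x3 y1 y2" for x y
    using that by (simp add: punctures_def)
  then have "punctures F x1 x2 y1 y2 \<inter> punctures F x2 x3 y1 y2 = {}"
    using off unfolding union by auto
  then show "card (punctures F x1 x3 y1 y2) = card (punctures F x1 x2 y1 y2) + card (punctures F x2 x3 y1 y2)"
    unfolding union using parts by (intro card_Un_disjoint) (auto simp: punctured_rectangle_def)
qed

definition holonomy_bounded :: "(real \<times> real \<Rightarrow> 'a) \<Rightarrow> real \<Rightarrow> real \<Rightarrow> real \<Rightarrow> real \<Rightarrow> bool" where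
  "holonomy_bounded F x1 x2 y1 y2 \<longleftrightarrow> N (holonomy F x1 x2 y1 y2) \<le> M * card (punctures F x1 x2 y1 y2)"

lemma holonomy_bounded_swap: "holonomy_bounded (F \<circ> prod.swap) y1 y2 x1 x2 \<longleftrightarrow> holonomy_bounded F x1 x2 y1 y2"
  by (simp add: holonomy_bounded_def holonomy_swap norm_minus punctures_swap card_image)

text \<open>Cutting off two strips on opposite sides, each of which misses some puncture.\<close>

lemma holonomy_bounded_middle:
  assumes rectangle: "punctured_rectangle F x1 x4 y1 y2" and "x1 \<le> x2" "x2 \<le> x3" "x3 \<le> x4"
    and off: "\<And>x y. x \<in> {x2, x3} \<Longrightarrow> y \<in> {y1..y2} \<Longrightarrow> F (x, y) \<notin> A"
    and "punctures F x2 x3 y1 y2 \<noteq> {}"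
    and fewer: "\<And>a b. punctured_rectangle F a b y1 y2 \<Longrightarrow>
      card (punctures F a b y1 y2) < card (punctures F x1 x4 y1 y2) \<Longrightarrow> holonomy_bounded F a b y1 y2"
    and middle: "punctured_rectangle F x2 x3 y1 y2 \<Longrightarrow>
      card (punctures F x2 x3 y1 y2) \<le> card (punctures F x1 x4 y1 y2) \<Longrightarrow> holonomy_bounded F x2 x3 y1 y2"
  shows "holonomy_bounded F x1 x4 y1 y2"
proof -
  have "x2 \<le> x4" using assms by simp
  note left = punctured_rectangle_split[OF rectangle assms(2) \<open>x2 \<le> x4\<close> off[OF insertI1]]
  note right = punctured_rectangle_split[OF left(2) assms(3,4) off[OF insertI2[OF singletonI]]]
  have cards: "card (punctures F x1 x4 y1 y2) =
      card (punctures F x1 x2 y1 y2) + card (punctures F x2 x3 y1 y2) + card (punctures F x3 x4 y1 y2)"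
    using left(4) right(4) by simp
  have "N (holonomy F x1 x4 y1 y2) \<le> N (holonomy F x1 x2 y1 y2) + N (holonomy F x2 x3 y1 y2) + N (holonomy F x3 x4 y1 y2)"
    using left(3) right(3) by simp
  moreover have "0 < card (punctures F x2 x3 y1 y2)"
    using right(1) assms(6) unfolding punctured_rectangle_def by (simp add: card_gt_0_iff)
  then have "holonomy_bounded F x1 x2 y1 y2" "holonomy_bounded F x2 x3 y1 y2" "holonomy_bounded F x3 x4 y1 y2"
    using cards left(1) right(1,2) by (auto intro!: fewer middle)
  ultimately show ?thesis
    unfolding holonomy_bounded_def cards by (simp add: algebra_simps)
qed

lemma puncture_square:
  assumes "punctured_rectangle F x1 x2 y1 y2" "(a, b) \<in> punctures F x1 x2 y1 y2"
  obtains e where "0 < e" "x1 \<le> a - e" "a + e \<le> x2" "y1 \<le> b - e" "b + e \<le> y2"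
    "F ` ({a - e..a + e} \<times> {b - e..b + e}) \<subseteq> chart (F (a, b))"
    "\<And>x y. (x, y) \<in> {x1..x2} \<times> {y1..y2} \<Longrightarrow> \<bar>x - a\<bar> = e \<or> \<bar>y - b\<bar> = e \<Longrightarrow> F (x, y) \<notin> A"
proof -
  let ?R = "{x1..x2} \<times> {y1..y2}"
  have inside: "x1 < a" "a < x2" "y1 < b" "b < y2"
    using assms unfolding punctured_rectangle_def by auto
  have "\<forall>\<^sub>F z in nhds (a, b). z \<in> ?R \<longrightarrow> F z \<in> chart (F (a, b))"
    using assms inside by (intro continuous_on_eventually_nhds) (auto simp: punctured_rectangle_def eventually_chart)
  then obtain U where U: "open U" "(a, b) \<in> U" "\<forall>z\<in>U. z \<in> ?R \<longrightarrow> F z \<in> chart (F (a, b))"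
    unfolding eventually_nhds by blast
  obtain V W where VW: "open V" "open W" "(a, b) \<in> V \<times> W" "V \<times> W \<subseteq> U"
    using open_prod_elim[OF U(1,2)] .
  obtain d where d: "d > 0" "cball a d \<subseteq> V" "cball b d \<subseteq> W"
  proof -
    obtain d1 d2 where "d1 > 0" "cball a d1 \<subseteq> V" "d2 > 0" "cball b d2 \<subseteq> W"
      using VW by (meson mem_Sigma_iff open_contains_cball)
    then show ?thesis by (intro that[of "min d1 d2"]) auto
  qed
  let ?P = "punctures F x1 x2 y1 y2"
  define m where "m = Min {d, a - x1, x2 - a, b - y1, y2 - b}"
  have "infinite ({0<..<m} - ((\<lambda>z. \<bar>fst z - a\<bar>) ` ?P \<union> (\<lambda>z. \<bar>snd z - b\<bar>) ` ?P))"
    using assms(1) d(1) inside unfolding m_def punctured_rectangle_def by (intro Diff_infinite_finite) auto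
  then obtain e where "e \<in> {0<..<m} - ((\<lambda>z. \<bar>fst z - a\<bar>) ` ?P \<union> (\<lambda>z. \<bar>snd z - b\<bar>) ` ?P)"
    using infinite_imp_nonempty by blast
  then have e: "0 < e" "e < Min {d, a - x1, x2 - a, b - y1, y2 - b}" "\<forall>z\<in>?P. e \<noteq> \<bar>fst z - a\<bar> \<and> e \<noteq> \<bar>snd z - b\<bar>"
    by (auto simp: m_def)
  show ?thesis
  proof (rule that[OF e(1)])
    have "{a - e..a + e} \<subseteq> V" "{b - e..b + e} \<subseteq> W"
      using d(2,3) e(2) by (auto simp: subset_iff dist_real_def)
    then have "{a - e..a + e} \<times> {b - e..b + e} \<subseteq> U" using VW(4) by blast
    moreover have "{a - e..a + e} \<times> {b - e..b + e} \<subseteq> ?R" using e(2) by auto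
    ultimately show "F ` ({a - e..a + e} \<times> {b - e..b + e}) \<subseteq> chart (F (a, b))" using U(3) by blast
    show "F (x, y) \<notin> A" if "(x, y) \<in> ?R" "\<bar>x - a\<bar> = e \<or> \<bar>y - b\<bar> = e" for x y
      using e(3) that unfolding punctures_def by auto
  qed (use e(2) in auto)
qed

lemma holonomy_bounded_chart:
  assumes "punctured_rectangle F x1 x2 y1 y2" "p \<in> A" "F ` ({x1..x2} \<times> {y1..y2}) \<subseteq> chart p"
    and "punctures F x1 x2 y1 y2 \<noteq> {}"
  shows "holonomy_bounded F x1 x2 y1 y2"
proof -
  have "\<exists>h\<in>H p. holonomy F x1 x2 y1 y2 = - \<phi> p (F (x1, y1)) + h + \<phi> p (F (x1, y1))"
    by (rule holonomy_coset[OF punctured_rectangle_sides[OF assms(1)] _ _ assms(3)])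
      (use assms(1) in \<open>simp_all add: punctured_rectangle_def\<close>)
  then have "N (holonomy F x1 x2 y1 y2) \<le> M"
    using norm_conj norm_meridian[OF assms(2)] by auto
  also have "M \<le> M * card (punctures F x1 x2 y1 y2)"
    using assms(1,4) by (simp add: punctured_rectangle_def card_gt_0_iff Suc_leI)
  finally show ?thesis by (simp add: holonomy_bounded_def)
qed

lemma holonomy_bounded_strip:
  assumes strip: "punctured_rectangle F x1 x2 y1 y2" and "y1 \<le> y3" "y3 \<le> y4" "y4 \<le> y2" and "p \<in> A"
    and chart: "F ` ({x1..x2} \<times> {y3..y4}) \<subseteq> chart p" and nonempty: "punctures F x1 x2 y3 y4 \<noteq> {}"
    and off: "\<And>x y. x \<in> {x1..x2} \<Longrightarrow> y \<in> {y3, y4} \<Longrightarrow> F (x, y) \<notin> A"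
    and fewer: "\<And>F' a b c d. punctured_rectangle F' a b c d \<Longrightarrow>
      card (punctures F' a b c d) < card (punctures F x1 x2 y1 y2) \<Longrightarrow> holonomy_bounded F' a b c d"
  shows "holonomy_bounded F x1 x2 y1 y2"
proof -
  have "holonomy_bounded (F \<circ> prod.swap) y1 y2 x1 x2"
  proof (rule holonomy_bounded_middle[OF punctured_rectangle_swap[OF strip] assms(2-4)])
    show "punctures (F \<circ> prod.swap) y3 y4 x1 x2 \<noteq> {}"
      unfolding punctures_swap using nonempty by blast
    show "(F \<circ> prod.swap) (y, x) \<notin> A" if "y \<in> {y3, y4}" "x \<in> {x1..x2}" for y x
      using off[OF that(2,1)] by simp
    show "holonomy_bounded (F \<circ> prod.swap) c d x1 x2"
      if "punctured_rectangle (F \<circ> prod.swap) c d x1 x2"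
        "card (punctures (F \<circ> prod.swap) c d x1 x2) < card (punctures (F \<circ> prod.swap) y1 y2 x1 x2)" for c d
      using that by (intro fewer) (simp_all add: punctures_swap card_image)
    assume "punctured_rectangle (F \<circ> prod.swap) y3 y4 x1 x2"
    from punctured_rectangle_swap[OF this] have "punctured_rectangle F x1 x2 y3 y4"
      by (simp add: comp_assoc)
    then show "holonomy_bounded (F \<circ> prod.swap) y3 y4 x1 x2"
      unfolding holonomy_bounded_swap using \<open>p \<in> A\<close> chart nonempty by (rule holonomy_bounded_chart)
  qed
  then show ?thesis by (simp only: holonomy_bounded_swap)
qed

lemma holonomy_bound:
  "punctured_rectangle F x1 x2 y1 y2 \<Longrightarrow> holonomy_bounded F x1 x2 y1 y2"
proof (induction "card (punctures F x1 x2 y1 y2)" arbitrary: F x1 x2 y1 y2 rule: less_induct)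
  case less
  show ?case
  proof (cases "punctures F x1 x2 y1 y2 = {}")
    case True
    then have "clear F ({x1..x2} \<times> {y1..y2})"
      using less.prems unfolding punctured_rectangle_def punctures_def clear_def by blast
    then show ?thesis
      using less.prems by (simp add: holonomy_eq_0 norm_zero punctured_rectangle_def holonomy_bounded_def)
  next
    case False
    then obtain a b where ab: "(a, b) \<in> punctures F x1 x2 y1 y2" by auto
    obtain e where e: "0 < e" "x1 \<le> a - e" "a + e \<le> x2" "y1 \<le> b - e" "b + e \<le> y2"
      and chart: "F ` ({a - e..a + e} \<times> {b - e..b + e}) \<subseteq> chart (F (a, b))"
      and off: "\<And>x y. (x, y) \<in> {x1..x2} \<times> {y1..y2} \<Longrightarrow> \<bar>x - a\<bar> = e \<or> \<bar>y - b\<bar> = e \<Longrightarrow> F (x, y) \<notin> A"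
      using puncture_square[OF less.prems ab] by metis
    have mem: "(a, b) \<in> punctures F (a - e) (a + e) y1 y2" "(a, b) \<in> punctures F (a - e) (a + e) (b - e) (b + e)"
      using ab e unfolding punctures_def by auto
    show ?thesis
    proof (rule holonomy_bounded_middle[OF less.prems e(2) _ e(3)])
      assume strip: "punctured_rectangle F (a - e) (a + e) y1 y2"
        and fewer: "card (punctures F (a - e) (a + e) y1 y2) \<le> card (punctures F x1 x2 y1 y2)"
      have "F (a, b) \<in> A" using ab by (simp add: punctures_def)
      show "holonomy_bounded F (a - e) (a + e) y1 y2"
      proof (rule holonomy_bounded_strip[OF strip e(4) _ e(5) \<open>F (a, b) \<in> A\<close> chart])
        show "punctures F (a - e) (a + e) (b - e) (b + e) \<noteq> {}" using mem(2) by blast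
        show "F (x, y) \<notin> A" if "x \<in> {a - e..a + e}" "y \<in> {b - e, b + e}" for x y
          using that e by (intro off) auto
      qed (use e(1) less.hyps fewer in auto)
    next
      show "F (x, y) \<notin> A" if "x \<in> {a - e, a + e}" "y \<in> {y1..y2}" for x y
        using that e by (intro off) auto
    qed (use mem(1) e(1) less.hyps in auto)
  qed
qed

end

context meridian_system
begin

lemma level_rebase:
  fixes w :: "'b::topological_space \<times> real \<Rightarrow> 'a"
  assumes "continuous_on (S \<times> {0..1}) w" "t \<in> S" "\<forall>\<^sub>F \<eta> in at_right 0. w (t, \<eta>) \<notin> K \<union> A"
    and "compatible p c (w (t, 0)) c'"
  shows "\<forall>\<^sub>F \<eta> in at_right 0. coset c' (w (t, 0)) (w (t, \<eta>)) = coset c p (w (t, \<eta>))"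
proof -
  have "\<forall>\<^sub>F z in nhds (t, 0). z \<in> S \<times> {0..1} \<longrightarrow> (w z \<notin> K \<union> A \<longrightarrow> coset c' (w (t, 0)) (w z) = coset c p (w z))"
    using assms(1,2,4) by (intro continuous_on_eventually_nhds coset_rebase) auto
  moreover have "filterlim (\<lambda>\<eta>. (t, \<eta>)) (nhds (t, 0)) (at_right (0::real))"
    by (intro tendsto_intros)
  ultimately have "\<forall>\<^sub>F \<eta> in at_right 0. (t, \<eta>) \<in> S \<times> {0..1} \<longrightarrow>
      (w (t, \<eta>) \<notin> K \<union> A \<longrightarrow> coset c' (w (t, 0)) (w (t, \<eta>)) = coset c p (w (t, \<eta>)))"
    by (rule eventually_compose_filterlim)
  moreover have "\<forall>\<^sub>F \<eta> in at_right 0. \<eta> \<in> {0<..<1::real}"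
    by (rule eventually_at_right_real) simp
  ultimately show ?thesis
    using assms(3) by eventually_elim (use assms(2) in auto)
qed

definition section_on :: "'a set \<Rightarrow> ('a \<Rightarrow> 'g) \<Rightarrow> bool" where
  "section_on C c \<longleftrightarrow> C \<subseteq> K \<and> (\<forall>p\<in>C. \<forall>\<^sub>F p' in nhds p. p' \<in> K \<longrightarrow> c p' \<in> coset (c p) p p')"

lemma section_on_compatible:
  assumes "section_on C c" "p \<in> C"
  shows "\<forall>\<^sub>F q in nhds p. q \<in> chart p \<and> (q \<in> K \<longrightarrow> compatible p (c p) q (c q))"
proof -
  have "p \<in> K" "\<forall>\<^sub>F q in nhds p. q \<in> K \<longrightarrow> c q \<in> coset (c p) p q"
    using assms by (auto simp: section_on_def)
  from this(2) eventually_chart curve_conj[OF this(1)] show ?thesis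
    by eventually_elim (simp add: compatible_def)
qed

definition transports_section :: "(real \<times> real \<Rightarrow> 'a) \<Rightarrow> ('a \<Rightarrow> 'g) \<Rightarrow> real \<Rightarrow> real \<Rightarrow> bool" where
  "transports_section w c a b \<longleftrightarrow> (\<forall>\<^sub>F \<eta> in at_right 0.
     (\<lambda>z. z + transport (\<lambda>x. w (x, \<eta>)) a b) ` coset (c (w (a, 0))) (w (a, 0)) (w (a, \<eta>)) =
     coset (c (w (b, 0))) (w (b, 0)) (w (b, \<eta>)))"

context
  fixes w :: "real \<times> real \<Rightarrow> 'a" and a b :: real and C :: "'a set" and c :: "'a \<Rightarrow> 'g"
  assumes cont: "continuous_on ({a..b} \<times> {0..1}) w"
    and off: "\<forall>\<^sub>F \<eta> in at_right 0. \<forall>x\<in>{a..b}. w (x, \<eta>) \<notin> K \<union> A"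
    and on_curve: "\<And>x. x \<in> {a..b} \<Longrightarrow> w (x, 0) \<in> C" and sec: "section_on C c"
begin

lemma eventually_clear_level: "\<forall>\<^sub>F \<eta> in at_right 0. \<eta> \<in> {0<..<1} \<and> clear (\<lambda>x. w (x, \<eta>)) {a..b}"
  using off eventually_at_right_real[OF zero_less_one]
proof eventually_elim
  case (elim \<eta>)
  have "continuous_on {a..b} (\<lambda>x. w (x, \<eta>))"
    using elim(2) by (intro continuous_on_compose2[OF cont] continuous_intros) auto
  then show ?case using elim by (auto simp: clear_def)
qed

lemma transports_section_local:
  assumes "x \<in> {a..b}"
  shows "\<exists>U. open U \<and> x \<in> U \<and> (\<forall>d e. a \<le> d \<and> d \<le> x \<and> x \<le> e \<and> e \<le> b \<and> {d..e} \<subseteq> U \<longrightarrow> transports_section w c d e)"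
proof -
  define p where "p = w (x, 0)"
  have "\<forall>\<^sub>F z in nhds (x, 0). z \<in> {a..b} \<times> {0..1} \<longrightarrow> w z \<in> chart p \<and> (w z \<in> K \<longrightarrow> compatible p (c p) (w z) (c (w z)))"
    using assms unfolding p_def
    by (intro continuous_on_eventually_nhds[OF cont] section_on_compatible[OF sec] on_curve) auto
  then obtain W where W: "open W" "(x, 0) \<in> W"
    "\<forall>z\<in>W. z \<in> {a..b} \<times> {0..1} \<longrightarrow> w z \<in> chart p \<and> (w z \<in> K \<longrightarrow> compatible p (c p) (w z) (c (w z)))"
    unfolding eventually_nhds by blast
  obtain U V where UV: "open U" "open V" "(x, 0) \<in> U \<times> V" "U \<times> V \<subseteq> W"
    using open_prod_elim[OF W(1,2)] .
  have rebase: "\<forall>\<^sub>F \<eta> in at_right 0. coset (c (w (t, 0))) (w (t, 0)) (w (t, \<eta>)) = coset (c p) p (w (t, \<eta>))"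
    if t: "t \<in> {a..b} \<inter> U" for t
  proof (rule level_rebase[OF cont])
    show "\<forall>\<^sub>F \<eta> in at_right 0. w (t, \<eta>) \<notin> K \<union> A"
      using off by eventually_elim (use t in blast)
    have "w (t, 0) \<in> K" using on_curve[of t] sec t by (auto simp: section_on_def)
    moreover have "(t, 0) \<in> W" "(t, 0) \<in> {a..b} \<times> {0..1::real}" using UV t by auto
    ultimately show "compatible p (c p) (w (t, 0)) (c (w (t, 0)))" using W(3) by blast
  qed (use t in auto)
  have V: "\<forall>\<^sub>F \<eta> in at_right 0. \<eta> \<in> V"
    using UV(2,3) by (intro topological_tendstoD[OF tendsto_ident_at]) auto
  have "transports_section w c d e" if "a \<le> d" "d \<le> x" "x \<le> e" "e \<le> b" "{d..e} \<subseteq> U" for d e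
  proof -
    have de: "d \<in> {a..b} \<inter> U" "e \<in> {a..b} \<inter> U" using that by auto
    from rebase[OF de(1)] rebase[OF de(2)] V eventually_clear_level show ?thesis
      unfolding transports_section_def
    proof eventually_elim
      case (elim \<eta>)
      have "(t, \<eta>) \<in> W \<inter> {a..b} \<times> {0..1}" if "t \<in> {d..e}" for t
        using that elim(3,4) \<open>{d..e} \<subseteq> U\<close> UV(4) \<open>a \<le> d\<close> \<open>e \<le> b\<close> by auto
      then have "(\<lambda>x. w (x, \<eta>)) ` {d..e} \<subseteq> chart p" using W(3) by blast
      moreover have "clear (\<lambda>x. w (x, \<eta>)) {d..e}"
        by (rule clear_subset[OF conjunct2[OF elim(4)]]) (use that in auto)
      ultimately show ?case
        unfolding elim(1,2) using that by (intro transport_coset_image) auto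
    qed
  qed
  then show ?thesis using UV(1,3) by (intro exI[of _ U]) auto
qed

lemma transport_near_curve: "a \<le> b \<Longrightarrow> transports_section w c a b"
proof (induction rule: Bolzano_subintervals)
  case (trans d e f)
  from trans(5,6) eventually_clear_level show ?case
    unfolding transports_section_def
  proof eventually_elim
    case (elim \<eta>)
    have "transport (\<lambda>x. w (x, \<eta>)) d f = transport (\<lambda>x. w (x, \<eta>)) d e + transport (\<lambda>x. w (x, \<eta>)) e f"
      using trans(1-4) elim(3) by (intro transport_split) (auto intro: clear_subset)
    then show ?case
      unfolding elim(2)[symmetric] elim(1)[symmetric] image_image by (simp only: add.assoc)
  qed
qed (rule transports_section_local)

end

lemma transport_near_side:
  fixes w :: "real \<times> real \<Rightarrow> 'a"
  assumes "x0 \<le> x1" and cont: "continuous_on ({x0..x1} \<times> {0..1}) w"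
    and off: "\<forall>\<^sub>F \<eta> in at_right 0. \<forall>x\<in>{x0..x1}. w (x, \<eta>) \<notin> K \<union> A"
    and on_curve: "\<And>x. x \<in> {x0..x1} \<Longrightarrow> w (x, 0) \<in> C" and sec: "section_on C c"
    and start: "compatible p b (w (x0, 0)) (c (w (x0, 0)))" and finish: "compatible q d (w (x1, 0)) (c (w (x1, 0)))"
  shows "\<forall>\<^sub>F \<eta> in at_right 0. (\<lambda>z. z + transport (\<lambda>x. w (x, \<eta>)) x0 x1) ` coset b p (w (x0, \<eta>)) = coset d q (w (x1, \<eta>))"
proof -
  have ends: "x0 \<in> {x0..x1}" "x1 \<in> {x0..x1}" using assms(1) by auto
  then have "\<forall>\<^sub>F \<eta> in at_right 0. w (x0, \<eta>) \<notin> K \<union> A" "\<forall>\<^sub>F \<eta> in at_right 0. w (x1, \<eta>) \<notin> K \<union> A"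
    using off by (auto elim: eventually_mono)
  note rebase = level_rebase[OF cont ends(1) this(1) start] level_rebase[OF cont ends(2) this(2) finish]
  have "transports_section w c x0 x1"
    by (rule transport_near_curve[OF cont off on_curve sec assms(1)])
  with rebase show ?thesis unfolding transports_section_def by eventually_elim simp
qed

lemma eventually_near_slice:
  fixes F :: "'b::t2_space \<times> 'c::t2_space \<Rightarrow> 'd::topological_space"
  assumes cont: "continuous_on (S \<times> T) F" and "compact S" "compact T" "x0 \<in> S"
    and slice: "\<And>y. y \<in> T \<Longrightarrow> F (x0, y) = p" and P: "\<forall>\<^sub>F q in nhds p. P q"
  shows "\<forall>\<^sub>F x in nhds x0. x \<in> S \<longrightarrow> (\<forall>y\<in>T. P (F (x, y)))"
proof -
  obtain W where W: "open W" "p \<in> W" "\<forall>q\<in>W. P q" using P unfolding eventually_nhds by blast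
  define far where "far = fst ` ((S \<times> T) \<inter> F -` (- W))"
  have "closedin (top_of_set (S \<times> T)) ((S \<times> T) \<inter> F -` (- W))"
    using W(1) by (intro continuous_closedin_preimage[OF cont]) (simp add: closed_Compl)
  then have "compact ((S \<times> T) \<inter> F -` (- W))"
    using compact_Times[OF assms(2,3)] closedin_compact by blast
  then have "compact far" unfolding far_def
    by (intro compact_continuous_image continuous_intros)
  then have "open (- far)" by (simp add: compact_imp_closed open_Compl)
  moreover have "x0 \<notin> far" using slice W(2) by (auto simp: far_def)
  ultimately have "\<forall>\<^sub>F x in nhds x0. x \<in> - far" by (intro eventually_nhds_in_open) auto
  then show ?thesis
  proof eventually_elim
    case (elim x)
    have "F (x, y) \<in> W" if "x \<in> S" "y \<in> T" for y
      using elim that by (force simp: far_def)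
    then show ?case using W(3) by blast
  qed
qed

definition collapsed_square :: "(real \<times> real \<Rightarrow> 'a) \<Rightarrow> 'a \<Rightarrow> 'a \<Rightarrow> bool" where
  "collapsed_square F p0 p1 \<longleftrightarrow> continuous_on ({-1..1} \<times> {-1..1}) F \<and>
     (\<forall>z\<in>{-1<..<1} \<times> {-1<..<1}. F z \<notin> K) \<and>
     (\<forall>x\<in>{-1<..<1}. F (x, -1) \<in> K - {p0} \<and> F (x, 1) \<in> K - {p0}) \<and>
     (\<forall>y\<in>{-1..1}. F (-1, y) = p0 \<and> F (1, y) = p1) \<and> p0 \<in> K \<and> p1 \<in> K - {p0}"

lemma collapsed_square_near_corner:
  assumes F: "collapsed_square F p0 p1" and "\<forall>\<^sub>F q in nhds p0. P q"
  shows "\<forall>\<^sub>F x in at_right (-1). x \<in> {-1<..<1} \<and> (\<forall>y\<in>{-1..1}. P (F (x, y)))"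
proof -
  have "\<forall>\<^sub>F x in nhds (-1). x \<in> {-1..1} \<longrightarrow> (\<forall>y\<in>{-1..1}. P (F (x, y)))"
    by (rule eventually_near_slice[OF _ _ _ _ _ assms(2)]) (use F in \<open>auto simp: collapsed_square_def\<close>)
  then have "\<forall>\<^sub>F x in at_right (-1). x \<in> {-1..1} \<longrightarrow> (\<forall>y\<in>{-1..1}. P (F (x, y)))"
    by (rule filter_leD[OF at_within_le_nhds])
  moreover have "\<forall>\<^sub>F x in at_right (-1). x \<in> {-1<..<1::real}" by (rule eventually_at_right_real) simp
  ultimately show ?thesis by eventually_elim auto
qed

lemma collapsed_square_left_edge:
  assumes F: "collapsed_square F p0 p1" and Z: "finite Z" "\<And>z. z \<in> Z \<Longrightarrow> -1 < fst z"
    and bottom: "\<forall>\<^sub>F x in at_right (-1). c (F (x, -1)) \<in> coset b p0 (F (x, -1))"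
    and top: "\<forall>\<^sub>F x in at_right (-1). c (F (x, 1)) \<in> coset t p0 (F (x, 1))"
  obtains x where "-1 < x" "x < 0" "\<forall>z\<in>Z. x < fst z" "\<forall>y\<in>{-1..1}. F (x, y) \<in> chart p0"
    "compatible p0 b (F (x, -1)) (c (F (x, -1)))" "compatible p0 t (F (x, 1)) (c (F (x, 1)))"
proof -
  have "p0 \<in> K" using F by (simp add: collapsed_square_def)
  with eventually_chart[of p0] have "\<forall>\<^sub>F q in nhds p0. q \<in> chart p0 \<and>
      (q \<in> K \<longrightarrow> H q = (\<lambda>h. - \<phi> p0 q + h + \<phi> p0 q) ` H p0)"
    using curve_conj by (intro eventually_conj)
  from collapsed_square_near_corner[OF F this] bottom top
  have "\<forall>\<^sub>F x in at_right (-1). (\<forall>y\<in>{-1..1}. F (x, y) \<in> chart p0) \<and>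
      compatible p0 b (F (x, -1)) (c (F (x, -1))) \<and> compatible p0 t (F (x, 1)) (c (F (x, 1)))"
  proof eventually_elim
    case (elim x)
    then have "F (x, -1) \<in> K" "F (x, 1) \<in> K" using F by (auto simp: collapsed_square_def)
    then show ?case using elim by (simp add: compatible_def)
  qed
  moreover have "\<forall>\<^sub>F x in at_right (-1). \<forall>z\<in>Z. x < fst z"
    using Z by (intro eventually_ball_finite ballI order_tendstoD(2)[OF tendsto_ident_at]) auto
  moreover have "\<forall>\<^sub>F x in at_right (-1). x \<in> {-1<..<0::real}" by (rule eventually_at_right_real) simp
  ultimately have "\<forall>\<^sub>F x in at_right (-1). -1 < x \<and> x < 0 \<and> (\<forall>z\<in>Z. x < fst z) \<and> (\<forall>y\<in>{-1..1}. F (x, y) \<in> chart p0) \<and>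
      compatible p0 b (F (x, -1)) (c (F (x, -1))) \<and> compatible p0 t (F (x, 1)) (c (F (x, 1)))"
    by eventually_elim simp
  then show ?thesis using that eventually_happens'[OF trivial_limit_at_right_real] by blast
qed

lemma collapsed_square_right_edge:
  assumes F: "collapsed_square F p0 p1" and Z: "finite Z" "\<And>z. z \<in> Z \<Longrightarrow> fst z < 1" and sec: "section_on (K - {p0}) c"
  obtains x where "0 < x" "x < 1" "\<forall>z\<in>Z. fst z < x" "\<forall>y\<in>{-1..1}. F (x, y) \<in> chart p1"
    "compatible p1 (c p1) (F (x, -1)) (c (F (x, -1)))" "compatible p1 (c p1) (F (x, 1)) (c (F (x, 1)))"
proof -
  have "\<forall>\<^sub>F x in nhds 1. x \<in> {-1..1} \<longrightarrow> (\<forall>y\<in>{-1..1}. F (x, y) \<in> chart p1 \<and>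
      (F (x, y) \<in> K \<longrightarrow> compatible p1 (c p1) (F (x, y)) (c (F (x, y)))))"
    by (rule eventually_near_slice[OF _ _ _ _ _ section_on_compatible[OF sec]])
      (use F in \<open>auto simp: collapsed_square_def\<close>)
  then have "\<forall>\<^sub>F x in at_left 1. x \<in> {-1..1} \<longrightarrow> (\<forall>y\<in>{-1..1}. F (x, y) \<in> chart p1 \<and>
      (F (x, y) \<in> K \<longrightarrow> compatible p1 (c p1) (F (x, y)) (c (F (x, y)))))"
    by (rule filter_leD[OF at_within_le_nhds])
  moreover have "\<forall>\<^sub>F x in at_left 1. \<forall>z\<in>Z. fst z < x"
    using Z by (intro eventually_ball_finite ballI order_tendstoD(1)[OF tendsto_ident_at]) auto
  moreover have "\<forall>\<^sub>F x in at_left 1. x \<in> {0<..<1::real}" by (rule eventually_at_left_real) simp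
  ultimately have "\<forall>\<^sub>F x in at_left 1. 0 < x \<and> x < 1 \<and> (\<forall>z\<in>Z. fst z < x) \<and> (\<forall>y\<in>{-1..1}. F (x, y) \<in> chart p1) \<and>
      compatible p1 (c p1) (F (x, -1)) (c (F (x, -1))) \<and> compatible p1 (c p1) (F (x, 1)) (c (F (x, 1)))"
  proof eventually_elim
    case (elim x)
    then have "F (x, -1) \<in> K" "F (x, 1) \<in> K" using F by (auto simp: collapsed_square_def)
    then show ?case using elim by simp
  qed
  then show ?thesis using that eventually_happens'[OF trivial_limit_at_left_real] by blast
qed

lemma collapsed_square_transport:
  assumes F: "collapsed_square F p0 p1" and sec: "section_on (K - {p0}) c"
    and "-1 < x0" "x0 \<le> x1" "x1 < 1" "s = 1 \<or> s = - 1"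
    and start: "compatible p0 b (F (x0, s)) (c (F (x0, s)))" and finish: "compatible p1 d (F (x1, s)) (c (F (x1, s)))"
    and off: "\<forall>\<^sub>F \<eta> in at_right 0. \<forall>x\<in>{x0..x1}. F (x, s * (1 - \<eta>)) \<notin> A"
  shows "\<forall>\<^sub>F \<eta> in at_right 0. (\<lambda>z. z + transport (\<lambda>x. F (x, s * (1 - \<eta>))) x0 x1) ` coset b p0 (F (x0, s * (1 - \<eta>))) =
    coset d p1 (F (x1, s * (1 - \<eta>)))"
proof -
  define w where "w z = F (fst z, s * (1 - snd z))" for z
  have "\<forall>\<^sub>F \<eta> in at_right 0. (\<lambda>z. z + transport (\<lambda>x. w (x, \<eta>)) x0 x1) ` coset b p0 (w (x0, \<eta>)) = coset d p1 (w (x1, \<eta>))"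
  proof (rule transport_near_side[OF assms(4) _ _ _ sec])
    have "continuous_on ({-1..1} \<times> {-1..1}) F" using F by (simp add: collapsed_square_def)
    then show "continuous_on ({x0..x1} \<times> {0..1}) w"
      unfolding w_def using assms(3-6) by (elim continuous_on_compose2) (auto intro!: continuous_intros)
    have "\<forall>\<^sub>F \<eta> in at_right 0. \<eta> \<in> {0<..<1::real}"
      by (rule eventually_at_right_real) simp
    with off show "\<forall>\<^sub>F \<eta> in at_right 0. \<forall>x\<in>{x0..x1}. w (x, \<eta>) \<notin> K \<union> A"
    proof eventually_elim
      case (elim \<eta>)
      then show ?case using F assms(3-6) by (auto simp: w_def collapsed_square_def)
    qed
    show "w (x, 0) \<in> K - {p0}" if "x \<in> {x0..x1}" for x
      using F assms(3-6) that by (auto simp: w_def collapsed_square_def)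
  qed (use start finish in \<open>simp_all add: w_def\<close>)
  then show ?thesis by (simp add: w_def)
qed

lemma holonomy_bound_cosets:
  assumes rectangle: "punctured_rectangle F x0 x1 y0 y1"
    and left: "\<And>y. y \<in> {y0..y1} \<Longrightarrow> F (x0, y) \<in> chart p" and right: "\<And>y. y \<in> {y0..y1} \<Longrightarrow> F (x1, y) \<in> chart q"
    and bottom: "(\<lambda>z. z + transport (\<lambda>x. F (x, y0)) x0 x1) ` coset b p (F (x0, y0)) = coset d q (F (x1, y0))"
    and top: "(\<lambda>z. z + transport (\<lambda>x. F (x, y1)) x0 x1) ` coset t p (F (x0, y1)) = coset d q (F (x1, y1))"
  shows "\<exists>h\<in>H p. N (- b + t + h) \<le> M * card (punctures F x0 x1 y0 y1)"
proof -
  have "y0 \<le> y1" using rectangle by (simp add: punctured_rectangle_def)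
  have "\<exists>h\<in>H p. holonomy F x0 x1 y0 y1 = - \<phi> p (F (x0, y0)) + (- b + t + h) + \<phi> p (F (x0, y0))"
    by (rule holonomy_coset_loop[OF bottom transport_coset_image top transport_coset_image])
      (use punctured_rectangle_sides(3,4)[OF rectangle] \<open>y0 \<le> y1\<close> left right in auto)
  then obtain h where h: "h \<in> H p" "holonomy F x0 x1 y0 y1 = - \<phi> p (F (x0, y0)) + (- b + t + h) + \<phi> p (F (x0, y0))"
    by blast
  have "N (- b + t + h) = N (holonomy F x0 x1 y0 y1)" unfolding h(2) by (rule norm_conj[symmetric])
  then show ?thesis
    using holonomy_bound[OF rectangle] by (intro bexI[OF _ h(1)]) (simp add: holonomy_bounded_def)
qed

lemma collapsed_square_rectangle:
  fixes F :: "real \<times> real \<Rightarrow> 'a"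
  defines "Z \<equiv> {z \<in> {-1<..<1} \<times> {-1<..<1}. F z \<in> A}"
  assumes F: "collapsed_square F p0 p1" and "finite Z" and x: "-1 < x0" "x0 \<le> x1" "x1 < 1" and y: "0 < y" "y < 1"
    and Z: "\<And>z. z \<in> Z \<Longrightarrow> x0 < fst z \<and> fst z < x1 \<and> \<bar>snd z\<bar> < y"
  shows "punctured_rectangle F x0 x1 (- y) y" "punctures F x0 x1 (- y) y = Z"
proof -
  have sub: "{x0..x1} \<times> {- y..y} \<subseteq> {-1<..<1} \<times> {-1<..<1}" "{x0..x1} \<times> {- y..y} \<subseteq> {-1..1} \<times> {-1..1}"
    using x y by auto
  have "z \<in> {x0..x1} \<times> {- y..y}" if "z \<in> Z" for z
    using Z[OF that] by (cases z) auto
  then show eq: "punctures F x0 x1 (- y) y = Z"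
    using sub(1) unfolding punctures_def Z_def by blast
  have "z \<in> {x0<..<x1} \<times> {- y<..<y}" if "z \<in> Z" for z
    using Z[OF that] by (simp add: mem_Times_iff abs_less_iff)
  then have "Z \<subseteq> {x0<..<x1} \<times> {- y<..<y}" by blast
  moreover have "continuous_on ({x0..x1} \<times> {- y..y}) F"
    using F sub(2) by (auto simp: collapsed_square_def elim: continuous_on_subset)
  moreover have "F ` ({x0..x1} \<times> {- y..y}) \<inter> K = {}"
    using F sub(1) unfolding collapsed_square_def by blast
  ultimately show "punctured_rectangle F x0 x1 (- y) y"
    using x y \<open>finite Z\<close> by (simp add: punctured_rectangle_def eq)
qed

lemma eventually_small_level:
  fixes Z :: "(real \<times> real) set"
  assumes "finite Z" "\<And>z. z \<in> Z \<Longrightarrow> \<bar>snd z\<bar> < 1"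
  shows "\<forall>\<^sub>F \<eta> in at_right 0. \<eta> \<in> {0<..<1} \<and> (\<forall>z\<in>Z. \<bar>snd z\<bar> < 1 - \<eta>)"
proof (intro eventually_conj eventually_at_right_real eventually_ball_finite ballI)
  fix z assume "z \<in> Z"
  then have "\<forall>\<^sub>F \<eta> in at_right 0. \<eta> < 1 - \<bar>snd z\<bar>"
    using assms(2) by (intro order_tendstoD(2)[OF tendsto_ident_at]) auto
  then show "\<forall>\<^sub>F \<eta> in at_right 0. \<bar>snd z\<bar> < 1 - \<eta>" by eventually_elim simp
qed (use assms(1) in auto)

text \<open>The value of \<open>c\<close> at \<open>p0\<close> is irrelevant: \<open>b\<close> and \<open>t\<close> are its limits at \<open>p0\<close> along the bottom and the top side.\<close>

theorem square_bound:
  fixes F :: "real \<times> real \<Rightarrow> 'a"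
  defines "Z \<equiv> {z \<in> {-1<..<1} \<times> {-1<..<1}. F z \<in> A}"
  assumes F: "collapsed_square F p0 p1" and "finite Z" and sec: "section_on (K - {p0}) c"
    and bottom: "\<forall>\<^sub>F x in at_right (-1). c (F (x, -1)) \<in> coset b p0 (F (x, -1))"
    and top: "\<forall>\<^sub>F x in at_right (-1). c (F (x, 1)) \<in> coset t p0 (F (x, 1))"
  shows "\<exists>h\<in>H p0. N (- b + t + h) \<le> M * card Z"
proof -
  have Z: "-1 < fst z \<and> fst z < 1 \<and> -1 < snd z \<and> snd z < 1" if "z \<in> Z" for z
    using that by (auto simp: Z_def)
  obtain x0 where x0: "-1 < x0" "x0 < 0" "\<forall>z\<in>Z. x0 < fst z" and near_left: "\<forall>y\<in>{-1..1}. F (x0, y) \<in> chart p0"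
      "compatible p0 b (F (x0, -1)) (c (F (x0, -1)))" "compatible p0 t (F (x0, 1)) (c (F (x0, 1)))"
    using collapsed_square_left_edge[OF F \<open>finite Z\<close> _ bottom top] Z by blast
  obtain x1 where x1: "0 < x1" "x1 < 1" "\<forall>z\<in>Z. fst z < x1" and near_right: "\<forall>y\<in>{-1..1}. F (x1, y) \<in> chart p1"
      "compatible p1 (c p1) (F (x1, -1)) (c (F (x1, -1)))" "compatible p1 (c p1) (F (x1, 1)) (c (F (x1, 1)))"
    using collapsed_square_right_edge[OF F \<open>finite Z\<close> _ sec] Z by blast
  have small: "\<forall>\<^sub>F \<eta> in at_right 0. \<eta> \<in> {0<..<1} \<and> (\<forall>z\<in>Z. \<bar>snd z\<bar> < 1 - \<eta>)"
    using \<open>finite Z\<close> Z by (intro eventually_small_level) (auto simp: abs_less_iff)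
  have off: "\<forall>\<^sub>F \<eta> in at_right 0. \<forall>x\<in>{x0..x1}. F (x, s * (1 - \<eta>)) \<notin> A" if "s = 1 \<or> s = - 1" for s
    using small
  proof (eventually_elim, intro ballI)
    fix \<eta> x :: real assume \<eta>: "\<eta> \<in> {0<..<1} \<and> (\<forall>z\<in>Z. \<bar>snd z\<bar> < 1 - \<eta>)" and "x \<in> {x0..x1}"
    then have "(x, s * (1 - \<eta>)) \<in> {-1<..<1} \<times> {-1<..<1}" using x0 x1 that by auto
    moreover have "(x, s * (1 - \<eta>)) \<notin> Z" using \<eta> that by force
    ultimately show "F (x, s * (1 - \<eta>)) \<notin> A" by (simp add: Z_def)
  qed
  have "x0 \<le> x1" using x0 x1 by simp
  note rectangles = collapsed_square_rectangle[OF F, folded Z_def, OF \<open>finite Z\<close> x0(1) this x1(2)]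
  note transport = collapsed_square_transport[OF F sec x0(1) \<open>x0 \<le> x1\<close> x1(2)]
  have "\<forall>\<^sub>F \<eta> in at_right (0::real). (\<exists>h\<in>H p0. N (- b + t + h) \<le> M * card Z)"
    using small transport[of "-1", OF _ near_left(2) near_right(2) off, simplified]
      transport[of 1, OF _ near_left(3) near_right(3) off, simplified]
  proof eventually_elim
    case (elim \<eta>)
    have rectangle: "punctured_rectangle F x0 x1 (- (1 - \<eta>)) (1 - \<eta>)" "punctures F x0 x1 (- (1 - \<eta>)) (1 - \<eta>) = Z"
      by (rule rectangles; use elim(1) x0(3) x1(3) in force)+
    show ?case
      unfolding rectangle(2)[symmetric]
      by (rule holonomy_bound_cosets[OF rectangle(1), of p0 p1 b "c p1" t])
        (use elim near_left(1) near_right(1) in auto)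
  qed
  then show ?thesis by simp
qed

end

definition square_to_disk :: "real \<times> real \<Rightarrow> real^2" where
  "square_to_disk z = vector [fst z, snd z * sqrt (1 - (fst z)\<^sup>2)]"

lemma square_to_disk_nth [simp]: "square_to_disk z $ 1 = fst z" "square_to_disk z $ 2 = snd z * sqrt (1 - (fst z)\<^sup>2)"
  by (simp_all add: square_to_disk_def)

lemma continuous_square_to_disk: "continuous_on S square_to_disk"
  unfolding continuous_on_def
proof (intro ballI vec_tendstoI)
  fix z :: "real \<times> real" and i :: 2
  have "\<forall>i. ((\<lambda>z. square_to_disk z $ i) \<longlongrightarrow> square_to_disk z $ i) (at z within S)"
    by (simp add: forall_2) (intro conjI tendsto_intros)
  then show "((\<lambda>z. square_to_disk z $ i) \<longlongrightarrow> square_to_disk z $ i) (at z within S)" ..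
qed

lemma norm_vec_2: "norm v = sqrt ((v $ 1)\<^sup>2 + (v $ 2)\<^sup>2)" for v :: "real^2"
  by (simp add: norm_vec_def L2_set_def sum_2)

lemma norm_square_to_disk:
  assumes "\<bar>x\<bar> \<le> 1"
  shows "norm (square_to_disk (x, y)) = sqrt (1 - (1 - x\<^sup>2) * (1 - y\<^sup>2))"
proof -
  have "x\<^sup>2 \<le> 1" using assms by (simp add: abs_square_le_1)
  then show ?thesis
    by (simp add: norm_vec_2 power_mult_distrib algebra_simps)
qed

lemma square_to_disk_cball: "\<bar>x\<bar> \<le> 1 \<Longrightarrow> \<bar>y\<bar> \<le> 1 \<Longrightarrow> square_to_disk (x, y) \<in> cball 0 1"
  by (simp add: norm_square_to_disk abs_square_le_1)

lemma square_to_disk_ball: "\<bar>x\<bar> < 1 \<Longrightarrow> \<bar>y\<bar> < 1 \<Longrightarrow> square_to_disk (x, y) \<in> ball 0 1"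
  by (simp add: norm_square_to_disk abs_square_less_1)

lemma square_to_disk_sphere: "\<bar>x\<bar> \<le> 1 \<Longrightarrow> \<bar>y\<bar> = 1 \<Longrightarrow> square_to_disk (x, y) \<in> sphere 0 1"
  by (auto simp: norm_square_to_disk abs_if split: if_splits)

lemma square_to_disk_inj: "inj_on square_to_disk ({-1<..<1} \<times> UNIV)"
proof (rule inj_onI, clarify)
  fix x y x' y' :: real
  assume x: "x \<in> {-1<..<1}" "x' \<in> {-1<..<1}" and eq: "square_to_disk (x, y) = square_to_disk (x', y')"
  have "x = x'" using arg_cong[OF eq, of "\<lambda>v. v $ 1"] by simp
  moreover have "x\<^sup>2 < 1" using x by (simp add: abs_square_less_1 abs_less_iff)
  ultimately show "x = x' \<and> y = y'" using arg_cong[OF eq, of "\<lambda>v. v $ 2"] by simp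
qed

lemma sphere_square_to_disk:
  assumes "v \<in> sphere 0 1"
  shows "v = square_to_disk (v $ 1, 1) \<or> v = square_to_disk (v $ 1, -1)"
proof -
  have "(v $ 1)\<^sup>2 + (v $ 2)\<^sup>2 = 1" using assms by (simp add: norm_vec_2)
  then have "\<bar>v $ 2\<bar> = sqrt (1 - (v $ 1)\<^sup>2)" by (simp flip: real_sqrt_abs)
  then show ?thesis by (auto simp: vec_eq_iff forall_2 abs_if split: if_splits)
qed

lemma disk_bounded_by_base_point:
  fixes K :: "'a::topological_space set"
  assumes "disk_bounded_by D K" "p \<in> K" "norm (u :: real^2) = 1"
  obtains f g where "homeomorphism (cball (0 :: real^2) 1) D f g" "f ` sphere 0 1 = K" "f u = p"
proof -
  obtain f g where fg: "homeomorphism (cball (0 :: real^2) 1) D f g" "f ` sphere 0 1 = K"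
    using assms(1) by (auto simp: disk_bounded_by_def)
  obtain v where v: "norm v = 1" "f v = p" using assms(2) fg(2) by auto
  obtain r where r: "orthogonal_transformation r" "r u = v"
    using rotation_exists_1[of u v] assms(3) v(1) by auto
  have inv: "orthogonal_transformation (inv r)"
    using r(1) by (rule orthogonal_transformation_inv)
  have "bij r" using r(1) by (rule orthogonal_transformation_bij)
  have "homeomorphism (cball 0 1) (cball 0 1) r (inv r)"
  proof (rule homeomorphismI)
    show "continuous_on (cball 0 1) r" "continuous_on (cball 0 1) (inv r)"
      using r(1) inv by (auto simp: linear_continuous_on linear_conv_bounded_linear
        dest: orthogonal_transformation_linear)
    show "r ` cball 0 1 \<subseteq> cball 0 1" "inv r ` cball 0 1 \<subseteq> cball 0 1"
      using r(1) inv by (auto simp: orthogonal_transformation_norm)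
  qed (use \<open>bij r\<close> in \<open>simp_all add: bij_is_inj bij_is_surj surj_f_inv_f\<close>)
  from homeomorphism_compose[OF this fg(1)]
  have "homeomorphism (cball 0 1) D (f \<circ> r) (inv r \<circ> g)" .
  moreover have "r ` sphere 0 1 = sphere 0 1"
  proof
    show "sphere 0 1 \<subseteq> r ` sphere 0 1"
    proof
      fix v :: "real^2" assume "v \<in> sphere 0 1"
      then have "inv r v \<in> sphere 0 1" using inv by (simp add: orthogonal_transformation_norm)
      moreover have "v = r (inv r v)" using \<open>bij r\<close> by (simp add: bij_is_surj surj_f_inv_f)
      ultimately show "v \<in> r ` sphere 0 1" by blast
    qed
  qed (use r(1) in \<open>auto simp: orthogonal_transformation_norm\<close>)
  ultimately show ?thesis using that fg(2) r(2) v(2) by (metis comp_apply image_comp)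
qed

context meridian_system
begin

lemma disk_collapsed_square:
  assumes hom: "homeomorphism (cball 0 1) D f g" "f ` sphere 0 1 = K"
  shows "collapsed_square (\<lambda>z. f (square_to_disk z)) (f (vector [-1, 0])) (f (vector [1, 0]))"
proof -
  have cont: "continuous_on (cball 0 1) f" and inj: "inj_on f (cball 0 1)"
    using hom(1) by (auto simp: homeomorphism_def intro: inj_on_inverseI)
  have corners: "square_to_disk (-1, y) = vector [-1, 0]" "square_to_disk (1, y) = vector [1, 0]" for y
    by (simp_all add: vec_eq_iff forall_2)
  have sphere: "vector [-1, 0] \<in> sphere (0 :: real^2) 1" "vector [1, 0] \<in> sphere (0 :: real^2) 1"
    by (simp_all add: norm_vec_2)
  have "continuous_on ({-1..1} \<times> {-1..1}) (\<lambda>z. f (square_to_disk z))"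
    using continuous_square_to_disk
    by (rule continuous_on_compose2[OF cont]) (auto simp del: mem_cball intro!: square_to_disk_cball)
  moreover have "f v \<notin> K" if "v \<in> ball 0 1" for v
    using that inj_on_image_mem_iff[OF inj, of v "sphere 0 1"] hom(2) by auto
  then have "f (square_to_disk z) \<notin> K" if "z \<in> {-1<..<1} \<times> {-1<..<1}" for z
    using that square_to_disk_ball[of "fst z" "snd z"] by (simp add: mem_Times_iff abs_less_iff)
  moreover have "f (square_to_disk (x, y)) \<in> K - {f (vector [-1, 0])}" if "x \<in> {-1<..<1}" "\<bar>y\<bar> = 1" for x y
  proof -
    have s: "square_to_disk (x, y) \<in> sphere 0 1" using that by (intro square_to_disk_sphere) auto
    have "square_to_disk (x, y) \<noteq> vector [-1, 0]" using that(1) by (auto simp: vec_eq_iff forall_2)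
    then have "f (square_to_disk (x, y)) \<noteq> f (vector [-1, 0])"
      using inj_onD[OF inj] s sphere(1) by fastforce
    then show ?thesis using s hom(2) by blast
  qed
  moreover have "f (vector [1, 0]) \<in> K - {f (vector [-1, 0])}"
  proof -
    have "vector [1, 0] \<noteq> (vector [-1, 0] :: real^2)" by (simp add: vec_eq_iff forall_2)
    then have "f (vector [1, 0]) \<noteq> f (vector [-1, 0])" using inj_onD[OF inj] sphere by fastforce
    then show ?thesis using sphere hom(2) by blast
  qed
  ultimately show ?thesis
    using sphere hom(2) unfolding collapsed_square_def by (auto simp: corners simp del: mem_sphere)
qed

lemma disk_punctures:
  assumes hom: "homeomorphism (cball 0 1) D f g" and fin: "finite (D \<inter> A)"
  defines "Z \<equiv> {z \<in> {-1<..<1} \<times> {-1<..<1}. f (square_to_disk z) \<in> A}"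
  shows "finite Z" "card Z \<le> card (D \<inter> A)"
proof -
  have "inj_on f (cball 0 1)" "f ` cball 0 1 = D"
    using hom by (auto simp: homeomorphism_def intro: inj_on_inverseI)
  moreover have sub: "square_to_disk ` Z \<subseteq> cball 0 1"
    unfolding Z_def by (auto simp del: mem_cball intro!: square_to_disk_cball)
  ultimately have "inj_on (f \<circ> square_to_disk) Z" "(f \<circ> square_to_disk) ` Z \<subseteq> D \<inter> A"
    unfolding Z_def
    by (auto intro!: comp_inj_on inj_on_subset[OF square_to_disk_inj] intro: inj_on_subset
      simp: image_subset_iff simp del: mem_cball)
  then show "finite Z" "card Z \<le> card (D \<inter> A)"
    using inj_on_finite card_inj_on_le fin by blast+
qed

lemma disk_boundary_reaches:
  assumes hom: "homeomorphism (cball 0 1) D f g" "f ` sphere 0 1 = K" and lim: "f (vector [-1, 0]) islimpt K \<inter> U"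
  shows "\<not> (\<forall>\<^sub>F x in at_right (-1). f (square_to_disk (x, -1)) \<notin> U \<and> f (square_to_disk (x, 1)) \<notin> U)"
proof
  assume "\<forall>\<^sub>F x in at_right (-1). f (square_to_disk (x, -1)) \<notin> U \<and> f (square_to_disk (x, 1)) \<notin> U"
  then obtain e where e: "-1 < e" "\<And>x. -1 < x \<Longrightarrow> x < e \<Longrightarrow> f (square_to_disk (x, -1)) \<notin> U \<and> f (square_to_disk (x, 1)) \<notin> U"
    unfolding eventually_at_right_field by blast
  let ?p = "f (vector [-1, 0])"
  have base: "vector [-1, 0] \<in> cball (0 :: real^2) 1" by (simp add: norm_vec_2)
  have "continuous_on D g" "?p \<in> D" "g ?p = vector [-1, 0]"
    using hom(1) base by (auto simp: homeomorphism_def)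
  moreover have "open {v :: real^2. v $ 1 < e}" by (intro open_Collect_less continuous_intros)
  then have "\<forall>\<^sub>F v in nhds (vector [-1, 0]). v \<in> {v :: real^2. v $ 1 < e}"
    using e(1) by (intro eventually_nhds_in_open) auto
  ultimately have "\<forall>\<^sub>F p in nhds ?p. p \<in> D \<longrightarrow> g p $ 1 < e"
    using continuous_on_eventually_nhds[of D g ?p "\<lambda>v. v $ 1 < e"] by simp
  then obtain V where V: "open V" "?p \<in> V" "\<And>p. p \<in> V \<Longrightarrow> p \<in> D \<Longrightarrow> g p $ 1 < e"
    unfolding eventually_nhds by blast
  obtain p where p: "p \<in> K \<inter> U" "p \<in> V" "p \<noteq> ?p"
    using islimptE[OF lim V(2,1)] by blast
  then obtain v where v: "v \<in> sphere 0 1" "f v = p" using hom(2) by blast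
  then have gv: "g p = v" and "p \<in> D" using hom(1) by (auto simp: homeomorphism_def)
  have "v $ 1 \<noteq> -1"
  proof
    assume "v $ 1 = -1"
    then have "v = vector [-1, 0]" using sphere_square_to_disk[OF v(1)] by (auto simp: vec_eq_iff forall_2)
    then show False using v(2) p(3) by simp
  qed
  moreover have "\<bar>v $ 1\<bar> \<le> 1" using component_le_norm_cart[of v 1] v(1) by simp
  ultimately have "-1 < v $ 1" "v $ 1 < e" using V(3)[OF p(2) \<open>p \<in> D\<close>] gv by auto
  from e(2)[OF this] show False using sphere_square_to_disk[OF v(1)] v(2) p(1) by auto
qed

lemma collapsed_square_side_in_one:
  assumes F: "collapsed_square F p0 p1" and U: "open U1" "open U2" "U1 \<inter> U2 = {}"
    and cover: "\<forall>\<^sub>F p in nhds p0. p \<in> K - {p0} \<longrightarrow> p \<in> U1 \<union> U2" and s: "s = 1 \<or> s = - 1"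
  shows "(\<forall>\<^sub>F x in at_right (-1). F (x, s) \<in> U1 - U2) \<or> (\<forall>\<^sub>F x in at_right (-1). F (x, s) \<in> U2 - U1)"
proof -
  have side: "F (x, s) \<in> K - {p0}" if "x \<in> {-1<..<1}" for x
    using F s that by (auto simp: collapsed_square_def)
  have "\<forall>\<^sub>F x in at_right (-1). x < 1 \<and> F (x, s) \<in> U1 \<union> U2"
    using collapsed_square_near_corner[OF F cover]
  proof eventually_elim
    case (elim x)
    moreover have "s \<in> {-1..1}" using s by auto
    ultimately have "F (x, s) \<in> K - {p0} \<longrightarrow> F (x, s) \<in> U1 \<union> U2" by blast
    then show ?case using side elim by auto
  qed
  then obtain e where e: "-1 < e" "\<And>x. x \<in> {-1<..<e} \<Longrightarrow> x < 1 \<and> F (x, s) \<in> U1 \<union> U2"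
    unfolding eventually_at_right_field by auto
  have cont: "continuous_on ({-1..1} \<times> {-1..1}) F" using F by (simp add: collapsed_square_def)
  have "(\<lambda>x. (x, s)) ` {-1<..<e} \<subseteq> {-1..1} \<times> {-1..1}" using e(2) s by fastforce
  then have "continuous_on {-1<..<e} (\<lambda>x. F (x, s))"
    by (intro continuous_on_compose2[OF cont]) (auto intro!: continuous_intros)
  then have "connected ((\<lambda>x. F (x, s)) ` {-1<..<e})"
    by (intro connected_continuous_image) auto
  moreover have sub: "(\<lambda>x. F (x, s)) ` {-1<..<e} \<subseteq> U1 \<union> U2" using e(2) by blast
  ultimately have "U1 \<inter> (\<lambda>x. F (x, s)) ` {-1<..<e} = {} \<or> U2 \<inter> (\<lambda>x. F (x, s)) ` {-1<..<e} = {}"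
    using U(3) by (intro connectedD[OF _ U(1,2)]) auto
  then have one: "(\<forall>x\<in>{-1<..<e}. F (x, s) \<in> U1 - U2) \<or> (\<forall>x\<in>{-1<..<e}. F (x, s) \<in> U2 - U1)"
    using sub by blast
  have "\<forall>\<^sub>F x in at_right (-1). F (x, s) \<in> V" if "\<forall>x\<in>{-1<..<e}. F (x, s) \<in> V" for V
    using eventually_at_right_real[OF e(1)] by (rule eventually_mono) (rule that[rule_format])
  with one show ?thesis by blast
qed

lemma disk_bound_sides:
  assumes hom: "homeomorphism (cball 0 1) D f g" "f ` sphere 0 1 = K" and fin: "finite (D \<inter> A)"
    and p0: "f (vector [-1, 0]) = p0" and sec: "section_on (K - {p0}) c"
    and bottom: "\<forall>\<^sub>F x in at_right (-1). c (f (square_to_disk (x, -1))) \<in> coset b p0 (f (square_to_disk (x, -1)))"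
    and top: "\<forall>\<^sub>F x in at_right (-1). c (f (square_to_disk (x, 1))) \<in> coset t p0 (f (square_to_disk (x, 1)))"
  shows "\<exists>h\<in>H p0. N (- b + t + h) \<le> M * card (D \<inter> A)"
proof -
  note punctures = disk_punctures[OF hom(1) fin]
  from square_bound[OF disk_collapsed_square[OF hom, unfolded p0] punctures(1) sec bottom top] show ?thesis
    using mult_le_mono2[OF punctures(2), of M] by (meson order_trans)
qed

lemma disk_boundary_branches:
  assumes hom: "homeomorphism (cball 0 1) D f g" "f ` sphere 0 1 = K" and p0: "f (vector [-1, 0]) = p0"
    and U: "open U1" "open U2" "U1 \<inter> U2 = {}" "\<forall>\<^sub>F p in nhds p0. p \<in> K - {p0} \<longrightarrow> p \<in> U1 \<union> U2"
    and lim: "p0 islimpt K \<inter> U1" "p0 islimpt K \<inter> U2"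
  shows "(\<forall>\<^sub>F x in at_right (-1). f (square_to_disk (x, -1)) \<in> U1) \<and>
    (\<forall>\<^sub>F x in at_right (-1). f (square_to_disk (x, 1)) \<in> U2) \<or>
    (\<forall>\<^sub>F x in at_right (-1). f (square_to_disk (x, -1)) \<in> U2) \<and>
      (\<forall>\<^sub>F x in at_right (-1). f (square_to_disk (x, 1)) \<in> U1)"
proof -
  define F where "F z = f (square_to_disk z)" for z
  note one = collapsed_square_side_in_one[OF disk_collapsed_square[OF hom, unfolded p0] U, folded F_def]
  note reach = disk_boundary_reaches[OF hom, unfolded p0, folded F_def]
  have "\<not> ((\<forall>\<^sub>F x in at_right (-1). F (x, -1) \<in> V - V') \<and> (\<forall>\<^sub>F x in at_right (-1). F (x, 1) \<in> V - V'))"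
    if "p0 islimpt K \<inter> V'" for V V'
  proof
    assume "(\<forall>\<^sub>F x in at_right (-1). F (x, -1) \<in> V - V') \<and> (\<forall>\<^sub>F x in at_right (-1). F (x, 1) \<in> V - V')"
    then have "\<forall>\<^sub>F x in at_right (-1). F (x, -1) \<in> V - V' \<and> F (x, 1) \<in> V - V'"
      by (simp only: eventually_conj_iff)
    then have "\<forall>\<^sub>F x in at_right (-1). F (x, -1) \<notin> V' \<and> F (x, 1) \<notin> V'"
      by eventually_elim simp
    then show False using reach[OF that] by blast
  qed
  moreover have "\<forall>\<^sub>F x in at_right (-1). F (x, s) \<in> V" if "\<forall>\<^sub>F x in at_right (-1). F (x, s) \<in> V - V'" for s V V'
    using that by eventually_elim simp
  ultimately show ?thesis using one[of 1] one[of "-1"] lim unfolding F_def by blast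
qed

text \<open>The two branches of the curve at \<open>p0\<close> are separated by \<open>U1\<close> and \<open>U2\<close>; the section \<open>c\<close> need not be continued
  across \<open>p0\<close>, and its failure to do so is the holonomy along the curve.\<close>

theorem disk_bound:
  assumes disk: "disk_bounded_by D K" and fin: "finite (D \<inter> A)" and p0: "p0 \<in> K" and sec: "section_on (K - {p0}) c"
    and U: "open U1" "open U2" "U1 \<inter> U2 = {}" "\<forall>\<^sub>F p in nhds p0. p \<in> K - {p0} \<longrightarrow> p \<in> U1 \<union> U2"
    and c1: "\<forall>\<^sub>F p in nhds p0. p \<in> K \<inter> U1 \<longrightarrow> c p \<in> coset c1 p0 p"
    and c2: "\<forall>\<^sub>F p in nhds p0. p \<in> K \<inter> U2 \<longrightarrow> c p \<in> coset c2 p0 p"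
    and lim: "p0 islimpt K \<inter> U1" "p0 islimpt K \<inter> U2"
  shows "\<exists>h\<in>H p0. N (- c1 + c2 + h) \<le> M * card (D \<inter> A)"
proof -
  obtain f g where hom: "homeomorphism (cball (0 :: real^2) 1) D f g" "f ` sphere 0 1 = K"
    and base: "f (vector [-1, 0]) = p0"
    by (rule disk_bounded_by_base_point[OF disk p0, of "vector [-1, 0]"]) (simp add: norm_vec_2)
  note corner = collapsed_square_near_corner[OF disk_collapsed_square[OF hom, unfolded base]]
  have side: "\<forall>\<^sub>F x in at_right (-1). c (f (square_to_disk (x, s))) \<in> coset d p0 (f (square_to_disk (x, s)))"
    if near: "\<forall>\<^sub>F p in nhds p0. p \<in> K \<inter> V \<longrightarrow> c p \<in> coset d p0 p"
      and inside: "\<forall>\<^sub>F x in at_right (-1). f (square_to_disk (x, s)) \<in> V" and s: "\<bar>s\<bar> = 1" for V d s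
    using corner[OF near] inside
  proof eventually_elim
    case (elim x)
    have "square_to_disk (x, s) \<in> sphere 0 1" using elim(1) s by (intro square_to_disk_sphere) auto
    then have "f (square_to_disk (x, s)) \<in> K" using hom(2) by blast
    moreover have "s \<in> {-1..1}" using s by (auto simp: abs_if split: if_splits)
    ultimately show ?case using elim by blast
  qed
  note bound = disk_bound_sides[OF hom fin base sec]
  from disk_boundary_branches[OF hom base U lim] show ?thesis
  proof (elim disjE conjE)
    assume "\<forall>\<^sub>F x in at_right (-1). f (square_to_disk (x, -1)) \<in> U1"
      "\<forall>\<^sub>F x in at_right (-1). f (square_to_disk (x, 1)) \<in> U2"
    then show ?thesis by (intro bound side[OF c1] side[OF c2]) auto
  next
    assume "\<forall>\<^sub>F x in at_right (-1). f (square_to_disk (x, -1)) \<in> U2"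
      "\<forall>\<^sub>F x in at_right (-1). f (square_to_disk (x, 1)) \<in> U1"
    then have "\<exists>h\<in>H p0. N (- c2 + c1 + h) \<le> M * card (D \<inter> A)"
      by (intro bound side[OF c1] side[OF c2]) auto
    then obtain h where h: "h \<in> H p0" "N (- c2 + c1 + h) \<le> M * card (D \<inter> A)" by blast
    have "N (- c2 + c1 + h) = N (- (- c2 + c1 + h))" by (simp only: norm_minus)
    also have "\<dots> = N (h + (- (- c2 + c1 + h)) - h)" by (simp only: norm_conj')
    also have "h + (- (- c2 + c1 + h)) - h = - c1 + c2 + - h" by (simp only: group_normal)
    finally show ?thesis using h subgroup_minus[OF h(1)] by metis
  qed
qed

end

section \<open>Local systems from labelled strands\<close>

text \<open>The strand \<open>i\<close> is the graph of \<open>(X i, Y i)\<close> over the heights at which it is live, viewed along the first coordinate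
  from \<open>+\<infinity>\<close>, so that \<open>i\<close> hides the points with a smaller first coordinate.  The labels satisfy the Wirtinger relations at
  the crossings of this diagram, \<open>sect\<close> is a section of the local system along the strands, and \<open>mgroup i a\<close> is the group
  at the points of strand \<open>i\<close> with label \<open>a\<close>.\<close>

locale labelled_strands =
  fixes I :: "'i set" and X Y :: "'i \<Rightarrow> real \<Rightarrow> real" and live :: "'i \<Rightarrow> real \<Rightarrow> bool"
    and label sect :: "'i \<Rightarrow> real \<Rightarrow> 'g::group_add" and mgroup :: "'i \<Rightarrow> 'g \<Rightarrow> 'g set"
begin

definition meeting :: "real \<Rightarrow> real \<Rightarrow> 'i set" where
  "meeting s y = {i \<in> I. live i s \<and> Y i s = y}"

definition regular_at :: "'i \<Rightarrow> real \<Rightarrow> bool" where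
  "regular_at i s0 \<longleftrightarrow> (\<forall>\<^sub>F s in nhds s0. live i s \<and> label i s = label i s0 \<and> sect i s = sect i s0)"

definition crossing_at :: "'i \<Rightarrow> 'i \<Rightarrow> real \<Rightarrow> bool" where
  "crossing_at i j s0 \<longleftrightarrow> X j s0 < X i s0 \<and>
     (\<forall>\<^sub>F s in nhds s0. live i s \<and> live j s \<and> label i s = label i s0 \<and> sect i s = sect i s0 \<and>
        label j s = (if Y j s \<le> Y i s then label j s0 else - label i s0 + label j s0 + label i s0) \<and>
        sect j s = (if Y j s \<le> Y i s then sect j s0 else sect j s0 + label j s0 + label i s0))"

definition cap_at :: "'i \<Rightarrow> 'i \<Rightarrow> real \<Rightarrow> bool" where
  "cap_at i j s0 \<longleftrightarrow> X j s0 = X i s0 \<and> live i s0 \<and> live j s0 \<and>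
     (\<exists>a. a + a = 0 \<and> mgroup i a = {0, a} \<and> mgroup j a = {0, a} \<and>
        (\<forall>\<^sub>F s in nhds s0. (live i s \<longrightarrow> label i s = a \<and> sect i s = sect i s0) \<and> (live j s \<longrightarrow> label j s = a \<and>
          sect j s = sect j s0))) \<and>
     ((\<forall>\<^sub>F s in nhds s0. (live i s \<longleftrightarrow> s \<le> s0) \<and> (live j s \<longleftrightarrow> s \<le> s0)) \<or>
      (\<forall>\<^sub>F s in nhds s0. (live i s \<longleftrightarrow> s0 \<le> s) \<and> (live j s \<longleftrightarrow> s0 \<le> s)))"

end

locale strand_diagram = labelled_strands I X Y live label sect mgroup
  for I :: "'i set" and X Y live and label sect :: "'i \<Rightarrow> real \<Rightarrow> 'g::group_add" and mgroup +
  fixes s\<^sub>0 y\<^sub>0 :: real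
  assumes finite_strands: "finite I"
    and cont_X: "i \<in> I \<Longrightarrow> isCont (X i) s" and cont_Y: "i \<in> I \<Longrightarrow> isCont (Y i) s"
    and closed_live: "i \<in> I \<Longrightarrow> closed {s. live i s}"
    and mgroup_zero: "0 \<in> mgroup i a" and mgroup_label: "a \<in> mgroup i a"
    and mgroup_add: "b \<in> mgroup i a \<Longrightarrow> c \<in> mgroup i a \<Longrightarrow> b + c \<in> mgroup i a"
    and mgroup_minus: "b \<in> mgroup i a \<Longrightarrow> - b \<in> mgroup i a"
    and mgroup_conj: "mgroup i (- c + a + c) = (\<lambda>h. - c + h + c) ` mgroup i a"
    and local_form: "meeting s y = {} \<or> (\<exists>i. meeting s y = {i} \<and> regular_at i s) \<or>
      (\<exists>i j. i \<noteq> j \<and> meeting s y = {i, j} \<and> crossing_at i j s) \<or>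
      (\<exists>i j. i \<noteq> j \<and> meeting s y = {i, j} \<and> cap_at i j s \<and> ((s, y) \<noteq> (s\<^sub>0, y\<^sub>0) \<longrightarrow> sect i s = sect j s))"
begin

definition sight :: "real^3 \<Rightarrow> 'i set" where
  "sight p = meeting (p $ 3) (p $ 2)"

lemma mem_sight: "i \<in> sight p \<longleftrightarrow> i \<in> I \<and> live i (p $ 3) \<and> Y i (p $ 3) = p $ 2"
  by (simp add: sight_def meeting_def)

lemma sight_cases [case_names none regular crossing cap]:
  fixes p :: "real^3"
  obtains "sight p = {}" | i where "sight p = {i}" "regular_at i (p $ 3)"
  | i j where "i \<noteq> j" "sight p = {i, j}" "crossing_at i j (p $ 3)"
  | i j where "i \<noteq> j" "sight p = {i, j}" "cap_at i j (p $ 3)"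
      "(p $ 3, p $ 2) \<noteq> (s\<^sub>0, y\<^sub>0) \<Longrightarrow> sect i (p $ 3) = sect j (p $ 3)"
  using local_form[of "p $ 3" "p $ 2", folded sight_def] by blast

definition hiding :: "real^3 \<Rightarrow> 'i set" where
  "hiding p = {i \<in> sight p. p $ 1 < X i (p $ 3)}"

definition through :: "real^3 \<Rightarrow> 'i set" where
  "through p = {i \<in> sight p. p $ 1 = X i (p $ 3)}"

definition charge :: "'i \<Rightarrow> real^3 \<Rightarrow> 'g" where
  "charge i q = (if live i (q $ 3) \<and> Y i (q $ 3) < q $ 2 then label i (q $ 3) else 0)"

definition charge2 :: "'i \<Rightarrow> 'i \<Rightarrow> real^3 \<Rightarrow> 'g" where
  "charge2 i j q = (if i = j then charge i q
     else if Y j (q $ 3) \<le> Y i (q $ 3) then charge j q + charge i q else charge i q + charge j q)"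

text \<open>At most two strands hide a given point; \<open>i\<close> and \<open>j\<close> are the front one and the back one.\<close>

definition potential :: "real^3 \<Rightarrow> real^3 \<Rightarrow> 'g" where
  "potential p q = (if hiding p = {} then 0
     else case SOME (i, j). hiding p = {i, j} \<and> X j (p $ 3) \<le> X i (p $ 3) of (i, j) \<Rightarrow> charge2 i j q)"

definition strand_at :: "real^3 \<Rightarrow> 'i" where
  "strand_at p = (SOME i. i \<in> through p)"

definition group_at :: "real^3 \<Rightarrow> 'g set" where
  "group_at p = (if through p = {} then {0} else mgroup (strand_at p) (label (strand_at p) (p $ 3)))"

definition curve_section :: "real^3 \<Rightarrow> 'g" where
  "curve_section p = sect (strand_at p) (p $ 3)"

lemma strand_at_mem: "i \<in> through p \<Longrightarrow> strand_at p \<in> through p"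
  unfolding strand_at_def by (rule someI)

lemma strand_at_single: "through p = {i} \<Longrightarrow> strand_at p = i"
  by (simp add: strand_at_def)

lemma potential_none: "hiding p = {} \<Longrightarrow> potential p q = 0"
  by (simp add: potential_def)

lemma potential_some:
  assumes "hiding p = {i, j}"
  obtains k l where "{k, l} = {i, j}" "X l (p $ 3) \<le> X k (p $ 3)" "\<And>q. potential p q = charge2 k l q"
proof -
  obtain k l where kl: "(SOME (k, l). hiding p = {k, l} \<and> X l (p $ 3) \<le> X k (p $ 3)) = (k, l)" by force
  have "(\<lambda>(k, l). hiding p = {k, l} \<and> X l (p $ 3) \<le> X k (p $ 3)) (if X j (p $ 3) \<le> X i (p $ 3) then (i, j) else (j, i))"
    using assms by (auto simp: insert_commute)
  from someI[of "\<lambda>(k, l). hiding p = {k, l} \<and> X l (p $ 3) \<le> X k (p $ 3)", OF this]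
  have "{k, l} = {i, j}" "X l (p $ 3) \<le> X k (p $ 3)" using assms kl by auto
  moreover have "potential p q = charge2 k l q" for q using assms kl by (simp add: potential_def)
  ultimately show ?thesis by (rule that)
qed

lemma potential_single:
  assumes "hiding p = {i}"
  shows "potential p q = charge i q"
proof -
  obtain k l where "{k, l} = {i, i}" "potential p q = charge2 k l q"
    using potential_some[of p i i] assms by auto
  then show ?thesis by (auto simp: charge2_def doubleton_eq_iff)
qed

lemma potential_pair:
  assumes "hiding p = {i, j}"
  shows "potential p q = charge2 i j q \<or> potential p q = charge2 j i q"
  using potential_some[OF assms] by (metis doubleton_eq_iff)

lemma potential_ordered_pair:
  assumes "hiding p = {i, j}" "X j (p $ 3) < X i (p $ 3)"
  shows "potential p q = charge2 i j q"
proof -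
  obtain k l where "{k, l} = {i, j}" "X l (p $ 3) \<le> X k (p $ 3)" "potential p q = charge2 k l q"
    using potential_some[OF assms(1)] by metis
  then show ?thesis using assms(2) by (auto simp: doubleton_eq_iff)
qed

lemma group_at_off: "through p = {} \<Longrightarrow> group_at p = {0}"
  by (simp add: group_at_def)

lemma group_at_single: "through p = {i} \<Longrightarrow> group_at p = mgroup i (label i (p $ 3))"
  by (simp add: group_at_def strand_at_single)

lemma group_at_subgroup:
  "0 \<in> group_at p" "b \<in> group_at p \<Longrightarrow> c \<in> group_at p \<Longrightarrow> b + c \<in> group_at p" "b \<in> group_at p \<Longrightarrow> - b \<in> group_at p"
  by (auto simp: group_at_def mgroup_zero mgroup_add mgroup_minus split: if_splits)

lemma potential_self: "potential p p = 0"
proof (cases "hiding p = {}")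
  case False
  have zero: "charge i p = 0" if "i \<in> hiding p" for i
    using that by (auto simp: charge_def hiding_def mem_sight)
  have "hiding p \<subseteq> sight p" by (auto simp: hiding_def)
  moreover obtain i j where "sight p \<subseteq> {i, j}" by (cases p rule: sight_cases) auto
  ultimately have "hiding p = {i} \<or> hiding p = {j} \<or> hiding p = {i, j}" using False by blast
  then obtain i j where ij: "hiding p = {i, j}" by auto
  then show ?thesis using potential_pair[OF ij, of p] zero by (auto simp: charge2_def)
qed (simp add: potential_none)

text \<open>All strict inequalities between the strands and \<open>p\<close>, which persist near \<open>p\<close>.\<close>

definition follows :: "real^3 \<Rightarrow> real^3 \<Rightarrow> bool" where
  "follows p q \<longleftrightarrow> (\<forall>i\<in>I. (Y i (p $ 3) < p $ 2 \<longrightarrow> Y i (q $ 3) < q $ 2) \<and> (p $ 2 < Y i (p $ 3) \<longrightarrow> q $ 2 < Y i (q $ 3)) \<and>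
     (X i (p $ 3) < p $ 1 \<longrightarrow> X i (q $ 3) < q $ 1) \<and> (p $ 1 < X i (p $ 3) \<longrightarrow> q $ 1 < X i (q $ 3)) \<and>
     (\<not> live i (p $ 3) \<longrightarrow> \<not> live i (q $ 3)) \<and> ((\<forall>\<^sub>F s in nhds (p $ 3). live i s) \<longrightarrow> live i (q $ 3)) \<and>
     (\<forall>j\<in>I. (Y i (p $ 3) < Y j (p $ 3) \<longrightarrow> Y i (q $ 3) < Y j (q $ 3)) \<and> (X i (p $ 3) < X j (p $ 3) \<longrightarrow>
       X i (q $ 3) < X j (q $ 3))))"

lemma eventually_height:
  assumes "\<forall>\<^sub>F s in nhds (p $ 3). P s"
  shows "\<forall>\<^sub>F q in nhds (p :: real^3). P (q $ 3)"
proof -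
  have "filterlim (\<lambda>q :: real^3. q $ 3) (nhds (p $ 3)) (nhds p)"
    by (rule tendsto_vec_nth) (rule filterlim_ident)
  then show ?thesis using assms by (rule eventually_compose_filterlim[rotated])
qed

lemma eventually_less_persists:
  fixes f g :: "real^3 \<Rightarrow> real"
  assumes "isCont f p" "isCont g p"
  shows "\<forall>\<^sub>F q in nhds p. f p < g p \<longrightarrow> f q < g q"
proof (cases "f p < g p")
  case True
  have "((\<lambda>q. g q - f q) \<longlongrightarrow> g p - f p) (nhds p)"
    using assms by (intro tendsto_diff) (auto simp: isCont_def tendsto_at_iff_tendsto_nhds)
  then have "\<forall>\<^sub>F q in nhds p. 0 < g q - f q"
    using True by (intro order_tendstoD) auto
  then show ?thesis by eventually_elim simp
qed simp

lemma isCont_strand: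
  "i \<in> I \<Longrightarrow> isCont (\<lambda>q. Y i (q $ 3)) (p :: real^3)" "i \<in> I \<Longrightarrow> isCont (\<lambda>q. X i (q $ 3)) (p :: real^3)"
  by (intro isCont_o2[OF _ cont_Y] isCont_o2[OF _ cont_X] continuous_intros; simp)+

lemma eventually_follows: "\<forall>\<^sub>F q in nhds p. follows p q"
  unfolding follows_def
proof (intro eventually_ball_finite[OF finite_strands] ballI eventually_conj)
  fix i assume i: "i \<in> I"
  note less = eventually_less_persists[where p = p]
  show "\<forall>\<^sub>F q in nhds p. Y i (p $ 3) < p $ 2 \<longrightarrow> Y i (q $ 3) < q $ 2"
    "\<forall>\<^sub>F q in nhds p. p $ 2 < Y i (p $ 3) \<longrightarrow> q $ 2 < Y i (q $ 3)"
    "\<forall>\<^sub>F q in nhds p. X i (p $ 3) < p $ 1 \<longrightarrow> X i (q $ 3) < q $ 1"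
    "\<forall>\<^sub>F q in nhds p. p $ 1 < X i (p $ 3) \<longrightarrow> q $ 1 < X i (q $ 3)"
    by (rule less[of "\<lambda>q. Y i (q $ 3)" "\<lambda>q. q $ 2"] less[of "\<lambda>q. q $ 2" "\<lambda>q. Y i (q $ 3)"]
        less[of "\<lambda>q. X i (q $ 3)" "\<lambda>q. q $ 1"] less[of "\<lambda>q. q $ 1" "\<lambda>q. X i (q $ 3)"];
        intro isCont_strand[OF i] continuous_intros)+
  show "\<forall>\<^sub>F q in nhds p. \<not> live i (p $ 3) \<longrightarrow> \<not> live i (q $ 3)"
  proof (cases "live i (p $ 3)")
    case False
    have "open (- {s. live i s})" using closed_live[OF i] by (simp add: open_Compl)
    then have "\<forall>\<^sub>F s in nhds (p $ 3). \<not> live i s"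
      using eventually_nhds_in_open[of "- {s. live i s}" "p $ 3"] False by simp
    then have "\<forall>\<^sub>F q in nhds p. \<not> live i (q $ 3)" by (rule eventually_height)
    then show ?thesis by (rule eventually_mono) simp
  qed simp
  show "\<forall>\<^sub>F q in nhds p. (\<forall>\<^sub>F s in nhds (p $ 3). live i s) \<longrightarrow> live i (q $ 3)"
    using eventually_height[of "live i" p] by (cases "\<forall>\<^sub>F s in nhds (p $ 3). live i s") auto
  fix j assume j: "j \<in> I"
  show "\<forall>\<^sub>F q in nhds p. Y i (p $ 3) < Y j (p $ 3) \<longrightarrow> Y i (q $ 3) < Y j (q $ 3)"
    "\<forall>\<^sub>F q in nhds p. X i (p $ 3) < X j (p $ 3) \<longrightarrow> X i (q $ 3) < X j (q $ 3)"
    by (rule less[of "\<lambda>q. Y i (q $ 3)" "\<lambda>q. Y j (q $ 3)"] less[of "\<lambda>q. X i (q $ 3)" "\<lambda>q. X j (q $ 3)"];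
        intro isCont_strand[OF i] isCont_strand[OF j])+
qed

lemma follows_Y:
  assumes "follows p q" "k \<in> I"
  shows "Y k (p $ 3) < p $ 2 \<Longrightarrow> Y k (q $ 3) < q $ 2" "p $ 2 < Y k (p $ 3) \<Longrightarrow> q $ 2 < Y k (q $ 3)"
    "l \<in> I \<Longrightarrow> Y k (p $ 3) < Y l (p $ 3) \<Longrightarrow> Y k (q $ 3) < Y l (q $ 3)"
  using assms unfolding follows_def by blast+

lemma follows_X:
  assumes "follows p q" "k \<in> I"
  shows "X k (p $ 3) < p $ 1 \<Longrightarrow> X k (q $ 3) < q $ 1" "p $ 1 < X k (p $ 3) \<Longrightarrow> q $ 1 < X k (q $ 3)"
    "l \<in> I \<Longrightarrow> X k (p $ 3) < X l (p $ 3) \<Longrightarrow> X k (q $ 3) < X l (q $ 3)"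
  using assms unfolding follows_def by blast+

lemma sight_follows: "follows p q \<Longrightarrow> sight q = {k \<in> sight p. live k (q $ 3) \<and> Y k (q $ 3) = q $ 2}"
  unfolding follows_def set_eq_iff mem_Collect_eq mem_sight by (metis linorder_neqE order_less_irrefl)

lemma through_follows:
  assumes "follows p q" "k \<in> through q"
  shows "k \<in> through p" "live k (q $ 3)" "Y k (q $ 3) = q $ 2" "X k (q $ 3) = q $ 1"
proof -
  have k: "k \<in> sight q" "X k (q $ 3) = q $ 1" using assms(2) by (auto simp: through_def)
  then show "live k (q $ 3)" "Y k (q $ 3) = q $ 2" "X k (q $ 3) = q $ 1" by (auto simp: mem_sight)
  have "k \<in> sight p" using k(1) sight_follows[OF assms(1)] by blast
  moreover have "X k (p $ 3) = p $ 1"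
    using follows_X(1,2)[OF assms(1), of k] k by (metis linorder_neqE mem_sight order_less_irrefl)
  ultimately show "k \<in> through p" by (simp add: through_def)
qed

lemma eventually_follows2:
  assumes "\<forall>\<^sub>F q in nhds p. G q"
    and "\<And>p' q. G p' \<Longrightarrow> G q \<Longrightarrow> follows p p' \<Longrightarrow> follows p q \<Longrightarrow> follows p' q \<Longrightarrow> R p' q"
  shows "\<forall>\<^sub>F p' in nhds p. \<forall>\<^sub>F q in nhds p'. R p' q"
proof -
  have good: "\<forall>\<^sub>F q in nhds p. G q \<and> follows p q"
    using assms(1) eventually_follows by (rule eventually_conj)
  then have "\<forall>\<^sub>F p' in nhds p. \<forall>\<^sub>F q in nhds p'. G q \<and> follows p q"
    by (simp only: eventually_eventually)
  with good show ?thesis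
  proof eventually_elim
    case (elim p')
    show ?case using elim(2) eventually_follows[of p']
      by eventually_elim (use assms(2) elim(1) in blast)
  qed
qed

definition cocycle_defect :: "real^3 \<Rightarrow> real^3 \<Rightarrow> real^3 \<Rightarrow> 'g" where
  "cocycle_defect p p' q = potential p p' + potential p' q - potential p q"

lemma defect_zero: "potential p p' + potential p' q = potential p q \<Longrightarrow> cocycle_defect p p' q \<in> group_at p"
  by (simp add: cocycle_defect_def group_at_subgroup)

lemma defect_unhidden: "hiding p = {} \<Longrightarrow> cocycle_defect p p' q = potential p' q"
  by (simp add: cocycle_defect_def potential_none)

lemma defect_in_front:
  assumes "follows p p'" "\<And>k. k \<in> sight p \<Longrightarrow> X k (p $ 3) < p $ 1"
  shows "cocycle_defect p p' q \<in> group_at p"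
proof -
  have "hiding p = {}" using assms(2) by (force simp: hiding_def)
  moreover have "X k (p' $ 3) < p' $ 1" if "k \<in> sight p'" for k
    using that assms follows_X(1)[OF assms(1)] sight_follows[OF assms(1)] by (auto simp: mem_sight)
  then have "hiding p' = {}" by (force simp: hiding_def)
  ultimately show ?thesis by (simp add: cocycle_defect_def potential_none group_at_subgroup)
qed

lemma charge_at_level: "Y k (p $ 3) = p $ 2 \<Longrightarrow> charge k p = 0"
  by (simp add: charge_def)

lemma cocycle_regular:
  assumes sight: "sight p = {i}" and follows: "follows p p'" "follows p q" "follows p' q"
    and label: "\<And>r. r \<in> {p, p', q} \<Longrightarrow> live i (r $ 3) \<and> label i (r $ 3) = a"
  shows "cocycle_defect p p' q \<in> group_at p"
proof -
  have i: "i \<in> I" using sight mem_sight[of i p] by simp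
  have charge: "charge i r = (if Y i (r $ 3) < r $ 2 then a else 0)" if "r \<in> {p', q}" for r
    using label that by (auto simp: charge_def)
  have hiding': "hiding p' = (if Y i (p' $ 3) = p' $ 2 \<and> p' $ 1 < X i (p' $ 3) then {i} else {})"
    using label[of p'] by (auto simp: hiding_def sight_follows[OF follows(1)] sight)
  consider "X i (p $ 3) < p $ 1" | "p $ 1 < X i (p $ 3)" | "p $ 1 = X i (p $ 3)" by linarith
  then show ?thesis
  proof cases
    case 1
    then show ?thesis using sight by (intro defect_in_front[OF follows(1)]) simp
  next
    case 2
    then have "hiding p = {i}" using sight by (auto simp: hiding_def)
    then have hidden: "potential p r = charge i r" for r by (rule potential_single)
    have "charge i p' + potential p' q = charge i q"
    proof (cases "Y i (p' $ 3) = p' $ 2")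
      case True
      then show ?thesis
        using follows_X(2)[OF follows(1) i 2] hiding' by (simp add: potential_single charge_at_level)
    next
      case False
      then have "charge i p' = charge i q"
        using follows_Y(1,2)[OF follows(3) i] charge by (cases "Y i (p' $ 3) < p' $ 2") auto
      then show ?thesis using False hiding' by (simp add: potential_none)
    qed
    then show ?thesis by (intro defect_zero) (simp add: hidden)
  next
    case 3
    then have "through p = {i}" "hiding p = {}" using sight by (auto simp: through_def hiding_def)
    moreover have "potential p' q \<in> {0, a}"
      using hiding' charge[of q]
      by (cases "hiding p' = {}") (auto simp: potential_none potential_single split: if_splits)
    ultimately show ?thesis
      using label[of p] mgroup_zero mgroup_label by (auto simp: defect_unhidden group_at_single)
  qed
qed

context
  fixes i j :: 'i and p p' q :: "real^3" and a b :: 'g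
  assumes sight: "sight p = {i, j}" and distinct: "i \<noteq> j" and behind: "X j (p $ 3) < X i (p $ 3)"
    and follows: "follows p p'" "follows p q" "follows p' q"
    and crossing_labels: "\<And>r. r \<in> {p, p', q} \<Longrightarrow> live i (r $ 3) \<and> live j (r $ 3) \<and> label i (r $ 3) = a \<and>
      label j (r $ 3) = (if Y j (r $ 3) \<le> Y i (r $ 3) then b else - a + b + a)"
begin

lemma crossing_strands: "i \<in> I" "j \<in> I" "Y i (p $ 3) = p $ 2" "Y j (p $ 3) = p $ 2"
  using sight by (auto simp: mem_sight[symmetric] set_eq_iff) (metis insertI1 insertI2 singletonI mem_sight sight)+

lemma crossing_charge_front: "r \<in> {p', q} \<Longrightarrow> charge i r = (if Y i (r $ 3) < r $ 2 then a else 0)"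
  using crossing_labels[of r] by (auto simp: charge_def)

lemma crossing_charge_back: "r \<in> {p', q} \<Longrightarrow>
    charge j r = (if Y j (r $ 3) < r $ 2 then (if Y j (r $ 3) \<le> Y i (r $ 3) then b else - a + b + a) else 0)"
  using crossing_labels[of r] by (auto simp: charge_def)

lemma crossing_charge2: "r \<in> {p', q} \<Longrightarrow>
    charge2 i j r = (if Y j (r $ 3) < r $ 2 then b else 0) + (if Y i (r $ 3) < r $ 2 then a else 0)"
  using distinct unfolding charge2_def crossing_charge_front crossing_charge_back
  by (auto simp: group_normal simp del: add_uminus_conv_diff)

lemma crossing_potential:
  "potential p' q =
    (if Y i (p' $ 3) = p' $ 2 \<and> p' $ 1 < X i (p' $ 3)
     then if Y j (p' $ 3) = p' $ 2 \<and> p' $ 1 < X j (p' $ 3) then charge2 i j q else charge i q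
     else if Y j (p' $ 3) = p' $ 2 \<and> p' $ 1 < X j (p' $ 3) then charge j q else 0)"
proof -
  have "hiding p' = {k \<in> {i, j}. Y k (p' $ 3) = p' $ 2 \<and> p' $ 1 < X k (p' $ 3)}"
    using crossing_labels[of p'] by (auto simp: hiding_def sight_follows[OF follows(1)] sight)
  moreover have "X j (p' $ 3) < X i (p' $ 3)"
    using follows_X(3)[OF follows(1) crossing_strands(2,1)] behind by simp
  moreover have "{k \<in> {i, j}. P k} = (if P i then if P j then {i, j} else {i} else if P j then {j} else {})" for P
    by auto
  ultimately show ?thesis
    by (auto simp: potential_none potential_single potential_ordered_pair)
qed

lemma crossing_front_cocycle:
  assumes "p' $ 1 < X i (p' $ 3)" "\<not> (Y j (p' $ 3) = p' $ 2 \<and> p' $ 1 < X j (p' $ 3))"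
  shows "charge i p' + potential p' q = charge i q"
proof (cases "Y i (p' $ 3) = p' $ 2")
  case True
  then show ?thesis using assms by (auto simp: charge_at_level crossing_potential)
next
  case False
  then have "charge i p' = charge i q"
    using follows_Y(1,2)[OF follows(3) crossing_strands(1)] crossing_charge_front
    by (cases "Y i (p' $ 3) < p' $ 2") auto
  then show ?thesis using False assms by (auto simp: crossing_potential)
qed

lemma crossing_order:
  assumes "Y j (p' $ 3) = p' $ 2" "Y i (p' $ 3) \<noteq> p' $ 2"
  shows "Y i (p' $ 3) < p' $ 2 \<and> Y i (q $ 3) < q $ 2 \<and> Y i (q $ 3) < Y j (q $ 3) \<or>
    p' $ 2 < Y i (p' $ 3) \<and> q $ 2 < Y i (q $ 3) \<and> Y j (q $ 3) < Y i (q $ 3)"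
  using assms follows_Y[OF follows(3) crossing_strands(1)] follows_Y(3)[OF follows(3) crossing_strands(2,1)]
    crossing_strands(2) by (metis linorder_neqE)

lemma crossing_back_cocycle:
  assumes "p' $ 1 < X i (p' $ 3)"
  shows "charge i p' + potential p' q - charge i q \<in> {0, b}"
proof (cases "Y j (p' $ 3) = p' $ 2 \<and> p' $ 1 < X j (p' $ 3)")
  case False
  then show ?thesis using crossing_front_cocycle[OF assms] by simp
next
  case True
  show ?thesis
  proof (cases "Y i (p' $ 3) = p' $ 2")
    case level: True
    then have "charge i p' + potential p' q - charge i q = charge2 i j q - charge i q"
      using True assms crossing_potential by (simp add: charge_at_level)
    then show ?thesis
      by (auto simp: crossing_charge2 crossing_charge_front group_normal simp del: add_uminus_conv_diff)
  next
    case False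
    then have "potential p' q = charge j q" using True crossing_potential by simp
    moreover have "charge i p' = charge i q" using crossing_order True False by (auto simp: crossing_charge_front)
    ultimately show ?thesis
      using crossing_order True False
      by (auto simp: crossing_charge_front crossing_charge_back group_normal simp del: add_uminus_conv_diff)
  qed
qed

lemma crossing_both_cocycle:
  assumes "p' $ 1 < X j (p' $ 3)" "p' $ 1 < X i (p' $ 3)"
  shows "charge2 i j p' + potential p' q = charge2 i j q"
proof (cases "Y j (p' $ 3) = p' $ 2")
  case j: False
  then have "Y j (p' $ 3) < p' $ 2 \<longleftrightarrow> Y j (q $ 3) < q $ 2"
    using follows_Y(1,2)[OF follows(3) crossing_strands(2)] by linarith
  moreover have "Y i (p' $ 3) \<noteq> p' $ 2 \<Longrightarrow> Y i (p' $ 3) < p' $ 2 \<longleftrightarrow> Y i (q $ 3) < q $ 2"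
    using follows_Y(1,2)[OF follows(3) crossing_strands(1)] by linarith
  ultimately show ?thesis
    using assms j by (cases "Y i (p' $ 3) = p' $ 2") (simp_all add: crossing_potential crossing_charge2 crossing_charge_front)
next
  case j: True
  show ?thesis
  proof (cases "Y i (p' $ 3) = p' $ 2")
    case True
    then show ?thesis using assms j by (simp add: crossing_potential crossing_charge2)
  next
    case False
    with crossing_order[OF j] j assms show ?thesis
      by (auto simp: crossing_potential crossing_charge2 crossing_charge_back group_normal simp del: add_uminus_conv_diff)
  qed
qed

lemma cocycle_crossing: "cocycle_defect p p' q \<in> group_at p"
proof -
  have labels: "label i (p $ 3) = a" "label j (p $ 3) = b"
    using crossing_labels[of p] crossing_strands(3,4) by auto
  have hiding: "hiding p = {k \<in> {i, j}. p $ 1 < X k (p $ 3)}"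
    and through: "through p = {k \<in> {i, j}. p $ 1 = X k (p $ 3)}"
    using sight by (auto simp: hiding_def through_def)
  note front = follows_X(1,2)[OF follows(1) crossing_strands(1)]
    and rear = follows_X(1,2)[OF follows(1) crossing_strands(2)]
  consider "X i (p $ 3) < p $ 1" | "p $ 1 = X i (p $ 3)" | "X j (p $ 3) < p $ 1" "p $ 1 < X i (p $ 3)"
    | "p $ 1 = X j (p $ 3)" | "p $ 1 < X j (p $ 3)"
    by linarith
  then show ?thesis
  proof cases
    case 1
    then show ?thesis using sight behind by (intro defect_in_front[OF follows(1)]) auto
  next
    case 2
    then have "hiding p = {}" "through p = {i}" using hiding through behind distinct by auto
    moreover have "X j (p' $ 3) < p' $ 1" using 2 behind rear(1) by simp
    then have "potential p' q \<in> {0, a}" by (auto simp: crossing_potential crossing_charge_front)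
    ultimately show ?thesis
      using mgroup_zero[of i a] mgroup_label[of a i] by (auto simp: defect_unhidden group_at_single labels)
  next
    case 3
    then have "hiding p = {i}" using hiding by auto
    then show ?thesis
      using crossing_front_cocycle front(2) rear(1) 3 by (intro defect_zero) (simp add: potential_single)
  next
    case 4
    then have single: "hiding p = {i}" "through p = {j}" using hiding through behind distinct by auto
    have "cocycle_defect p p' q \<in> {0, b}"
      using crossing_back_cocycle front(2) 4 behind unfolding cocycle_defect_def potential_single[OF single(1)] by simp
    then show ?thesis
      using mgroup_zero[of j b] mgroup_label[of b j] by (auto simp: group_at_single[OF single(2)] labels)
  next
    case 5
    then have "p $ 1 < X i (p $ 3)" using behind by simp
    with 5 have "hiding p = {i, j}" using hiding by auto
    then show ?thesis
      using crossing_both_cocycle front(2) rear(2) 5 \<open>p $ 1 < X i (p $ 3)\<close> behind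
      by (intro defect_zero) (simp add: potential_ordered_pair)
  qed
qed

end

lemma eventually_cap_liveness:
  assumes "(\<forall>\<^sub>F s in nhds s0. live i s \<longleftrightarrow> s \<le> s0) \<or> (\<forall>\<^sub>F s in nhds s0. live i s \<longleftrightarrow> s0 \<le> s)"
  shows "\<forall>\<^sub>F s in nhds s0. s \<noteq> s0 \<longrightarrow> live i s \<longrightarrow> (\<forall>\<^sub>F t in nhds s. live i t)"
proof -
  have persists: "\<forall>\<^sub>F s in nhds s0. s \<noteq> s0 \<longrightarrow> live i s \<longrightarrow> (\<forall>\<^sub>F t in nhds s. live i t)"
    if P: "\<forall>\<^sub>F s in nhds s0. live i s \<longleftrightarrow> P s" and op: "open {s. s \<noteq> s0 \<and> P s}" for P
  proof -
    from P have "\<forall>\<^sub>F s in nhds s0. \<forall>\<^sub>F t in nhds s. live i t \<longleftrightarrow> P t" by (simp only: eventually_eventually)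
    with P show ?thesis
    proof eventually_elim
      case (elim s)
      show ?case
      proof (intro impI)
        assume "s \<noteq> s0" "live i s"
        then have "\<forall>\<^sub>F t in nhds s. t \<in> {s. s \<noteq> s0 \<and> P s}"
          using elim(1) by (intro eventually_nhds_in_open[OF op]) simp
        with elim(2) show "\<forall>\<^sub>F t in nhds s. live i t" by eventually_elim simp
      qed
    qed
  qed
  have "{s. s \<noteq> s0 \<and> s \<le> s0} = {..<s0}" "{s. s \<noteq> s0 \<and> s0 \<le> s} = {s0<..}" by auto
  then show ?thesis using assms persists[of "\<lambda>s. s \<le> s0"] persists[of "\<lambda>s. s0 \<le> s"] by fastforce
qed

definition near_cap :: "'i \<Rightarrow> 'i \<Rightarrow> 'g \<Rightarrow> real \<Rightarrow> real \<Rightarrow> bool" where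
  "near_cap i j a s0 s \<longleftrightarrow> (live i s \<longleftrightarrow> live j s) \<and> (s \<noteq> s0 \<longrightarrow> live i s \<longrightarrow> (\<forall>\<^sub>F t in nhds s. live i t)) \<and>
     (live i s \<longrightarrow> label i s = a \<and> label j s = a \<and> sect i s = sect i s0 \<and> sect j s = sect j s0)"

lemma cap_atE:
  assumes "cap_at i j s0"
  obtains a where "X j s0 = X i s0" "live i s0" "live j s0" "a + a = 0" "mgroup i a = {0, a}" "mgroup j a = {0, a}"
    "\<forall>\<^sub>F s in nhds s0. near_cap i j a s0 s"
proof -
  obtain a where a: "a + a = 0" "mgroup i a = {0, a}" "mgroup j a = {0, a}"
    "\<forall>\<^sub>F s in nhds s0. (live i s \<longrightarrow> label i s = a \<and> sect i s = sect i s0) \<and> (live j s \<longrightarrow> label j s = a \<and>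
      sect j s = sect j s0)"
    using assms by (auto simp: cap_at_def)
  have caps: "X j s0 = X i s0" "live i s0" "live j s0" using assms by (simp_all add: cap_at_def)
  have live: "(\<forall>\<^sub>F s in nhds s0. (live i s \<longleftrightarrow> s \<le> s0) \<and> (live j s \<longleftrightarrow> s \<le> s0)) \<or>
      (\<forall>\<^sub>F s in nhds s0. (live i s \<longleftrightarrow> s0 \<le> s) \<and> (live j s \<longleftrightarrow> s0 \<le> s))"
    using assms by (simp add: cap_at_def)
  have "\<forall>\<^sub>F s in nhds s0. live i s \<longleftrightarrow> live j s" using live by (auto elim: eventually_mono)
  moreover have "\<forall>\<^sub>F s in nhds s0. s \<noteq> s0 \<longrightarrow> live i s \<longrightarrow> (\<forall>\<^sub>F t in nhds s. live i t)"
    using live by (intro eventually_cap_liveness) (simp only: eventually_conj_iff, blast)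
  ultimately have "\<forall>\<^sub>F s in nhds s0. near_cap i j a s0 s"
    using a(4) unfolding near_cap_def by eventually_elim blast
  then show ?thesis by (rule that[OF caps a(1-3)])
qed

context
  fixes i j :: 'i and p p' q :: "real^3" and a :: 'g
  assumes sight: "sight p = {i, j}" and distinct: "i \<noteq> j" and level: "X j (p $ 3) = X i (p $ 3)"
    and involution: "a + a = 0" and groups: "mgroup i a = {0, a}" "mgroup j a = {0, a}"
    and follows: "follows p p'" "follows p q" "follows p' q"
    and cap_labels: "\<And>r. r \<in> {p, p', q} \<Longrightarrow> (live i (r $ 3) \<longleftrightarrow> live j (r $ 3)) \<and>
      (live i (r $ 3) \<longrightarrow> label i (r $ 3) = a \<and> label j (r $ 3) = a)"
    and cap_liveness: "p' $ 3 \<noteq> p $ 3 \<Longrightarrow> live i (p' $ 3) \<Longrightarrow> live i (q $ 3)"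
begin

lemma cap_strands: "k \<in> {i, j} \<Longrightarrow> k \<in> I \<and> Y k (p $ 3) = p $ 2 \<and> X k (p $ 3) = X i (p $ 3)"
  using sight level mem_sight[of k p] by auto

lemma cap_charge:
  "k \<in> {i, j} \<Longrightarrow> r \<in> {p', q} \<Longrightarrow> charge k r = (if live i (r $ 3) \<and> Y k (r $ 3) < r $ 2 then a else 0)"
  using cap_labels[of r] by (auto simp: charge_def)

lemma cap_potential:
  assumes "hiding p0 \<subseteq> {i, j}" "r \<in> {p', q}"
  shows "potential p0 r =
    (if live i (r $ 3) \<and> (i \<in> hiding p0 \<and> Y i (r $ 3) < r $ 2) \<noteq> (j \<in> hiding p0 \<and> Y j (r $ 3) < r $ 2) then a else 0)"
proof -
  consider "hiding p0 = {}" | k where "hiding p0 = {k}" "k \<in> {i, j}" | "hiding p0 = {i, j}" using assms(1) by blast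
  then show ?thesis
  proof cases
    case 1
    then show ?thesis by (simp add: potential_none)
  next
    case (2 k)
    then show ?thesis using distinct cap_charge[OF 2(2) assms(2)] by (auto simp: potential_single)
  next
    case 3
    then show ?thesis
      using potential_pair[OF 3, of r] distinct involution cap_charge[OF _ assms(2), of i] cap_charge[OF _ assms(2), of j]
      by (auto simp: charge2_def split: if_splits)
  qed
qed

lemma cap_hiding: "k \<in> {i, j} \<Longrightarrow> k \<in> hiding p' \<longleftrightarrow> live i (p' $ 3) \<and> Y k (p' $ 3) = p' $ 2 \<and> p' $ 1 < X k (p' $ 3)"
  using cap_labels[of p'] by (auto simp: hiding_def sight_follows[OF follows(1)] sight)

lemma cap_below_persists:
  assumes "p' $ 3 \<noteq> p $ 3" and k: "k \<in> {i, j}" and "k \<notin> hiding p'" "p' $ 1 < X k (p' $ 3)"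
  shows "live i (q $ 3) \<and> Y k (q $ 3) < q $ 2 \<longleftrightarrow> live i (p' $ 3) \<and> Y k (p' $ 3) < p' $ 2"
proof (cases "live i (p' $ 3)")
  case True
  then have "Y k (p' $ 3) \<noteq> p' $ 2" using cap_hiding[OF k] assms by blast
  then have "Y k (q $ 3) < q $ 2 \<longleftrightarrow> Y k (p' $ 3) < p' $ 2"
    using follows_Y(1,2)[OF follows(3), of k] cap_strands[OF k] by (meson linorder_neqE order_less_asym)
  then show ?thesis using True assms(1) cap_liveness by simp
next
  case False
  then have "\<not> live i (q $ 3)" using follows(3) cap_strands[of i] unfolding follows_def by blast
  then show ?thesis using False by simp
qed

lemma cap_cocycle_at_level:
  assumes "p' $ 3 = p $ 3" "p $ 1 < X i (p $ 3)" "hiding p = {i, j}"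
  shows "potential p p' + potential p' q = potential p q"
proof -
  have Y: "Y k (p' $ 3) = p $ 2" "p' $ 1 < X k (p' $ 3)" if "k \<in> {i, j}" for k
    using cap_strands[OF that] follows_X(2)[OF follows(1), of k] assms(1,2) by auto
  have sub: "hiding p' \<subseteq> {i, j}" using sight_follows[OF follows(1)] sight by (auto simp: hiding_def)
  have live: "live i (p' $ 3)" using assms(1) sight mem_sight[of i p] by simp
  show ?thesis
  proof (cases "p' $ 2 = p $ 2")
    case True
    then have "i \<in> hiding p'" "j \<in> hiding p'" using cap_hiding Y live by auto
    then show ?thesis using assms(3) Y True by (simp add: cap_potential sub)
  next
    case False
    then have "i \<notin> hiding p'" "j \<notin> hiding p'" using cap_hiding Y by auto
    moreover have "Y i (q $ 3) < q $ 2 \<longleftrightarrow> Y j (q $ 3) < q $ 2"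
      using follows_Y(1,2)[OF follows(3), of i] follows_Y(1,2)[OF follows(3), of j] cap_strands Y False
      by (metis insertI1 insertI2 linorder_neqE order_less_asym singletonI)
    ultimately show ?thesis using assms(3) Y by (simp add: cap_potential sub)
  qed
qed

lemma cap_cocycle_off_level:
  assumes "p' $ 3 \<noteq> p $ 3" "p $ 1 < X i (p $ 3)" "hiding p = {i, j}"
  shows "potential p p' + potential p' q = potential p q"
proof -
  have "p' $ 1 < X k (p' $ 3)" if "k \<in> {i, j}" for k
    using cap_strands[OF that] follows_X(2)[OF follows(1), of k] assms(2) by auto
  then have front: "k \<in> {i, j} \<Longrightarrow> p' $ 1 < X k (p' $ 3)" for k .
  define below where "below k r \<longleftrightarrow> live i (r $ 3) \<and> Y k (r $ 3) < r $ 2" for k and r :: "real^3"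
  have persists: "k \<notin> hiding p' \<Longrightarrow> below k q \<longleftrightarrow> below k p'" "k \<in> hiding p' \<Longrightarrow> \<not> below k p'" if "k \<in> {i, j}" for k
    using cap_below_persists[OF assms(1) that _ front[OF that]] cap_hiding[OF that] by (auto simp: below_def)
  have "hiding p' \<subseteq> {i, j}" using sight_follows[OF follows(1)] sight by (auto simp: hiding_def)
  then have "potential p' q = (if (i \<in> hiding p' \<and> below i q) \<noteq> (j \<in> hiding p' \<and> below j q) then a else 0)"
    by (auto simp: cap_potential below_def)
  moreover have "potential p r = (if below i r \<noteq> below j r then a else 0)" if "r \<in> {p', q}" for r
    using that assms(3) by (auto simp: cap_potential below_def)
  ultimately show ?thesis
    using persists[of i] persists[of j] involution by (cases "i \<in> hiding p'"; cases "j \<in> hiding p'") auto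
qed

lemma cocycle_cap: "cocycle_defect p p' q \<in> group_at p"
proof -
  consider "X i (p $ 3) < p $ 1" | "p $ 1 = X i (p $ 3)" | "p $ 1 < X i (p $ 3)" by linarith
  then show ?thesis
  proof cases
    case 1
    then show ?thesis using sight level by (intro defect_in_front[OF follows(1)]) auto
  next
    case 2
    then have through: "through p = {i, j}" and "hiding p = {}" using sight level by (auto simp: through_def hiding_def)
    have "strand_at p \<in> {i, j}" using strand_at_mem[of i p] through by simp
    moreover have "label i (p $ 3) = a" "label j (p $ 3) = a" using cap_labels[of p] sight mem_sight[of i p] by auto
    ultimately have "group_at p = {0, a}" using groups through by (auto simp: group_at_def)
    moreover have "hiding p' \<subseteq> {i, j}" using sight_follows[OF follows(1)] sight by (auto simp: hiding_def)
    then have "potential p' q \<in> {0, a}" by (simp add: cap_potential)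
    ultimately show ?thesis using defect_unhidden[OF \<open>hiding p = {}\<close>] by simp
  next
    case 3
    then have "hiding p = {i, j}" using sight level by (auto simp: hiding_def)
    with 3 show ?thesis using cap_cocycle_at_level cap_cocycle_off_level by (intro defect_zero) blast
  qed
qed

end

lemma cocycle_eventually_cap:
  assumes "i \<noteq> j" "sight p = {i, j}" "cap_at i j (p $ 3)"
  shows "\<forall>\<^sub>F p' in nhds p. \<forall>\<^sub>F q in nhds p'. cocycle_defect p p' q \<in> group_at p"
proof -
  from assms(3) obtain a where a: "X j (p $ 3) = X i (p $ 3)" "a + a = 0" "mgroup i a = {0, a}" "mgroup j a = {0, a}"
    and near_cap: "\<forall>\<^sub>F s in nhds (p $ 3). near_cap i j a (p $ 3) s"
    by (rule cap_atE)
  show ?thesis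
  proof (rule eventually_follows2[OF eventually_height[OF near_cap]])
    fix p' q assume follows: "follows p p'" "follows p q" "follows p' q"
      and near: "near_cap i j a (p $ 3) (p' $ 3)" "near_cap i j a (p $ 3) (q $ 3)"
    have "i \<in> I" using assms(2) mem_sight[of i p] by simp
    then have "p' $ 3 \<noteq> p $ 3 \<Longrightarrow> live i (p' $ 3) \<Longrightarrow> live i (q $ 3)"
      using follows(3) near(1) unfolding follows_def near_cap_def by blast
    then show "cocycle_defect p p' q \<in> group_at p"
      using near eventually_nhds_x_imp_x[OF near_cap]
      by (intro cocycle_cap[OF assms(2,1) a follows]) (auto simp: near_cap_def)
  qed
qed

lemma cocycle_eventually: "\<forall>\<^sub>F p' in nhds p. \<forall>\<^sub>F q in nhds p'. cocycle_defect p p' q \<in> group_at p"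
proof (cases p rule: sight_cases)
  case none
  then show ?thesis by (intro eventually_follows2[of "\<lambda>_. True"] defect_in_front) auto
next
  case (regular i)
  show ?thesis
    by (rule eventually_follows2[OF eventually_height[OF regular(2)[unfolded regular_at_def]]], rule cocycle_regular[OF regular(1)])
      (use regular eventually_nhds_x_imp_x in \<open>auto simp: regular_at_def\<close>)
next
  case (crossing i j)
  then have behind: "X j (p $ 3) < X i (p $ 3)"
    and ev: "\<forall>\<^sub>F s in nhds (p $ 3). live i s \<and> live j s \<and> label i s = label i (p $ 3) \<and>
      label j s = (if Y j s \<le> Y i s then label j (p $ 3) else - label i (p $ 3) + label j (p $ 3) + label i (p $ 3))"
    by (auto simp: crossing_at_def elim: eventually_mono)
  show ?thesis
    by (rule eventually_follows2[OF eventually_height[OF ev]], rule cocycle_crossing[OF crossing(2,1) behind])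
      (use eventually_nhds_x_imp_x[OF ev] in auto)
next
  case (cap i j)
  then show ?thesis by (intro cocycle_eventually_cap)
qed

sublocale local_system potential group_at "{p. through p \<noteq> {}}"
proof
  fix p :: "real^3"
  show "\<forall>\<^sub>F p' in nhds p. \<forall>\<^sub>F q in nhds p'. q \<notin> {p. through p \<noteq> {}} \<longrightarrow>
      potential p p' + potential p' q - potential p q \<in> group_at p"
    using cocycle_eventually[of p] unfolding cocycle_defect_def by (auto elim!: eventually_mono)
qed (auto simp: group_at_off group_at_subgroup potential_self)

definition continues :: "real^3 \<Rightarrow> real^3 \<Rightarrow> bool" where
  "continues p p' \<longleftrightarrow> group_at p' = (\<lambda>h. - potential p p' + h + potential p p') ` group_at p \<and>
     ((p $ 3, p $ 2) \<noteq> (s\<^sub>0, y\<^sub>0) \<longrightarrow> curve_section p' \<in> coset (curve_section p) p p')"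

lemma continuesI:
  assumes "group_at p' = (\<lambda>h. - potential p p' + h + potential p p') ` group_at p"
    and "(p $ 3, p $ 2) \<noteq> (s\<^sub>0, y\<^sub>0) \<Longrightarrow> h \<in> group_at p \<and> curve_section p' = curve_section p + h + potential p p'"
  shows "continues p p'"
  using assms by (auto simp: continues_def coset_def)

lemma continues_front:
  assumes "through p = {i}" "through p' = {i}" "hiding p = {}" "label i (p' $ 3) = label i (p $ 3)"
    "sect i (p' $ 3) = sect i (p $ 3)"
  shows "continues p p'"
  by (rule continuesI[where h = 0])
    (use assms in \<open>simp_all add: group_at_single mgroup_zero potential_none curve_section_def strand_at_single\<close>)

lemma continues_back:
  assumes "through p = {j}" "through p' = {j}" "hiding p = {i}" "Y j (p' $ 3) = p' $ 2" "live i (p' $ 3)"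
    "label i (p' $ 3) = label i (p $ 3)"
    and label: "label j (p' $ 3) = (if Y j (p' $ 3) \<le> Y i (p' $ 3) then label j (p $ 3)
      else - label i (p $ 3) + label j (p $ 3) + label i (p $ 3))"
    and sect: "sect j (p' $ 3) = (if Y j (p' $ 3) \<le> Y i (p' $ 3) then sect j (p $ 3)
      else sect j (p $ 3) + label j (p $ 3) + label i (p $ 3))"
  shows "continues p p'"
proof -
  have potential: "potential p p' = (if Y j (p' $ 3) \<le> Y i (p' $ 3) then 0 else label i (p $ 3))"
    using assms(4-6) by (simp add: potential_single[OF assms(3)] charge_def)
  show ?thesis
    by (rule continuesI[where h = "if Y j (p' $ 3) \<le> Y i (p' $ 3) then 0 else label j (p $ 3)"])
      (use assms(1,2) label sect in
        \<open>auto simp: potential group_at_single mgroup_zero mgroup_label mgroup_conj curve_section_def strand_at_single\<close>)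
qed

lemma continues_cap:
  assumes through: "through p = {i, j}" and through': "through p' \<noteq> {}" "through p' \<subseteq> {i, j}" and "hiding p = {}"
    and groups: "mgroup i a = {0, a}" "mgroup j a = {0, a}"
    and label: "\<And>k r. k \<in> {i, j} \<Longrightarrow> r \<in> {p, p'} \<Longrightarrow> label k (r $ 3) = a"
    and sect: "\<And>k. k \<in> {i, j} \<Longrightarrow> sect k (p' $ 3) = sect k (p $ 3)"
    and closed: "(p $ 3, p $ 2) \<noteq> (s\<^sub>0, y\<^sub>0) \<Longrightarrow> sect i (p $ 3) = sect j (p $ 3)"
  shows "continues p p'"
proof -
  have strand: "strand_at p \<in> {i, j}" "strand_at p' \<in> {i, j}"
    using through through' strand_at_mem by blast+
  then have "group_at p = {0, a}" "group_at p' = {0, a}"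
    using through through' groups label by (auto simp: group_at_def)
  then show ?thesis
    using strand sect closed \<open>hiding p = {}\<close>
    by (intro continuesI[where h = 0]) (auto simp: potential_none curve_section_def)
qed

lemma continues_crossing:
  assumes sight: "sight p = {i, j}" and behind: "X j (p $ 3) < X i (p $ 3)" and follows: "follows p p'"
    and "through p' \<noteq> {}"
    and strands: "live i (p' $ 3) \<and> live j (p' $ 3) \<and> label i (p' $ 3) = label i (p $ 3) \<and>
      sect i (p' $ 3) = sect i (p $ 3) \<and>
      label j (p' $ 3) = (if Y j (p' $ 3) \<le> Y i (p' $ 3) then label j (p $ 3)
        else - label i (p $ 3) + label j (p $ 3) + label i (p $ 3)) \<and>
      sect j (p' $ 3) = (if Y j (p' $ 3) \<le> Y i (p' $ 3) then sect j (p $ 3)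
        else sect j (p $ 3) + label j (p $ 3) + label i (p $ 3))"
  shows "continues p p'"
proof -
  obtain k where k: "k \<in> through p'" using \<open>through p' \<noteq> {}\<close> by blast
  note through = through_follows[OF follows]
  have behind': "X j (p' $ 3) < X i (p' $ 3)"
    using follows_X(3)[OF follows] sight behind mem_sight by blast
  have "through p' \<subseteq> {i, j}" using through(1) sight by (auto simp: through_def)
  moreover from this have "k \<in> {i, j}" using k by blast
  moreover have "\<not> (i \<in> through p' \<and> j \<in> through p')" using through(4) behind' by force
  ultimately have single: "through p' = {k}" "k \<in> {i, j}" using k by blast+
  have level: "p $ 1 = X k (p $ 3)" using through(1)[OF k] by (simp add: through_def)
  from single(2) show "continues p p'"
  proof (elim insertE emptyE)
    assume "k = i"
    then have "through p = {i}" "hiding p = {}" "through p' = {i}"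
      using single(1) level sight behind by (auto simp: through_def hiding_def)
    then show ?thesis using strands by (intro continues_front[of p i]) auto
  next
    assume "k = j"
    then have "through p = {j}" "hiding p = {i}" "through p' = {j}"
      using single(1) level sight behind by (auto simp: through_def hiding_def)
    then show ?thesis using strands through(3)[of j] by (intro continues_back[of p j p' i]) auto
  qed
qed

lemma eventually_continues_crossing:
  assumes "sight p = {i, j}" "crossing_at i j (p $ 3)"
  shows "\<forall>\<^sub>F p' in nhds p. through p' \<noteq> {} \<longrightarrow> continues p p'"
proof -
  have behind: "X j (p $ 3) < X i (p $ 3)"
    and near: "\<forall>\<^sub>F s in nhds (p $ 3). live i s \<and> live j s \<and> label i s = label i (p $ 3) \<and>
      sect i s = sect i (p $ 3) \<and>
      label j s = (if Y j s \<le> Y i s then label j (p $ 3) else - label i (p $ 3) + label j (p $ 3) + label i (p $ 3)) \<and>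
      sect j s = (if Y j s \<le> Y i s then sect j (p $ 3) else sect j (p $ 3) + label j (p $ 3) + label i (p $ 3))"
    using assms(2) by (auto simp: crossing_at_def)
  show ?thesis using eventually_height[OF near] eventually_follows[of p]
    by eventually_elim (use continues_crossing[OF assms(1) behind] in blast)
qed

lemma eventually_continues_cap:
  assumes "sight p = {i, j}" "cap_at i j (p $ 3)" "(p $ 3, p $ 2) \<noteq> (s\<^sub>0, y\<^sub>0) \<Longrightarrow> sect i (p $ 3) = sect j (p $ 3)"
  shows "\<forall>\<^sub>F p' in nhds p. through p' \<noteq> {} \<longrightarrow> continues p p'"
proof -
  from assms(2) obtain a where a: "X j (p $ 3) = X i (p $ 3)" "live i (p $ 3)" "live j (p $ 3)" "a + a = 0"
      "mgroup i a = {0, a}" "mgroup j a = {0, a}"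
    and near_cap: "\<forall>\<^sub>F s in nhds (p $ 3). near_cap i j a (p $ 3) s"
    by (rule cap_atE)
  show ?thesis using eventually_height[OF near_cap] eventually_follows[of p]
  proof eventually_elim
    case (elim p')
    show ?case
    proof
      assume "through p' \<noteq> {}"
      then obtain k where k: "k \<in> through p'" by blast
      have through: "through p' \<subseteq> through p" "live k (p' $ 3)" using through_follows(1,2)[OF elim(2)] k by blast+
      then have "through p = {i, j}" "hiding p = {}" "k \<in> {i, j}" using k assms(1) a(1)
        by (auto simp: through_def hiding_def)
      then show "continues p p'"
        using through k elim(1) a assms(3) eventually_nhds_x_imp_x[OF near_cap] unfolding near_cap_def
        by (intro continues_cap[of p i j p' a]) auto
    qed
  qed
qed

lemma eventually_continues: "\<forall>\<^sub>F p' in nhds p. through p' \<noteq> {} \<longrightarrow> continues p p'"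
proof (cases p rule: sight_cases)
  case none
  show ?thesis using eventually_follows[of p]
    by eventually_elim (use none sight_follows in \<open>auto simp: through_def\<close>)
next
  case (regular i)
  show ?thesis using eventually_height[OF regular(2)[unfolded regular_at_def]] eventually_follows[of p]
  proof eventually_elim
    case (elim p')
    show ?case
    proof
      assume "through p' \<noteq> {}"
      then have "through p' = {i}" "i \<in> through p"
        using through_follows(1)[OF elim(2)] regular(1) by (auto simp: through_def)
      then show "continues p p'"
        using elim(1) regular(1) by (intro continues_front[of p i]) (auto simp: through_def hiding_def)
    qed
  qed
next
  case (crossing i j)
  then show ?thesis by (intro eventually_continues_crossing)
next
  case (cap i j)
  then show ?thesis by (intro eventually_continues_cap)
qed

lemma eventually_group_conj:
  "\<forall>\<^sub>F p' in nhds p. through p' \<noteq> {} \<longrightarrow> group_at p' = (\<lambda>h. - potential p p' + h + potential p p') ` group_at p"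
  using eventually_continues[of p] by eventually_elim (simp add: continues_def)

lemma eventually_curve_section:
  "(p $ 3, p $ 2) \<noteq> (s\<^sub>0, y\<^sub>0) \<Longrightarrow> \<forall>\<^sub>F p' in nhds p. through p' \<noteq> {} \<longrightarrow> curve_section p' \<in> coset (curve_section p) p p'"
  using eventually_continues[of p] by (auto simp: continues_def elim: eventually_mono)

end

section \<open>Permutations and the Pell equation\<close>

unbundle permutation_syntax

instantiation Perm.perm :: (type) group_add
begin

definition zero_perm :: "'a perm" where "zero_perm = 1"
definition plus_perm :: "'a perm \<Rightarrow> 'a perm \<Rightarrow> 'a perm" where "plus_perm f g = f * g"
definition uminus_perm :: "'a perm \<Rightarrow> 'a perm" where "uminus_perm f = inverse f"
definition minus_perm :: "'a perm \<Rightarrow> 'a perm \<Rightarrow> 'a perm" where "minus_perm f g = f * inverse g"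

instance
proof
  fix a b c :: "'a perm"
  show "a + b + c = a + (b + c)" by (simp add: plus_perm_def mult.assoc)
  show "0 + a = a" "a + 0 = a" by (simp_all add: plus_perm_def zero_perm_def)
  show "- a + a = 0" by (simp add: plus_perm_def zero_perm_def uminus_perm_def)
  show "a + - b = a - b" by (simp add: plus_perm_def minus_perm_def uminus_perm_def)
qed

end

lemma apply_plus [simp]: "(a + b) \<langle>$\<rangle> z = a \<langle>$\<rangle> (b \<langle>$\<rangle> z)"
  by (simp add: plus_perm_def apply_sequence)

lemma apply_zero [simp]: "0 \<langle>$\<rangle> z = z"
  by (simp add: zero_perm_def)

lemma apply_uminus [simp]: "a \<langle>$\<rangle> ((- a) \<langle>$\<rangle> z) = z" "(- a) \<langle>$\<rangle> (a \<langle>$\<rangle> z) = z" for a :: "'a perm"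
  by (simp_all flip: apply_plus)

lemma affected_zero [simp]: "affected (0 :: 'a perm) = {}"
  by (simp add: zero_perm_def)

lemma affected_plus: "affected (a + b :: 'a perm) \<subseteq> affected a \<union> affected b"
  by (auto simp: in_affected)

lemma affected_uminus [simp]: "affected (- a :: 'a perm) = affected a"
proof -
  have "(- a) \<langle>$\<rangle> z = z \<longleftrightarrow> a \<langle>$\<rangle> z = z" for z
    by (metis apply_uminus)
  then show ?thesis by (auto simp: in_affected)
qed

lemma card_affected_plus: "card (affected (a + b :: 'a perm)) \<le> card (affected a) + card (affected b)"
  by (meson affected_plus card_Un_le card_mono finite_UnI finite_affected order_trans)

lemma affected_conj: "affected (- c + a + c :: 'a perm) = (\<lambda>z. (- c) \<langle>$\<rangle> z) ` affected a"
proof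
  show "affected (- c + a + c) \<subseteq> (\<lambda>z. (- c) \<langle>$\<rangle> z) ` affected a"
  proof
    fix z assume "z \<in> affected (- c + a + c)"
    then have "c \<langle>$\<rangle> z \<in> affected a" by (auto simp: in_affected)
    then show "z \<in> (\<lambda>z. (- c) \<langle>$\<rangle> z) ` affected a" by (rule rev_image_eqI) simp
  qed
  have "(- c) \<langle>$\<rangle> y \<noteq> (- c) \<langle>$\<rangle> z" if "y \<noteq> z" for y z
    using that by (metis apply_uminus(1))
  then show "(\<lambda>z. (- c) \<langle>$\<rangle> z) ` affected a \<subseteq> affected (- c + a + c)"
    by (auto simp: in_affected)
qed

lemma card_affected_conj: "card (affected (- c + a + c :: 'a perm)) = card (affected a)"
  unfolding affected_conj by (rule card_image) (auto intro: inj_on_inverseI[of _ "\<lambda>z. c \<langle>$\<rangle> z"])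

lemma apply_Perm:
  assumes "\<And>z. g (f z) = z" "\<And>z. f (g z) = z" "finite S" "\<And>z. z \<notin> S \<Longrightarrow> f z = z"
  shows "Perm f \<langle>$\<rangle> z = f z"
proof -
  have "bij f" using assms(1,2) by (metis bijI')
  moreover have "{z. f z \<noteq> z} \<subseteq> S" using assms(4) by blast
  ultimately show ?thesis
    using finite_subset[OF _ assms(3)] by (simp add: Perm_inverse)
qed

lemma card_le_affected_commutator:
  assumes "\<And>z. z \<in> S \<Longrightarrow> k \<langle>$\<rangle> (u \<langle>$\<rangle> z) \<noteq> u \<langle>$\<rangle> (k \<langle>$\<rangle> z)"
  shows "card S \<le> card (affected (- u + k + u - k :: 'a perm))"
proof -
  have "(\<lambda>z. k \<langle>$\<rangle> z) ` S \<subseteq> affected (- u + k + u - k)"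
  proof (rule image_subsetI)
    fix z assume "z \<in> S"
    have "(- u + k + u - k) \<langle>$\<rangle> (k \<langle>$\<rangle> z) = (- u) \<langle>$\<rangle> (k \<langle>$\<rangle> (u \<langle>$\<rangle> z))"
      unfolding diff_conv_add_uminus by (simp del: add_uminus_conv_diff)
    moreover have "(- u) \<langle>$\<rangle> (k \<langle>$\<rangle> (u \<langle>$\<rangle> z)) \<noteq> k \<langle>$\<rangle> z"
      using assms[OF \<open>z \<in> S\<close>] by (metis apply_uminus(1))
    ultimately show "k \<langle>$\<rangle> z \<in> affected (- u + k + u - k)" by (simp add: in_affected)
  qed
  then have "card ((\<lambda>z. k \<langle>$\<rangle> z) ` S) \<le> card (affected (- u + k + u - k))" by (intro card_mono) auto
  moreover have "card ((\<lambda>z. k \<langle>$\<rangle> z) ` S) = card S"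
    by (rule card_image) (auto intro: inj_on_inverseI[of _ "\<lambda>z. (- k) \<langle>$\<rangle> z"])
  ultimately show ?thesis by simp
qed

definition block_rotation :: "int \<Rightarrow> int \<Rightarrow> int \<Rightarrow> int \<Rightarrow> int" where
  "block_rotation c n j i = (if 0 \<le> i \<and> i < c then (i + j) mod c
     else if c \<le> i \<and> i < n then c + (i - c + j) mod (n - c) else i)"

context
  fixes c n :: int
  assumes cn: "0 < c" "c < n"
begin

lemma block_rotation_mem:
  "block_rotation c n j i \<in> {0..<c} \<longleftrightarrow> i \<in> {0..<c}" "block_rotation c n j i \<in> {c..<n} \<longleftrightarrow> i \<in> {c..<n}"
  "block_rotation c n j i \<in> {0..<n} \<longleftrightarrow> i \<in> {0..<n}"
proof -
  have range: "0 \<le> (i + j) mod c" "(i + j) mod c < c" "0 \<le> (i - c + j) mod (n - c)" "(i - c + j) mod (n - c) < n - c"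
    using cn by simp_all
  show "block_rotation c n j i \<in> {0..<c} \<longleftrightarrow> i \<in> {0..<c}" "block_rotation c n j i \<in> {c..<n} \<longleftrightarrow> i \<in> {c..<n}"
    "block_rotation c n j i \<in> {0..<n} \<longleftrightarrow> i \<in> {0..<n}"
    using range cn unfolding block_rotation_def by (smt (verit) atLeastLessThan_iff)+
qed

lemma block_rotation_add: "block_rotation c n k (block_rotation c n j i) = block_rotation c n (k + j) i"
proof -
  consider "i \<in> {0..<c}" | "i \<in> {c..<n}" | "i \<notin> {0..<n}" using cn by fastforce
  then show ?thesis
  proof cases
    case 1
    then show ?thesis using block_rotation_mem(1)[of j i] cn
      by (simp add: block_rotation_def mod_add_left_eq mod_add_right_eq ac_simps)
  next
    case 2
    define r where "r = (i - c + j) mod (n - c)"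
    have r: "0 \<le> r" "r < n - c" using cn by (simp_all add: r_def)
    have "block_rotation c n j i = c + r" using 2 cn by (simp add: block_rotation_def r_def)
    moreover have "block_rotation c n k (c + r) = c + (r + k) mod (n - c)" using r cn by (simp add: block_rotation_def)
    moreover have "(r + k) mod (n - c) = (i - c + (k + j)) mod (n - c)"
      unfolding r_def mod_add_left_eq by (simp add: ac_simps)
    ultimately show ?thesis using 2 cn by (simp add: block_rotation_def)
  next
    case 3
    then show ?thesis using cn by (auto simp: block_rotation_def)
  qed
qed

lemma block_rotation_0: "block_rotation c n 0 i = i"
  using cn by (auto simp: block_rotation_def)

lemma block_rotation_cong: "i \<in> {0..<c} \<Longrightarrow> c dvd j - k \<Longrightarrow> block_rotation c n j i = block_rotation c n k i"
  "i \<in> {c..<n} \<Longrightarrow> (n - c) dvd j - k \<Longrightarrow> block_rotation c n j i = block_rotation c n k i"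
proof -
  assume "i \<in> {0..<c}" "c dvd j - k"
  then have "(i + j) mod c = (i + k) mod c"
    using mod_eq_dvd_iff[of "i + j" c "i + k"] by simp
  then show "block_rotation c n j i = block_rotation c n k i" using \<open>i \<in> {0..<c}\<close> by (simp add: block_rotation_def)
next
  assume "i \<in> {c..<n}" "(n - c) dvd j - k"
  then have "(i - c + j) mod (n - c) = (i - c + k) mod (n - c)"
    using mod_eq_dvd_iff[of "i - c + j" "n - c" "i - c + k"] by simp
  then show "block_rotation c n j i = block_rotation c n k i" using \<open>i \<in> {c..<n}\<close> by (simp add: block_rotation_def)
qed

lemma block_rotation_trivial: "c dvd j \<Longrightarrow> (n - c) dvd j \<Longrightarrow> block_rotation c n j i = i"
  using block_rotation_cong[of i j 0] block_rotation_0[of i] by (cases "i \<in> {0..<n}"; force simp: block_rotation_def)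

definition sheet_rotation :: "int \<Rightarrow> (int \<times> bool) perm" where
  "sheet_rotation j = Perm (\<lambda>(i, b). (block_rotation c n (if b then - j else j) i, b))"

lemma apply_sheet_rotation: "sheet_rotation j \<langle>$\<rangle> (i, b) = (block_rotation c n (if b then - j else j) i, b)"
proof -
  have "sheet_rotation j \<langle>$\<rangle> (i, b) = (\<lambda>(i, b). (block_rotation c n (if b then - j else j) i, b)) (i, b)"
    unfolding sheet_rotation_def
  proof (rule apply_Perm[where g = "\<lambda>(i, b). (block_rotation c n (if b then j else - j) i, b)"
    and S = "{0..<n} \<times> UNIV"])
    fix z :: "int \<times> bool" assume "z \<notin> {0..<n} \<times> UNIV"
    then show "(\<lambda>(i, b). (block_rotation c n (if b then - j else j) i, b)) z = z"
      using cn by (cases z) (auto simp: block_rotation_def)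
  qed (auto simp: block_rotation_add block_rotation_0)
  then show ?thesis by simp
qed

lemma sheet_rotation_add: "sheet_rotation (i + j) = sheet_rotation i + sheet_rotation j"
  by (rule perm_eqI) (clarsimp simp: apply_sheet_rotation block_rotation_add algebra_simps)

end

definition sheet_swap :: "int \<Rightarrow> (int \<times> bool) perm" where
  "sheet_swap n = Perm (\<lambda>(i, b). (i, if 0 \<le> i \<and> i < n then \<not> b else b))"

lemma apply_sheet_swap: "sheet_swap n \<langle>$\<rangle> (i, b) = (i, if 0 \<le> i \<and> i < n then \<not> b else b)"
proof -
  have "sheet_swap n \<langle>$\<rangle> (i, b) = (\<lambda>(i, b). (i, if 0 \<le> i \<and> i < n then \<not> b else b)) (i, b)"
    unfolding sheet_swap_def
    by (rule apply_Perm[where g = "\<lambda>(i, b). (i, if 0 \<le> i \<and> i < n then \<not> b else b)" and S = "{0..<n} \<times> UNIV"])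
      (auto split: if_splits)
  then show ?thesis by simp
qed

lemma sheet_swap_involution: "sheet_swap n + sheet_swap n = 0"
  by (rule perm_eqI) (clarsimp simp: apply_sheet_swap)

lemma sheet_swap_rotation:
  assumes "0 < c" "c < n"
  shows "sheet_swap n + sheet_rotation c n j = sheet_rotation c n (- j) + sheet_swap n"
proof (rule perm_eqI, clarify)
  fix i b
  have "0 \<le> block_rotation c n k i \<and> block_rotation c n k i < n \<longleftrightarrow> 0 \<le> i \<and> i < n" for k
    using block_rotation_mem(3)[OF assms, of k i] by simp
  moreover have "block_rotation c n k i = i" if "\<not> (0 \<le> i \<and> i < n)" for k
    using that assms by (auto simp: block_rotation_def)
  ultimately show "(sheet_swap n + sheet_rotation c n j) \<langle>$\<rangle> (i, b) = (sheet_rotation c n (- j) + sheet_swap n) \<langle>$\<rangle> (i, b)"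
    by (auto simp: apply_sheet_swap apply_sheet_rotation[OF assms])
qed

definition meridian :: "int \<Rightarrow> int \<Rightarrow> int \<Rightarrow> (int \<times> bool) perm" where
  "meridian c d n = Perm (\<lambda>(i, b). (if b then i else block_rotation c n 1 (block_rotation d n (-1) i), b))"

lemma apply_meridian:
  assumes "0 < c" "c < n" "0 < d" "d < n"
  shows "meridian c d n \<langle>$\<rangle> (i, b) = (if b then i else block_rotation c n 1 (block_rotation d n (-1) i), b)"
proof -
  have "meridian c d n \<langle>$\<rangle> (i, b) = (\<lambda>(i, b). (if b then i else block_rotation c n 1 (block_rotation d n (-1) i), b)) (i, b)"
    unfolding meridian_def
  proof (rule apply_Perm[where g = "\<lambda>(i, b). (if b then i else block_rotation d n 1 (block_rotation c n (-1) i), b)"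
    and S = "{0..<n} \<times> UNIV"])
    fix z :: "int \<times> bool" assume "z \<notin> {0..<n} \<times> UNIV"
    then show "(\<lambda>(i, b). (if b then i else block_rotation c n 1 (block_rotation d n (-1) i), b)) z = z"
      using assms by (cases z) (auto simp: block_rotation_def)
  qed (auto simp: block_rotation_add[OF assms(1,2)] block_rotation_add[OF assms(3,4)] block_rotation_0[OF assms(1,2)]
    block_rotation_0[OF assms(3,4)])
  then show ?thesis by simp
qed

lemma card_affected_meridian:
  assumes "0 < c" "c < n" "0 < d" "d < n" "d \<le> c"
  shows "card (affected (meridian c d n)) \<le> 3"
proof -
  have "affected (meridian c d n) \<subseteq> {(0, False), (d, False), (c, False)}"
  proof
    fix z assume "z \<in> affected (meridian c d n)"
    then obtain i where z: "z = (i, False)" and ne: "block_rotation c n 1 (block_rotation d n (-1) i) \<noteq> i"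
      by (cases z) (auto simp: in_affected apply_meridian[OF assms(1-4)] split: if_splits)
    have "i = 0 \<or> i = d \<or> i = c"
    proof (rule ccontr)
      assume other: "\<not> (i = 0 \<or> i = d \<or> i = c)"
      then have "block_rotation d n (-1) i = (if 0 < i \<and> i < n then i - 1 else i)"
        using assms by (auto simp: block_rotation_def mod_pos_pos_trivial)
      moreover have "block_rotation c n 1 (i - 1) = i" if "0 < i" "i < n"
        using that other assms by (auto simp: block_rotation_def mod_pos_pos_trivial)
      moreover have "block_rotation c n 1 i = i" if "\<not> (0 < i \<and> i < n)"
        using that other assms by (auto simp: block_rotation_def)
      ultimately show False using ne by (auto split: if_splits)
    qed
    then show "z \<in> {(0, False), (d, False), (c, False)}" using z by auto
  qed
  moreover have "card {(0, False), (d, False), (c, False)} \<le> 3"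
    using card_length[of "[(0, False), (d, False), (c, False)]"] by simp
  ultimately show ?thesis
    by (meson card_mono finite.emptyI finite.insertI order_trans)
qed

locale pell =
  fixes x y :: int
  assumes pell: "x\<^sup>2 = 3 * y\<^sup>2 + 1" and parity: "even x" "odd y" and pos: "0 < y" "y < x" "x < 3 * y"
begin

abbreviation period :: int where "period \<equiv> 2 * x + 2 * y"
abbreviation D :: int where "D \<equiv> 2 * x * y"
abbreviation E :: int where "E \<equiv> (x - y) * (3 * y - x)"
abbreviation D' :: int where "D' \<equiv> - ((x + y) * (x + 3 * y))"
abbreviation E' :: int where "E' \<equiv> - (2 * x * y)"

definition rotation :: "int \<Rightarrow> (int \<times> bool) perm" where "rotation i = sheet_rotation (2 * x) period (- D' * i)"
definition rotation' :: "int \<Rightarrow> (int \<times> bool) perm" where "rotation' i = sheet_rotation (x + y) period (D * i)"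
definition reflection :: "(int \<times> bool) perm" where "reflection = sheet_swap period"
definition axis_meridian :: "(int \<times> bool) perm" where "axis_meridian = meridian (2 * x) (x + y) period"

lemma splits: "0 < 2 * x" "2 * x < period" "0 < x + y" "x + y < period"
  using pos by auto

lemma det: "D' * E = 1 + D * E'"
proof -
  have "D' * E = - ((x\<^sup>2 - y\<^sup>2) * (9 * y\<^sup>2 - x\<^sup>2))" by (simp add: power2_eq_square algebra_simps)
  also have "\<dots> = 1 - 4 * x\<^sup>2 * y\<^sup>2" unfolding pell by (simp add: algebra_simps)
  finally show ?thesis by (simp add: power2_eq_square algebra_simps)
qed

lemma rotation_add: "rotation (i + j) = rotation i + rotation j"
  and rotation'_add: "rotation' (i + j) = rotation' i + rotation' j"
  using sheet_rotation_add[OF splits(1,2)] sheet_rotation_add[OF splits(3,4)]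
  by (simp_all add: rotation_def rotation'_def distrib_left)

lemma reflection_involution: "reflection + reflection = 0"
  by (simp add: reflection_def sheet_swap_involution)

lemma reflection_rotation: "reflection + rotation i = rotation (- i) + reflection"
  and reflection_rotation': "reflection + rotation' i = rotation' (- i) + reflection"
  using sheet_swap_rotation[OF splits(1,2)] sheet_swap_rotation[OF splits(3,4)]
  by (simp_all add: rotation_def rotation'_def reflection_def)

lemma sheet_rotation_eq_0: "c dvd j \<Longrightarrow> period - c dvd j \<Longrightarrow> 0 < c \<Longrightarrow> c < period \<Longrightarrow> sheet_rotation c period j = 0"
  by (rule perm_eqI) (auto simp: apply_sheet_rotation block_rotation_trivial)

lemma rotation_D: "rotation D = 0"
proof -
  have "2 * x dvd - D' * D" "period - 2 * x dvd - D' * D" by simp_all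
  then show ?thesis unfolding rotation_def using splits by (intro sheet_rotation_eq_0) auto
qed

lemma rotation'_D': "rotation' D' = 0"
proof -
  have "x + y dvd D * D'" by simp
  moreover have "period - (x + y) = x + y" by simp
  ultimately show ?thesis unfolding rotation'_def using splits by (intro sheet_rotation_eq_0) auto
qed

lemma rotation_E: "rotation (- E) = sheet_rotation (2 * x) period 1"
proof -
  have "- D' * - E = 1 + D * E'" using det by simp
  moreover have "sheet_rotation (2 * x) period (D * E') = 0" using splits by (intro sheet_rotation_eq_0) auto
  ultimately show ?thesis unfolding rotation_def by (simp only: sheet_rotation_add[OF splits(1,2)] add_0_right)
qed

lemma rotation'_E': "rotation' (- E') = sheet_rotation (x + y) period 1"
proof -
  have "D * - E' = 1 + D' * - E" using det by simp
  moreover have "sheet_rotation (x + y) period (D' * - E) = 0"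
  proof (rule sheet_rotation_eq_0)
    show "x + y dvd D' * - E" by simp
    moreover have "period - (x + y) = x + y" by simp
    ultimately show "period - (x + y) dvd D' * - E" by metis
  qed (use splits in auto)
  ultimately show ?thesis unfolding rotation'_def by (simp only: sheet_rotation_add[OF splits(3,4)] add_0_right)
qed

lemma meridian_relation: "rotation (- E) + reflection + axis_meridian = axis_meridian + rotation' (- E') + reflection"
proof (rule perm_eqI, clarify)
  fix i :: int and b :: bool
  show "(rotation (- E) + reflection + axis_meridian) \<langle>$\<rangle> (i, b) = (axis_meridian + rotation' (- E') + reflection) \<langle>$\<rangle> (i, b)"
  proof (cases "0 \<le> i \<and> i < period")
    case True
    have "0 \<le> block_rotation (2 * x) period 1 (block_rotation (x + y) period (- 1) i) \<and>
      block_rotation (2 * x) period 1 (block_rotation (x + y) period (- 1) i) < period"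
      using block_rotation_mem(3)[OF splits(1,2)] block_rotation_mem(3)[OF splits(3,4)] True
      by (simp add: atLeastLessThan_def)
    then show ?thesis
      unfolding rotation_E rotation'_E' axis_meridian_def reflection_def using True
      by (simp add: apply_sheet_rotation[OF splits(1,2)] apply_sheet_rotation[OF splits(3,4)] apply_sheet_swap
        apply_meridian[OF splits] block_rotation_add[OF splits(1,2)] block_rotation_add[OF splits(3,4)]
        block_rotation_0[OF splits(1,2)] block_rotation_0[OF splits(3,4)])
  next
    case False
    then have "block_rotation c period j i = i" if "0 < c" "c < period" for c j using that
      by (auto simp: block_rotation_def)
    then show ?thesis
      unfolding rotation_E rotation'_E' axis_meridian_def reflection_def using False splits
      by (simp add: apply_sheet_rotation[OF splits(1,2)] apply_sheet_rotation[OF splits(3,4)] apply_sheet_swap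
        apply_meridian[OF splits])
  qed
qed

definition longitude :: "(int \<times> bool) perm" where
  "longitude = - rotation (x * y) + (axis_meridian + rotation' (x * y)) + rotation (x * y) - (axis_meridian + rotation' (x * y))"

lemma half_turn:
  assumes "m = D' * (x * y) \<or> m = - (D' * (x * y))"
  shows "i \<in> {0..<x} \<Longrightarrow> block_rotation (2 * x) period m i = i + x"
    "i \<in> {x..<2*x} \<Longrightarrow> block_rotation (2 * x) period m i = i - x"
    "i \<in> {2*x..<period} \<Longrightarrow> block_rotation (2 * x) period m i = i"
proof -
  have "odd (D' * y)" using parity by simp
  then have "2 dvd D' * y - 1" "2 dvd - (D' * y) - 1" by simp_all
  then have "x * 2 dvd x * (D' * y - 1)" "x * 2 dvd x * (- (D' * y) - 1)"
    by (simp_all only: dvd_times_left_cancel_iff mult_dvd_mono dvd_refl)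
  moreover have "x * (D' * y - 1) = D' * (x * y) - x" "x * (- (D' * y) - 1) = - (D' * (x * y)) - x"
    by (simp_all add: algebra_simps)
  ultimately have "x * 2 dvd D' * (x * y) - x" "x * 2 dvd - (D' * (x * y)) - x" by metis+
  then have d1: "2 * x dvd m - x" using assms by (metis mult.commute)
  have "x * y dvd D' * (x * y)" by simp
  moreover have "2 * y dvd x * y" using parity(1) by simp
  ultimately have "2 * y dvd D' * (x * y)" by (rule dvd_trans[rotated])
  then have d2: "2 * y dvd m - 0" using assms by auto
  show "block_rotation (2 * x) period m i = i + x" if "i \<in> {0..<x}"
  proof -
    have "block_rotation (2 * x) period m i = block_rotation (2 * x) period x i"
      using that d1 by (intro block_rotation_cong(1)[OF splits(1,2)]) auto
    also have "\<dots> = i + x" using that by (simp add: block_rotation_def)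
    finally show ?thesis .
  qed
  show "block_rotation (2 * x) period m i = i - x" if "i \<in> {x..<2*x}"
  proof -
    have "m - (- x) = (m - x) + 2 * x" by simp
    then have "2 * x dvd m - (- x)" using dvd_add[OF d1 dvd_refl] by metis
    then have "block_rotation (2 * x) period m i = block_rotation (2 * x) period (- x) i"
      using that by (intro block_rotation_cong(1)[OF splits(1,2)]) auto
    also have "\<dots> = i - x" using that by (simp add: block_rotation_def)
    finally show ?thesis .
  qed
  show "block_rotation (2 * x) period m i = i" if "i \<in> {2*x..<period}"
    using block_rotation_cong(2)[OF splits(1,2) that, of m 0] d2 block_rotation_0[OF splits(1,2)] by simp
qed

lemma half_step:
  obtains c where "2 * c = x + y + 1"
    "\<And>i m. m = - (D * (x * y)) \<or> m = D * (x * y) - 1 \<Longrightarrow> i \<in> {0..<period} \<Longrightarrow>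
      block_rotation (x + y) period m i = block_rotation (x + y) period (- c) i"
proof -
  have odd: "odd (x + y)" using parity by simp
  then obtain c where c: "2 * c = x + y + 1" by (metis dvd_def even_plus_one_iff)
  have "2 * (D * (x * y)) - 1 = - (D' * E)" using det by simp
  moreover have "x + y dvd - (D' * E)" by simp
  ultimately have d: "x + y dvd 2 * (D * (x * y)) - 1" by metis
  have "x + y dvd (2 * (D * (x * y)) - 1) - (x + y)" using d by (simp only: dvd_diff dvd_refl)
  moreover have "(2 * (D * (x * y)) - 1) - (x + y) = (D * (x * y) - c) * 2" using c by simp
  ultimately have "x + y dvd (D * (x * y) - c) * 2" by metis
  moreover have "coprime (x + y) 2" using odd by simp
  ultimately have e: "x + y dvd D * (x * y) - c" using coprime_dvd_mult_left_iff by blast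
  show thesis
  proof (rule that[OF c])
    fix i m assume m: "m = - (D * (x * y)) \<or> m = D * (x * y) - 1" and i: "i \<in> {0..<period}"
    have "x + y dvd m - - c"
    proof (cases "m = - (D * (x * y))")
      case True
      then have "m - - c = - (D * (x * y) - c)" by simp
      then show ?thesis using e by (metis dvd_minus_iff)
    next
      case False
      then have "m - - c = (2 * (D * (x * y)) - 1) - (D * (x * y) - c)" using m by simp
      then show ?thesis using d e by (metis dvd_diff)
    qed
    moreover have "period - (x + y) = x + y" by simp
    ultimately have "x + y dvd m - - c" "period - (x + y) dvd m - - c" by metis+
    then show "block_rotation (x + y) period m i = block_rotation (x + y) period (- c) i"
      using i block_rotation_cong[OF splits(3,4), of i m "- c"] by (cases "i < x + y") auto
  qed
qed

lemma half_turn_no_commute: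
  assumes i: "i \<in> {y..<x} \<union> {x + y..<2 * x}" and c: "2 * c = x + y + 1"
    and J: "\<And>i. i \<in> {0..<x} \<Longrightarrow> J i = i + x" "\<And>i. i \<in> {x..<2*x} \<Longrightarrow> J i = i - x" "\<And>i. i \<in> {2*x..<period} \<Longrightarrow> J i = i"
  shows "block_rotation (x + y) period (- c) (J i) \<noteq> J (block_rotation (x + y) period (- c) i)"
proof -
  have up: "block_rotation (x + y) period (- c) j = j - c + (x + y)" if "j \<in> {x + y..<2 * x}" for j
  proof -
    have "period - (x + y) = x + y" by simp
    then have "(j - (x + y) + - c) mod (period - (x + y)) = (j - (x + y) + - c + (x + y)) mod (x + y)"
      by (simp only: mod_add_self2)
    also have "\<dots> = j - c" using that c pos by (subst mod_pos_pos_trivial) auto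
    finally show ?thesis using that pos by (simp add: block_rotation_def)
  qed
  have up_ge: "2 * x \<le> j - c + (x + y)" "j - c + (x + y) < period" if "j \<in> {x + y..<2 * x}" for j
    using that c pos by auto
  have low: "block_rotation (x + y) period (- c) j \<in> {0..<x + y}" if "j \<in> {y..<x}" for j
    using block_rotation_mem(1)[OF splits(3,4), of "- c" j] that pos by auto
  have Jlow: "J j < 2 * x" if "j \<in> {0..<x + y}" for j
    using J(1)[of j] J(2)[of j] that pos by (cases "j < x") auto
  from i show ?thesis
  proof
    assume i: "i \<in> {y..<x}"
    then have "J i = i + x" "i + x \<in> {x + y..<2 * x}" using J(1)[of i] pos by auto
    then have "block_rotation (x + y) period (- c) (J i) \<ge> 2 * x" using up[of "J i"] up_ge[of "J i"] by simp
    moreover have "J (block_rotation (x + y) period (- c) i) < 2 * x" using Jlow low i by blast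
    ultimately show ?thesis by simp
  next
    assume i: "i \<in> {x + y..<2 * x}"
    then have "J (block_rotation (x + y) period (- c) i) \<ge> 2 * x" using up[OF i] up_ge[OF i] J(3) by auto
    moreover have "J i = i - x" "i - x \<in> {y..<x}" using i J(2)[of i] pos by auto
    then have "block_rotation (x + y) period (- c) (J i) < x + y" using low by auto
    ultimately show ?thesis using pos by simp
  qed
qed

lemma longitude_moves_sheets:
  assumes "i \<in> {y..<x} \<union> {x + y..<2 * x}"
  defines "k \<equiv> axis_meridian + rotation' (x * y)" and "u \<equiv> rotation (x * y)"
  shows "k \<langle>$\<rangle> (u \<langle>$\<rangle> (i, b)) \<noteq> u \<langle>$\<rangle> (k \<langle>$\<rangle> (i, b))"
proof -
  obtain c where c: "2 * c = x + y + 1" "\<And>i m. m = - (D * (x * y)) \<or> m = D * (x * y) - 1 \<Longrightarrow> i \<in> {0..<period} \<Longrightarrow>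
      block_rotation (x + y) period m i = block_rotation (x + y) period (- c) i"
    by (rule half_step) blast
  define turn where "turn b = block_rotation (2 * x) period (if b then D' * (x * y) else - (D' * (x * y)))" for b
  define step where "step = block_rotation (x + y) period (- c)"
  have range: "i \<in> {0..<period}" "turn b i \<in> {0..<period}"
    using assms(1) pos block_rotation_mem(3)[OF splits(1,2)] by (auto simp: turn_def)
  have u: "u \<langle>$\<rangle> (i, b) = (turn b i, b)" for i
    unfolding u_def rotation_def turn_def by (simp add: apply_sheet_rotation[OF splits(1,2)])
  have k: "k \<langle>$\<rangle> (i, b) = (block_rotation (2 * x) period (if b then 0 else 1) (step i), b)" if "i \<in> {0..<period}" for i
    unfolding k_def rotation'_def axis_meridian_def step_def using c(2)[OF _ that]
    by (simp add: apply_sheet_rotation[OF splits(3,4)] apply_meridian[OF splits] block_rotation_add[OF splits(3,4)]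
      block_rotation_0[OF splits(1,2)])
  have swap: "turn b (block_rotation (2 * x) period m i) = block_rotation (2 * x) period m (turn b i)" for m i
    by (simp only: turn_def block_rotation_add[OF splits(1,2)] add.commute)
  have cancel: "block_rotation (2 * x) period (- m) (block_rotation (2 * x) period m i) = i" for m i
    using block_rotation_add[OF splits(1,2)] block_rotation_0[OF splits(1,2)] by simp
  have "step (turn b i) \<noteq> turn b (step i)"
    unfolding step_def turn_def by (rule half_turn_no_commute[OF assms(1) c(1)]) (use half_turn in auto)
  then show ?thesis using u k range swap cancel by (metis prod.inject)
qed

lemma longitude_moves: "card (affected longitude) \<ge> nat (4 * (x - y))"
proof -
  define S where "S = ({y..<x} \<union> {x + y..<2 * x}) \<times> (UNIV :: bool set)"
  have "card ({y..<x} \<union> {x + y..<2 * x}) = nat (x - y) + nat (x - y)"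
    using pos by (subst card_Un_disjoint) auto
  then have "card S = nat (4 * (x - y))" unfolding S_def by (simp add: card_cartesian_product)
  moreover have "card S \<le> card (affected longitude)"
    unfolding longitude_def by (rule card_le_affected_commutator) (use longitude_moves_sheets in \<open>auto simp: S_def\<close>)
  ultimately show ?thesis by simp
qed

lemma reflection_moves:
  assumes "\<And>i b. snd (g \<langle>$\<rangle> (i, b)) = b"
  shows "card (affected (g + (rotation i + reflection))) \<ge> nat (4 * (x - y))"
proof -
  have "{0..<period} \<times> UNIV \<subseteq> affected (g + (rotation i + reflection))"
  proof
    fix z :: "int \<times> bool" assume "z \<in> {0..<period} \<times> UNIV"
    then obtain j b where z: "z = (j, b)" "0 \<le> j" "j < period" by auto
    have "snd ((g + (rotation i + reflection)) \<langle>$\<rangle> z) = (\<not> b)"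
      using assms z by (simp add: reflection_def apply_sheet_swap rotation_def apply_sheet_rotation[OF splits(1,2)])
    then show "z \<in> affected (g + (rotation i + reflection))" using z by (auto simp: in_affected)
  qed
  then have "card ({0..<period} \<times> (UNIV :: bool set)) \<le> card (affected (g + (rotation i + reflection)))"
    by (intro card_mono) auto
  moreover have "card ({0..<period} \<times> (UNIV :: bool set)) = 2 * nat period" by (simp add: card_cartesian_product)
  moreover have "nat (4 * (x - y)) \<le> nat (2 * period)" using pos by (intro nat_mono) simp
  then have "nat (4 * (x - y)) \<le> 2 * nat period" by (simp only: nat_mult_distrib) simp
  ultimately show ?thesis by linarith
qed

end

fun pell_pair :: "nat \<Rightarrow> int \<times> int" where
  "pell_pair 0 = (2, 1)"
| "pell_pair (Suc j) = (case pell_pair j of (x, y) \<Rightarrow> (7 * x + 12 * y, 4 * x + 7 * y))"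

lemma pell_pair_pell: "pell (fst (pell_pair j)) (snd (pell_pair j))"
proof (induction j)
  case 0
  show ?case by standard auto
next
  case (Suc j)
  obtain x y where xy: "pell_pair j = (x, y)" by force
  interpret pell x y using Suc xy by simp
  have "(7 * x + 12 * y)\<^sup>2 - 3 * (4 * x + 7 * y)\<^sup>2 = x\<^sup>2 - 3 * y\<^sup>2" by (simp add: power2_eq_square algebra_simps)
  then show ?case using xy pell parity pos by unfold_locales auto
qed

lemma pell_pair_growth: "4 * (fst (pell_pair j) - snd (pell_pair j)) \<ge> 3 * 2 ^ (2 * j + 1) - 2"
proof (induction j)
  case (Suc j)
  obtain x y where xy: "pell_pair j = (x, y)" by force
  interpret pell x y using pell_pair_pell[of j] xy by simp
  show ?case using Suc xy pos by (simp add: power_add)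
qed simp

section \<open>The strands\<close>

definition interpolate :: "(nat \<Rightarrow> real) \<Rightarrow> nat \<Rightarrow> real \<Rightarrow> real" where
  "interpolate f M t = f 0 + (\<Sum>i<M. (f (Suc i) - f i) * max 0 (min 1 (t - real i)))"

lemma interpolate_segment:
  assumes "m < M" "real m \<le> t" "t \<le> real m + 1"
  shows "interpolate f M t = f m + (f (Suc m) - f m) * (t - real m)"
proof -
  define g where "g i = (f (Suc i) - f i) * max 0 (min 1 (t - real i))" for i
  have "sum g {..<M} = sum g {..<m} + g m + sum g {Suc m..<M}"
    using sum.atLeastLessThan_concat[of 0 m M g] sum.atLeast_Suc_lessThan[of m M g] assms(1)
    by (simp add: lessThan_atLeast0 add.assoc)
  also have "sum g {..<m} = (\<Sum>i<m. f (Suc i) - f i)"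
    using assms(2) by (intro sum.cong) (auto simp: g_def min_def max_def)
  also have "\<dots> = f m - f 0" by (rule sum_lessThan_telescope)
  also have "sum g {Suc m..<M} = 0"
    using assms(3) by (intro sum.neutral) (auto simp: g_def min_def max_def)
  also have "g m = (f (Suc m) - f m) * (t - real m)" using assms by (simp add: g_def min_def max_def)
  finally show ?thesis by (simp add: interpolate_def g_def)
qed

lemma interpolate_le_0: "t \<le> 0 \<Longrightarrow> interpolate f M t = f 0"
  by (auto simp: interpolate_def min_def max_def intro!: sum.neutral)

lemma interpolate_ge: "real M \<le> t \<Longrightarrow> interpolate f M t = f M"
proof -
  assume "real M \<le> t"
  then have "(\<Sum>i<M. (f (Suc i) - f i) * max 0 (min 1 (t - real i))) = (\<Sum>i<M. f (Suc i) - f i)"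
    by (intro sum.cong) (auto simp: min_def max_def)
  then show ?thesis by (simp add: interpolate_def sum_lessThan_telescope)
qed

lemma continuous_interpolate: "isCont (interpolate f M) t"
  unfolding interpolate_def[abs_def] by (intro continuous_intros)

definition turn_sign :: "nat \<Rightarrow> real" where "turn_sign m = (if even (m div 6) then 1 else - 1)"
definition vertex_X :: "nat \<Rightarrow> real"
  where "vertex_X m = turn_sign m * (if m mod 3 = 0 then 0 else if m mod 3 = 1 then 2 else - 2)"
definition vertex_Y :: "nat \<Rightarrow> real" where "vertex_Y m = turn_sign m * (if m mod 3 = 0 then 0 else 4)"

lemma turn_sign_cases: "turn_sign m = 1 \<or> turn_sign m = - 1" by (simp add: turn_sign_def)

lemma turn_sign_Suc: "m mod 3 \<noteq> 2 \<Longrightarrow> turn_sign (Suc m) = turn_sign m"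
proof -
  assume "m mod 3 \<noteq> 2"
  then have "\<not> 3 dvd Suc m" by presburger
  then have "\<not> 6 dvd Suc m" using dvd_trans[of 3 6 "Suc m"] by auto
  then have "Suc m div 6 = m div 6" by (simp add: div_Suc dvd_eq_mod_eq_0)
  then show ?thesis by (simp add: turn_sign_def)
qed

text \<open>The moving strand passes next to a fixed strand only half way along an edge; \<open>back_strand m\<close> is then the strand
  behind and \<open>front_strand m\<close> the one in front.\<close>

definition back_strand :: "nat \<Rightarrow> nat"
  where "back_strand m = (if turn_sign m = 1 then (if m mod 3 = 0 then 2 else 1) else (if m mod 3 = 0 then 1 else 0))"
definition front_strand :: "nat \<Rightarrow> nat"
  where "front_strand m = (if turn_sign m = 1 then (if m mod 3 = 0 then 1 else 2) else (if m mod 3 = 0 then 0 else 1))"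

lemma back_front_strand: "back_strand m < 3" "front_strand m < 3" "back_strand m \<noteq> front_strand m"
    "{back_strand m, front_strand m} = {0, 1} \<or> {back_strand m, front_strand m} = {1, 2}"
  using turn_sign_cases[of m] by (auto simp: back_strand_def front_strand_def)

locale strands =
  fixes J :: nat
  assumes J: "0 < J" "12 dvd J"
begin

abbreviation core :: real where "core \<equiv> real J"
abbreviation rim :: real where "rim \<equiv> 2 * real J"

lemma core_ge_12: "core \<ge> 12" using J by (auto elim!: dvdE)

definition winding_X :: "real \<Rightarrow> real" where "winding_X t = interpolate vertex_X J t"
definition winding_Y :: "real \<Rightarrow> real" where "winding_Y t = interpolate vertex_Y J t"

lemma winding_outside: "t \<le> 0 \<or> core \<le> t \<Longrightarrow> winding_X t = 0 \<and> winding_Y t = 0"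
proof -
  have "vertex_X J = 0" "vertex_Y J = 0" using J(2) by (auto simp: vertex_X_def vertex_Y_def elim!: dvdE)
  then show "t \<le> 0 \<or> core \<le> t \<Longrightarrow> winding_X t = 0 \<and> winding_Y t = 0"
    by (auto simp: winding_X_def winding_Y_def interpolate_le_0 interpolate_ge) (simp_all add: vertex_X_def vertex_Y_def)
qed

lemma winding_segment:
  assumes "m < J" "real m \<le> t" "t \<le> real m + 1"
  shows "m mod 3 = 0 \<Longrightarrow> winding_X t = turn_sign m * (2 * (t - real m)) \<and> winding_Y t = turn_sign m * (4 * (t - real m))"
    "m mod 3 = 1 \<Longrightarrow> winding_X t = turn_sign m * (2 - 4 * (t - real m)) \<and> winding_Y t = turn_sign m * 4"
    "m mod 3 = 2 \<Longrightarrow> winding_X t = turn_sign m * (2 * (t - real m) - 2) \<and>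
      winding_Y t = turn_sign m * (4 - 4 * (t - real m))"
proof -
  note seg = interpolate_segment[OF assms]
  have s: "Suc m mod 3 = (if m mod 3 = 2 then 0 else Suc (m mod 3))" by presburger
  show "m mod 3 = 0 \<Longrightarrow> winding_X t = turn_sign m * (2 * (t - real m)) \<and> winding_Y t = turn_sign m * (4 * (t - real m))"
    "m mod 3 = 1 \<Longrightarrow> winding_X t = turn_sign m * (2 - 4 * (t - real m)) \<and> winding_Y t = turn_sign m * 4"
    "m mod 3 = 2 \<Longrightarrow> winding_X t = turn_sign m * (2 * (t - real m) - 2) \<and>
      winding_Y t = turn_sign m * (4 - 4 * (t - real m))"
    unfolding winding_X_def winding_Y_def seg using s turn_sign_Suc[of m]
    by (simp_all add: vertex_X_def vertex_Y_def algebra_simps)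
qed

lemma segment_exists:
  assumes "0 < t" "t < core"
  obtains m where "m < J" "real m \<le> t" "t \<le> real m + 1"
proof (rule that[of "nat \<lfloor>t\<rfloor>"])
  show "nat \<lfloor>t\<rfloor> < J" using assms by linarith
qed (use assms in linarith)+

lemma winding_bounds: "\<bar>winding_X t\<bar> \<le> 2" "\<bar>winding_Y t\<bar> \<le> 4"
proof -
  have "\<bar>winding_X t\<bar> \<le> 2 \<and> \<bar>winding_Y t\<bar> \<le> 4"
  proof (cases "0 < t \<and> t < core")
    case True
    then obtain m where m: "m < J" "real m \<le> t" "t \<le> real m + 1" using segment_exists by blast
    consider "m mod 3 = 0" | "m mod 3 = 1" | "m mod 3 = 2" by linarith
    then show ?thesis
      using winding_segment[OF m] turn_sign_cases[of m] m by cases (auto simp: abs_le_iff)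
  next
    case False
    then show ?thesis using winding_outside[of t] by auto
  qed
  then show "\<bar>winding_X t\<bar> \<le> 2" "\<bar>winding_Y t\<bar> \<le> 4" by auto
qed

lemma crossing_time:
  assumes "\<bar>winding_Y t\<bar> = 2"
  obtains m where "m < J" "t = real m + 1 / 2" "m mod 3 \<noteq> 1" "winding_Y t = 2 * turn_sign m"
    "winding_X t = (if back_strand m = 1 then - 1 else 1)"
proof -
  have "0 < t \<and> t < core" using winding_outside[of t] assms by force
  then obtain m where m: "m < J" "real m \<le> t" "t \<le> real m + 1" using segment_exists by blast
  consider "m mod 3 = 0" | "m mod 3 = 1" | "m mod 3 = 2" by linarith
  then show ?thesis
  proof cases
    case 1
    have "4 * (t - real m) = 2" using winding_segment(1)[OF m 1] assms turn_sign_cases[of m] m by (auto simp: abs_mult)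
    then show ?thesis using winding_segment(1)[OF m 1] 1 m turn_sign_cases[of m]
      by (intro that[of m]) (auto simp: back_strand_def)
  next
    case 2
    then show ?thesis using winding_segment(2)[OF m 2] assms turn_sign_cases[of m] by auto
  next
    case 3
    have "4 - 4 * (t - real m) = 2" using winding_segment(3)[OF m 3] assms turn_sign_cases[of m] m
      by (auto simp: abs_mult)
    then show ?thesis using winding_segment(3)[OF m 3] 3 m turn_sign_cases[of m]
      by (intro that[of m]) (auto simp: back_strand_def)
  qed
qed

lemma winding_order:
  assumes m: "m < J" "m mod 3 \<noteq> 1" and t: "\<bar>t - (real m + 1 / 2)\<bar> \<le> 1 / 2"
  shows "(if back_strand m = 1 then winding_Y t \<le> 2 * turn_sign m else 2 * turn_sign m \<le> winding_Y t) \<longleftrightarrow>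
    real m + 1 / 2 \<le> t"
proof -
  have m': "m < J" "real m \<le> t" "t \<le> real m + 1" using m t by linarith+
  consider "m mod 3 = 0" | "m mod 3 = 2" using m(2) by linarith
  then show ?thesis
    using winding_segment[OF m'] turn_sign_cases[of m] by cases (auto simp: back_strand_def)
qed

definition strand_X :: "nat \<Rightarrow> real \<Rightarrow> real" where
  "strand_X i s = (if i = 0 then - max 0 (core - \<bar>s\<bar>) else if i = 1 then winding_X (\<bar>s\<bar> - core) - max 0 (core - \<bar>s\<bar>)
     else if i = 4 then 0 else max 0 (core - \<bar>s\<bar>))"

definition strand_Y :: "nat \<Rightarrow> real \<Rightarrow> real" where
  "strand_Y i s = (if i = 0 then - 2 + 2 * max 0 (s - rim) else if i = 1 then winding_Y (\<bar>s\<bar> - core)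
     else if i = 2 then 2 - 2 * max 0 (- rim - s) else if i = 3 then 6 - 4 * max 0 (s - rim) - 8 / 7 * max 0 (- rim - s)
       else s)"

definition bottom :: "nat \<Rightarrow> real" where "bottom i = (if i = 0 \<or> i = 3 then - rim - 7 else - rim - 1)"

definition live :: "nat \<Rightarrow> real \<Rightarrow> bool" where "live i s \<longleftrightarrow> i = 4 \<or> (bottom i \<le> s \<and> s \<le> rim + 1)"

lemma continuous_strand_X: "isCont (strand_X i) s" and continuous_strand_Y: "isCont (strand_Y i) s"
proof -
  have abs: "isCont (\<lambda>s :: real. \<bar>s\<bar> - core) s" by (intro continuous_intros)
  have P: "isCont (\<lambda>s. winding_X (\<bar>s\<bar> - core)) s" "isCont (\<lambda>s. winding_Y (\<bar>s\<bar> - core)) s"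
    unfolding winding_X_def winding_Y_def by (rule isCont_o2[OF abs continuous_interpolate])+
  show "isCont (strand_X i) s" unfolding strand_X_def[abs_def]
    by (cases "i = 0"; cases "i = 1"; cases "i = 4") (auto intro!: continuous_intros P)
  show "isCont (strand_Y i) s" unfolding strand_Y_def[abs_def]
    by (cases "i = 0"; cases "i = 1"; cases "i = 2"; cases "i = 3") (auto intro!: continuous_intros P)
qed

lemma closed_live: "closed {s. live i s}"
proof -
  have "{s. live i s} = (if i = 4 then UNIV else {bottom i..rim + 1})" by (auto simp: live_def)
  then show ?thesis by simp
qed

lemma strand_Y_bounds:
  assumes "i < 4" "live i s"
  shows "- 4 \<le> strand_Y i s" "strand_Y i s \<le> 6"
proof -
  have "- 4 \<le> strand_Y i s \<and> strand_Y i s \<le> 6"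
  proof (cases "i = 3")
    case True
    define u where "u = max 0 (s - rim)"
    define v where "v = max 0 (- rim - s)"
    have "0 \<le> u" "u \<le> 1" "0 \<le> v" "v \<le> 7" "u = 0 \<or> v = 0"
      using assms True core_ge_12 by (auto simp: live_def bottom_def u_def v_def)
    moreover have "strand_Y i s = 6 - 4 * u - 8 / 7 * v" using True by (simp add: strand_Y_def u_def v_def)
    ultimately show ?thesis by linarith
  next
    case False
    then show ?thesis using assms winding_bounds(2)[of "\<bar>s\<bar> - core"] core_ge_12
      by (auto simp: strand_Y_def live_def bottom_def abs_le_iff max_def)
  qed
  then show "- 4 \<le> strand_Y i s" "strand_Y i s \<le> 6" by auto
qed

definition winding_crossing :: "nat \<Rightarrow> real \<Rightarrow> bool" where
  "winding_crossing m s \<longleftrightarrow> m < J \<and> m mod 3 \<noteq> 1 \<and> \<bar>s\<bar> = core + real m + 1 / 2"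

definition cap :: "real \<Rightarrow> nat \<Rightarrow> nat \<Rightarrow> bool" where
  "cap s i j \<longleftrightarrow> (s, i, j) \<in> {(rim + 1, 0, 1), (rim + 1, 2, 3), (- rim - 1, 1, 2), (- rim - 7, 0, 3)}"

definition axis_height :: "nat \<Rightarrow> real" where
  "axis_height i = (if i = 0 then - 2 else if i = 1 then 0 else if i = 2 then 2 else 6)"

lemma winding_crossing_height:
  assumes "winding_crossing m s"
  shows "core < \<bar>s\<bar>" "\<bar>s\<bar> < rim"
  using assms by (auto simp: winding_crossing_def)

lemma strand_Y_winding:
  assumes "core \<le> \<bar>s\<bar>" "\<bar>s\<bar> \<le> rim"
  shows "strand_Y 0 s = - 2" "strand_Y 1 s = winding_Y (\<bar>s\<bar> - core)" "strand_Y 2 s = 2"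
  using assms by (auto simp: strand_Y_def max_def)

lemma strand_Y_core:
  assumes "\<bar>s\<bar> \<le> core" "i < 4"
  shows "strand_Y i s = axis_height i"
  using assms winding_outside[of "\<bar>s\<bar> - core"] by (auto simp: strand_Y_def axis_height_def max_def)

lemma live_winding: "\<bar>s\<bar> \<le> rim \<Longrightarrow> live i s"
  by (auto simp: live_def bottom_def)

lemma winding_meeting:
  assumes "i = 0 \<and> j = 1 \<and> winding_Y (\<bar>s\<bar> - core) = - 2 \<or> i = 1 \<and> j = 2 \<and> winding_Y (\<bar>s\<bar> - core) = 2"
  obtains m where "winding_crossing m s" "{i, j} = {back_strand m, front_strand m}"
proof -
  have "\<bar>winding_Y (\<bar>s\<bar> - core)\<bar> = 2" using assms by auto
  then obtain m where m: "m < J" "\<bar>s\<bar> - core = real m + 1 / 2" "m mod 3 \<noteq> 1" "winding_Y (\<bar>s\<bar> - core) = 2 * turn_sign m"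
    by (rule crossing_time)
  have "turn_sign m = - 1 \<longleftrightarrow> i = 0" using m(4) assms turn_sign_cases[of m] by auto
  then have "{i, j} = {back_strand m, front_strand m}"
    using assms turn_sign_cases[of m] by (auto simp: back_strand_def front_strand_def)
  then show ?thesis using m by (intro that[of m]) (auto simp: winding_crossing_def)
qed

lemma winding_crossing_meets:
  assumes "winding_crossing m s"
  shows "strand_Y (back_strand m) s = strand_Y (front_strand m) s"
    "strand_X (back_strand m) s < strand_X (front_strand m) s"
proof -
  note height = winding_crossing_height[OF assms]
  have m: "m < J" "m mod 3 \<noteq> 1" "\<bar>s\<bar> - core = real m + 1 / 2" using assms by (auto simp: winding_crossing_def)
  have "winding_Y (\<bar>s\<bar> - core) = 2 * turn_sign m \<and>
    winding_X (\<bar>s\<bar> - core) = (if m mod 3 = 0 then turn_sign m else - turn_sign m)"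
    unfolding m(3) using winding_segment(1,3)[OF m(1), of "real m + 1 / 2"] m(2)
    by (cases "m mod 3 = 0") (auto simp: not_less)
  then show "strand_Y (back_strand m) s = strand_Y (front_strand m) s"
    "strand_X (back_strand m) s < strand_X (front_strand m) s"
    using height strand_Y_winding[of s] turn_sign_cases[of m]
    by (auto simp: back_strand_def front_strand_def strand_X_def)
qed

lemma meeting_axis:
  assumes "i < 4" "live i s" "strand_Y i s = s"
  shows "s = axis_height i"
proof -
  have "\<bar>s\<bar> \<le> core" using strand_Y_bounds[OF assms(1,2)] assms(3) core_ge_12 by auto
  then show ?thesis using strand_Y_core[of s i] assms(1,3) by simp
qed

lemma meeting_2_3:
  assumes "live 2 s" "live 3 s" "strand_Y 2 s = strand_Y 3 s"
  shows "s = rim + 1"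
proof -
  define u where "u = max 0 (s - rim)"
  define v where "v = max 0 (- rim - s)"
  have "0 \<le> u" "u \<le> 1" "0 \<le> v" "v \<le> 1" "u = 0 \<or> v = 0"
    using assms core_ge_12 by (auto simp: live_def bottom_def u_def v_def)
  moreover have "2 - 2 * v = 6 - 4 * u - 8 / 7 * v" using assms(3) by (simp add: strand_Y_def u_def v_def)
  ultimately have "u = 1" by linarith
  then show ?thesis by (simp add: u_def max_def split: if_splits)
qed

lemma coincidence [consumes 5, case_names winding cap axis]:
  assumes "i < j" "j < 5" "live i s" "live j s" "strand_Y i s = strand_Y j s"
  obtains m where "winding_crossing m s" "{i, j} = {back_strand m, front_strand m}" | "cap s i j"
    | "j = 4" "s = axis_height i"
proof -
  have outside: "winding_Y (\<bar>s\<bar> - core) = 0" if "rim \<le> \<bar>s\<bar> \<or> \<bar>s\<bar> \<le> core" using winding_outside[of "\<bar>s\<bar> - core"] that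
    by auto
  have bounds: "- 4 \<le> winding_Y (\<bar>s\<bar> - core)" "winding_Y (\<bar>s\<bar> - core) \<le> 4"
    using winding_bounds(2)[of "\<bar>s\<bar> - core"] by (auto simp: abs_le_iff)
  consider "i = 0" "j = 1" | "i = 1" "j = 2" | "i = 2" "j = 3" | "j = 4" "i < 4" | "(i, j) \<in> {(0, 2), (0, 3), (1, 3)}"
    using assms(1,2) by force
  then show ?thesis
  proof cases
    case 1
    show ?thesis
    proof (cases "s \<le> rim")
      case True
      then have "winding_Y (\<bar>s\<bar> - core) = - 2" using assms(5) 1 by (simp add: strand_Y_def)
      then show ?thesis using winding_meeting[of i j s] 1 that(1) by blast
    next
      case False
      then have "cap s i j" using assms 1 outside by (simp add: strand_Y_def live_def bottom_def cap_def)
      then show ?thesis by (rule that(2))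
    qed
  next
    case 2
    show ?thesis
    proof (cases "- rim \<le> s")
      case True
      then have "winding_Y (\<bar>s\<bar> - core) = 2" using assms(5) 2 by (simp add: strand_Y_def)
      then show ?thesis using winding_meeting[of i j s] 2 that(1) by blast
    next
      case False
      then have "cap s i j" using assms 2 outside core_ge_12 by (simp add: strand_Y_def live_def bottom_def cap_def)
      then show ?thesis by (rule that(2))
    qed
  next
    case 3
    then show ?thesis using meeting_2_3[of s] assms by (intro that(2)) (simp add: cap_def)
  next
    case 4
    then show ?thesis using meeting_axis[of i s] assms by (intro that(3)) (simp_all add: strand_Y_def[of 4])
  next
    case 5
    then have "cap s i j"
      using assms(3-5) bounds core_ge_12 outside
      by (auto simp: strand_Y_def live_def bottom_def cap_def max_def split: if_splits)
    then show ?thesis by (rule that(2))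
  qed
qed

lemma no_triple:
  assumes "i < j" "j < k" "k < 5" "live i s" "live j s" "live k s" "strand_Y i s = strand_Y j s"
    "strand_Y j s = strand_Y k s"
  shows False
proof -
  have apart: False if "live a s" "live b s" "strand_Y a s = strand_Y b s" "(a, b) \<in> {(0, 2), (1, 3)}" for a b
  proof -
    have "a < b" "b < 5" using that(4) by auto
    from this that(1-3) show False
    proof (cases rule: coincidence)
      case (winding m)
      then have "{a, b} = {0, 1} \<or> {a, b} = {1, 2}" using back_front_strand(4)[of m] by simp
      then show ?thesis using that(4) by (auto simp: doubleton_eq_iff)
    qed (use that(4) in \<open>auto simp: cap_def\<close>)
  qed
  have axis: "s = axis_height a" if "a < 4" "live a s" "strand_Y a s = strand_Y 4 s" for a
    using meeting_axis[of a s] that by (simp add: strand_Y_def[of 4])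
  consider "(i, j, k) \<in> {(0, 1, 2), (0, 1, 3), (0, 2, 3), (1, 2, 3)}" | "k = 4"
    using assms(1-3) by force
  then show ?thesis
  proof cases
    case 1
    then show ?thesis using assms(4-8) apart[of 0 2] apart[of 1 3] by auto
  next
    case 2
    then have "axis_height i = axis_height j" "j < 4" using axis[of i] axis[of j] assms by simp_all
    then show ?thesis using assms(1) by (auto simp: axis_height_def split: if_splits)
  qed
qed

lemma cap_meets:
  assumes "cap s i j"
  shows "strand_X j s = strand_X i s" "strand_Y i s = strand_Y j s" "live i s" "live j s" "i < j" "j < 4"
    "rim + 1 \<le> \<bar>s\<bar>"
proof -
  show "i < j" "j < 4" "live i s" "live j s" "rim + 1 \<le> \<bar>s\<bar>"
    using assms core_ge_12 by (auto simp: cap_def live_def bottom_def)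
  then show "strand_X j s = strand_X i s" "strand_Y i s = strand_Y j s"
    using assms winding_outside[of "\<bar>s\<bar> - core"] by (auto simp: cap_def strand_X_def strand_Y_def)
qed

lemma cap_exists:
  assumes "i < 4" "s = rim + 1 \<or> s = bottom i"
  obtains j where "cap s i j \<or> cap s j i"
proof -
  have "i = 0 \<or> i = 1 \<or> i = 2 \<or> i = 3" using assms(1) by linarith
  then show ?thesis
    using assms(2) that[of 0] that[of 1] that[of 2] that[of 3] by (auto simp: cap_def bottom_def)
qed

lemma cap_liveness:
  assumes "cap s0 i j"
  shows "(\<forall>\<^sub>F s in nhds s0. (live i s \<longleftrightarrow> s \<le> s0) \<and> (live j s \<longleftrightarrow> s \<le> s0)) \<or>
    (\<forall>\<^sub>F s in nhds s0. (live i s \<longleftrightarrow> s0 \<le> s) \<and> (live j s \<longleftrightarrow> s0 \<le> s))"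
proof (cases "s0 = rim + 1")
  case True
  have "\<forall>\<^sub>F s in nhds s0. s \<in> {0<..}" using True by (intro eventually_nhds_in_open) auto
  then have "\<forall>\<^sub>F s in nhds s0. (live i s \<longleftrightarrow> s \<le> s0) \<and> (live j s \<longleftrightarrow> s \<le> s0)"
    by eventually_elim (use True assms core_ge_12 in \<open>auto simp: live_def bottom_def cap_def\<close>)
  then show ?thesis ..
next
  case False
  have "\<forall>\<^sub>F s in nhds s0. s \<in> {..<0}" using False assms by (intro eventually_nhds_in_open) (auto simp: cap_def)
  then have "\<forall>\<^sub>F s in nhds s0. (live i s \<longleftrightarrow> s0 \<le> s) \<and> (live j s \<longleftrightarrow> s0 \<le> s)"
    by eventually_elim (use False assms core_ge_12 in \<open>auto simp: live_def bottom_def cap_def\<close>)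
  then show ?thesis ..
qed

definition level :: "real \<Rightarrow> nat" where "level s = min J (nat \<lfloor>\<bar>s\<bar> - core + 1 / 2\<rfloor>)"

lemma level_0: "\<bar>s\<bar> < core + 1 / 2 \<Longrightarrow> level s = 0"
  by (simp add: level_def floor_le_iff)

lemma level_J: "rim \<le> \<bar>s\<bar> \<Longrightarrow> level s = J"
  by (simp add: level_def le_nat_floor min_absorb1)

lemma level_near: "\<bar>s0\<bar> < core \<Longrightarrow> \<forall>\<^sub>F s in nhds s0. level s = 0 \<and> \<bar>s\<bar> < core"
proof -
  assume "\<bar>s0\<bar> < core"
  then have "\<forall>\<^sub>F s in nhds s0. s \<in> {- core<..<core}" by (intro eventually_nhds_in_open) auto
  then show ?thesis by eventually_elim (simp add: level_0 abs_less_iff)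
qed

lemma level_crossing:
  assumes "m < J" "\<bar>s0\<bar> = core + real m + 1 / 2"
  shows "\<forall>\<^sub>F s in nhds s0. level s = (if \<bar>s0\<bar> \<le> \<bar>s\<bar> then Suc m else m) \<and> \<bar>\<bar>s\<bar> - \<bar>s0\<bar>\<bar> < 1 / 2 \<and> s * s0 > 0"
proof -
  have "\<forall>\<^sub>F s in nhds s0. dist s s0 < 1 / 2" unfolding eventually_nhds_metric by (intro exI[of _ "1 / 2"]) simp
  then show ?thesis
  proof eventually_elim
    case (elim s)
    have close: "\<bar>\<bar>s\<bar> - \<bar>s0\<bar>\<bar> < 1 / 2" using elim unfolding dist_real_def by linarith
    have "s > 0 \<and> s0 > 0 \<or> s < 0 \<and> s0 < 0" using elim assms(2) core_ge_12 unfolding dist_real_def by linarith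
    then have "s * s0 > 0" by (auto simp: zero_less_mult_iff)
    moreover have "\<lfloor>\<bar>s\<bar> - core + 1 / 2\<rfloor> = (if \<bar>s0\<bar> \<le> \<bar>s\<bar> then int (Suc m) else int m)"
      using close assms(2) by (auto intro!: floor_unique)
    ultimately show ?case using assms(1) close by (auto simp: level_def)
  qed
qed

lemma eventually_clamped_floor:
  fixes a :: real
  assumes "a \<notin> \<int> \<or> a < 1 \<or> real k < a"
  shows "\<forall>\<^sub>F b in nhds a. min k (nat \<lfloor>b\<rfloor>) = min k (nat \<lfloor>a\<rfloor>)"
proof -
  consider "a \<notin> \<int>" | "a < 1" | "real k < a" using assms by blast
  then show ?thesis
  proof cases
    case 1
    then have "a \<in> {of_int \<lfloor>a\<rfloor><..<of_int \<lfloor>a\<rfloor> + 1}"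
      using floor_correct[of a] by (auto simp: less_le Ints_def)
    then have "\<forall>\<^sub>F b in nhds a. b \<in> {of_int \<lfloor>a\<rfloor><..<of_int \<lfloor>a\<rfloor> + 1}" by (intro eventually_nhds_in_open) auto
    then show ?thesis
    proof eventually_elim
      case (elim b)
      then have "\<lfloor>b\<rfloor> = \<lfloor>a\<rfloor>" by (intro floor_unique) auto
      then show ?case by simp
    qed
  next
    case 2
    then have "\<forall>\<^sub>F b in nhds a. b \<in> {..<1}" by (intro eventually_nhds_in_open) auto
    then show ?thesis by eventually_elim (use 2 in \<open>simp add: floor_less_iff\<close>)
  next
    case 3
    then have "\<forall>\<^sub>F b in nhds a. b \<in> {real k<..}" by (intro eventually_nhds_in_open) auto
    then show ?thesis by eventually_elim (use 3 in \<open>simp add: le_nat_floor min_absorb1\<close>)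
  qed
qed

lemma level_const:
  assumes "\<And>m. m < J \<Longrightarrow> \<bar>s0\<bar> \<noteq> core + real m + 1 / 2"
  shows "\<forall>\<^sub>F s in nhds s0. level s = level s0"
proof -
  define a where "a = \<bar>s0\<bar> - core + 1 / 2"
  have "a \<notin> \<int>" if "1 \<le> a" "a \<le> core"
  proof
    assume "a \<in> \<int>"
    then obtain i where i: "a = of_int i" by (auto simp: Ints_def)
    then have "nat (i - 1) < J" "a = real (nat (i - 1)) + 1" using that by auto
    then show False using assms unfolding a_def by fastforce
  qed
  then have "\<forall>\<^sub>F b in nhds a. min J (nat \<lfloor>b\<rfloor>) = min J (nat \<lfloor>a\<rfloor>)"
    by (intro eventually_clamped_floor) fastforce
  moreover have "filterlim (\<lambda>s. \<bar>s\<bar> - core + 1 / 2) (nhds a) (nhds s0)"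
    unfolding a_def by (intro tendsto_intros filterlim_ident)
  ultimately show ?thesis unfolding level_def a_def by (rule eventually_compose_filterlim)
qed

lemma eventually_same_side:
  fixes a s0 :: real
  assumes "s0 \<noteq> a"
  shows "\<forall>\<^sub>F s in nhds s0. (a \<le> s \<longleftrightarrow> a \<le> s0) \<and> (s \<le> a \<longleftrightarrow> s0 \<le> a)"
proof (cases "s0 < a")
  case True
  then have "\<forall>\<^sub>F s in nhds s0. s \<in> {..<a}" by (intro eventually_nhds_in_open) auto
  then show ?thesis by eventually_elim (use True in auto)
next
  case False
  then have "\<forall>\<^sub>F s in nhds s0. s \<in> {a<..}" using assms by (intro eventually_nhds_in_open) auto
  then show ?thesis by eventually_elim (use False assms in auto)
qed

lemma eventually_winding_crossing:
  assumes "winding_crossing m s0"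
  shows "\<forall>\<^sub>F s in nhds s0. level s = (if strand_Y (back_strand m) s \<le> strand_Y (front_strand m) s then Suc m else m) \<and>
    core \<le> \<bar>s\<bar> \<and> \<bar>s\<bar> \<le> rim \<and> (\<forall>i. axis_height i \<le> s \<longleftrightarrow> 0 \<le> s0)"
proof -
  have m: "m < J" "m mod 3 \<noteq> 1" "\<bar>s0\<bar> = core + real m + 1 / 2" using assms by (auto simp: winding_crossing_def)
  show ?thesis using level_crossing[OF m(1,3)]
  proof eventually_elim
    case (elim s)
    have "real m + 1 \<le> core" using m(1) by linarith
    then have height: "core \<le> \<bar>s\<bar>" "\<bar>s\<bar> \<le> rim" using elim m(3) by linarith+
    have "s > 0 \<and> s0 > 0 \<or> s < 0 \<and> s0 < 0" using elim by (auto simp: zero_less_mult_iff)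
    then have "axis_height i \<le> s \<longleftrightarrow> 0 \<le> s0" for i using height(1) core_ge_12 by (auto simp: axis_height_def)
    moreover have "strand_Y (back_strand m) s \<le> strand_Y (front_strand m) s \<longleftrightarrow>
        (if back_strand m = 1 then winding_Y (\<bar>s\<bar> - core) \<le> 2 * turn_sign m else 2 * turn_sign m \<le> winding_Y (\<bar>s\<bar> - core))"
      using strand_Y_winding[OF height] turn_sign_cases[of m] by (auto simp: back_strand_def front_strand_def)
    moreover have "\<bar>\<bar>s\<bar> - core - (real m + 1 / 2)\<bar> \<le> 1 / 2" using elim m(3) by linarith
    then have "(if back_strand m = 1 then winding_Y (\<bar>s\<bar> - core) \<le> 2 * turn_sign m
      else 2 * turn_sign m \<le> winding_Y (\<bar>s\<bar> - core))
        \<longleftrightarrow> \<bar>s0\<bar> \<le> \<bar>s\<bar>"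
      using winding_order[OF m(1,2), of "\<bar>s\<bar> - core"] m(3) by auto
    ultimately show ?case using elim height by simp
  qed
qed

end

section \<open>Labelling the strands\<close>

text \<open>The labels of the three winding strands, in the upper and in the lower half, before the \<open>m\<close>-th segment of the
  winding.  The fourth strand has a constant label and a constant section.\<close>

locale coloring = strands J for J +
  fixes upper_label lower_label upper_section lower_section :: "nat \<Rightarrow> nat \<Rightarrow> 'g::group_add"
    and outer_label axis_label outer_section :: 'g and mgroup :: "nat \<Rightarrow> 'g \<Rightarrow> 'g set"
  assumes involution: "upper_label i m + upper_label i m = 0" "lower_label i m + lower_label i m = 0"
    "outer_label + outer_label = 0"
    and step_same: "m < J \<Longrightarrow> m mod 3 = 1 \<or> i \<noteq> back_strand m \<Longrightarrow>
        upper_label i (Suc m) = upper_label i m \<and> lower_label i (Suc m) = lower_label i m \<and>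
        upper_section i (Suc m) = upper_section i m \<and> lower_section i (Suc m) = lower_section i m"
    and step_back: "m < J \<Longrightarrow> m mod 3 \<noteq> 1 \<Longrightarrow> i = back_strand m \<Longrightarrow> k = front_strand m \<Longrightarrow>
        upper_label i m = - upper_label k m + upper_label i (Suc m) + upper_label k m \<and>
        lower_label i m = - lower_label k m + lower_label i (Suc m) + lower_label k m \<and>
        upper_section i m = upper_section i (Suc m) + upper_label i (Suc m) + upper_label k m \<and>
        lower_section i m = lower_section i (Suc m) + lower_label i (Suc m) + lower_label k m"
    and caps: "upper_label 0 J = upper_label 1 J" "upper_label 2 J = outer_label" "lower_label 1 J = lower_label 2 J"
      "lower_label 0 J = outer_label" "upper_section 2 J = outer_section" "lower_section 0 J = outer_section"
      "lower_section 1 J = lower_section 2 J"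
    and middle: "upper_label 2 0 = outer_label" "lower_label 2 0 = outer_label" "upper_section 2 0 = lower_section 2 0"
    and middle_axis: "i \<in> {0, 1} \<Longrightarrow> lower_label i 0 = - axis_label + upper_label i 0 + axis_label \<and>
        lower_section i 0 = upper_section i 0 + upper_label i 0 + axis_label"
    and mgroup_zero: "0 \<in> mgroup i a" and mgroup_label: "a \<in> mgroup i a"
    and mgroup_add: "b \<in> mgroup i a \<Longrightarrow> c \<in> mgroup i a \<Longrightarrow> b + c \<in> mgroup i a"
    and mgroup_minus: "b \<in> mgroup i a \<Longrightarrow> - b \<in> mgroup i a"
    and mgroup_conj: "mgroup i (- c + a + c) = (\<lambda>h. - c + h + c) ` mgroup i a"
    and mgroup_involution: "i < 4 \<Longrightarrow> a + a = 0 \<Longrightarrow> mgroup i a = {0, a}"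
begin

definition label :: "nat \<Rightarrow> real \<Rightarrow> 'g" where
  "label i s = (if i = 3 then outer_label
     else if i = 4 then (if s \<le> 2 then axis_label else if s \<le> 6 then - outer_label + axis_label + outer_label else axis_label)
     else if axis_height i \<le> s then upper_label i (level s) else lower_label i (level s))"

definition sect :: "nat \<Rightarrow> real \<Rightarrow> 'g" where
  "sect i s = (if i = 3 then outer_section
     else if i = 4 then (if s \<le> 2 then 0 else if s \<le> 6 then axis_label + outer_label
       else axis_label + outer_label + (- outer_label + axis_label + outer_label) + outer_label)
     else if axis_height i \<le> s then upper_section i (level s) else lower_section i (level s))"

sublocale labelled_strands "{..<5}" strand_X strand_Y live label sect mgroup .

lemma eventually_live: "i = 4 \<or> bottom i < s0 \<and> s0 < rim + 1 \<Longrightarrow> \<forall>\<^sub>F s in nhds s0. live i s"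
  using eventually_nhds_in_open[of "{bottom i<..<rim + 1}" s0]
  by (cases "i = 4") (auto simp: live_def elim!: eventually_mono)

lemma regular_axis:
  assumes "s0 \<noteq> 2" "s0 \<noteq> 6"
  shows "regular_at 4 s0"
  unfolding regular_at_def
  using eventually_same_side[OF assms(1)] eventually_same_side[OF assms(2)]
  by eventually_elim (simp add: label_def sect_def live_def)

lemma eventually_same_labels:
  assumes "\<And>m. winding_crossing m s0 \<Longrightarrow> i \<noteq> back_strand m"
  shows "\<forall>\<^sub>F s in nhds s0. upper_label i (level s) = upper_label i (level s0) \<and>
    lower_label i (level s) = lower_label i (level s0) \<and>
    upper_section i (level s) = upper_section i (level s0) \<and> lower_section i (level s) = lower_section i (level s0)"
proof (cases "\<exists>m<J. \<bar>s0\<bar> = core + real m + 1 / 2")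
  case True
  then obtain m where m: "m < J" "\<bar>s0\<bar> = core + real m + 1 / 2" by blast
  then have "m mod 3 = 1 \<or> i \<noteq> back_strand m" using assms[of m] by (auto simp: winding_crossing_def)
  note same = step_same[OF m(1) this]
  have "level s0 = Suc m" using eventually_nhds_x_imp_x[OF level_crossing[OF m]] by simp
  then show ?thesis using level_crossing[OF m] by (auto simp: same elim!: eventually_mono)
next
  case False
  then have "\<forall>\<^sub>F s in nhds s0. level s = level s0" by (intro level_const) auto
  then show ?thesis by eventually_elim simp
qed

lemma regular_strand:
  assumes "i < 4" "bottom i < s0" "s0 < rim + 1" "i < 2 \<longrightarrow> s0 \<noteq> axis_height i"
    "\<And>m. winding_crossing m s0 \<Longrightarrow> i \<noteq> back_strand m"
  shows "regular_at i s0"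
proof -
  have live: "\<forall>\<^sub>F s in nhds s0. live i s" using assms(2,3) by (intro eventually_live) simp
  consider "i = 3" | "i < 3" "s0 \<noteq> axis_height i" | "i = 2" "s0 = 2"
    using assms(1,4) by (cases "i = 2"; cases "i = 3") (auto simp: axis_height_def)
  then show ?thesis
  proof cases
    case 1
    then show ?thesis using live by (auto simp: regular_at_def label_def sect_def elim: eventually_mono)
  next
    case 2
    have "\<forall>\<^sub>F s in nhds s0. upper_label i (level s) = upper_label i (level s0) \<and>
      lower_label i (level s) = lower_label i (level s0) \<and>
        upper_section i (level s) = upper_section i (level s0) \<and> lower_section i (level s) = lower_section i (level s0)"
      using assms(5) by (rule eventually_same_labels)
    with live eventually_same_side[OF 2(2)] show ?thesis
      unfolding regular_at_def by eventually_elim (use 2(1) in \<open>simp add: label_def sect_def\<close>)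
  next
    case 3
    then have "\<bar>s0\<bar> < core" using core_ge_12 by simp
    from live level_near[OF this] show ?thesis
      unfolding regular_at_def by eventually_elim (use 3 middle core_ge_12 in \<open>simp add: label_def sect_def level_0\<close>)
  qed
qed

lemma crossing_winding:
  assumes "winding_crossing m s0"
  shows "crossing_at (front_strand m) (back_strand m) s0"
proof -
  note near = eventually_winding_crossing[OF assms]
  have m: "m < J" "m mod 3 \<noteq> 1" using assms by (auto simp: winding_crossing_def)
  define i k where "i = back_strand m" and "k = front_strand m"
  have ik: "i < 3" "k < 3" "k \<noteq> i" using back_front_strand[of m] by (auto simp: i_def k_def)
  have order: "strand_Y i s0 \<le> strand_Y k s0" using winding_crossing_meets(1)[OF assms] by (simp add: i_def k_def)
  have label: "label l s = (if 0 \<le> s0 then upper_label l n else lower_label l n)"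
    "sect l s = (if 0 \<le> s0 then upper_section l n else lower_section l n)"
    if "l < 3" "\<forall>i. axis_height i \<le> s \<longleftrightarrow> 0 \<le> s0" "level s = n" for l s n
    using that by (auto simp: label_def sect_def)
  have at_s0: "level s0 = Suc m" "\<forall>i. axis_height i \<le> s0 \<longleftrightarrow> 0 \<le> s0"
    using eventually_nhds_x_imp_x[OF near] order by (auto simp: i_def k_def)
  note front = step_same[OF m(1) disjI2[OF ik(3)[unfolded i_def]]] and behind = step_back[OF m i_def k_def]
  have "\<forall>\<^sub>F s in nhds s0. live k s \<and> live i s \<and> label k s = label k s0 \<and> sect k s = sect k s0 \<and>
      label i s = (if strand_Y i s \<le> strand_Y k s then label i s0 else - label k s0 + label i s0 + label k s0) \<and>
      sect i s = (if strand_Y i s \<le> strand_Y k s then sect i s0 else sect i s0 + label i s0 + label k s0)"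
    using near
  proof eventually_elim
    case (elim s)
    have live: "live i s" "live k s" using elim by (auto intro: live_winding)
    show ?case
    proof (cases "strand_Y i s \<le> strand_Y k s")
      case True
      then have "level s = Suc m" using elim by (simp add: i_def k_def)
      then show ?thesis using True live elim label[OF _ at_s0(2,1)] label[of _ s "Suc m"] ik by simp
    next
      case False
      then have "level s = m" using elim by (simp add: i_def k_def)
      then show ?thesis using False live elim label[OF _ at_s0(2,1)] label[of _ s m] ik front behind
        by (cases "0 \<le> s0") simp_all
    qed
  qed
  then show ?thesis using winding_crossing_meets(2)[OF assms] unfolding crossing_at_def i_def k_def by simp
qed

lemma crossing_behind_axis:
  assumes "i \<in> {0, 1}"
  shows "crossing_at 4 i (axis_height i)"
proof -
  have height: "\<bar>axis_height i\<bar> < core" "axis_height i < 2" using assms core_ge_12 by (auto simp: axis_height_def)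
  have "\<forall>\<^sub>F s in nhds (axis_height i). s \<in> {..<2}" using height by (intro eventually_nhds_in_open) auto
  with level_near[OF height(1)] have "\<forall>\<^sub>F s in nhds (axis_height i). live 4 s \<and> live i s \<and>
      label 4 s = label 4 (axis_height i) \<and> sect 4 s = sect 4 (axis_height i) \<and>
      label i s = (if strand_Y i s \<le> strand_Y 4 s then label i (axis_height i)
        else - label 4 (axis_height i) + label i (axis_height i) + label 4 (axis_height i)) \<and>
      sect i s = (if strand_Y i s \<le> strand_Y 4 s then sect i (axis_height i)
        else sect i (axis_height i) + label i (axis_height i) + label 4 (axis_height i))"
  proof eventually_elim
    case (elim s)
    have "strand_Y i s = axis_height i" "strand_Y 4 s = s" using strand_Y_core[of s i] elim assms
      by (auto simp: strand_Y_def[of 4])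
    moreover have "live i s" "live 4 s" using elim by (auto intro: live_winding)
    ultimately show ?case
      using elim assms height middle_axis[OF assms] level_0[of "axis_height i"] by (auto simp: label_def sect_def)
  qed
  moreover have "strand_X i (axis_height i) < strand_X 4 (axis_height i)"
    using assms height(1) winding_outside[of "\<bar>axis_height i\<bar> - core"] by (auto simp: strand_X_def)
  ultimately show ?thesis by (simp add: crossing_at_def)
qed

lemma crossing_front_of_axis:
  assumes "i \<in> {2, 3}"
  shows "crossing_at i 4 (axis_height i)"
proof -
  define s0 where "s0 = axis_height i"
  have height: "\<bar>s0\<bar> < core" "0 < s0" using assms core_ge_12 by (auto simp: s0_def axis_height_def)
  have minus: "- outer_label = outer_label" using involution(3) by (simp add: minus_unique)
  have "\<forall>\<^sub>F s in nhds s0. s \<in> {s0 - 1<..<s0 + 1}" by (intro eventually_nhds_in_open) auto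
  with level_near[OF height(1)] have "\<forall>\<^sub>F s in nhds s0. live i s \<and> live 4 s \<and> label i s = label i s0 \<and>
    sect i s = sect i s0 \<and>
      label 4 s = (if strand_Y 4 s \<le> strand_Y i s then label 4 s0 else - label i s0 + label 4 s0 + label i s0) \<and>
      sect 4 s = (if strand_Y 4 s \<le> strand_Y i s then sect 4 s0 else sect 4 s0 + label 4 s0 + label i s0)"
  proof eventually_elim
    case (elim s)
    have level: "level s = 0" "level s0 = 0" using elim(1) level_0[of s0] height by simp_all
    have near: "s0 - 1 < s" "s < s0 + 1" using elim(2) by auto
    have Y: "strand_Y i s = s0" "strand_Y 4 s = s"
      using strand_Y_core[of s i] elim(1) assms by (auto simp: s0_def strand_Y_def[of 4])
    have strand: "label i s = outer_label" "label i s0 = outer_label" "sect i s = sect i s0"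
      using assms middle level by (auto simp: label_def sect_def)
    have "label 4 s = (if s \<le> s0 then label 4 s0 else - outer_label + label 4 s0 + outer_label)"
      using assms near minus involution(3)
      by (elim insertE emptyE; simp add: s0_def axis_height_def label_def add.assoc; simp flip: add.assoc)
    moreover have "sect 4 s = (if s \<le> s0 then sect 4 s0 else sect 4 s0 + label 4 s0 + outer_label)"
      using assms near by (elim insertE emptyE; simp add: s0_def axis_height_def label_def sect_def)
    moreover have "live i s" "live 4 s" using elim by (auto intro: live_winding)
    ultimately show ?case using Y strand by simp
  qed
  moreover have "strand_X 4 s0 < strand_X i s0" using assms height(1) by (auto simp: strand_X_def)
  ultimately show ?thesis by (simp add: crossing_at_def flip: s0_def)
qed

lemma cap_label_eq:
  assumes "cap s0 i j"
  shows "label i s0 = label j s0" "label j s0 + label j s0 = 0" "(i, j) \<noteq> (0, 1) \<Longrightarrow> sect i s0 = sect j s0"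
proof -
  have "level s0 = J" using cap_meets(7)[OF assms] by (intro level_J) simp
  then have "label i s0 = label j s0 \<and> label j s0 + label j s0 = 0 \<and> ((i, j) \<noteq> (0, 1) \<longrightarrow> sect i s0 = sect j s0)"
    using assms core_ge_12 unfolding cap_def
    by (elim insertE emptyE) (simp_all add: caps[simplified] involution label_def sect_def axis_height_def)
  then show "label i s0 = label j s0" "label j s0 + label j s0 = 0" "(i, j) \<noteq> (0, 1) \<Longrightarrow> sect i s0 = sect j s0" by auto
qed

lemma cap_is_cap_at:
  assumes "cap s0 i j"
  shows "cap_at i j s0"
proof -
  note meets = cap_meets[OF assms]
  have "\<forall>\<^sub>F s in nhds s0. s \<in> {s0 - 1<..<s0 + 1}" by (intro eventually_nhds_in_open) auto
  then have "\<forall>\<^sub>F s in nhds s0. label i s = label i s0 \<and> label j s = label j s0 \<and> sect i s = sect i s0 \<and>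
    sect j s = sect j s0"
  proof eventually_elim
    case (elim s)
    have "rim \<le> \<bar>s\<bar>" using elim meets(7) by auto
    moreover have "rim \<le> s \<and> rim \<le> s0 \<or> s \<le> - rim \<and> s0 \<le> - rim" using elim meets(7)
      by (auto simp: abs_if split: if_splits)
    then have "axis_height k \<le> s \<longleftrightarrow> axis_height k \<le> s0" for k
      using core_ge_12 by (auto simp: axis_height_def)
    ultimately show ?case using meets(5-7) level_J[of s] level_J[of s0] by (simp add: label_def sect_def)
  qed
  then have "\<forall>\<^sub>F s in nhds s0. (live i s \<longrightarrow> label i s = label j s0 \<and> sect i s = sect i s0) \<and>
      (live j s \<longrightarrow> label j s = label j s0 \<and> sect j s = sect j s0)"
    by eventually_elim (simp add: cap_label_eq(1)[OF assms])
  moreover have "mgroup i (label j s0) = {0, label j s0}" "mgroup j (label j s0) = {0, label j s0}"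
    using mgroup_involution cap_label_eq(2)[OF assms] meets(5,6) by simp_all
  ultimately show ?thesis
    using meets cap_label_eq(2)[OF assms] cap_liveness[OF assms] unfolding cap_at_def by blast
qed

lemma irregular_meets:
  assumes "i < 5" "live i s0" "\<not> regular_at i s0"
  shows "\<exists>j<5. j \<noteq> i \<and> live j s0 \<and> strand_Y j s0 = strand_Y i s0"
proof (cases "i = 4")
  case True
  then have "s0 = axis_height 2 \<or> s0 = axis_height 3" using regular_axis[of s0] assms(3) by (auto simp: axis_height_def)
  then obtain k where k: "k \<in> {2, 3}" "s0 = axis_height k" by blast
  then have "\<bar>s0\<bar> < core" using core_ge_12 by (auto simp: axis_height_def)
  then show ?thesis
    using k True strand_Y_core[of s0 k] by (intro exI[of _ k]) (auto simp: strand_Y_def[of 4] intro: live_winding)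
next
  case False
  then have i: "i < 4" using assms(1) by simp
  consider "\<not> (bottom i < s0 \<and> s0 < rim + 1)" | "i < 2" "s0 = axis_height i"
    | m where "winding_crossing m s0" "i = back_strand m"
    using regular_strand[OF i, of s0] assms(3) by blast
  then show ?thesis
  proof cases
    case 1
    then have "s0 = rim + 1 \<or> s0 = bottom i" using assms(2) False by (auto simp: live_def)
    then obtain j where "cap s0 i j \<or> cap s0 j i" using cap_exists[OF i] by blast
    then show ?thesis
    proof
      assume "cap s0 i j"
      then show ?thesis using cap_meets[of s0 i j] by (intro exI[of _ j]) simp
    next
      assume "cap s0 j i"
      then show ?thesis using cap_meets[of s0 j i] i by (intro exI[of _ j]) simp
    qed
  next
    case 2
    then have "\<bar>s0\<bar> < core" using core_ge_12 by (auto simp: axis_height_def)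
    then show ?thesis
      using 2 strand_Y_core[of s0 i] False i by (intro exI[of _ 4]) (auto simp: strand_Y_def[of 4] live_def)
  next
    case (3 m)
    then show ?thesis
      using winding_crossing_meets(1)[of m s0] winding_crossing_height[of m s0] back_front_strand(2,3)[of m]
      by (intro exI[of _ "front_strand m"]) (simp add: live_winding)
  qed
qed

lemma meeting_at_most_2:
  obtains "meeting s y = {}" | i where "meeting s y = {i}" | i j where "i < j" "meeting s y = {i, j}"
proof (cases "\<exists>i. meeting s y \<subseteq> {i}")
  case False
  then obtain a b where "a \<in> meeting s y" "b \<in> meeting s y" "a \<noteq> b" by blast
  then obtain i j where ij: "i < j" "i \<in> meeting s y" "j \<in> meeting s y" by (metis linorder_neqE)
  have triple: False if "i < j" "j < k" "i \<in> meeting s y" "j \<in> meeting s y" "k \<in> meeting s y" for i j k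
    using no_triple[of i j k s] that by (auto simp: meeting_def)
  have "k \<in> {i, j}" if "k \<in> meeting s y" for k
    using triple[OF ij(1) _ ij(2,3) that] triple[OF _ ij(1) that ij(2,3)] triple[OF _ _ ij(2) that ij(3)]
    by (metis insert_iff linorder_less_linear)
  then have "meeting s y = {i, j}" using ij by blast
  with ij(1) show ?thesis by (rule that(3))
qed (use that in blast)

lemma meeting_pair:
  assumes "i < j" "meeting s y = {i, j}"
  shows "(\<exists>a b. a \<noteq> b \<and> meeting s y = {a, b} \<and> crossing_at a b s) \<or>
    (cap_at i j s \<and> ((s, y) \<noteq> (rim + 1, 0) \<longrightarrow> sect i s = sect j s))"
proof -
  have "i \<in> meeting s y" "j \<in> meeting s y" using assms(2) by simp_all
  then have ij: "j < 5" "live i s" "live j s" "strand_Y i s = strand_Y j s" "strand_Y i s = y"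
    by (auto simp: meeting_def)
  from assms(1) ij(1-4) show ?thesis
  proof (cases rule: coincidence)
    case (winding m)
    then have "meeting s y = {front_strand m, back_strand m}" using assms(2) by auto
    then show ?thesis using crossing_winding[OF winding(1)] back_front_strand(3)[of m] by metis
  next
    case cap
    moreover have "(s, y) = (rim + 1, 0)" if "(i, j) = (0, 1)"
      using cap that ij(5) by (auto simp: cap_def strand_Y_def)
    ultimately show ?thesis using cap_is_cap_at[OF cap] cap_label_eq(3)[OF cap] by blast
  next
    case axis
    then have "i \<in> {0, 1} \<or> i \<in> {2, 3}" using assms(1) by auto
    then show ?thesis
      using crossing_behind_axis[of i] crossing_front_of_axis[of i] axis assms by (metis insert_commute less_irrefl)
  qed
qed

sublocale strand_diagram "{..<5}" strand_X strand_Y live label sect mgroup "rim + 1" 0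
proof
  fix s y
  show "meeting s y = {} \<or> (\<exists>i. meeting s y = {i} \<and> regular_at i s) \<or>
      (\<exists>i j. i \<noteq> j \<and> meeting s y = {i, j} \<and> crossing_at i j s) \<or>
      (\<exists>i j. i \<noteq> j \<and> meeting s y = {i, j} \<and> cap_at i j s \<and> ((s, y) \<noteq> (rim + 1, 0) \<longrightarrow> sect i s = sect j s))"
  proof (cases rule: meeting_at_most_2[of s y])
    case (2 i)
    then have "i \<in> meeting s y" by simp
    then have i: "i < 5" "live i s" "strand_Y i s = y" by (auto simp: meeting_def)
    have "regular_at i s"
    proof (rule ccontr)
      assume "\<not> regular_at i s"
      then obtain j where "j < 5" "j \<noteq> i" "live j s" "strand_Y j s = y" using irregular_meets[OF i(1,2)] i(3) by auto
      then have "j \<in> meeting s y" by (simp add: meeting_def)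
      then show False using 2 \<open>j \<noteq> i\<close> by simp
    qed
    then show ?thesis using 2 by blast
  next
    case (3 i j)
    then show ?thesis using meeting_pair[OF 3] by (metis less_irrefl)
  qed simp
qed (simp_all add: continuous_strand_X continuous_strand_Y closed_live mgroup_zero mgroup_label mgroup_add mgroup_minus mgroup_conj)

end

section \<open>The permutation labels\<close>

definition next_indices :: "nat \<Rightarrow> (nat \<Rightarrow> int) \<Rightarrow> nat \<Rightarrow> int" where
  "next_indices m e = (if m mod 3 = 1 then e else e(back_strand m := 2 * e (front_strand m) - e (back_strand m)))"

primrec indices :: "(nat \<Rightarrow> int) \<Rightarrow> nat \<Rightarrow> nat \<Rightarrow> int" where
  "indices e 0 = e"
| "indices e (Suc m) = next_indices m (indices e m)"

definition index_triple :: "int \<Rightarrow> int \<Rightarrow> int \<Rightarrow> nat \<Rightarrow> int" where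
  "index_triple a b c i = (if i = 0 then a else if i = 1 then b else if i = 2 then c else 0)"

lemma index_triple_nth: "index_triple a b c 0 = a" "index_triple a b c (Suc 0) = b" "index_triple a b c 2 = c"
    "index_triple a b c 1 = b"
  by (simp_all add: index_triple_def)

lemma index_triple_update: "(index_triple a b c)(0 := d) = index_triple d b c"
  "(index_triple a b c)(Suc 0 := d) = index_triple a d c"
    "(index_triple a b c)(2 := d) = index_triple a b d"
  by (auto simp: index_triple_def)

lemma next_indices_triple: "next_indices m (index_triple a b c) = (if m mod 3 = 1 then index_triple a b c else
   if even (m div 6) then (if m mod 3 = 0 then index_triple a b (2 * b - c) else index_triple a (2 * c - b) c)
   else (if m mod 3 = 0 then index_triple a (2 * a - b) c else index_triple (2 * b - a) b c))"
  by (auto simp: next_indices_def back_strand_def front_strand_def turn_sign_def index_triple_update index_triple_nth)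

lemma next_indices_12: "next_indices (12 + m) = next_indices m"
proof -
  have "(12 + m) mod 3 = m mod 3" "(12 + m) div 6 = 2 + m div 6" by presburger+
  then show ?thesis by (intro ext) (simp add: next_indices_def back_strand_def front_strand_def turn_sign_def)
qed

lemma indices_12:
  "indices (index_triple a b c) 12 = index_triple (5 * a - 4 * (5 * b - 4 * c)) (4 * a - 3 * (5 * b - 4 * c)) (4 * b - 3 * c)"
proof -
  have "indices e 12 = next_indices 11 (next_indices 10 (next_indices 9 (next_indices 8 (next_indices 7 (next_indices 6
      (next_indices 5 (next_indices 4 (next_indices 3 (next_indices 2 (next_indices 1 (next_indices 0 e)))))))))))"
        for e
    by (simp add: eval_nat_numeral)
  then show ?thesis by (simp add: next_indices_triple algebra_simps)
qed

lemma indices_add_12: "indices e (12 + m) = indices (indices e 12) m"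
  by (induction m) (simp_all only: add_Suc_right add_0_right indices.simps next_indices_12)

definition windings :: "nat \<Rightarrow> nat" where
  "windings j = 12 * (2 * j + 1)"

lemma indices_windings_Suc: "indices e (windings (Suc j)) = indices (indices (indices e 12) 12) (windings j)"
proof -
  have "windings (Suc j) = 12 + (12 + windings j)" by (simp add: windings_def)
  then show ?thesis by (simp only: indices_add_12)
qed

definition upper_start :: "int \<Rightarrow> int \<Rightarrow> nat \<Rightarrow> int" where
  "upper_start x y = index_triple (1 - (x - y) * (3 * y - x)) (1 + 2 * x * y - (x - y) * (3 * y - x)) (1 + 2 * x * y)"

definition lower_start :: "int \<Rightarrow> int \<Rightarrow> nat \<Rightarrow> int" where
  "lower_start x y = index_triple (2 * x * y) (2 * x * y - (x + y) * (x + 3 * y)) (- ((x + y) * (x + 3 * y)))"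

lemma indices_start:
  fixes x y :: int
  assumes "x\<^sup>2 = 3 * y\<^sup>2 + 1"
  shows "indices (indices (upper_start (7 * x + 12 * y) (4 * x + 7 * y)) 12) 12 = upper_start x y"
    "indices (indices (lower_start (7 * x + 12 * y) (4 * x + 7 * y)) 12) 12 = lower_start x y"
proof -
  have square: "x * x = 3 * (y * y) + 1" using assms by (simp add: power2_eq_square)
  have square_left: "x * (x * k) = k + y * (y * (3 * k))" for k
    using arg_cong[OF square, of "\<lambda>z. z * k"] by (simp add: algebra_simps)
  have triple: "index_triple a b c = index_triple a' b' c'" if "a = a'" "b = b'" "c = c'" for a b c a' b' c'
    using that by simp
  show "indices (indices (upper_start (7 * x + 12 * y) (4 * x + 7 * y)) 12) 12 = upper_start x y"
    "indices (indices (lower_start (7 * x + 12 * y) (4 * x + 7 * y)) 12) 12 = lower_start x y"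
    unfolding upper_start_def lower_start_def indices_12
    by (intro triple; simp add: algebra_simps square square_left)+
qed

lemma indices_final:
  assumes "pell_pair j = (x, y)"
  shows "indices (upper_start x y) (windings j) = index_triple 0 0 1 \<and>
    indices (lower_start x y) (windings j) = index_triple 0 1 1"
  using assms
proof (induction j arbitrary: x y)
  case 0
  then have "x = 2" "y = 1" by simp_all
  then show ?case
    using indices_12[of 0 4 5] indices_12[of 4 "-11" "-15"] by (simp add: windings_def upper_start_def lower_start_def)
next
  case (Suc j)
  obtain u v where uv: "pell_pair j = (u, v)" by force
  interpret pell u v using pell_pair_pell[of j] uv by simp
  have "x = 7 * u + 12 * v" "y = 4 * u + 7 * v" using Suc.prems uv by simp_all
  then show ?case using Suc.IH[OF uv] by (simp only: indices_windings_Suc indices_start[OF pell])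
qed

definition meridian_group :: "nat \<Rightarrow> 'a perm \<Rightarrow> 'a perm set" where
  "meridian_group i a = (if i < 4 \<and> a + a = 0 then {0, a} else {g. affected g \<subseteq> affected a})"

lemma meridian_group_subgroup: "0 \<in> meridian_group i a" "a \<in> meridian_group i a"
    "b \<in> meridian_group i a \<Longrightarrow> c \<in> meridian_group i a \<Longrightarrow> b + c \<in> meridian_group i a"
    "b \<in> meridian_group i a \<Longrightarrow> - b \<in> meridian_group i a"
proof -
  have "- a = a" if "a + a = 0" using that by (simp add: minus_unique)
  then show "0 \<in> meridian_group i a" "a \<in> meridian_group i a"
    "b \<in> meridian_group i a \<Longrightarrow> c \<in> meridian_group i a \<Longrightarrow> b + c \<in> meridian_group i a"
    "b \<in> meridian_group i a \<Longrightarrow> - b \<in> meridian_group i a"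
    using affected_plus[of b c] by (auto simp: meridian_group_def split: if_splits)
qed

lemma affected_subset_conj:
  "{g. affected g \<subseteq> affected (- c + a + c)} = (\<lambda>h. - c + h + c) ` {g. affected g \<subseteq> affected (a :: 'a perm)}"
proof (intro set_eqI iffI)
  fix g assume "g \<in> (\<lambda>h. - c + h + c) ` {g. affected g \<subseteq> affected a}"
  then obtain k where "g = - c + k + c" "affected k \<subseteq> affected a" by blast
  then show "g \<in> {g. affected g \<subseteq> affected (- c + a + c)}" by (simp add: affected_conj image_mono)
next
  fix g assume g: "g \<in> {g. affected g \<subseteq> affected (- c + a + c)}"
  have "affected (- (- c) + g + (- c)) \<subseteq> affected a"
    using g unfolding affected_conj by (auto simp: image_iff)
  moreover have "g = - c + (- (- c) + g + (- c)) + c" by (simp add: add.assoc)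
  ultimately show "g \<in> (\<lambda>h. - c + h + c) ` {g. affected g \<subseteq> affected a}" by blast
qed

lemma meridian_group_conj: "meridian_group i (- c + a + c) = (\<lambda>h. - c + h + c) ` meridian_group i a"
proof -
  have "- c + a + c + (- c + a + c) = - c + (a + a) + c" by (simp add: add.assoc)
  moreover have "- c + (a + a) + c = 0 \<longleftrightarrow> a + a = 0"
    by (metis add.assoc add.right_neutral add_0 add_minus_cancel left_minus minus_add_cancel)
  ultimately have "- c + a + c + (- c + a + c) = 0 \<longleftrightarrow> a + a = 0" by simp
  then show ?thesis using affected_subset_conj[of c a] by (auto simp: meridian_group_def)
qed

text \<open>The labels of the winding strands are reflections.  Their indices at the middle level are chosen such that they
  satisfy the relations at the caps after all windings.\<close>

locale tangle =
  fixes j :: nat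
begin

abbreviation "x \<equiv> fst (pell_pair j)"
abbreviation "y \<equiv> snd (pell_pair j)"

sublocale pell x y by (rule pell_pair_pell)
sublocale strands "windings j" by standard (simp_all add: windings_def)

definition upper_reflection :: "int \<Rightarrow> (int \<times> bool) perm" where "upper_reflection i = rotation (i - 1) + reflection"
definition lower_reflection :: "int \<Rightarrow> (int \<times> bool) perm" where "lower_reflection i = rotation' i + reflection"

definition upper_index :: "nat \<Rightarrow> nat \<Rightarrow> int" where "upper_index = indices (upper_start x y)"
definition lower_index :: "nat \<Rightarrow> nat \<Rightarrow> int" where "lower_index = indices (lower_start x y)"

definition upper_offset :: "nat \<Rightarrow> (int \<times> bool) perm" where
  "upper_offset i = (if i = 0 then rotation' (- (x * y)) - axis_meridian - reflection + rotation ((1 + E) div 2)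
     else if i = 1 then rotation (- (x * y)) + rotation' (- (x * y)) - axis_meridian - reflection + rotation (x * y + (1 + E) div 2)
     else 0)"
definition lower_offset :: "nat \<Rightarrow> (int \<times> bool) perm" where
  "lower_offset i = (if i = 0 then 0 else rotation (- (x * y)) - rotation' (- (D' div 2)))"

definition upper_label where "upper_label i m = upper_reflection (upper_index m i)"
definition lower_label where "lower_label i m = lower_reflection (lower_index m i)"
definition upper_section where "upper_section i m = upper_offset i + rotation (- (upper_index m i div 2))"
definition lower_section where "lower_section i m = lower_offset i + rotation' (- (lower_index m i div 2))"

lemma rotation_0 [simp]: "rotation 0 = 0" using rotation_add[of 0 0] by (metis add.right_neutral add_left_cancel)
lemma rotation'_0 [simp]: "rotation' 0 = 0" using rotation'_add[of 0 0] by (metis add.right_neutral add_left_cancel)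
lemma rotation_minus: "- rotation i = rotation (- i)" using rotation_add[of i "- i"] by (simp add: minus_unique)
lemma rotation'_minus: "- rotation' i = rotation' (- i)" using rotation'_add[of i "- i"] by (simp add: minus_unique)
lemma rotation_add_left: "rotation i + (rotation k + a) = rotation (i + k) + a"
  "rotation' i + (rotation' k + a) = rotation' (i + k) + a"
  by (simp_all add: rotation_add rotation'_add add.assoc)
lemma diff_rotation': "a - rotation' i = a + rotation' (- i)"
  by (simp add: diff_conv_add_uminus rotation'_minus del: add_uminus_conv_diff)
lemma reflection_minus: "- reflection = reflection" using reflection_involution by (simp add: minus_unique)

lemma reflection_mult:
  "upper_reflection a + upper_reflection b = rotation (a - b)"
    "lower_reflection a + lower_reflection b = rotation' (a - b)"
proof -
  have "upper_reflection a + upper_reflection b = rotation (a - 1) + (reflection + rotation (b - 1)) + reflection"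
    by (simp add: upper_reflection_def add.assoc)
  also have "\<dots> = rotation (a - 1) + rotation (- (b - 1))" using reflection_involution
    by (simp add: reflection_rotation add.assoc)
  finally show "upper_reflection a + upper_reflection b = rotation (a - b)" by (simp flip: rotation_add)
  have "lower_reflection a + lower_reflection b = rotation' a + (reflection + rotation' b) + reflection"
    by (simp add: lower_reflection_def add.assoc)
  also have "\<dots> = rotation' a + rotation' (- b)" using reflection_involution
    by (simp add: reflection_rotation' add.assoc)
  finally show "lower_reflection a + lower_reflection b = rotation' (a - b)" by (simp flip: rotation'_add)
qed

lemma rotation_reflection:
  "rotation b + upper_reflection a = upper_reflection (a + b)"
    "rotation' b + lower_reflection a = lower_reflection (a + b)"
  by (simp_all add: upper_reflection_def lower_reflection_def algebra_simps flip: add.assoc rotation_add rotation'_add)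

lemma minus_reflection: "- upper_reflection a = upper_reflection a" "- lower_reflection a = lower_reflection a"
  using reflection_mult[of a a] by (simp_all add: minus_unique)

lemma index_final: "upper_index (windings j) = index_triple 0 0 1" "lower_index (windings j) = index_triple 0 1 1"
  using indices_final[of j x y] by (simp_all add: upper_index_def lower_index_def)

lemma halves: "(1 + D) div 2 = x * y" "- E' div 2 = x * y" "D' div 2 - (D' - E') div 2 = - (x * y)"
  "(1 - E) div 2 = (1 + E) div 2 - E" "(1 + D - E) div 2 = x * y + (1 + E) div 2 - E"
proof -
  have "odd E" using parity by simp
  then obtain e where e: "E = 2 * e + 1" by (elim oddE)
  define d where "d = x * y"
  have D: "D = 2 * d" "E' = - (2 * d)" by (simp_all add: d_def)
  show "(1 + D) div 2 = x * y" "- E' div 2 = x * y" "D' div 2 - (D' - E') div 2 = - (x * y)"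
    unfolding D d_def[symmetric] by simp_all
  show "(1 - E) div 2 = (1 + E) div 2 - E" "(1 + D - E) div 2 = x * y + (1 + E) div 2 - E"
    unfolding e D d_def[symmetric] by simp_all
qed

lemma index_middle: "upper_index 0 = index_triple (1 - E) (1 + D - E) (1 + D)"
  "lower_index 0 = index_triple (- E') (D' - E') D'"
  by (simp_all add: upper_index_def lower_index_def upper_start_def lower_start_def)

lemma upper_label_middle: "upper_label 0 0 = rotation (- E) + reflection"
  "upper_label (Suc 0) 0 = rotation (- E) + reflection"
    "upper_label 2 0 = reflection"
  using rotation_add[of D "- E"] rotation_D
  by (simp_all add: upper_label_def index_middle index_triple_nth upper_reflection_def)

lemma lower_label_middle: "lower_label 0 0 = rotation' (- E') + reflection"
  "lower_label (Suc 0) 0 = rotation' (- E') + reflection"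
    "lower_label 2 0 = reflection"
  using rotation'_add[of D' "- E'"] rotation'_D'
  by (simp_all add: lower_label_def index_middle index_triple_nth lower_reflection_def del: minus_minus)

lemma label_axis_relation:
  assumes "i \<in> {0, 1}"
  shows "lower_label i 0 = - axis_meridian + upper_label i 0 + axis_meridian"
proof -
  have "- axis_meridian + (rotation (- E) + reflection + axis_meridian) = rotation' (- E') + reflection"
    unfolding meridian_relation by (simp add: add.assoc)
  moreover have "upper_label i 0 = rotation (- E) + reflection" "lower_label i 0 = rotation' (- E') + reflection"
    using assms upper_label_middle lower_label_middle by auto
  ultimately show ?thesis by (simp add: add.assoc)
qed

lemma section_axis_relation:
  assumes "i \<in> {0, 1}"
  shows "lower_section i 0 = upper_section i 0 + upper_label i 0 + axis_meridian"
proof (cases "i = 0")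
  case True
  have "upper_section i 0 + (rotation (- E) + reflection) + axis_meridian =
      rotation' (- (x * y)) - axis_meridian - reflection + rotation ((1 + E) div 2 - (1 - E) div 2 - E) + reflection + axis_meridian"
    using True by (simp add: upper_section_def upper_offset_def index_middle index_triple_nth add.assoc
      rotation_add_left flip: rotation_add)
  also have "\<dots> = rotation' (- (x * y))" unfolding halves(4) using reflection_involution by (simp add: add.assoc)
  finally show ?thesis
    using True halves(2) upper_label_middle(1)
    by (simp add: lower_section_def lower_offset_def index_middle index_triple_nth)
next
  case False
  then have i: "i = Suc 0" using assms by simp
  have "upper_section i 0 + (rotation (- E) + reflection) + axis_meridian =
      rotation (- (x * y)) + rotation' (- (x * y)) - axis_meridian - reflection + rotation (x * y + (1 + E) div 2 - (1 + D - E) div 2 - E)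
        + reflection + axis_meridian"
    using i by (simp add: upper_section_def upper_offset_def index_middle index_triple_nth add.assoc rotation_add_left
      flip: rotation_add)
  also have "\<dots> = rotation (- (x * y)) + rotation' (- (x * y))" unfolding halves(5) using reflection_involution
    by (simp add: add.assoc)
  also have "\<dots> = rotation (- (x * y)) + rotation' (D' div 2 - (D' - E') div 2)" by (simp only: halves(3))
  finally show ?thesis
    using i upper_label_middle(2)
    by (simp add: lower_section_def lower_offset_def index_middle index_triple_nth add.assoc diff_rotation'
      flip: rotation'_add)
qed

lemma half_reflect: "(2 * a - b) div 2 = a - b + b div 2" for a b :: int
  by presburger

sublocale coloring "windings j" upper_label lower_label upper_section lower_section reflection axis_meridian 0 meridian_group
proof
  fix i k m
  show "upper_label i m + upper_label i m = 0" "lower_label i m + lower_label i m = 0" "reflection + reflection = 0"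
    by (simp_all add: upper_label_def lower_label_def reflection_mult reflection_involution)
  show "upper_label i (Suc m) = upper_label i m \<and> lower_label i (Suc m) = lower_label i m \<and>
      upper_section i (Suc m) = upper_section i m \<and> lower_section i (Suc m) = lower_section i m"
    if "m mod 3 = 1 \<or> i \<noteq> back_strand m"
    using that
    by (auto simp: upper_label_def lower_label_def upper_section_def lower_section_def upper_index_def lower_index_def
      next_indices_def)
  show "upper_label i m = - upper_label k m + upper_label i (Suc m) + upper_label k m \<and>
      lower_label i m = - lower_label k m + lower_label i (Suc m) + lower_label k m \<and>
      upper_section i m = upper_section i (Suc m) + upper_label i (Suc m) + upper_label k m \<and>
      lower_section i m = lower_section i (Suc m) + lower_label i (Suc m) + lower_label k m"
    if "m mod 3 \<noteq> 1" "i = back_strand m" "k = front_strand m"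
  proof -
    have "upper_index (Suc m) i = 2 * upper_index m k - upper_index m i"
      "lower_index (Suc m) i = 2 * lower_index m k - lower_index m i"
      using that by (simp_all add: upper_index_def lower_index_def next_indices_def)
    then show ?thesis
      by (simp add: upper_label_def lower_label_def upper_section_def lower_section_def minus_reflection reflection_mult
        rotation_reflection
        add.assoc half_reflect flip: rotation_add rotation'_add)
  qed
  show "upper_label 0 (windings j) = upper_label 1 (windings j)" "upper_label 2 (windings j) = reflection"
    "lower_label 1 (windings j) = lower_label 2 (windings j)" "lower_label 0 (windings j) = reflection"
    "upper_section 2 (windings j) = 0" "lower_section 0 (windings j) = 0"
      "lower_section 1 (windings j) = lower_section 2 (windings j)"
    unfolding upper_label_def lower_label_def upper_section_def lower_section_def index_final
    by (simp_all add: index_triple_nth upper_reflection_def lower_reflection_def upper_offset_def lower_offset_def)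
  show "upper_label 2 0 = reflection" "lower_label 2 0 = reflection"
    by (simp_all add: upper_label_middle lower_label_middle)
  show "upper_section 2 0 = lower_section 2 0"
    by (simp add: upper_section_def lower_section_def upper_offset_def lower_offset_def index_middle index_triple_nth
      halves(1) add.assoc)
qed (fact meridian_group_subgroup meridian_group_conj |
    simp add: label_axis_relation section_axis_relation meridian_group_def)+

lemma section_jump:
  "- upper_section 1 (windings j) + upper_section 0 (windings j) =
    - (reflection + rotation ((1 + E) div 2)) + longitude + (reflection + rotation ((1 + E) div 2))"
proof -
  define q where "q = (1 + E) div 2"
  define d where "d = x * y"
  have half_turn: "rotation d = rotation (- d)" using rotation_D rotation_add[of d d] unfolding d_def
    by (metis mult.assoc mult_2 minus_unique rotation_minus)
  have "- upper_section 1 (windings j) + upper_section 0 (windings j) =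
      - (rotation (- d) + rotation' (- d) - axis_meridian - reflection + rotation (d + q)) +
        (rotation' (- d) - axis_meridian - reflection + rotation q)"
    unfolding upper_section_def index_final by (simp add: index_triple_nth upper_offset_def q_def d_def)
  also have "\<dots> = - rotation q + (rotation (- d) + reflection) + axis_meridian + rotation' d + rotation d - rotation' d - axis_meridian + reflection + rotation q"
    unfolding rotation_add[of d q]
    by (simp only: diff_conv_add_uminus minus_add minus_minus add.assoc rotation_minus rotation'_minus reflection_minus)
  also have "\<dots> = - rotation q + (reflection + rotation d) + axis_meridian + rotation' d + rotation d - rotation' d - axis_meridian + reflection + rotation q"
    by (simp only: reflection_rotation)
  also have "\<dots> = - (reflection + rotation q) + longitude + (reflection + rotation q)"
    unfolding longitude_def d_def[symmetric]
    by (simp only: diff_conv_add_uminus minus_add minus_minus add.assoc rotation_minus rotation'_minus reflection_minus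
      half_turn[symmetric])
  finally show ?thesis unfolding q_def .
qed

lemma snd_longitude: "snd (longitude \<langle>$\<rangle> z) = snd z"
proof -
  have snd: "snd (rotation i \<langle>$\<rangle> z) = snd z" "snd (rotation' i \<langle>$\<rangle> z) = snd z" "snd (axis_meridian \<langle>$\<rangle> z) = snd z"
    for i z
    unfolding rotation_def rotation'_def axis_meridian_def
    by (cases z; simp only: apply_sheet_rotation[OF splits(1,2)] apply_sheet_rotation[OF splits(3,4)] apply_meridian[OF
      splits] snd_conv)+
  moreover have "snd ((- axis_meridian) \<langle>$\<rangle> z) = snd z" for z using snd(3)[of "(- axis_meridian) \<langle>$\<rangle> z"] by simp
  ultimately show ?thesis
    unfolding longitude_def
    by (simp add: minus_add rotation_minus rotation'_minus del: add_uminus_conv_diff flip: add_uminus_conv_diff)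
qed

lemma conj_reflection:
  assumes "a = reflection + rotation q"
  shows "a + (rotation (- 1) + reflection) - a = rotation (1 - 2 * q) + reflection"
proof -
  have q2: "2 * q - 1 = q + - 1 + q" by simp
  have "a + (rotation (- 1) + reflection) - a =
    reflection + (rotation q + rotation (- 1)) + (reflection + rotation (- q)) + reflection"
    unfolding assms by (simp only: diff_conv_add_uminus minus_add minus_minus add.assoc rotation_minus reflection_minus)
  also have "\<dots> = reflection + rotation (2 * q - 1) + reflection + reflection"
    unfolding reflection_rotation[of "- q"] q2 rotation_add by (simp only: minus_minus add.assoc)
  also have "\<dots> = rotation (1 - 2 * q) + reflection" unfolding reflection_rotation using reflection_involution
    by (simp add: add.assoc)
  finally show ?thesis .
qed

lemma section_jump_moves:
  assumes "g \<in> {0, upper_reflection 0}"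
  shows "nat (4 * (x - y)) \<le> card (affected (- upper_section 1 (windings j) + upper_section 0 (windings j) + g))"
proof -
  define a where "a = reflection + rotation ((1 + E) div 2)"
  have eq: "- upper_section 1 (windings j) + upper_section 0 (windings j) + g = - a + (longitude + (a + g - a)) + a"
    unfolding section_jump a_def by (simp add: add.assoc)
  show ?thesis
  proof (cases "g = 0")
    case True
    then show ?thesis unfolding eq card_affected_conj using longitude_moves by simp
  next
    case False
    then have "g = rotation (- 1) + reflection" using assms by (simp add: upper_reflection_def)
    then have "a + g - a = rotation (1 - 2 * ((1 + E) div 2)) + reflection"
      using conj_reflection[OF a_def] by simp
    then show ?thesis unfolding eq card_affected_conj
      by (simp only:) (intro reflection_moves snd_longitude[THEN trans], simp)
  qed
qed

end

context strands
begin

definition strand_curve :: "(nat \<Rightarrow> real \<Rightarrow> real) \<Rightarrow> (nat \<Rightarrow> real \<Rightarrow> real) \<Rightarrow> (real^3) set" where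
  "strand_curve X Y = {p. \<exists>i<4. live i (p $ 3) \<and> p $ 1 = X i (p $ 3) \<and> p $ 2 = Y i (p $ 3)}"

definition curve :: "(real^3) set" where
  "curve = strand_curve strand_X strand_Y"

definition slanted_axis :: "(real^3) set" where
  "slanted_axis = {p. p $ 1 = 0 \<and> p $ 2 = p $ 3}"

lemma mem_curve: "p \<in> curve \<longleftrightarrow> (\<exists>i<4. live i (p $ 3) \<and> p $ 1 = strand_X i (p $ 3) \<and> p $ 2 = strand_Y i (p $ 3))"
  by (simp add: curve_def strand_curve_def)

lemma curve_off_axis: "curve \<inter> slanted_axis = {}"
proof (intro equals0I)
  fix p assume "p \<in> curve \<inter> slanted_axis"
  then obtain i where i: "i < 4" "live i (p $ 3)" "strand_X i (p $ 3) = 0" "strand_Y i (p $ 3) = p $ 3"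
    by (auto simp: mem_curve slanted_axis_def)
  have "- 4 \<le> p $ 3" "p $ 3 \<le> 6" using strand_Y_bounds[OF i(1,2)] i(4) by auto
  then have "\<bar>p $ 3\<bar> < core" using core_ge_12 by linarith
  then show False using i(1,3) winding_outside[of "\<bar>p $ 3\<bar> - core"] by (auto simp: strand_X_def split: if_splits)
qed

definition top_cap :: "real^3" where
  "top_cap = vector [0, 0, rim + 1]"

lemma top_cap_nth [simp]: "top_cap $ 1 = 0" "top_cap $ 2 = 0" "top_cap $ 3 = rim + 1"
  by (simp_all add: top_cap_def)

lemma strands_above_rim:
  assumes "rim \<le> s"
  shows "strand_X i s = 0" "strand_Y 0 s = 2 * (s - rim - 1)" "strand_Y 1 s = 0" "strand_Y 2 s = 2"
    "strand_Y 3 s = 6 - 4 * (s - rim)"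
  using assms winding_outside[of "\<bar>s\<bar> - core"] by (auto simp: strand_X_def strand_Y_def)

lemma curve_at_top_cap:
  assumes "p \<in> curve" "p $ 3 = rim + 1" "p $ 2 = 0"
  shows "p = top_cap"
proof -
  obtain i where "p $ 1 = strand_X i (p $ 3)" using assms(1) by (auto simp: mem_curve)
  then have "p $ 1 = 0" using assms(2) strands_above_rim(1)[of "rim + 1" i] by simp
  then show ?thesis using assms(2,3) by (simp add: vec_eq_iff forall_3)
qed

text \<open>The two half-spaces separate the strands that meet at the top cap.\<close>

definition beyond_top_cap :: "(real^3) set" where "beyond_top_cap = {p. p $ 3 - (rim + 1) < p $ 2}"
definition before_top_cap :: "(real^3) set" where "before_top_cap = {p. p $ 2 < p $ 3 - (rim + 1)}"

lemma open_beyond_before_top_cap: "open beyond_top_cap" "open before_top_cap" "beyond_top_cap \<inter> before_top_cap = {}"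
  by (auto simp: beyond_top_cap_def before_top_cap_def intro!: open_Collect_less continuous_intros)

lemma islimpt_along_ray:
  fixes x v :: "'a::real_normed_vector"
  assumes "v \<noteq> 0" "\<And>d. 0 < d \<Longrightarrow> d < 1 \<Longrightarrow> x + d *\<^sub>R v \<in> S"
  shows "x islimpt S"
  unfolding islimpt_approachable
proof (intro allI impI)
  fix e :: real assume "0 < e"
  define d where "d = min (1 / 2) (e / (2 * norm v))"
  have "0 < d" "d < 1" using assms(1) \<open>0 < e\<close> by (auto simp: d_def)
  moreover have "d * norm v \<le> e / (2 * norm v) * norm v" by (intro mult_right_mono) (simp_all add: d_def)
  then have "d * norm v < e" using assms(1) \<open>0 < e\<close> by simp
  ultimately show "\<exists>y\<in>S. y \<noteq> x \<and> dist y x < e"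
    using assms by (intro bexI[of _ "x + d *\<^sub>R v"]) (auto simp: dist_norm)
qed

lemma top_cap_islimpt: "top_cap islimpt curve \<inter> beyond_top_cap" "top_cap islimpt curve \<inter> before_top_cap"
proof -
  define ray where "ray a d = top_cap + d *\<^sub>R vector [0, a, - 1]" for a d
  have ray: "ray a d $ 1 = 0" "ray a d $ 2 = d * a" "ray a d $ 3 = rim + 1 - d" for a d by (simp_all add: ray_def)
  have nonzero: "vector [0, a, - 1 :: real] \<noteq> (0 :: real^3)" for a by (simp add: vec_eq_iff forall_3)
  have live: "live i (rim + 1 - d)" if "i < 4" "0 < d" "d < 1" for i d using that core_ge_12
    by (auto simp: live_def bottom_def)
  have "ray 0 d \<in> curve \<inter> beyond_top_cap" "ray (- 2) d \<in> curve \<inter> before_top_cap" if "0 < d" "d < 1" for d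
    using that live[OF _ that, of 1] live[OF _ that, of 0] strands_above_rim[of "rim + 1 - d"]
    by (auto simp: ray mem_curve beyond_top_cap_def before_top_cap_def intro: exI[of _ 1] exI[of _ 0])
  then show "top_cap islimpt curve \<inter> beyond_top_cap" "top_cap islimpt curve \<inter> before_top_cap"
    unfolding ray_def using islimpt_along_ray[OF nonzero] by blast+
qed

end

context tangle
begin

lemma mem_through:
  "i \<in> through p \<longleftrightarrow> i < 5 \<and> live i (p $ 3) \<and> p $ 1 = strand_X i (p $ 3) \<and> p $ 2 = strand_Y i (p $ 3)"
  by (auto simp: through_def mem_sight)

lemma mem_curve_through: "p \<in> curve \<longleftrightarrow> (\<exists>i<4. i \<in> through p)"
  and mem_axis_through: "p \<in> slanted_axis \<longleftrightarrow> 4 \<in> through p"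
  by (auto simp: mem_curve slanted_axis_def mem_through strand_X_def strand_Y_def live_def)

lemma through_nonempty: "{p. through p \<noteq> {}} = curve \<union> slanted_axis"
proof -
  have "i < 4 \<or> i = 4" if "i \<in> through p" for i p using that by (auto simp: mem_through)
  then show ?thesis unfolding set_eq_iff mem_Collect_eq Un_iff mem_curve_through mem_axis_through by blast
qed

lemma card_affected_axis_label: "card (affected (label 4 s)) \<le> 3"
proof -
  have "card (affected axis_meridian) \<le> 3" unfolding axis_meridian_def using pos
    by (intro card_affected_meridian) simp_all
  then show ?thesis using card_affected_conj[of reflection axis_meridian] by (simp add: label_def)
qed

lemma card_affected_axis_group:
  assumes "p \<in> slanted_axis" "g \<in> group_at p"
  shows "card (affected g) \<le> 3"
proof -
  have "p \<notin> curve" using assms(1) curve_off_axis by blast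
  moreover have "i < 4 \<or> i = 4" if "i \<in> through p" for i using that by (auto simp: mem_through)
  ultimately have "through p = {4}" using assms(1) unfolding mem_curve_through mem_axis_through set_eq_iff singleton_iff
    by metis
  then have "affected g \<subseteq> affected (label 4 (p $ 3))" using assms(2) by (simp add: group_at_single meridian_group_def)
  then have "card (affected g) \<le> card (affected (label 4 (p $ 3)))" by (intro card_mono finite_affected)
  then show ?thesis using card_affected_axis_label by (rule order_trans)
qed

sublocale spanning: meridian_system potential group_at curve slanted_axis "\<lambda>a. card (affected a)" 3
proof (intro meridian_system.intro meridian_system_axioms.intro)
  show "local_system potential group_at (curve \<union> slanted_axis)" using local_system_axioms unfolding through_nonempty .
  show "\<forall>\<^sub>F p' in nhds p. p' \<in> curve \<longrightarrow> group_at p' = (\<lambda>h. - potential p p' + h + potential p p') ` group_at p" for p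
    using eventually_group_conj[of p] by eventually_elim (auto simp: mem_curve_through)
qed (simp_all add: card_affected_plus card_affected_conj card_affected_axis_group)

lemma through_top_cap: "through top_cap = {0, 1}"
proof -
  have "i \<in> through top_cap \<longleftrightarrow> i = 0 \<or> i = 1" for i
  proof -
    have "i < 5 \<longleftrightarrow> i = 0 \<or> i = 1 \<or> i = 2 \<or> i = 3 \<or> i = 4" by linarith
    then show ?thesis using strands_above_rim[of "rim + 1"] core_ge_12
      by (auto simp: mem_through live_def bottom_def strand_Y_def[of 4])
  qed
  then show ?thesis by blast
qed

lemma hiding_top_cap: "hiding top_cap = {}"
  using strands_above_rim(1)[of "rim + 1"] by (simp add: hiding_def)

lemma group_at_top_cap: "group_at top_cap = {0, upper_reflection 0}"
proof -
  have "level (rim + 1) = windings j" by (intro level_J) simp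
  then have "label 0 (rim + 1) = upper_reflection 0" "label 1 (rim + 1) = upper_reflection 0"
    using core_ge_12 by (simp_all add: label_def upper_label_def axis_height_def index_final index_triple_nth)
  moreover have "strand_at top_cap \<in> {0, 1}" using strand_at_mem[of 0 top_cap] through_top_cap by simp
  ultimately show ?thesis
    by (auto simp: group_at_def through_top_cap meridian_group_def reflection_mult)
qed

lemma coset_top_cap: "c \<in> coset c top_cap p"
  by (auto simp: coset_def group_at_top_cap potential_none[OF hiding_top_cap])

lemma near_top_cap:
  "\<forall>\<^sub>F p in nhds top_cap. p \<in> curve \<longrightarrow> rim \<le> p $ 3 \<and> p $ 3 \<le> rim + 1 \<and> through p \<subseteq> {0, 1}"
proof -
  have "\<forall>\<^sub>F p in nhds top_cap. p \<in> {p. rim < p $ 3} \<inter> {p. p $ 3 < rim + 2} \<inter> {p. - 1 < p $ 2} \<inter> {p. p $ 2 < 1}"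
    by (intro eventually_nhds_in_open open_Int open_Collect_less continuous_intros) simp_all
  then show ?thesis
  proof eventually_elim
    case (elim p)
    show ?case
    proof
      assume "p \<in> curve"
      then obtain i where "i < 4" "live i (p $ 3)" by (auto simp: mem_curve)
      then have s: "rim \<le> p $ 3" "p $ 3 \<le> rim + 1" using elim by (auto simp: live_def)
      have "i \<in> {0, 1}" if "i \<in> through p" for i
      proof -
        have "i = 0 \<or> i = 1 \<or> i = 2 \<or> i = 3 \<or> i = 4" using that unfolding mem_through by linarith
        moreover have "2 \<le> strand_Y 3 (p $ 3)" using strands_above_rim(5)[OF s(1)] s by simp
        ultimately show ?thesis
          using that elim strands_above_rim(4)[OF s(1)] core_ge_12 s by (auto simp: mem_through strand_Y_def[of 4])
      qed
      then show "rim \<le> p $ 3 \<and> p $ 3 \<le> rim + 1 \<and> through p \<subseteq> {0, 1}" using s by blast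
    qed
  qed
qed

lemma near_top_cap_single_strand:
  "\<forall>\<^sub>F p in nhds top_cap. p \<in> curve - {top_cap} \<longrightarrow> rim \<le> p $ 3 \<and>
    (p \<in> beyond_top_cap \<and> through p = {1} \<or> p \<in> before_top_cap \<and> through p = {0})"
  using near_top_cap
proof eventually_elim
  case (elim p)
  show ?case
  proof
    assume p: "p \<in> curve - {top_cap}"
    then have s: "rim \<le> p $ 3" "p $ 3 \<le> rim + 1" "through p \<subseteq> {0, 1}" using elim by auto
    have Y: "0 \<in> through p \<Longrightarrow> p $ 2 = 2 * (p $ 3 - rim - 1)" "1 \<in> through p \<Longrightarrow> p $ 2 = 0"
      using strands_above_rim[OF s(1)] by (auto simp: mem_through)
    have strand: "0 \<in> through p \<or> 1 \<in> through p" using p s(3) by (force simp: mem_curve_through)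
    have "p $ 3 \<noteq> rim + 1" using curve_at_top_cap[of p] p Y strand by auto
    then have below: "p $ 3 < rim + 1" using s(2) by simp
    then have "\<not> (0 \<in> through p \<and> 1 \<in> through p)" using Y by auto
    then have "through p = {0} \<and> p $ 2 = 2 * (p $ 3 - rim - 1) \<or> through p = {1} \<and> p $ 2 = 0" using s(3) strand Y
      by blast
    then show "rim \<le> p $ 3 \<and> (p \<in> beyond_top_cap \<and> through p = {1} \<or> p \<in> before_top_cap \<and> through p = {0})"
      using s(1) below unfolding beyond_top_cap_def before_top_cap_def by (elim disjE) simp_all
  qed
qed

lemma near_top_cap_section:
  assumes "(S, i) = (beyond_top_cap, 1) \<or> (S, i) = (before_top_cap, 0)"
  shows "\<forall>\<^sub>F p in nhds top_cap. p \<in> curve \<inter> S \<longrightarrow> curve_section p \<in> coset (upper_section i (windings j)) top_cap p"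
  using near_top_cap_single_strand
proof eventually_elim
  case (elim p)
  show ?case
  proof
    assume p: "p \<in> curve \<inter> S"
    then have "p \<noteq> top_cap" using assms by (auto simp: beyond_top_cap_def before_top_cap_def)
    then have s: "rim \<le> p $ 3" "through p = {i}" using elim p assms open_beyond_before_top_cap(3) by auto
    then have "curve_section p = sect i (p $ 3)" by (simp add: curve_section_def strand_at_single)
    also have "\<dots> = upper_section i (windings j)"
      using assms s(1) level_J[of "p $ 3"] core_ge_12 by (auto simp: sect_def axis_height_def)
    finally show "curve_section p \<in> coset (upper_section i (windings j)) top_cap p" using coset_top_cap by simp
  qed
qed

lemma section_on_curve: "spanning.section_on (curve - {top_cap}) curve_section"
  unfolding spanning.section_on_def
proof (intro conjI ballI)
  fix p assume "p \<in> curve - {top_cap}"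
  then have "(p $ 3, p $ 2) \<noteq> (rim + 1, 0)" using curve_at_top_cap by blast
  then have "\<forall>\<^sub>F p' in nhds p. through p' \<noteq> {} \<longrightarrow> curve_section p' \<in> coset (curve_section p) p p'"
    by (rule eventually_curve_section)
  then show "\<forall>\<^sub>F p' in nhds p. p' \<in> curve \<longrightarrow> curve_section p' \<in> coset (curve_section p) p p'"
    by eventually_elim (auto simp: mem_curve_through)
qed simp

theorem puncture_bound:
  assumes "disk_bounded_by W curve" "finite (W \<inter> slanted_axis)"
  shows "2 ^ (2 * j + 1) \<le> card (W \<inter> slanted_axis)"
proof -
  have "top_cap \<in> curve" unfolding mem_curve_through through_top_cap by (intro exI[of _ 0]) simp
  moreover have "\<forall>\<^sub>F p in nhds top_cap. p \<in> curve - {top_cap} \<longrightarrow> p \<in> beyond_top_cap \<union> before_top_cap"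
    using near_top_cap_single_strand by eventually_elim blast
  ultimately have "\<exists>g\<in>group_at top_cap.
      card (affected (- upper_section 1 (windings j) + upper_section 0 (windings j) + g)) \<le> 3 * card (W \<inter> slanted_axis)"
    by (intro spanning.disk_bound[OF assms _ section_on_curve open_beyond_before_top_cap _ _ _ top_cap_islimpt]
      near_top_cap_section) simp_all
  then have "nat (4 * (x - y)) \<le> 3 * card (W \<inter> slanted_axis)"
    using section_jump_moves unfolding group_at_top_cap by (meson order_trans)
  then have "3 * 2 ^ (2 * j + 1) - 2 \<le> 3 * int (card (W \<inter> slanted_axis))" using pell_pair_growth[of j] by linarith
  then have "2 ^ (2 * j + 1) \<le> int (card (W \<inter> slanted_axis))" by linarith
  then show ?thesis by (metis of_nat_le_iff of_nat_numeral of_nat_power)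
qed

end

section \<open>Piecewise affine maps\<close>

lemma disk_bounded_by_image:
  fixes \<phi> :: "'a::t2_space \<Rightarrow> 'b::t2_space"
  assumes "disk_bounded_by D K" "continuous_on D \<phi>" "inj_on \<phi> D"
  shows "disk_bounded_by (\<phi> ` D) (\<phi> ` K)"
proof -
  obtain f g where fg: "homeomorphism (cball (0 :: real^2) 1) D f g" "f ` sphere 0 1 = K"
    using assms(1) by (auto simp: disk_bounded_by_def)
  have "f ` cball 0 1 = D" "continuous_on (cball 0 1) f" "inj_on f (cball 0 1)"
    using fg(1) by (auto simp: homeomorphism_def intro: inj_on_inverseI)
  then have "\<exists>g'. homeomorphism (cball (0 :: real^2) 1) (\<phi> ` D) (\<phi> \<circ> f) g'"
    using assms by (intro homeomorphism_compact continuous_on_compose comp_inj_on) (auto simp: image_comp)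
  then show ?thesis using fg(2) unfolding disk_bounded_by_def by (force simp: image_comp)
qed

definition affine_on :: "'a::real_vector set \<Rightarrow> ('a \<Rightarrow> 'b::real_vector) \<Rightarrow> bool" where
  "affine_on C f \<longleftrightarrow> (\<exists>L c. linear L \<and> (\<forall>x\<in>C. f x = L x + c))"

lemma affine_on_linear: "linear L \<Longrightarrow> affine_on C L"
  unfolding affine_on_def by (intro exI[of _ L] exI[of _ 0]) simp

lemma affine_on_const: "affine_on C (\<lambda>x. c)"
  unfolding affine_on_def by (intro exI[of _ "\<lambda>x. 0"] exI[of _ c]) (simp add: module_hom_zero linear_iff_module_hom)

lemma affine_on_add:
  assumes "affine_on C f" "affine_on C g"
  shows "affine_on C (\<lambda>x. f x + g x)"
proof -
  obtain L c L' c' where "linear L" "\<forall>x\<in>C. f x = L x + c" "linear L'" "\<forall>x\<in>C. g x = L' x + c'"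
    using assms unfolding affine_on_def by blast
  then show ?thesis
    unfolding affine_on_def by (intro exI[of _ "\<lambda>x. L x + L' x"] exI[of _ "c + c'"]) (simp add: linear_compose_add)
qed

lemma affine_on_linear_compose:
  assumes "linear F" "affine_on C f"
  shows "affine_on C (\<lambda>x. F (f x))"
proof -
  obtain L c where "linear L" "\<forall>x\<in>C. f x = L x + c" using assms(2) unfolding affine_on_def by blast
  then show ?thesis
    using assms(1) linear_compose[of L F] unfolding affine_on_def
    by (intro exI[of _ "F \<circ> L"] exI[of _ "F c"]) (simp add: linear_add)
qed

lemma affine_on_cong: "affine_on C f \<Longrightarrow> (\<And>x. x \<in> C \<Longrightarrow> g x = f x) \<Longrightarrow> affine_on C g"
  by (simp add: affine_on_def)

lemma affine_on_positive_part:
  fixes f :: "'a::real_vector \<Rightarrow> real"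
  assumes "affine_on C f" "(\<forall>x\<in>C. f x \<le> 0) \<or> (\<forall>x\<in>C. 0 \<le> f x)"
  shows "affine_on C (\<lambda>x. max 0 (f x))"
  using assms(2)
proof
  assume "\<forall>x\<in>C. f x \<le> 0"
  then show ?thesis by (intro affine_on_cong[OF affine_on_const[of C 0]]) simp
next
  assume "\<forall>x\<in>C. 0 \<le> f x"
  then show ?thesis by (intro affine_on_cong[OF assms(1)]) simp
qed

lemma affine_on_real:
  fixes f :: "'a::euclidean_space \<Rightarrow> real"
  assumes "affine_on C f"
  obtains v c where "\<And>x. x \<in> C \<Longrightarrow> f x = v \<bullet> x + c"
proof -
  obtain L c where L: "linear L" "\<forall>x\<in>C. f x = L x + c" using assms unfolding affine_on_def by blast
  have "L x = adjoint L 1 \<bullet> x" for x using adjoint_works[OF L(1), of x 1] by (simp add: inner_commute)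
  then show ?thesis using L(2) by (intro that[of "adjoint L 1" c]) simp
qed

definition unseparated :: "('a::euclidean_space \<times> real) set \<Rightarrow> 'a set \<Rightarrow> bool" where
  "unseparated I C \<longleftrightarrow> (\<forall>(a, b)\<in>I. (\<forall>x\<in>C. a \<bullet> x \<le> b) \<or> (\<forall>x\<in>C. b \<le> a \<bullet> x))"

lemma unseparated_mono: "unseparated I C \<Longrightarrow> I' \<subseteq> I \<Longrightarrow> unseparated I' C"
  by (auto simp: unseparated_def)

definition cell :: "('a::euclidean_space \<times> real) set \<Rightarrow> ('a \<times> real) set \<Rightarrow> 'a set" where
  "cell I \<sigma> = (\<Inter>(a, b)\<in>I. if (a, b) \<in> \<sigma> then {x. a \<bullet> x \<le> b} else {x. b \<le> a \<bullet> x})"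

lemma closed_cell: "closed (cell I \<sigma>)"
  unfolding cell_def by (intro closed_INT) (auto simp: closed_halfspace_le closed_halfspace_ge)

lemma unseparated_cell: "unseparated I (cell I \<sigma>)"
proof -
  have "(\<forall>x\<in>cell I \<sigma>. a \<bullet> x \<le> b) \<or> (\<forall>x\<in>cell I \<sigma>. b \<le> a \<bullet> x)" if "(a, b) \<in> I" for a b
    using that by (cases "(a, b) \<in> \<sigma>") (force simp: cell_def)+
  then show ?thesis by (auto simp: unseparated_def)
qed

lemma unseparated_subset_cell:
  assumes "unseparated I C"
  obtains \<sigma> where "\<sigma> \<subseteq> I" "C \<subseteq> cell I \<sigma>"
proof (rule that[of "{(a, b) \<in> I. \<forall>x\<in>C. a \<bullet> x \<le> b}"])
  show "C \<subseteq> cell I {(a, b) \<in> I. \<forall>x\<in>C. a \<bullet> x \<le> b}"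
    using assms unfolding cell_def unseparated_def by fastforce
qed auto

definition piecewise_affine :: "('a::euclidean_space \<Rightarrow> 'b::real_vector) \<Rightarrow> bool" where
  "piecewise_affine f \<longleftrightarrow> (\<exists>I. finite I \<and> (\<forall>C. unseparated I C \<longrightarrow> affine_on C f))"

lemma piecewise_affine_linear: "linear L \<Longrightarrow> piecewise_affine L"
  unfolding piecewise_affine_def using affine_on_linear by blast

lemma piecewise_affine_const: "piecewise_affine (\<lambda>x. c)"
  unfolding piecewise_affine_def using affine_on_const by blast

lemma piecewise_affine_coord: "piecewise_affine (\<lambda>p :: real^'n. p $ i)"
  by (intro piecewise_affine_linear linearI) simp_all

lemma piecewise_affine_add:
  assumes "piecewise_affine f" "piecewise_affine g"
  shows "piecewise_affine (\<lambda>x. f x + g x)"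
proof -
  obtain I I' where I: "finite I" "\<And>C. unseparated I C \<Longrightarrow> affine_on C f" "finite I'"
    "\<And>C. unseparated I' C \<Longrightarrow> affine_on C g"
    using assms unfolding piecewise_affine_def by blast
  have "affine_on C (\<lambda>x. f x + g x)" if "unseparated (I \<union> I') C" for C
    using that by (intro affine_on_add I(2,4)) (auto elim: unseparated_mono)
  then show ?thesis unfolding piecewise_affine_def using I(1,3) by (intro exI[of _ "I \<union> I'"]) auto
qed

lemma piecewise_affine_linear_compose:
  assumes "linear F" "piecewise_affine f"
  shows "piecewise_affine (\<lambda>x. F (f x))"
  using assms affine_on_linear_compose unfolding piecewise_affine_def by blast

lemma piecewise_affine_scale: "piecewise_affine f \<Longrightarrow> piecewise_affine (\<lambda>x. k * f x)" for k :: real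
  by (rule piecewise_affine_linear_compose) (auto intro: linearI simp: algebra_simps)

lemma piecewise_affine_minus: "piecewise_affine f \<Longrightarrow> piecewise_affine (\<lambda>x. - f x)"
  by (rule piecewise_affine_linear_compose) (auto intro: linearI)

lemma piecewise_affine_diff: "piecewise_affine f \<Longrightarrow> piecewise_affine g \<Longrightarrow> piecewise_affine (\<lambda>x. f x - g x)"
  using piecewise_affine_add[OF _ piecewise_affine_minus] by fastforce

lemma piecewise_affine_positive_part:
  fixes f :: "'a::euclidean_space \<Rightarrow> real"
  assumes "piecewise_affine f"
  shows "piecewise_affine (\<lambda>x. max 0 (f x))"
proof -
  obtain I where I: "finite I" "\<And>C. unseparated I C \<Longrightarrow> affine_on C f" using assms unfolding piecewise_affine_def by blast
  have "\<exists>v c. \<forall>x\<in>cell I \<sigma>. f x = v \<bullet> x + c" for \<sigma> using affine_on_real[OF I(2)[OF unseparated_cell]] by metis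
  then obtain v c where f: "\<And>\<sigma> x. x \<in> cell I \<sigma> \<Longrightarrow> f x = v \<sigma> \<bullet> x + c \<sigma>" by metis
  define I' where "I' = I \<union> (\<lambda>\<sigma>. (v \<sigma>, - c \<sigma>)) ` Pow I"
  have "affine_on C (\<lambda>x. max 0 (f x))" if C: "unseparated I' C" for C
  proof -
    have C': "unseparated I C" using C by (rule unseparated_mono) (simp add: I'_def)
    then obtain \<sigma> where \<sigma>: "\<sigma> \<subseteq> I" "C \<subseteq> cell I \<sigma>" by (rule unseparated_subset_cell)
    then have "(v \<sigma>, - c \<sigma>) \<in> I'" by (auto simp: I'_def)
    then have "(\<forall>x\<in>C. v \<sigma> \<bullet> x \<le> - c \<sigma>) \<or> (\<forall>x\<in>C. - c \<sigma> \<le> v \<sigma> \<bullet> x)" using C unfolding unseparated_def by blast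
    then have "(\<forall>x\<in>C. f x \<le> 0) \<or> (\<forall>x\<in>C. 0 \<le> f x)" using f \<sigma>(2) by force
    then show ?thesis by (rule affine_on_positive_part[OF I(2)[OF C']])
  qed
  moreover have "finite I'" using I(1) by (simp add: I'_def)
  ultimately show ?thesis unfolding piecewise_affine_def by blast
qed

lemma piecewise_affine_max:
  fixes f g :: "'a::euclidean_space \<Rightarrow> real"
  assumes "piecewise_affine f" "piecewise_affine g"
  shows "piecewise_affine (\<lambda>x. max (f x) (g x))"
proof -
  have "(\<lambda>x. max (f x) (g x)) = (\<lambda>x. g x + max 0 (f x - g x))" by (auto simp: fun_eq_iff max_def)
  then show ?thesis
    using piecewise_affine_add[OF assms(2) piecewise_affine_positive_part[OF piecewise_affine_diff[OF assms]]] by simp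
qed

lemma piecewise_affine_min:
  fixes f g :: "'a::euclidean_space \<Rightarrow> real"
  assumes "piecewise_affine f" "piecewise_affine g"
  shows "piecewise_affine (\<lambda>x. min (f x) (g x))"
proof -
  have "(\<lambda>x. min (f x) (g x)) = (\<lambda>x. - max (- f x) (- g x))" by (auto simp: fun_eq_iff min_def max_def)
  then show ?thesis
    using piecewise_affine_minus[OF piecewise_affine_max[OF assms[THEN piecewise_affine_minus]]] by simp
qed

lemma piecewise_affine_abs: "piecewise_affine (f :: 'a::euclidean_space \<Rightarrow> real) \<Longrightarrow> piecewise_affine (\<lambda>x. \<bar>f x\<bar>)"
proof -
  assume "piecewise_affine f"
  moreover have "(\<lambda>x. \<bar>f x\<bar>) = (\<lambda>x. max (f x) (- f x))" by (auto simp: fun_eq_iff)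
  ultimately show ?thesis using piecewise_affine_max[OF _ piecewise_affine_minus] by simp
qed

lemmas piecewise_affine_intros = piecewise_affine_const piecewise_affine_coord piecewise_affine_add piecewise_affine_diff
  piecewise_affine_minus piecewise_affine_scale piecewise_affine_max piecewise_affine_min piecewise_affine_abs

lemma piecewise_affine_continuous:
  fixes f :: "'a::euclidean_space \<Rightarrow> 'b::real_normed_vector"
  assumes "piecewise_affine f"
  shows "continuous_on S f"
proof -
  obtain I where I: "finite I" "\<And>C. unseparated I C \<Longrightarrow> affine_on C f" using assms unfolding piecewise_affine_def by blast
  have "continuous_on (\<Union>\<sigma>\<in>Pow I. cell I \<sigma>) f"
  proof (intro continuous_on_closed_Union closed_cell)
    fix \<sigma>
    obtain L c where L: "linear L" "\<forall>x\<in>cell I \<sigma>. f x = L x + c"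
      using I(2)[OF unseparated_cell] unfolding affine_on_def by blast
    then have "continuous_on (cell I \<sigma>) (\<lambda>x. L x + c)"
      by (intro continuous_intros linear_continuous_on) (simp add: linear_conv_bounded_linear)
    then show "continuous_on (cell I \<sigma>) f" using L(2) by (simp cong: continuous_on_cong)
  qed (use I(1) in simp)
  moreover have "x \<in> (\<Union>\<sigma>\<in>Pow I. cell I \<sigma>)" for x
    using unseparated_subset_cell[of I "{x}"] by (force simp: unseparated_def)
  ultimately show ?thesis by (elim continuous_on_subset) blast
qed

lemma face_of_affine_image:
  assumes face: "F face_of S" and S: "convex S" and inj: "inj_on \<phi> S" and affine: "affine_on S \<phi>"
  shows "\<phi> ` F face_of \<phi> ` S"
proof -
  obtain L c where L: "linear L" "\<And>x. x \<in> S \<Longrightarrow> \<phi> x = L x + c" using affine unfolding affine_on_def by blast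
  have comb: "\<phi> ((1 - u) *\<^sub>R x + u *\<^sub>R y) = (1 - u) *\<^sub>R \<phi> x + u *\<^sub>R \<phi> y" if "x \<in> S" "y \<in> S" "0 \<le> u" "u \<le> 1" for x y u
  proof -
    have "(1 - u) *\<^sub>R x + u *\<^sub>R y \<in> S" using S that by (simp add: convexD)
    then have "\<phi> ((1 - u) *\<^sub>R x + u *\<^sub>R y) = (1 - u) *\<^sub>R L x + u *\<^sub>R L y + c" by (simp add: L linear_add linear_scale)
    also have "\<dots> = (1 - u) *\<^sub>R (L x + c) + u *\<^sub>R (L y + c)" by (simp add: algebra_simps)
    finally show ?thesis using L(2) that by simp
  qed
  have F: "F \<subseteq> S" "convex F" using face by (auto simp: face_of_def)
  then have "\<phi> ` F = (\<lambda>x. c + x) ` L ` F" using L(2) by (force simp: image_image add.commute)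
  then have conv: "convex (\<phi> ` F)" using F(2) L(1) by (simp add: convex_linear_image convex_translation)
  show ?thesis unfolding face_of_def
  proof (intro conjI ballI impI)
    fix a b x assume "a \<in> \<phi> ` S" "b \<in> \<phi> ` S" "x \<in> \<phi> ` F" and seg: "x \<in> open_segment a b"
    then obtain a' b' x' where p: "a' \<in> S" "a = \<phi> a'" "b' \<in> S" "b = \<phi> b'" "x' \<in> F" "x = \<phi> x'" by blast
    obtain u where u: "a \<noteq> b" "0 < u" "u < 1" "x = (1 - u) *\<^sub>R a + u *\<^sub>R b" using seg by (auto simp: in_segment)
    have "\<phi> x' = \<phi> ((1 - u) *\<^sub>R a' + u *\<^sub>R b')" using comb[OF p(1,3), of u] u p by simp
    moreover have "(1 - u) *\<^sub>R a' + u *\<^sub>R b' \<in> S" using S p u by (simp add: convexD)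
    ultimately have "x' = (1 - u) *\<^sub>R a' + u *\<^sub>R b'" using inj p F(1) by (meson inj_onD subsetD)
    then have "x' \<in> open_segment a' b'" using u p by (auto simp: in_segment)
    then have "a' \<in> F" "b' \<in> F" using face p by (auto simp: face_of_def)
    then show "a \<in> \<phi> ` F" "b \<in> \<phi> ` F" using p by auto
  qed (use F conv in auto)
qed

lemma polytope_affine_image:
  fixes \<phi> :: "'a::euclidean_space \<Rightarrow> 'b::euclidean_space"
  assumes "polytope S" "affine_on S \<phi>"
  shows "polytope (\<phi> ` S)"
proof -
  obtain L c where L: "linear L" "\<forall>x\<in>S. \<phi> x = L x + c" using assms(2) unfolding affine_on_def by blast
  have "\<phi> ` S = (\<lambda>x. c + x) ` L ` S" using L(2) by (force simp: image_image add.commute)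
  then show ?thesis using L(1) assms(1) by (simp add: polytope_linear_image polytope_translation_eq)
qed

lemma unseparated_subdivision:
  fixes \<T> :: "'a::euclidean_space set set"
  assumes "simplicial_complex \<T>" "finite I"
  obtains \<G> where "\<Union>\<G> = \<Union>\<T>" "finite \<G>" "\<And>X. X \<in> \<G> \<Longrightarrow> polytope X" "\<And>X Y. X \<in> \<G> \<Longrightarrow> Y \<in> \<G> \<Longrightarrow> X \<inter> Y face_of X"
    "\<And>X. X \<in> \<G> \<Longrightarrow> unseparated I X"
proof -
  have "\<exists>G. \<Union>G = \<Union>\<T> \<and> finite G \<and> (\<forall>C\<in>G. \<exists>D. D \<in> \<T> \<and> C \<subseteq> D) \<and>
      (\<forall>C\<in>\<T>. \<forall>x\<in>C. \<exists>D. D \<in> G \<and> x \<in> D \<and> D \<subseteq> C) \<and> (\<forall>X\<in>G. polytope X) \<and>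
      (\<forall>X\<in>G. aff_dim X \<le> int DIM('a)) \<and> (\<forall>X\<in>G. \<forall>Y\<in>G. X \<inter> Y face_of X) \<and>
      (\<forall>X\<in>G. \<forall>x\<in>X. \<forall>y\<in>X. \<forall>a b. (a,b) \<in> I \<longrightarrow> a \<bullet> x \<le> b \<and> a \<bullet> y \<le> b \<or> a \<bullet> x \<ge> b \<and> a \<bullet> y \<ge> b)"
    using assms
    by (intro cell_subdivision_lemma aff_dim_le_DIM) (auto simp: simplicial_complex_def dest: simplex_imp_polytope)
  then obtain G where G: "\<Union>G = \<Union>\<T>" "finite G" "\<forall>X\<in>G. polytope X" "\<forall>X\<in>G. \<forall>Y\<in>G. X \<inter> Y face_of X"
    "\<forall>X\<in>G. \<forall>x\<in>X. \<forall>y\<in>X. \<forall>a b. (a, b) \<in> I \<longrightarrow> a \<bullet> x \<le> b \<and> a \<bullet> y \<le> b \<or> a \<bullet> x \<ge> b \<and> a \<bullet> y \<ge> b"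
    by (elim exE conjE) (rule that)
  have "unseparated I X" if "X \<in> G" for X
    unfolding unseparated_def
  proof safe
    fix a b x y assume "(a, b) \<in> I" "x \<in> X" "\<not> b \<le> a \<bullet> x" "y \<in> X"
    then show "a \<bullet> y \<le> b" using G(5)[rule_format, OF that, of x y a b] by linarith
  qed
  then show ?thesis using G by (intro that[of G]) auto
qed

lemma piecewise_affine_image_complex:
  fixes \<phi> :: "'a::euclidean_space \<Rightarrow> 'b::euclidean_space"
  assumes "simplicial_complex \<T>" "piecewise_affine \<phi>" "inj \<phi>"
  obtains \<T>' where "simplicial_complex \<T>'" "\<Union>\<T>' = \<phi> ` \<Union>\<T>"
proof -
  obtain I where I: "finite I" "\<And>C. unseparated I C \<Longrightarrow> affine_on C \<phi>" using assms(2) unfolding piecewise_affine_def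
    by blast
  from assms(1) I(1) obtain G where G: "\<Union>G = \<Union>\<T>" "finite G" "\<And>X. X \<in> G \<Longrightarrow> polytope X"
      "\<And>X Y. X \<in> G \<Longrightarrow> Y \<in> G \<Longrightarrow> X \<inter> Y face_of X" "\<And>X. X \<in> G \<Longrightarrow> unseparated I X"
    by (rule unseparated_subdivision) blast
  have face: "\<phi> ` X \<inter> \<phi> ` Y face_of \<phi> ` X" if "X \<in> G" "Y \<in> G" for X Y
    unfolding image_Int[OF assms(3), symmetric] using G(3-5) that I(2) assms(3)
    by (intro face_of_affine_image) (auto intro: polytope_imp_convex inj_on_subset)
  define M where "M = (\<lambda>X. \<phi> ` X) ` G"
  have "finite M" using G(2) by (simp add: M_def)
  then obtain \<T>' where "simplicial_complex \<T>'" "\<Union>\<T>' = \<Union>M"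
  proof (rule simplicial_subdivision_of_cell_complex)
    show "polytope C" if "C \<in> M" for C using that G(3,5) I(2) by (auto simp: M_def intro: polytope_affine_image)
    show "C1 \<inter> C2 face_of C1" if "C1 \<in> M" "C2 \<in> M" for C1 C2 using that face by (auto simp: M_def)
  qed
  moreover have "\<Union>M = \<phi> ` \<Union>\<T>" unfolding M_def G(1)[symmetric] by blast
  ultimately show ?thesis by (intro that[of \<T>']) simp_all
qed

theorem piecewise_affine_unknotted:
  fixes \<phi> :: "real^3 \<Rightarrow> real^3"
  assumes "unknotted K" "piecewise_affine \<phi>" "inj \<phi>"
  shows "unknotted (\<phi> ` K)"
proof -
  obtain \<T> where \<T>: "simplicial_complex \<T>" "disk_bounded_by (\<Union>\<T>) K"
    using assms(1) by (auto simp: unknotted_def PL_triangulated_disk_bounded_by_def)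
  from \<T>(1) assms(2,3) obtain \<T>' where \<T>': "simplicial_complex \<T>'" "\<Union>\<T>' = \<phi> ` \<Union>\<T>"
    by (rule piecewise_affine_image_complex)
  have "disk_bounded_by (\<phi> ` \<Union>\<T>) (\<phi> ` K)"
    using \<T>(2) assms(2,3) by (intro disk_bounded_by_image piecewise_affine_continuous) (auto intro: inj_on_subset)
  then show ?thesis using \<T>' unfolding unknotted_def PL_triangulated_disk_bounded_by_def by auto
qed

theorem push_unknotted:
  fixes m :: "real^3 \<Rightarrow> real"
  assumes "unknotted K" "piecewise_affine m" and slope: "\<And>p t. t > 0 \<Longrightarrow> m p - t < m (p + t *\<^sub>R e)"
  shows "unknotted ((\<lambda>p. p + m p *\<^sub>R e) ` K)"
proof (rule piecewise_affine_unknotted[OF assms(1)])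
  have "linear (\<lambda>t :: real. t *\<^sub>R e)" by (simp add: linearI scaleR_add_left)
  then show "piecewise_affine (\<lambda>p. p + m p *\<^sub>R e)"
    by (intro piecewise_affine_add piecewise_affine_linear_compose[OF _ assms(2)] piecewise_affine_linear linear_ident)
  show "inj (\<lambda>p. p + m p *\<^sub>R e)"
  proof (rule injI)
    fix p q assume eq: "p + m p *\<^sub>R e = q + m q *\<^sub>R e"
    have p: "p = q + (m q - m p) *\<^sub>R e" and q: "q = p + (m p - m q) *\<^sub>R e"
      using eq by (auto simp: algebra_simps)
    consider "m q - m p > 0" | "m p - m q > 0" | "m p = m q" by linarith
    then show "p = q"
    proof cases
      case 1
      then show ?thesis using slope[OF 1, of q] p by simp
    next
      case 2
      then show ?thesis using slope[OF 2, of p] q by simp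
    qed (use p in simp)
  qed
qed

lemma shear_unknotted:
  fixes m :: "real^3 \<Rightarrow> real"
  assumes "unknotted K" "piecewise_affine m" "\<And>p t. m (p + t *\<^sub>R e) = m p"
  shows "unknotted ((\<lambda>p. p + m p *\<^sub>R e) ` K)"
  using assms by (intro push_unknotted) auto

lemma homeomorphism_interior_image:
  fixes S T :: "'a::euclidean_space set"
  assumes "homeomorphism S T f g"
  shows "f ` interior S = interior T"
proof -
  have fg: "continuous_on S f" "inj_on f S" "f ` S = T" "continuous_on T g" "inj_on g T" "g ` T = S"
    "\<And>y. y \<in> T \<Longrightarrow> f (g y) = y"
    using assms by (auto simp: homeomorphism_def intro: inj_on_inverseI)
  have "f ` interior S \<subseteq> interior T" "g ` interior T \<subseteq> interior S"
    using continuous_image_subset_interior[OF fg(1,2)] continuous_image_subset_interior[OF fg(4,5)] fg(3,6) by auto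
  moreover from this(2) have "y \<in> f ` interior S" if "y \<in> interior T" for y
    using fg(7)[of y] interior_subset that by (metis image_eqI image_subset_iff subsetD)
  ultimately show ?thesis by blast
qed

lemma convex_disk_bounded_by_frontier:
  fixes T :: "(real^2) set"
  assumes "convex T" "compact T" "interior T \<noteq> {}"
  shows "disk_bounded_by T (frontier T)"
proof -
  have "cball (0 :: real^2) 1 homeomorphic T" using assms by (intro homeomorphic_convex_compact) auto
  then obtain f g where fg: "homeomorphism (cball (0 :: real^2) 1) T f g" by (auto simp: homeomorphic_def)
  then have f: "inj_on f (cball 0 1)" "f ` cball 0 1 = T" by (auto simp: homeomorphism_def intro: inj_on_inverseI)
  have "sphere (0 :: real^2) 1 = cball 0 1 - ball 0 1" by auto
  then have "f ` sphere 0 1 = f ` cball 0 1 - f ` ball 0 1"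
    using f(1) by (simp add: inj_on_image_set_diff[of f "cball 0 1"] ball_subset_cball)
  also have "f ` ball 0 1 = interior T" using homeomorphism_interior_image[OF fg] by simp
  also have "f ` cball 0 1 - interior T = frontier T" using compact_imp_closed[OF assms(2)]
    by (simp add: frontier_def f(2))
  finally show ?thesis using fg unfolding disk_bounded_by_def by blast
qed

lemma triangle_unknotted:
  fixes L :: "real^2 \<Rightarrow> real^3"
  assumes L: "linear L" "inj L" and "interior (convex hull {a, b, c}) \<noteq> {}"
  shows "unknotted (closed_segment (L a) (L b) \<union> closed_segment (L b) (L c) \<union> closed_segment (L c) (L a))"
proof -
  define T where "T = convex hull {a, b, c}"
  have "disk_bounded_by T (frontier T)"
    using assms(3) by (intro convex_disk_bounded_by_frontier) (auto simp: T_def compact_convex_hull finite_imp_compact)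
  also have "frontier T = closed_segment a b \<union> closed_segment b c \<union> closed_segment c a"
    unfolding T_def by (rule frontier_of_triangle) simp
  finally have "disk_bounded_by (L ` T) (L ` (closed_segment a b \<union> closed_segment b c \<union> closed_segment c a))"
    using L by (intro disk_bounded_by_image) (auto intro: linear_continuous_on inj_on_subset
      simp: linear_conv_bounded_linear)
  moreover have "polytope (L ` T)" using L(1) by (simp add: T_def polytope_linear_image polytope_convex_hull)
  then obtain M where "simplicial_complex M" "\<Union>M = L ` T"
    using simplicial_subdivision_of_cell_complex[of "{L ` T}" thesis] by (auto simp: polytope_imp_convex face_of_refl)
  ultimately show ?thesis
    unfolding unknotted_def PL_triangulated_disk_bounded_by_def image_Un closed_segment_linear_image[OF L(1), symmetric]
    by metis
qed

section \<open>The curves are unknotted\<close>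

definition plane_point :: "real \<Rightarrow> real \<Rightarrow> real^3" where "plane_point y s = vector [0, y, s]"

lemma plane_point_nth [simp]: "plane_point y s $ 1 = 0" "plane_point y s $ 2 = y" "plane_point y s $ 3 = s"
  by (simp_all add: plane_point_def)

lemma plane_point_comb:
  "(1 - u) *\<^sub>R plane_point y s + u *\<^sub>R plane_point y' s' = plane_point ((1 - u) * y + u * y') ((1 - u) * s + u * s')"
  by (simp add: vec_eq_iff forall_3)

definition edge :: "real \<Rightarrow> real \<Rightarrow> real \<Rightarrow> real \<Rightarrow> (real^3) set" where
  "edge y s y' s' = closed_segment (plane_point y s) (plane_point y' s')"

lemma edge_image: "edge y s y' s' = (\<lambda>u. plane_point ((1 - u) * y + u * y') ((1 - u) * s + u * s')) ` {0..1}"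
  unfolding edge_def closed_segment_image_interval plane_point_comb ..

lemma edge_commute: "edge y s y' s' = edge y' s' y s"
  by (simp add: edge_def closed_segment_commute)

lemma edge_split:
  assumes "0 \<le> l" "l \<le> 1" "y0 = (1 - l) * y1 + l * y2" "s0 = (1 - l) * s1 + l * s2"
  shows "edge y1 s1 y2 s2 = edge y1 s1 y0 s0 \<union> edge y0 s0 y2 s2"
proof -
  have "plane_point y0 s0 \<in> closed_segment (plane_point y1 s1) (plane_point y2 s2)"
    unfolding in_segment plane_point_comb using assms by blast
  then show ?thesis unfolding edge_def by (rule Un_closed_segment[symmetric])
qed

lemma edge_graph:
  assumes "s < s'" and affine: "\<And>t. s \<le> t \<Longrightarrow> t \<le> s' \<Longrightarrow> Y t = Y s + (Y s' - Y s) * ((t - s) / (s' - s))"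
  shows "edge (Y s) s (Y s') s' = {p. p $ 1 = 0 \<and> s \<le> p $ 3 \<and> p $ 3 \<le> s' \<and> p $ 2 = Y (p $ 3)}"
proof (intro set_eqI iffI)
  fix p assume "p \<in> edge (Y s) s (Y s') s'"
  then obtain u where u: "0 \<le> u" "u \<le> 1" "p = plane_point ((1 - u) * Y s + u * Y s') ((1 - u) * s + u * s')"
    unfolding edge_image by auto
  have p3: "p $ 3 = s + u * (s' - s)" using u by (simp add: algebra_simps)
  have range: "0 \<le> u * (s' - s)" "u * (s' - s) \<le> s' - s" using u assms(1) by (auto intro: mult_left_le_one_le)
  have "(p $ 3 - s) / (s' - s) = u" using p3 assms(1) by simp
  then have "p $ 2 = Y (p $ 3)" using affine[of "p $ 3"] range p3 u by (simp add: algebra_simps)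
  then show "p \<in> {p. p $ 1 = 0 \<and> s \<le> p $ 3 \<and> p $ 3 \<le> s' \<and> p $ 2 = Y (p $ 3)}" using u range p3 by simp
next
  fix p assume p: "p \<in> {p :: real^3. p $ 1 = 0 \<and> s \<le> p $ 3 \<and> p $ 3 \<le> s' \<and> p $ 2 = Y (p $ 3)}"
  define u where "u = (p $ 3 - s) / (s' - s)"
  have "0 \<le> u" "u \<le> 1" using p assms(1) by (auto simp: u_def)
  moreover have "u * (s' - s) = p $ 3 - s" using assms(1) by (simp add: u_def)
  moreover have "p $ 2 = Y s + (Y s' - Y s) * u" using p affine[of "p $ 3"] by (simp add: u_def)
  ultimately have "p = plane_point ((1 - u) * Y s + u * Y s') ((1 - u) * s + u * s')"
    using p by (simp add: vec_eq_iff forall_3 algebra_simps)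
  then show "p \<in> edge (Y s) s (Y s') s'" unfolding edge_image using \<open>0 \<le> u\<close> \<open>u \<le> 1\<close> by auto
qed

lemma push_edge:
  assumes "\<And>u. 0 \<le> u \<Longrightarrow> u \<le> 1 \<Longrightarrow> M ((1 - u) * y + u * y') ((1 - u) * s + u * s') = (1 - u) * k + u * k'"
  shows "(\<lambda>p. p + M (p $ 2) (p $ 3) *\<^sub>R plane_point a b) ` edge y s y' s' =
    edge (y + k * a) (s + k * b) (y' + k' * a) (s' + k' * b)"
  unfolding edge_image image_image
proof (intro image_cong refl)
  fix u :: real assume "u \<in> {0..1}"
  then have M: "M ((1 - u) * y + u * y') ((1 - u) * s + u * s') = (1 - u) * k + u * k'" by (intro assms) auto
  show "plane_point ((1 - u) * y + u * y') ((1 - u) * s + u * s') +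
      M (plane_point ((1 - u) * y + u * y') ((1 - u) * s + u * s') $ 2) (plane_point ((1 - u) * y + u * y') ((1 - u) * s + u * s') $ 3) *\<^sub>R
        plane_point a b =
    plane_point ((1 - u) * (y + k * a) + u * (y' + k' * a)) ((1 - u) * (s + k * b) + u * (s' + k' * b))"
    unfolding plane_point_nth M by (simp add: vec_eq_iff forall_3 algebra_simps)
qed

fun affine_eval :: "real \<times> real \<times> real \<Rightarrow> real \<Rightarrow> real \<Rightarrow> real" where
  "affine_eval (a, b, c) y s = a * y + b * s + c"

lemma affine_eval_comb:
  "affine_eval g ((1 - u) * y + u * y') ((1 - u) * s + u * s') = (1 - u) * affine_eval g y s + u * affine_eval g y' s'"
  by (cases g) (simp add: algebra_simps)

lemma affine_eval_translate:
  "affine_eval g (y + t * a) (s + t * b) = affine_eval g y s + t * (affine_eval g a b - affine_eval g 0 0)"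
  by (cases g) (simp add: algebra_simps)

lemma affine_eval_edge:
  "p \<in> edge y s y' s' \<Longrightarrow> affine_eval g y s \<le> 0 \<Longrightarrow> affine_eval g y' s' \<le> 0 \<Longrightarrow> affine_eval g (p $ 2) (p $ 3) \<le> 0"
  unfolding edge_image by (auto simp: affine_eval_comb intro!: add_nonpos_nonpos mult_nonneg_nonpos)

lemma piecewise_affine_eval: "piecewise_affine (\<lambda>p :: real^3. affine_eval g (p $ 2) (p $ 3))"
  by (cases g) (auto intro!: piecewise_affine_intros)

definition bump :: "real \<times> real \<times> real \<Rightarrow> real \<times> real \<times> real \<Rightarrow> real \<times> real \<times> real \<Rightarrow> real \<Rightarrow> real \<Rightarrow> real" where
  "bump g1 g2 g3 y s = max 0 (min (affine_eval g1 y s) (min (affine_eval g2 y s) (affine_eval g3 y s)))"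

lemma bump_commute: "bump g1 g2 g3 = bump g2 g1 g3"
  by (simp add: fun_eq_iff bump_def min.left_commute)

lemma push_bump_unknotted:
  assumes "unknotted K" and slope: "\<And>g. g \<in> {g1, g2, g3} \<Longrightarrow> affine_eval g a b - affine_eval g 0 0 > - 1"
  shows "unknotted ((\<lambda>p. p + bump g1 g2 g3 (p $ 2) (p $ 3) *\<^sub>R plane_point a b) ` K)"
proof (rule push_unknotted[OF assms(1)])
  show "piecewise_affine (\<lambda>p :: real^3. bump g1 g2 g3 (p $ 2) (p $ 3))"
    unfolding bump_def by (intro piecewise_affine_intros piecewise_affine_eval)
  fix p :: "real^3" and t :: real assume t: "t > 0"
  have less: "affine_eval g y s - t < affine_eval g (y + t * a) (s + t * b)" if "g \<in> {g1, g2, g3}" for g y s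
    unfolding affine_eval_translate using mult_strict_left_mono[OF slope[OF that] t] by simp
  show "bump g1 g2 g3 (p $ 2) (p $ 3) - t <
      bump g1 g2 g3 ((p + t *\<^sub>R plane_point a b) $ 2) ((p + t *\<^sub>R plane_point a b) $ 3)"
    using less[of g1 "p $ 2" "p $ 3"] less[of g2 "p $ 2" "p $ 3"] less[of g3 "p $ 2" "p $ 3"] t
    unfolding bump_def by (simp add: max_def min_def)
qed

lemma push_bump_edge:
  assumes "affine_eval g1 y1 s1 = 0" "affine_eval g1 y0 s0 = 1" "affine_eval g2 y1 s1 \<ge> 0" "affine_eval g2 y0 s0 = 1"
    "affine_eval g3 y1 s1 \<ge> 0" "affine_eval g3 y0 s0 \<ge> 1"
  shows "(\<lambda>p. p + bump g1 g2 g3 (p $ 2) (p $ 3) *\<^sub>R plane_point a b) ` edge y1 s1 y0 s0 = edge y1 s1 (y0 + a) (s0 + b)"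
proof -
  have "bump g1 g2 g3 ((1 - u) * y1 + u * y0) ((1 - u) * s1 + u * s0) = (1 - u) * 0 + u * 1" if u: "0 \<le> u" "u \<le> 1" for u
  proof -
    have "affine_eval g2 ((1 - u) * y1 + u * y0) ((1 - u) * s1 + u * s0) \<ge> u" using u assms
      by (simp add: affine_eval_comb)
    moreover have "affine_eval g3 ((1 - u) * y1 + u * y0) ((1 - u) * s1 + u * s0) \<ge> u"
      using u assms mult_left_mono[OF assms(6) u(1)] by (simp add: affine_eval_comb add_nonneg_nonneg add_increasing)
    moreover have "affine_eval g1 ((1 - u) * y1 + u * y0) ((1 - u) * s1 + u * s0) = u" using assms
      by (simp add: affine_eval_comb)
    ultimately show ?thesis using u by (simp add: bump_def)
  qed
  from push_edge[of "bump g1 g2 g3", OF this, where a = a and b = b] show ?thesis by simp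
qed

definition vanishing :: "real \<times> real \<times> real \<Rightarrow> real \<times> real \<times> real \<Rightarrow> real \<times> real \<times> real \<Rightarrow> (real^3) set \<Rightarrow> bool" where
  "vanishing g1 g2 g3 R \<longleftrightarrow> (\<forall>p\<in>R. bump g1 g2 g3 (p $ 2) (p $ 3) = 0)"

lemma vanishing_Un: "vanishing g1 g2 g3 (A \<union> B) \<longleftrightarrow> vanishing g1 g2 g3 A \<and> vanishing g1 g2 g3 B"
  by (auto simp: vanishing_def)

lemma vanishing_edge:
  assumes "\<exists>g\<in>{g1, g2, g3}. affine_eval g y s \<le> 0 \<and> affine_eval g y' s' \<le> 0"
  shows "vanishing g1 g2 g3 (edge y s y' s')"
  unfolding vanishing_def
proof
  fix p assume "p \<in> edge y s y' s'"
  then have "\<exists>g\<in>{g1, g2, g3}. affine_eval g (p $ 2) (p $ 3) \<le> 0" using assms affine_eval_edge by blast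
  then show "bump g1 g2 g3 (p $ 2) (p $ 3) = 0" by (auto simp: bump_def min_def max_def)
qed

text \<open>Pushing the point \<open>(y0, s0)\<close> of an edge along \<open>(a, b)\<close>: the displacement is cut off by three affine functions,
  each of which also keeps some of the remaining edges in place.\<close>

lemma ear:
  assumes "unknotted (edge y1 s1 y2 s2 \<union> R)" and "vanishing g1 g2 g3 R"
    and "0 \<le> l" "l \<le> 1" "y0 = (1 - l) * y1 + l * y2" "s0 = (1 - l) * s1 + l * s2"
    and "\<And>g. g \<in> {g1, g2, g3} \<Longrightarrow> affine_eval g a b - affine_eval g 0 0 > - 1"
    and "affine_eval g1 y1 s1 = 0" "affine_eval g1 y0 s0 = 1" "affine_eval g1 y2 s2 \<ge> 0"
    and "affine_eval g2 y1 s1 \<ge> 0" "affine_eval g2 y0 s0 = 1" "affine_eval g2 y2 s2 = 0"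
    and "affine_eval g3 y1 s1 \<ge> 0" "affine_eval g3 y0 s0 \<ge> 1" "affine_eval g3 y2 s2 \<ge> 0"
    and "y = y0 + a" "s = s0 + b"
  shows "unknotted (edge y1 s1 y s \<union> (edge y s y2 s2 \<union> R))"
proof -
  define push where "push = (\<lambda>p. p + bump g1 g2 g3 (p $ 2) (p $ 3) *\<^sub>R plane_point a b)"
  have "unknotted (push ` (edge y1 s1 y2 s2 \<union> R))" unfolding push_def using assms(1,7) by (rule push_bump_unknotted)
  also have "edge y1 s1 y2 s2 = edge y1 s1 y0 s0 \<union> edge y0 s0 y2 s2" by (rule edge_split[OF assms(3-6)])
  also have "push ` (edge y1 s1 y0 s0 \<union> edge y0 s0 y2 s2 \<union> R) = edge y1 s1 y s \<union> (edge y s y2 s2 \<union> R)"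
  proof -
    have "push ` edge y1 s1 y0 s0 = edge y1 s1 y s"
      unfolding push_def assms(17,18) using assms by (intro push_bump_edge) simp_all
    moreover have "push ` edge y2 s2 y0 s0 = edge y2 s2 y s"
      unfolding push_def assms(17,18) bump_commute[of g1] using assms by (intro push_bump_edge) simp_all
    moreover have "push ` R = R" using assms(2) by (force simp: push_def vanishing_def image_iff)
    ultimately show ?thesis by (simp add: image_Un Un_assoc edge_commute[of y0] edge_commute[of y s y2])
  qed
  finally show ?thesis .
qed

lemma start_triangle: "unknotted (edge 0 2 2 2 \<union> (edge 2 2 (-2) (-8) \<union> edge (-2) (-8) 0 2))"
proof -
  define L :: "real^2 \<Rightarrow> real^3" where "L v = plane_point (v $ 1) (v $ 2)" for v
  define a b c :: "real^2" where "a = vector [0, 2]" and "b = vector [2, 2]" and "c = vector [-2, -8]"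
  have L: "linear L" by (intro linearI) (simp_all add: L_def vec_eq_iff forall_3)
  have inj: "inj L" by (rule injI) (simp add: L_def vec_eq_iff forall_3 forall_2)
  have dist: "a \<noteq> b" "a \<noteq> c" "b \<noteq> c" by (auto simp: a_def b_def c_def vec_eq_iff forall_2)
  have "\<not> collinear {a, b, c}"
  proof
    assume "collinear {a, b, c}"
    then obtain u where u: "\<And>x y. x \<in> {a, b, c} \<Longrightarrow> y \<in> {a, b, c} \<Longrightarrow> \<exists>k. x - y = k *\<^sub>R u" unfolding collinear_def by blast
    obtain k where k: "b - a = k *\<^sub>R u" using u[of b a] by auto
    obtain k' where k': "c - a = k' *\<^sub>R u" using u[of c a] by auto
    have "k * u $ 1 = 2" "k * u $ 2 = 0" using k by (simp_all add: vec_eq_iff forall_2 a_def b_def)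
    then have "u $ 2 = 0" by auto
    moreover have "k' * u $ 2 = - 10" using k' by (simp add: vec_eq_iff forall_2 a_def c_def)
    ultimately show False by simp
  qed
  then have "\<not> affine_dependent {a, b, c}" using collinear_3_eq_affine_dependent[of a b c] by blast
  moreover have "card {a, b, c} = Suc DIM(real^2)" using dist by simp
  ultimately have "interior (convex hull {a, b, c}) \<noteq> {}" using interior_convex_hull_eq_empty[of "{a, b, c}"] by blast
  from triangle_unknotted[OF L inj this] show ?thesis
    by (simp add: L_def a_def b_def c_def edge_def Un_assoc)
qed

lemma planar_polygon:
  "unknotted (edge 0 2 0 (-2) \<union> edge 0 (-2) 2 (-1) \<union> edge 2 (-1) 2 2 \<union> edge 2 2 6 1 \<union> edge 6 1 6 (-1) \<union>
     edge 6 (-1) (-2) (-8) \<union> edge (-2) (-8) (-2) 1 \<union> edge (-2) 1 0 2)"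
proof -
  have quadrilateral: "unknotted (edge 0 2 0 (-2) \<union> (edge 0 (-2) 2 2 \<union> (edge 2 2 (-2) (-8) \<union> edge (-2) (-8) 0 2)))"
    by (rule ear[OF start_triangle, where l = "1/2" and ?y0.0 = 1 and ?s0.0 = 2 and a = "-1" and b = "-4"
        and ?g1.0 = "(1, -1/5, 2/5)" and ?g2.0 = "(-1, 2/5, 6/5)" and ?g3.0 = "(-1, 2/5, 6/5)"])
      (auto simp: vanishing_Un vanishing_edge)
  have pentagon: "unknotted (edge 2 2 6 1 \<union> (edge 6 1 (-2) (-8) \<union> (edge 0 2 0 (-2) \<union> edge 0 (-2) 2 2 \<union> edge (-2) (-8) 0 2)))"
  proof (rule ear[where l = "1/10" and ?y0.0 = "8/5" and ?s0.0 = 1 and a = "22/5" and b = 0 and ?g1.0 = "(10, -5, -10)"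
        and ?g2.0 = "(5/9, -1/9, 2/9)" and ?g3.0 = "(5/9, -1/9, 2/9)"])
    show "unknotted (edge 2 2 (-2) (-8) \<union> (edge 0 2 0 (-2) \<union> edge 0 (-2) 2 2 \<union> edge (-2) (-8) 0 2))"
      using quadrilateral by (simp add: Un_ac)
  qed (auto simp: vanishing_Un vanishing_edge)
  have hexagon: "unknotted (edge 6 1 6 (-1) \<union> (edge 6 (-1) (-2) (-8) \<union>
      (edge 0 2 0 (-2) \<union> edge 0 (-2) 2 2 \<union> edge 2 2 6 1 \<union> edge (-2) (-8) 0 2)))"
  proof (rule ear[where l = "2/9" and ?y0.0 = "38/9" and ?s0.0 = "-1" and a = "16/9" and b = 0
        and ?g1.0 = "(9/20, -9/10, -9/5)" and ?g2.0 = "(45/217, -9/217, 18/217)" and ?g3.0 = "(45/217, -9/217, 18/217)"])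
    show "unknotted (edge 6 1 (-2) (-8) \<union> (edge 0 2 0 (-2) \<union> edge 0 (-2) 2 2 \<union> edge 2 2 6 1 \<union> edge (-2) (-8) 0 2))"
      using pentagon by (simp add: Un_ac)
  qed (auto simp: vanishing_Un vanishing_edge)
  have heptagon: "unknotted (edge (-2) (-8) (-2) 1 \<union> (edge (-2) 1 0 2 \<union>
      (edge 0 2 0 (-2) \<union> edge 0 (-2) 2 2 \<union> edge 2 2 6 1 \<union> edge 6 1 6 (-1) \<union> edge 6 (-1) (-2) (-8))))"
  proof (rule ear[where l = "9/10" and ?y0.0 = "-1/5" and ?s0.0 = 1 and a = "-9/5" and b = 0
        and ?g1.0 = "(-35/297, 40/297, 250/297)" and ?g2.0 = "(-5, 0, 0)" and ?g3.0 = "(-5, 0, 0)"])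
    show "unknotted (edge (-2) (-8) 0 2 \<union> (edge 0 2 0 (-2) \<union> edge 0 (-2) 2 2 \<union> edge 2 2 6 1 \<union> edge 6 1 6 (-1) \<union> edge 6 (-1) (-2) (-8)))"
      using hexagon by (simp add: Un_ac)
  qed (auto simp: vanishing_Un vanishing_edge)
  have "unknotted (edge 0 (-2) 2 (-1) \<union> (edge 2 (-1) 2 2 \<union>
      (edge 0 2 0 (-2) \<union> edge 2 2 6 1 \<union> edge 6 1 6 (-1) \<union> edge 6 (-1) (-2) (-8) \<union> edge (-2) (-8) (-2) 1 \<union> edge (-2) 1 0 2)))"
  proof (rule ear[where l = "1/4" and ?y0.0 = "1/2" and ?s0.0 = "-1" and a = "3/2" and b = 0 and ?g1.0 = "(2, 0, 0)"
        and ?g2.0 = "(-2/9, -2/9, 8/9)" and ?g3.0 = "(-2/11, 12/11, 24/11)"])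
    show "unknotted (edge 0 (-2) 2 2 \<union>
        (edge 0 2 0 (-2) \<union> edge 2 2 6 1 \<union> edge 6 1 6 (-1) \<union> edge 6 (-1) (-2) (-8) \<union> edge (-2) (-8) (-2) 1 \<union> edge (-2) 1 0 2))"
      using heptagon by (simp add: Un_ac)
  qed (auto simp: vanishing_Un vanishing_edge)
  then show ?thesis by (simp add: Un_ac)
qed

definition stretch :: "real \<Rightarrow> real \<Rightarrow> real" where
  "stretch z s = (z - 1) * max (- 1) (min 1 s)"

lemma stretch_comb:
  assumes u: "0 \<le> u" "u \<le> 1" and "1 \<le> s \<and> 1 \<le> s' \<or> \<bar>s\<bar> \<le> 1 \<and> \<bar>s'\<bar> \<le> 1 \<or> s \<le> - 1 \<and> s' \<le> - 1"
  shows "stretch z ((1 - u) * s + u * s') = (1 - u) * stretch z s + u * stretch z s'"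
proof -
  have le: "(1 - u) * t + u * t' \<le> c" if "t \<le> c" "t' \<le> c" for t t' c :: real using u that
    by (intro convex_bound_le) auto
  have ge: "c \<le> (1 - u) * t + u * t'" if "c \<le> t" "c \<le> t'" for t t' c :: real using le[of "- t" "- c" "- t'"] that
    by simp
  from assms(3) have "max (- 1) (min 1 ((1 - u) * s + u * s')) = (1 - u) * max (- 1) (min 1 s) + u * max (- 1) (min 1 s')"
  proof (elim disjE conjE)
    assume "1 \<le> s" "1 \<le> s'"
    then show ?thesis using ge[of 1 s s'] by simp
  next
    assume "\<bar>s\<bar> \<le> 1" "\<bar>s'\<bar> \<le> 1"
    then show ?thesis using ge[of "- 1" s s'] le[of s 1 s'] by (simp add: abs_le_iff)
  next
    assume "s \<le> - 1" "s' \<le> - 1"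
    then show ?thesis using le[of s "- 1" s'] by simp
  qed
  then show ?thesis by (simp only: stretch_def distrib_left mult.left_commute)
qed

lemma stretch_edge:
  assumes "1 \<le> s \<and> 1 \<le> s' \<or> \<bar>s\<bar> \<le> 1 \<and> \<bar>s'\<bar> \<le> 1 \<or> s \<le> - 1 \<and> s' \<le> - 1" and "r = s + stretch z s" "r' = s' + stretch z s'"
  shows "(\<lambda>p. p + stretch z (p $ 3) *\<^sub>R plane_point 0 1) ` edge y s y' s' = edge y r y' r'"
  using push_edge[of "\<lambda>y. stretch z" y y' s s' "stretch z s"
    "stretch z s'" 0 1] stretch_comb[OF _ _ assms(1)] assms(2,3) by simp

lemma stretched_polygon:
  assumes "z \<ge> 1"
  shows "unknotted
   (edge (-2) (- z - 7) (-2) (- z) \<union> edge (-2) (- z) (-2) z \<union> edge (-2) z 0 (z + 1) \<union>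
    (edge 0 (- z - 1) 0 (- z) \<union> edge 0 (- z) 0 z \<union> edge 0 z 0 (z + 1)) \<union>
    (edge 0 (- z - 1) 2 (- z) \<union> edge 2 (- z) 2 z \<union> edge 2 z 2 (z + 1)) \<union>
    (edge (-2) (- z - 7) 6 (- z) \<union> edge 6 (- z) 6 z \<union> edge 6 z 2 (z + 1)))"
proof -
  have "edge 0 (-2) 0 2 = edge 0 (-2) 0 (-1) \<union> edge 0 (-1) 0 2" by (rule edge_split[of "1/4"]) simp_all
  moreover have "edge 0 (-1) 0 2 = edge 0 (-1) 0 1 \<union> edge 0 1 0 2" by (rule edge_split[of "2/3"]) simp_all
  moreover have "edge 2 (-1) 2 2 = edge 2 (-1) 2 1 \<union> edge 2 1 2 2" by (rule edge_split[of "2/3"]) simp_all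
  moreover have "edge (-2) (-8) (-2) 1 = edge (-2) (-8) (-2) (-1) \<union> edge (-2) (-1) (-2) 1"
    by (rule edge_split[of "7/9"]) simp_all
  ultimately have "unknotted
     (edge (-2) (-8) (-2) (-1) \<union> edge (-2) (-1) (-2) 1 \<union> edge (-2) 1 0 2 \<union> (edge 0 (-2) 0 (-1) \<union> edge 0 (-1) 0 1 \<union> edge 0 1 0 2) \<union>
      (edge 0 (-2) 2 (-1) \<union> edge 2 (-1) 2 1 \<union> edge 2 1 2 2) \<union> (edge (-2) (-8) 6 (-1) \<union> edge 6 (-1) 6 1 \<union> edge 6 1 2 2))"
    (is "unknotted ?K")
    using planar_polygon
    by (simp add: edge_commute[of 0 2 0 "-2"] edge_commute[of 2 2 6 1] edge_commute[of 6 1 6 "-1"] edge_commute[of 6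
      "-1" "-2" "-8"] Un_ac)
  then have "unknotted ((\<lambda>p. p + stretch z (p $ 3) *\<^sub>R plane_point 0 1) ` ?K)"
  proof (rule push_unknotted)
    show "piecewise_affine (\<lambda>p :: real^3. stretch z (p $ 3))" unfolding stretch_def by (intro piecewise_affine_intros)
    fix p :: "real^3" and t :: real assume t: "t > 0"
    have "stretch z (p $ 3) \<le> stretch z ((p + t *\<^sub>R plane_point 0 1) $ 3)"
      unfolding stretch_def using assms t by (intro mult_left_mono) auto
    then show "stretch z (p $ 3) - t < stretch z ((p + t *\<^sub>R plane_point 0 1) $ 3)" using t by linarith
  qed
  moreover have "(\<lambda>p. p + stretch z (p $ 3) *\<^sub>R plane_point 0 1) ` edge y (-8) y' (-1) = edge y (- z - 7) y' (- z)"
    "(\<lambda>p. p + stretch z (p $ 3) *\<^sub>R plane_point 0 1) ` edge y (-2) y' (-1) = edge y (- z - 1) y' (- z)"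
    "(\<lambda>p. p + stretch z (p $ 3) *\<^sub>R plane_point 0 1) ` edge y (-1) y' 1 = edge y (- z) y' z"
    "(\<lambda>p. p + stretch z (p $ 3) *\<^sub>R plane_point 0 1) ` edge y 1 y' 2 = edge y z y' (z + 1)" for y y'
    by (rule stretch_edge; simp add: stretch_def)+
  ultimately show ?thesis by (simp only: image_Un)
qed

context strands
begin

lemma strand_curve_parametric: "strand_curve X Y = {vector [X i s, Y i s, s] | i s. i < 4 \<and> live i s}"
proof (intro set_eqI iffI)
  fix p assume "p \<in> strand_curve X Y"
  then obtain i where i: "i < 4" "live i (p $ 3)" "p $ 1 = X i (p $ 3)" "p $ 2 = Y i (p $ 3)"
    by (auto simp: strand_curve_def)
  then have "p = vector [X i (p $ 3), Y i (p $ 3), p $ 3]" by (simp add: vec_eq_iff forall_3)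
  with i(1,2) show "p \<in> {vector [X i s, Y i s, s] | i s. i < 4 \<and> live i s}" by blast
qed (auto simp: strand_curve_def)

lemma strand_curve_shear:
  fixes m :: "real^3 \<Rightarrow> real"
  assumes "unknotted (strand_curve X Y)" "piecewise_affine m" "\<And>p t. m (p + t *\<^sub>R e) = m p" "e $ 3 = 0"
    and "\<And>i s. i < 4 \<Longrightarrow> live i s \<Longrightarrow>
      X' i s = X i s + m (vector [X i s, Y i s, s]) * e $ 1 \<and> Y' i s = Y i s + m (vector [X i s, Y i s, s]) * e $ 2"
  shows "unknotted (strand_curve X' Y')"
proof -
  have "(vector [X i s, Y i s, s] :: real^3) + m (vector [X i s, Y i s, s]) *\<^sub>R e = vector [X' i s, Y' i s, s]"
    if "i < 4" "live i s" for i s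
    using assms(5)[OF that] assms(4) by (simp add: vec_eq_iff forall_3)
  then have "(\<lambda>p. p + m p *\<^sub>R e) ` strand_curve X Y = strand_curve X' Y'"
    unfolding strand_curve_parametric by (force simp: image_iff)
  then show ?thesis using shear_unknotted[OF assms(1-3)] by simp
qed

definition flat_Y :: "nat \<Rightarrow> real \<Rightarrow> real" where
  "flat_Y i s = (if i = 1 then 0 else strand_Y i s)"

lemma flat_strand_edges:
  assumes "i < 4"
  shows "{p. p $ 1 = 0 \<and> live i (p $ 3) \<and> p $ 2 = flat_Y i (p $ 3)} =
    edge (flat_Y i (bottom i)) (bottom i) (flat_Y i (- rim)) (- rim) \<union> edge (flat_Y i (- rim)) (- rim) (flat_Y i rim) rim \<union>
    edge (flat_Y i rim) rim (flat_Y i (rim + 1)) (rim + 1)"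
proof -
  have i: "i = 0 \<or> i = 1 \<or> i = 2 \<or> i = 3" using assms by linarith
  have order: "bottom i < - rim" "- rim < rim" "rim < rim + 1" using core_ge_12 by (auto simp: bottom_def)
  have lower: "edge (flat_Y i (bottom i)) (bottom i) (flat_Y i (- rim)) (- rim) =
      {p. p $ 1 = 0 \<and> bottom i \<le> p $ 3 \<and> p $ 3 \<le> - rim \<and> p $ 2 = flat_Y i (p $ 3)}"
    by (rule edge_graph[OF order(1)]) (use i order in \<open>elim disjE; simp add: flat_Y_def strand_Y_def bottom_def field_simps\<close>)
  have middle: "edge (flat_Y i (- rim)) (- rim) (flat_Y i rim) rim =
      {p. p $ 1 = 0 \<and> - rim \<le> p $ 3 \<and> p $ 3 \<le> rim \<and> p $ 2 = flat_Y i (p $ 3)}"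
    by (rule edge_graph[OF order(2)]) (use i order in \<open>elim disjE; simp add: flat_Y_def strand_Y_def\<close>)
  have upper: "edge (flat_Y i rim) rim (flat_Y i (rim + 1)) (rim + 1) =
      {p. p $ 1 = 0 \<and> rim \<le> p $ 3 \<and> p $ 3 \<le> rim + 1 \<and> p $ 2 = flat_Y i (p $ 3)}"
    by (rule edge_graph[OF order(3)]) (use i order in \<open>elim disjE; simp add: flat_Y_def strand_Y_def algebra_simps\<close>)
  have live: "live i t \<longleftrightarrow> bottom i \<le> t \<and> t \<le> - rim \<or> - rim \<le> t \<and> t \<le> rim \<or> rim \<le> t \<and> t \<le> rim + 1" for t
    using order assms by (auto simp: live_def)
  show ?thesis unfolding lower middle upper live by blast
qed

lemma flat_unknotted: "unknotted (strand_curve (\<lambda>i s. 0) flat_Y)"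
proof -
  have rim: "1 \<le> rim" using core_ge_12 by simp
  have four: "{..<4} = {0, 1, 2, 3 :: nat}" by auto
  have "strand_curve (\<lambda>i s. 0) flat_Y = (\<Union>i\<in>{..<4}. {p. p $ 1 = 0 \<and> live i (p $ 3) \<and> p $ 2 = flat_Y i (p $ 3)})"
    unfolding strand_curve_def by blast
  also have "\<dots> = (\<Union>i\<in>{..<4}. edge (flat_Y i (bottom i)) (bottom i) (flat_Y i (- rim)) (- rim) \<union>
      edge (flat_Y i (- rim)) (- rim) (flat_Y i rim) rim \<union> edge (flat_Y i rim) rim (flat_Y i (rim + 1)) (rim + 1))"
    using flat_strand_edges by simp
  also have "\<dots> =
      edge (-2) (- rim - 7) (-2) (- rim) \<union> edge (-2) (- rim) (-2) rim \<union> edge (-2) rim 0 (rim + 1) \<union>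
      (edge 0 (- rim - 1) 0 (- rim) \<union> edge 0 (- rim) 0 rim \<union> edge 0 rim 0 (rim + 1)) \<union>
      (edge 0 (- rim - 1) 2 (- rim) \<union> edge 2 (- rim) 2 rim \<union> edge 2 rim 2 (rim + 1)) \<union>
      (edge (-2) (- rim - 7) 6 (- rim) \<union> edge 6 (- rim) 6 rim \<union> edge 6 rim 2 (rim + 1))"
    using rim by (simp add: four flat_Y_def strand_Y_def bottom_def Un_assoc)
  finally show ?thesis using stretched_polygon[OF rim] by simp
qed

text \<open>In the \<open>k\<close>-th stage the winding strand is straightened below the \<open>k\<close>-th vertex of its path.\<close>

definition stage :: "nat \<Rightarrow> (real^3) set" where
  "stage k = strand_curve (\<lambda>i s. if i = 1 then winding_X (max (\<bar>s\<bar> - core) (real k)) else 0)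
    (\<lambda>i s. if i = 1 then winding_Y (max (\<bar>s\<bar> - core) (real k)) else strand_Y i s)"

lemma winding_truncated:
  assumes "k < J"
  defines "c t \<equiv> max 0 (min 1 (real k + 1 - t))"
  shows "winding_X (max t (real k)) = winding_X (max t (real (Suc k))) + c t * (vertex_X k - vertex_X (Suc k))"
    "winding_Y (max t (real k)) = winding_Y (max t (real (Suc k))) + c t * (vertex_Y k - vertex_Y (Suc k))"
    "c t \<noteq> 0 \<Longrightarrow> winding_X (max t (real (Suc k))) = vertex_X (Suc k) \<and>
      winding_Y (max t (real (Suc k))) = vertex_Y (Suc k)"
proof -
  have seg: "winding_X u = vertex_X k + (vertex_X (Suc k) - vertex_X k) * (u - real k)"
      "winding_Y u = vertex_Y k + (vertex_Y (Suc k) - vertex_Y k) * (u - real k)" if "real k \<le> u" "u \<le> real k + 1" for u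
    using interpolate_segment[OF assms(1) that] by (simp_all add: winding_X_def winding_Y_def)
  have last: "winding_X (real (Suc k)) = vertex_X (Suc k)" "winding_Y (real (Suc k)) = vertex_Y (Suc k)"
    using seg[of "real (Suc k)"] by simp_all
  show "winding_X (max t (real (Suc k))) = vertex_X (Suc k) \<and> winding_Y (max t (real (Suc k))) = vertex_Y (Suc k)"
    if "c t \<noteq> 0"
  proof -
    have "t < real (Suc k)" using that by (auto simp: c_def max_def min_def split: if_splits)
    then have "max t (real (Suc k)) = real (Suc k)" by simp
    then show ?thesis using last by simp
  qed
  consider "t \<le> real k" | "real k < t" "t < real k + 1" | "real k + 1 \<le> t" by linarith
  then have "winding_X (max t (real k)) = winding_X (max t (real (Suc k))) + c t * (vertex_X k - vertex_X (Suc k)) \<and>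
    winding_Y (max t (real k)) = winding_Y (max t (real (Suc k))) + c t * (vertex_Y k - vertex_Y (Suc k))"
  proof cases
    case 1
    then have "max t (real k) = real k" "max t (real (Suc k)) = real (Suc k)" "c t = 1" by (auto simp: c_def)
    then show ?thesis using seg[of "real k"] last by simp
  next
    case 2
    then have "max t (real k) = t" "max t (real (Suc k)) = real (Suc k)" "c t = real k + 1 - t" by (auto simp: c_def)
    then show ?thesis using seg[of t] 2 unfolding last by (simp only: last) (simp add: algebra_simps)
  next
    case 3
    then have "max t (real k) = t" "max t (real (Suc k)) = t" "c t = 0" by (auto simp: c_def)
    then show ?thesis by simp
  qed
  then show "winding_X (max t (real k)) = winding_X (max t (real (Suc k))) + c t * (vertex_X k - vertex_X (Suc k))"
    "winding_Y (max t (real k)) = winding_Y (max t (real (Suc k))) + c t * (vertex_Y k - vertex_Y (Suc k))" by auto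
qed

text \<open>The shear from one stage to the next acts in a strip around the line through two successive vertices; the other strands
  lie outside the strip.\<close>

definition strip :: "nat \<Rightarrow> real \<Rightarrow> real \<Rightarrow> real" where
  "strip k x y = (if k mod 3 = 0 then y - 2 * x else if k mod 3 = 1 then y - 4 * turn_sign k else y + 2 * x)"

definition strip_bump :: "nat \<Rightarrow> real^3 \<Rightarrow> real" where
  "strip_bump k p = max 0 (min (1 - \<bar>strip k (p $ 1) (p $ 2)\<bar>) (real k + 1 - (\<bar>p $ 3\<bar> - core)))"

lemma strip_vertex: "strip k (vertex_X (Suc k)) (vertex_Y (Suc k)) = 0"
    "strip k (x + t * (vertex_X k - vertex_X (Suc k))) (y + t * (vertex_Y k - vertex_Y (Suc k))) = strip k x y"
proof -
  have "k mod 3 = 0 \<or> k mod 3 = 1 \<or> k mod 3 = 2" by linarith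
  moreover have "Suc k mod 3 = (if k mod 3 = 2 then 0 else Suc (k mod 3))" by presburger
  ultimately show "strip k (vertex_X (Suc k)) (vertex_Y (Suc k)) = 0"
    "strip k (x + t * (vertex_X k - vertex_X (Suc k))) (y + t * (vertex_Y k - vertex_Y (Suc k))) = strip k x y"
    using turn_sign_Suc[of k] by (auto simp: strip_def vertex_X_def vertex_Y_def algebra_simps)
qed

lemma piecewise_affine_strip_bump: "piecewise_affine (strip_bump k)"
proof -
  have "piecewise_affine (\<lambda>p :: real^3. strip k (p $ 1) (p $ 2))"
    unfolding strip_def by (cases "k mod 3 = 0"; cases "k mod 3 = 1") (auto intro!: piecewise_affine_intros)
  then show ?thesis unfolding strip_bump_def[abs_def] by (intro piecewise_affine_intros)
qed

lemma strip_bump_winding: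
  assumes "k < J"
  shows "strip_bump k (vector [winding_X (max (\<bar>s\<bar> - core) (real (Suc k))), winding_Y (max (\<bar>s\<bar> - core) (real (Suc k))), s]) =
    max 0 (min 1 (real k + 1 - (\<bar>s\<bar> - core)))" (is "_ = ?c")
proof (cases "?c = 0")
  case True
  then have "real k + 1 - (\<bar>s\<bar> - core) \<le> 0" by (auto simp: max_def min_def split: if_splits)
  then show ?thesis using True by (simp add: strip_bump_def)
next
  case False
  then show ?thesis using winding_truncated(3)[OF assms False] by (simp add: strip_bump_def strip_vertex)
qed

lemma strip_bump_other_strands:
  assumes "k < J" "i < 4" "i \<noteq> 1"
  shows "strip_bump k (vector [0, strand_Y i s, s]) = 0"
proof (cases "\<bar>s\<bar> \<le> rim")
  case True
  then have "strand_Y i s = - 2 \<or> strand_Y i s = 2 \<or> strand_Y i s = 6" using assms by (auto simp: strand_Y_def)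
  then have "1 - \<bar>strip k 0 (strand_Y i s)\<bar> \<le> 0" using turn_sign_cases[of k] unfolding strip_def
    by (elim disjE) simp_all
  then show ?thesis by (simp add: strip_bump_def)
next
  case False
  moreover have "real k + 1 \<le> core" using assms(1) by linarith
  ultimately have "real k + 1 - (\<bar>s\<bar> - core) \<le> 0" by linarith
  then show ?thesis by (simp add: strip_bump_def)
qed

lemma stage_step:
  assumes k: "k < J" and "unknotted (stage (Suc k))"
  shows "unknotted (stage k)"
proof -
  define e :: "real^3" where "e = vector [vertex_X k - vertex_X (Suc k), vertex_Y k - vertex_Y (Suc k), 0]"
  have e: "e $ 1 = vertex_X k - vertex_X (Suc k)" "e $ 2 = vertex_Y k - vertex_Y (Suc k)" "e $ 3 = 0"
    by (simp_all add: e_def)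
  have "strip_bump k (p + t *\<^sub>R e) = strip_bump k p" for p t by (simp add: strip_bump_def e strip_vertex)
  from assms(2)[unfolded stage_def] piecewise_affine_strip_bump this e(3) show ?thesis
    unfolding stage_def
    by (rule strand_curve_shear)
      (simp add: e strip_bump_winding[OF k] strip_bump_other_strands[OF k] winding_truncated(1,2)[OF k] del: of_nat_Suc)
qed

lemma stage_unknotted: "unknotted (stage 0)"
proof -
  have "unknotted (stage (J - k))" if "k \<le> J" for k
    using that
  proof (induction k)
    case 0
    have "winding_X (max t core) = 0" "winding_Y (max t core) = 0" for t using winding_outside[of "max t core"] by auto
    then have "stage J = strand_curve (\<lambda>i s. 0) flat_Y" by (simp add: stage_def flat_Y_def[abs_def] cong: if_cong)
    then show ?case using flat_unknotted by simp
  next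
    case (Suc k)
    then have "Suc (J - Suc k) = J - k" by simp
    with Suc show ?case using stage_step[of "J - Suc k"] by simp
  qed
  from this[of J] show ?thesis by simp
qed

definition lean :: "real^3 \<Rightarrow> real" where
  "lean p = max (- max 0 (core - \<bar>p $ 3\<bar>)) (min (max 0 (core - \<bar>p $ 3\<bar>)) (core * (p $ 2 - 1)))"

lemma lean_saturated:
  assumes "y \<le> 0 \<or> 2 \<le> y \<or> core \<le> \<bar>s\<bar>"
  shows "lean (vector [a, y, s]) = (if y \<le> 0 then - max 0 (core - \<bar>s\<bar>) else max 0 (core - \<bar>s\<bar>))"
proof -
  define z where "z = core * (y - 1)"
  have "z \<le> - core" if "y \<le> 0" using mult_left_mono[OF that, of core] by (simp add: z_def algebra_simps)
  moreover have "core \<le> z" if "2 \<le> y" using mult_left_mono[OF that, of core] by (simp add: z_def algebra_simps)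
  moreover define c where "c = max 0 (core - \<bar>s\<bar>)"
  have "0 \<le> c" "c \<le> core" "core \<le> \<bar>s\<bar> \<Longrightarrow> c = 0" by (auto simp: c_def)
  moreover have "lean (vector [a, y, s]) = max (- c) (min c z)" by (simp add: lean_def z_def c_def)
  ultimately show ?thesis using assms unfolding c_def[symmetric] by (auto simp: max_def min_def)
qed

lemma lean_strand:
  assumes "i < 4"
  shows "lean (vector [a, strand_Y i s, s]) = (if i < 2 then - max 0 (core - \<bar>s\<bar>) else max 0 (core - \<bar>s\<bar>))"
proof (cases "\<bar>s\<bar> < core")
  case True
  have "i = 0 \<or> i = 1 \<or> i = 2 \<or> i = 3" using assms by linarith
  then show ?thesis using strand_Y_core[of s i] assms True by (subst lean_saturated) (auto simp: axis_height_def)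
next
  case False
  then show ?thesis by (subst lean_saturated) auto
qed

theorem curve_unknotted: "unknotted curve"
proof -
  define e :: "real^3" where "e = vector [1, 0, 0]"
  have e: "e $ 1 = 1" "e $ 2 = 0" "e $ 3 = 0" by (simp_all add: e_def)
  have winding: "winding_X (max (\<bar>s\<bar> - core) 0) = winding_X (\<bar>s\<bar> - core)"
    "winding_Y (max (\<bar>s\<bar> - core) 0) = winding_Y (\<bar>s\<bar> - core)" for s
    using winding_outside[of "\<bar>s\<bar> - core"] winding_outside[of 0] by (cases "\<bar>s\<bar> - core \<le> 0"; simp add: max_def)+
  have "unknotted (strand_curve strand_X strand_Y)"
  proof (rule strand_curve_shear[OF stage_unknotted[unfolded stage_def], where m = lean and e = e])
    show "piecewise_affine lean" unfolding lean_def[abs_def] by (intro piecewise_affine_intros)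
    show "lean (p + t *\<^sub>R e) = lean p" for p t by (simp add: lean_def e)
    fix i :: nat and s assume "i < 4"
    then have i: "i = 0 \<or> i = 1 \<or> i = 2 \<or> i = 3" by linarith
    define X where "X = (if i = 1 then winding_X (\<bar>s\<bar> - core) else 0)"
    note lean_strand[OF \<open>i < 4\<close>, of X s]
    moreover have "strand_X i s = X + (if i < 2 then - max 0 (core - \<bar>s\<bar>) else max 0 (core - \<bar>s\<bar>))"
      using i by (auto simp: strand_X_def X_def)
    ultimately show "strand_X i s = (if i = 1 then winding_X (max (\<bar>s\<bar> - core) (real 0)) else 0) +
        lean (vector [if i = 1 then winding_X (max (\<bar>s\<bar> - core) (real 0)) else 0,
          if i = 1 then winding_Y (max (\<bar>s\<bar> - core) (real 0)) else strand_Y i s, s]) * e $ 1 \<and>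
      strand_Y i s = (if i = 1 then winding_Y (max (\<bar>s\<bar> - core) (real 0)) else strand_Y i s) +
        lean (vector [if i = 1 then winding_X (max (\<bar>s\<bar> - core) (real 0)) else 0,
          if i = 1 then winding_Y (max (\<bar>s\<bar> - core) (real 0)) else strand_Y i s, s]) * e $ 2"
      using i by (auto simp: winding X_def e strand_Y_def[of "Suc 0"])
  qed (rule e)
  then show ?thesis by (simp add: curve_def)
qed

end

section \<open>Polygons from parametrizations\<close>

lemma affine_on_comb:
  assumes "affine_on C g" "convex C" "x \<in> C" "y \<in> C" "0 \<le> u" "u \<le> 1"
  shows "g ((1 - u) *\<^sub>R x + u *\<^sub>R y) = (1 - u) *\<^sub>R g x + u *\<^sub>R g y"
proof -
  obtain L c where L: "linear L" "\<forall>x\<in>C. g x = L x + c" using assms(1) unfolding affine_on_def by blast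
  have "(1 - u) *\<^sub>R x + u *\<^sub>R y \<in> C" using assms by (simp add: convexD)
  then have "g ((1 - u) *\<^sub>R x + u *\<^sub>R y) = (1 - u) *\<^sub>R L x + u *\<^sub>R L y + c" using L
    by (simp add: linear_add linear_scale)
  also have "\<dots> = (1 - u) *\<^sub>R (L x + c) + u *\<^sub>R (L y + c)" by (simp add: algebra_simps)
  finally show ?thesis using L(2) assms by simp
qed

lemma affine_on_image_segment:
  fixes s t :: real
  assumes "affine_on {s..t} g" "s < t"
  shows "closed_segment (g s) (g t) = g ` {s..t}"
proof -
  have "{s..t} = (\<lambda>u. (1 - u) *\<^sub>R s + u *\<^sub>R t) ` {0..1}"
    using closed_segment_image_interval[of s t] assms(2) by (simp add: closed_segment_eq_real_ivl)
  then have "g ` {s..t} = (\<lambda>u. g ((1 - u) *\<^sub>R s + u *\<^sub>R t)) ` {0..1}" by (simp only: image_image)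
  also have "\<dots> = (\<lambda>u. (1 - u) *\<^sub>R g s + u *\<^sub>R g t) ` {0..1}"
    using assms by (intro image_cong refl affine_on_comb[OF assms(1)]) auto
  finally show ?thesis by (simp add: closed_segment_image_interval)
qed

lemma successively_less_last:
  "successively (\<lambda>s t :: 'a::order. s < t \<and> P s t) (b # c # vs) \<Longrightarrow> b < last (c # vs)"
proof (induction vs arbitrary: b c)
  case (Cons d vs)
  then have "b < c" "c < last (d # vs)" by auto
  then show ?case by simp
qed simp

lemma polygonal_path_join:
  fixes g :: "real \<Rightarrow> 'a::real_normed_vector"
  assumes "a < b" "affine_on {a..b} g" "b < l" "inj_on g {a..l}"
    and r: "arc r" "path_image r = g ` {b..l}" "pathstart r = g b"
  shows "arc (linepath (g a) (g b) +++ r) \<and> path_image (linepath (g a) (g b) +++ r) = g ` {a..l}"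
proof -
  have segment: "path_image (linepath (g a) (g b)) = g ` {a..b}" using affine_on_image_segment[OF assms(2,1)] by simp
  have "g a \<noteq> g b" using inj_onD[OF assms(4), of a b] assms(1,3) by auto
  have "g ` {a..b} \<inter> g ` {b..l} = g ` ({a..b} \<inter> {b..l})"
    using assms by (intro inj_on_image_Int[symmetric, of g "{a..l}"]) auto
  also have "{a..b} \<inter> {b..l} = {b}" using assms by auto
  finally have "arc (linepath (g a) (g b) +++ r)"
    using r segment \<open>g a \<noteq> g b\<close> by (intro arc_join) (auto simp: arc_linepath)
  moreover have "{a..b} \<union> {b..l} = {a..l}" using assms by auto
  then have "path_image (linepath (g a) (g b) +++ r) = g ` {a..l}"
    using r segment by (subst path_image_join) (auto simp flip: image_Un)
  ultimately show ?thesis by blast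
qed

lemma polygonal_path_arc:
  fixes g :: "real \<Rightarrow> 'a::real_normed_vector"
  assumes "2 \<le> length ts" "successively (\<lambda>s t. s < t \<and> affine_on {s..t} g) ts" "inj_on g {hd ts..last ts}"
  shows "arc (polygonal_path (map g ts)) \<and> path_image (polygonal_path (map g ts)) = g ` {hd ts..last ts} \<and>
    pathstart (polygonal_path (map g ts)) = g (hd ts) \<and> pathfinish (polygonal_path (map g ts)) = g (last ts)"
  using assms
proof (induction ts rule: induct_list012)
  case (3 a b ts)
  have ab: "a < b" "affine_on {a..b} g" using "3.prems"(2) by auto
  show ?case
  proof (cases ts)
    case Nil
    have "g a \<noteq> g b" using inj_onD[OF "3.prems"(3), of a b] ab Nil by auto
    then show ?thesis using Nil ab affine_on_image_segment[OF ab(2,1)] by (simp add: arc_linepath)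
  next
    case (Cons c vs)
    have suc: "successively (\<lambda>s t. s < t \<and> affine_on {s..t} g) (b # ts)" using "3.prems"(2) by simp
    then have "b < last (c # vs)" unfolding Cons by (rule successively_less_last)
    then have less: "b < last ts" by (simp add: Cons)
    have inj: "inj_on g {a..last ts}" using "3.prems"(3) Cons by simp
    then have "inj_on g {hd (b # ts)..last (b # ts)}" using ab Cons by (auto elim: inj_on_subset)
    then have IH: "arc (polygonal_path (map g (b # ts)))"
      "path_image (polygonal_path (map g (b # ts))) = g ` {b..last ts}"
      "pathstart (polygonal_path (map g (b # ts))) = g b" "pathfinish (polygonal_path (map g (b # ts))) = g (last ts)"
      using "3.IH"(2) suc Cons by auto
    have "polygonal_path (map g (a # b # ts)) = linepath (g a) (g b) +++ polygonal_path (map g (b # ts))" using Cons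
      by simp
    then show ?thesis using polygonal_path_join[OF ab less inj IH(1-3)] IH(4) Cons by simp
  qed
qed simp_all

lemma closed_polygon_path_map:
  assumes "ts \<noteq> []" "butlast ts \<noteq> []" "g (last ts) = g (hd ts)"
  shows "closed_polygon_path (map g (butlast ts)) = polygonal_path (map g ts)"
proof -
  have "hd (map g (butlast ts)) = g (last ts)" using assms by (cases ts) (auto simp: hd_map)
  moreover have "map g ts = map g (butlast ts) @ [g (last ts)]"
    using append_butlast_last_id[OF assms(1)] by (metis list.simps(8,9) map_append)
  ultimately show ?thesis by (simp add: closed_polygon_path_def)
qed

lemma simple_path_close_segment:
  fixes g :: "real \<Rightarrow> 'a::real_normed_vector"
  assumes "a < b" "affine_on {a..b} g" "b < l" and inj: "inj_on g {a..<l}" and closed: "g l = g a"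
    and r: "arc r" "path_image r = g ` {b..l}" "pathstart r = g b" "pathfinish r = g l"
  shows "simple_path (linepath (g a) (g b) +++ r)" "path_image (linepath (g a) (g b) +++ r) = g ` {a..l}"
proof -
  have segment: "path_image (linepath (g a) (g b)) = g ` {a..b}" using affine_on_image_segment[OF assms(2,1)] by simp
  have "g a \<noteq> g b" using inj_onD[OF inj, of a b] assms(1,3) by auto
  have "g ` {a..b} \<inter> g ` {b..l} \<subseteq> {g a, g b}"
  proof
    fix z assume "z \<in> g ` {a..b} \<inter> g ` {b..l}"
    then obtain x y where xy: "a \<le> x" "x \<le> b" "z = g x" "b \<le> y" "y \<le> l" "z = g y" by auto
    then have "y = l \<or> x = y" using inj_onD[OF inj, of x y] assms(1,3) by force
    then show "z \<in> {g a, g b}" using xy closed by auto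
  qed
  then show "simple_path (linepath (g a) (g b) +++ r)"
    using r closed segment \<open>g a \<noteq> g b\<close> by (intro simple_path_join_loop) (auto simp: arc_linepath)
  have "{a..b} \<union> {b..l} = {a..l}" using assms by auto
  then show "path_image (linepath (g a) (g b) +++ r) = g ` {a..l}"
    using r segment by (subst path_image_join) (auto simp flip: image_Un)
qed

lemma inj_on_half_open_shift:
  fixes g :: "'a::linorder \<Rightarrow> 'b"
  assumes "inj_on g {a..<l}" "g l = g a" "a < b" "b < l"
  shows "inj_on g {b..l}"
proof -
  have "g l \<notin> g ` {b..<l}"
  proof
    assume "g l \<in> g ` {b..<l}"
    then obtain x where x: "g x = g a" "b \<le> x" "x < l" using assms(2) by auto
    then have "x = a" using assms(3,4) by (intro inj_onD[OF assms(1)]) auto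
    then show False using x(2) assms(3) by simp
  qed
  moreover have "inj_on g {b..<l}" using assms(1,3) by (rule_tac inj_on_subset) auto
  moreover have "{b..l} = insert l {b..<l}" using assms(4) by auto
  ultimately show ?thesis by (auto simp: inj_on_insert)
qed

lemma closed_polygon_parametrized:
  fixes g :: "real \<Rightarrow> 'a::real_normed_vector"
  assumes ts: "4 \<le> length ts" "successively (\<lambda>s t. s < t \<and> affine_on {s..t} g) ts"
    and inj: "inj_on g {hd ts..<last ts}" and closed: "g (last ts) = g (hd ts)"
  shows "closed_polygonal_curve (map g (butlast ts))" "polygon_carrier (map g (butlast ts)) = g ` {hd ts..last ts}"
proof -
  obtain a b c vs where t: "ts = a # b # c # vs" using ts(1) by (auto simp: Suc_le_length_iff numeral_eq_Suc)
  define l where "l = last (c # vs)"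
  have ab: "a < b" "affine_on {a..b} g" using ts(2) t by auto
  have suc: "successively (\<lambda>s t. s < t \<and> affine_on {s..t} g) (b # c # vs)" using ts(2) t by simp
  then have less: "b < l" unfolding l_def by (rule successively_less_last)
  have inj: "inj_on g {a..<l}" and closed: "g l = g a" using inj closed by (simp_all add: t l_def)
  define r where "r = polygonal_path (map g (b # c # vs))"
  have "inj_on g {hd (b # c # vs)..last (b # c # vs)}" using inj_on_half_open_shift[OF inj closed ab(1) less]
    by (simp add: l_def)
  from polygonal_path_arc[OF _ suc this]
  have r: "arc r" "path_image r = g ` {b..l}" "pathstart r = g b" "pathfinish r = g l" by (simp_all add: r_def l_def)
  have path: "closed_polygon_path (map g (butlast ts)) = linepath (g a) (g b) +++ r"
    using closed_polygon_path_map[of ts g] closed by (simp add: t r_def l_def)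
  note loop = simple_path_close_segment[OF ab less inj closed r]
  show "closed_polygonal_curve (map g (butlast ts))"
    unfolding closed_polygonal_curve_def path using loop(1) r closed by simp
  show "polygon_carrier (map g (butlast ts)) = g ` {hd ts..last ts}"
    unfolding polygon_carrier_def path loop(2) by (simp add: t l_def)
qed

lemma polygon_edges_map:
  assumes "ts \<noteq> []" "butlast ts \<noteq> []" "g (last ts) = g (hd ts)"
  shows "polygon_edges (map g (butlast ts)) = zip (map g (butlast ts)) (map g (tl ts))"
proof -
  obtain a us where ts: "ts = a # us" "us \<noteq> []" using assms(1,2) by (cases ts) (auto split: if_splits)
  then have "map g us = map g (butlast us) @ [g (last us)]"
    using append_butlast_last_id[of us] by (metis list.simps(8,9) map_append)
  then have "rotate1 (map g (butlast ts)) = map g (tl ts)" using assms(3) ts by simp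
  then show ?thesis by (simp add: polygon_edges_def)
qed

lemma polygon_length_bounds:
  assumes "2 \<le> length ts" and closed: "g (last ts) = g (hd ts)"
    and lip: "successively (\<lambda>s t. dist (g s) (g t) \<le> C * (t - s)) ts" and first: "g (ts ! 0) \<noteq> g (ts ! 1)"
  shows "0 < polygon_length (map g (butlast ts))" "polygon_length (map g (butlast ts)) \<le> C * (last ts - hd ts)"
proof -
  define len where "len ts = sum_list (map (\<lambda>(x, y). dist x y) (zip (map g (butlast ts)) (map g (tl ts))))" for ts
  obtain a b vs where t: "ts = a # b # vs" using assms(1) by (auto simp: Suc_le_length_iff numeral_eq_Suc)
  have eq: "polygon_length (map g (butlast ts)) = len ts"
    using polygon_edges_map[of ts g] closed t by (simp add: polygon_length_def len_def)
  have len_Cons: "len (x # y # zs) = dist (g x) (g y) + len (y # zs)" for x y zs by (simp add: len_def)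
  have nonneg: "0 \<le> len zs" for zs unfolding len_def by (rule sum_list_nonneg) auto
  have "g a \<noteq> g b" using first t by simp
  then show "0 < polygon_length (map g (butlast ts))"
    unfolding eq unfolding t len_Cons using nonneg[of "b # vs"] by (simp add: add_pos_nonneg)
  have "len zs \<le> C * (last zs - hd zs)" if "successively (\<lambda>s t. dist (g s) (g t) \<le> C * (t - s)) zs" "zs \<noteq> []" for zs
    using that
  proof (induction zs rule: induct_list012)
    case (3 x y zs)
    have "len (y # zs) \<le> C * (last (y # zs) - y)" using 3 by simp
    moreover have "dist (g x) (g y) \<le> C * (y - x)" using 3 by simp
    ultimately show ?case unfolding len_Cons by (simp add: algebra_simps)
  qed (simp_all add: len_def)
  from this[OF lip] show "polygon_length (map g (butlast ts)) \<le> C * (last ts - hd ts)" unfolding eq using t by simp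
qed

lemma polygon_length_scale:
  assumes "c > 0"
  shows "polygon_length (map (\<lambda>p. c *\<^sub>R p) vs) = c * polygon_length vs"
proof -
  have dist: "dist (c *\<^sub>R a) (c *\<^sub>R b) = c * dist a b" for a b :: 'a
    using assms by (simp add: dist_norm flip: scaleR_diff_right)
  have "polygon_edges (map (\<lambda>p. c *\<^sub>R p) vs) = map (\<lambda>(a, b). (c *\<^sub>R a, c *\<^sub>R b)) (polygon_edges vs)"
    unfolding polygon_edges_def by (simp add: rotate1_map zip_map_map)
  then show ?thesis unfolding polygon_length_def by (simp add: comp_def case_prod_unfold dist sum_list_const_mult)
qed

lemma successively_upt:
  assumes "\<And>m. a \<le> m \<Longrightarrow> Suc m < b \<Longrightarrow> P m (Suc m)"
  shows "successively P [a..<b]"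
  using assms
proof (induction b)
  case (Suc b)
  show ?case
  proof (cases "a < b")
    case True
    then have "last [a..<b] = b - 1" "Suc (b - 1) = b" by auto
    then show ?thesis using Suc True Suc.prems[of "b - 1"] by (auto simp: successively_append_iff)
  next
    case False
    then show ?thesis by (cases "a = b") auto
  qed
qed simp

section \<open>A parametrization of the curve\<close>

lemma affine_on_ident: "affine_on C (\<lambda>x. x)"
  by (rule affine_on_linear) (rule linear_ident)

lemma affine_on_minus: "affine_on C f \<Longrightarrow> affine_on C (\<lambda>x. - f x)"
  by (rule affine_on_linear_compose) (auto intro: linearI)

lemma affine_on_diff: "affine_on C f \<Longrightarrow> affine_on C g \<Longrightarrow> affine_on C (\<lambda>x. f x - g x)"
  using affine_on_add[OF _ affine_on_minus] by fastforce

lemma affine_on_mult: "affine_on C f \<Longrightarrow> affine_on C (\<lambda>x. k * f x)" for k :: real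
  by (rule affine_on_linear_compose) (auto intro: linearI simp: algebra_simps)

lemma affine_on_divide: "affine_on C f \<Longrightarrow> affine_on C (\<lambda>x. f x / k)" for k :: real
  using affine_on_mult[of C f "inverse k"] by (simp add: field_simps)

lemmas affine_on_intros = affine_on_const affine_on_ident affine_on_add affine_on_diff affine_on_minus affine_on_mult
  affine_on_divide

lemma affine_on_compose:
  assumes "affine_on D f" "affine_on C h" "h ` C \<subseteq> D"
  shows "affine_on C (\<lambda>x. f (h x))"
proof -
  obtain L c where L: "linear L" "\<forall>x\<in>D. f x = L x + c" using assms(1) unfolding affine_on_def by blast
  have "affine_on C (\<lambda>x. L (h x) + c)" using affine_on_linear_compose[OF L(1) assms(2)]
    by (intro affine_on_add affine_on_const)
  then show ?thesis by (rule affine_on_cong) (use L(2) assms(3) in auto)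
qed

lemma affine_on_abs:
  fixes f :: "'a::real_vector \<Rightarrow> real"
  assumes "affine_on C f" "(\<forall>x\<in>C. f x \<le> 0) \<or> (\<forall>x\<in>C. 0 \<le> f x)"
  shows "affine_on C (\<lambda>x. \<bar>f x\<bar>)"
  using assms(2)
proof
  assume "\<forall>x\<in>C. f x \<le> 0"
  then show ?thesis by (intro affine_on_cong[OF affine_on_minus[OF assms(1)]]) simp
next
  assume "\<forall>x\<in>C. 0 \<le> f x"
  then show ?thesis by (intro affine_on_cong[OF assms(1)]) simp
qed

lemma affine_on_vec3:
  fixes f :: "'a::real_vector \<Rightarrow> real^3"
  assumes "affine_on C (\<lambda>x. f x $ 1)" "affine_on C (\<lambda>x. f x $ 2)" "affine_on C (\<lambda>x. f x $ 3)"
  shows "affine_on C f"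
proof -
  have "linear (\<lambda>t :: real. t *\<^sub>R axis i 1 :: real^3)" for i by (simp add: linearI scaleR_add_left)
  then have "affine_on C (\<lambda>x. f x $ i *\<^sub>R axis i 1 :: real^3)" if "affine_on C (\<lambda>x. f x $ i)" for i
    using affine_on_linear_compose[OF _ that] by blast
  then have "affine_on C (\<lambda>x. f x $ 1 *\<^sub>R axis 1 1 + f x $ 2 *\<^sub>R axis 2 1 + f x $ 3 *\<^sub>R axis 3 1 :: real^3)"
    using assms by (intro affine_on_add) simp_all
  then show ?thesis by (rule affine_on_cong) (simp add: vec_eq_iff forall_3 axis_def)
qed

lemma affine_on_interpolate: "m < M \<Longrightarrow> affine_on {real m..real m + 1} (interpolate f M)"
  by (rule affine_on_cong[of _ "\<lambda>t. f m + (f (Suc m) - f m) * (t - real m)"])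
    (auto intro!: affine_on_intros simp: interpolate_segment)

context strands
begin

definition strand_point :: "nat \<Rightarrow> real \<Rightarrow> real^3" where
  "strand_point i s = vector [strand_X i s, strand_Y i s, s]"

lemma strand_point_nth [simp]: "strand_point i s $ 1 = strand_X i s" "strand_point i s $ 2 = strand_Y i s"
  "strand_point i s $ 3 = s"
  by (simp_all add: strand_point_def)

lemma mem_curve_strand_point: "p \<in> curve \<longleftrightarrow> (\<exists>i<4. live i (p $ 3) \<and> p = strand_point i (p $ 3))"
  by (auto simp: mem_curve vec_eq_iff forall_3)

lemma cap_strand_point: "cap s i j \<Longrightarrow> strand_point i s = strand_point j s"
  using cap_meets(1,2)[of s i j] by (simp add: strand_point_def)

definition perimeter :: real where "perimeter = 8 * rim + 20"

definition strand_of :: "real \<Rightarrow> nat" where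
  "strand_of t = (if t \<le> 2 * rim + 2 then 1 else if t \<le> 4 * rim + 4 then 2 else if t \<le> 6 * rim + 12 then 3 else 0)"

definition height_of :: "real \<Rightarrow> real" where
  "height_of t = (if t \<le> 2 * rim + 2 then rim + 1 - t else if t \<le> 4 * rim + 4 then t - (3 * rim + 3)
     else if t \<le> 6 * rim + 12 then 5 * rim + 5 - t else t - (7 * rim + 19))"

definition param :: "real \<Rightarrow> real^3" where
  "param t = strand_point (strand_of t) (height_of t)"

text \<open>On each of the four legs \<open>(i, c, \<epsilon>, a, b)\<close> the parameter \<open>t \<in> {a..b}\<close> runs along strand \<open>i\<close> at height \<open>c + \<epsilon> * t\<close>.\<close>

definition legs :: "(nat \<times> real \<times> real \<times> real \<times> real) set" where
  "legs = {(1, rim + 1, - 1, 0, 2 * rim + 2), (2, - (3 * rim + 3), 1, 2 * rim + 2, 4 * rim + 4),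
     (3, 5 * rim + 5, - 1, 4 * rim + 4, 6 * rim + 12), (0, - (7 * rim + 19), 1, 6 * rim + 12, perimeter)}"

lemma leg_live: "(i, c, \<epsilon>, a, b) \<in> legs \<Longrightarrow> a \<le> t \<Longrightarrow> t \<le> b \<Longrightarrow> i < 4 \<and> live i (c + \<epsilon> * t)"
  by (auto simp: legs_def live_def bottom_def perimeter_def)

lemma param_leg:
  assumes "(i, c, \<epsilon>, a, b) \<in> legs" "a \<le> t" "t \<le> b"
  shows "param t = strand_point i (c + \<epsilon> * t)"
proof (cases "i \<noteq> 1 \<and> t = a")
  case False
  then have "strand_of t = i \<and> height_of t = c + \<epsilon> * t"
    using assms core_ge_12 by (auto simp: legs_def strand_of_def height_of_def)
  then show ?thesis by (simp add: param_def)
next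
  case True
  have caps: "strand_point 1 (- rim - 1) = strand_point 2 (- rim - 1)"
    "strand_point 2 (rim + 1) = strand_point 3 (rim + 1)"
    "strand_point 3 (- rim - 7) = strand_point 0 (- rim - 7)"
    by (rule cap_strand_point cap_strand_point[symmetric]; simp add: cap_def)+
  have starts: "strand_of (2 * rim + 2) = 1" "height_of (2 * rim + 2) = - rim - 1" "strand_of (4 * rim + 4) = 2"
    "height_of (4 * rim + 4) = rim + 1" "strand_of (6 * rim + 12) = 3" "height_of (6 * rim + 12) = - rim - 7"
    using core_ge_12 by (simp_all add: strand_of_def height_of_def)
  consider "i = 2" "c + \<epsilon> * t = - rim - 1" "t = 2 * rim + 2" | "i = 3" "c + \<epsilon> * t = rim + 1" "t = 4 * rim + 4"
    | "i = 0" "c + \<epsilon> * t = - rim - 7" "t = 6 * rim + 12"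
    using assms(1) True by (auto simp: legs_def)
  then show ?thesis by cases (simp_all only: param_def starts caps)
qed

lemma leg_exists:
  assumes "0 \<le> t" "t \<le> perimeter"
  obtains i c \<epsilon> a b where "(i, c, \<epsilon>, a, b) \<in> legs" "a \<le> t" "t \<le> b"
proof -
  consider "t \<le> 2 * rim + 2" | "2 * rim + 2 \<le> t" "t \<le> 4 * rim + 4" | "4 * rim + 4 \<le> t" "t \<le> 6 * rim + 12"
    | "6 * rim + 12 \<le> t"
    by linarith
  then show ?thesis using assms that unfolding legs_def by cases blast+
qed

lemma param_closed: "param perimeter = param 0"
proof -
  have "param perimeter = strand_point 0 (rim + 1)"
    using param_leg[of 0 "- (7 * rim + 19)" 1 "6 * rim + 12" perimeter perimeter] core_ge_12
    by (simp add: legs_def perimeter_def)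
  also have "\<dots> = strand_point 1 (rim + 1)" by (rule cap_strand_point) (simp add: cap_def)
  also have "\<dots> = param 0" using core_ge_12 by (simp add: param_def strand_of_def height_of_def)
  finally show ?thesis .
qed

lemma param_image: "param ` {0..perimeter} = curve"
proof (intro set_eqI iffI)
  fix p assume "p \<in> param ` {0..perimeter}"
  then obtain t where t: "0 \<le> t" "t \<le> perimeter" "p = param t" by auto
  from t(1,2) obtain i c \<epsilon> a b where leg: "(i, c, \<epsilon>, a, b) \<in> legs" "a \<le> t" "t \<le> b" by (rule leg_exists)
  then show "p \<in> curve" using leg_live[OF leg] param_leg[OF leg] t(3) by (auto simp: mem_curve_strand_point)
next
  fix p assume "p \<in> curve"
  then obtain i where i: "i < 4" "live i (p $ 3)" "p = strand_point i (p $ 3)" by (auto simp: mem_curve_strand_point)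
  have height: "bottom i \<le> p $ 3" "p $ 3 \<le> rim + 1" using i by (auto simp: live_def)
  have "\<exists>c \<epsilon> a b. (i, c, \<epsilon>, a, b) \<in> legs \<and> \<epsilon> * \<epsilon> = 1 \<and> a \<le> \<epsilon> * (p $ 3 - c) \<and> \<epsilon> * (p $ 3 - c) \<le> b \<and> 0 \<le> a \<and>
    b \<le> perimeter"
  proof -
    consider "i = 0" | "i = 1" | "i = 2" | "i = 3" using i(1) by linarith
    then show ?thesis using height core_ge_12 unfolding legs_def perimeter_def by cases (auto simp: bottom_def)
  qed
  then obtain c \<epsilon> a b where leg: "(i, c, \<epsilon>, a, b) \<in> legs" "\<epsilon> * \<epsilon> = 1" "a \<le> \<epsilon> * (p $ 3 - c)" "\<epsilon> * (p $ 3 - c) \<le> b"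
    "0 \<le> a" "b \<le> perimeter"
    by blast
  have "c + \<epsilon> * (\<epsilon> * (p $ 3 - c)) = p $ 3" using leg(2) by (simp flip: mult.assoc)
  then have "p = param (\<epsilon> * (p $ 3 - c))" using param_leg[OF leg(1,3,4)] i(3) by simp
  then show "p \<in> param ` {0..perimeter}" using leg by (intro image_eqI) auto
qed

lemma strand_height_bounds:
  assumes "0 \<le> t" "t < perimeter"
  shows "strand_of t < 4" "live (strand_of t) (height_of t)"
    "strand_of t = 0 \<Longrightarrow> - rim - 7 < height_of t \<and> height_of t < rim + 1" "strand_of t = 2 \<Longrightarrow> - rim - 1 < height_of t"
    "strand_of t = 3 \<Longrightarrow> height_of t < rim + 1"
  using assms core_ge_12 by (auto simp: strand_of_def height_of_def live_def bottom_def perimeter_def split: if_splits)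

lemma param_distinct_strands:
  assumes "0 \<le> t" "t < perimeter" "0 \<le> u" "u < perimeter" and eq: "param t = param u"
    and less: "strand_of t < strand_of u"
  shows False
proof -
  note t = strand_height_bounds[OF assms(1,2)] and u = strand_height_bounds[OF assms(3,4)]
  have height: "height_of t = height_of u"
    and X: "strand_X (strand_of t) (height_of u) = strand_X (strand_of u) (height_of u)"
    and Y: "strand_Y (strand_of t) (height_of u) = strand_Y (strand_of u) (height_of u)"
    using eq by (auto simp: param_def vec_eq_iff forall_3)
  have "strand_of u < 5" using u(1) by simp
  from less this t(2)[unfolded height] u(2) Y show False
  proof (cases rule: coincidence)
    case (winding m)
    then show ?thesis using winding_crossing_meets(2)[OF winding(1)] X by (auto simp: doubleton_eq_iff)
  next
    case cap
    then show ?thesis using t(3) u(4,5) height by (auto simp: cap_def)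
  next
    case axis
    then show ?thesis using u(1) by simp
  qed
qed

lemma param_inj: "inj_on param {0..<perimeter}"
proof (rule inj_onI)
  fix t u assume tu: "t \<in> {0..<perimeter}" "u \<in> {0..<perimeter}" "param t = param u"
  then have "strand_of t = strand_of u"
    using param_distinct_strands[of t u] param_distinct_strands[of u t]
    by (metis atLeastLessThan_iff linorder_less_linear)
  moreover have "height_of t = height_of u" using tu(3) by (simp add: param_def vec_eq_iff forall_3)
  ultimately show "t = u" by (auto simp: strand_of_def height_of_def split: if_splits)
qed

definition kink_free :: "real \<Rightarrow> real \<Rightarrow> bool" where
  "kink_free p q \<longleftrightarrow> (q \<le> - core \<or> (- core \<le> p \<and> q \<le> 0) \<or> (0 \<le> p \<and> q \<le> core) \<or> core \<le> p) \<and> (rim \<le> p \<or> q \<le> rim) \<and>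
    (- rim \<le> p \<or> q \<le> - rim)"

definition in_winding_segment :: "real \<Rightarrow> real \<Rightarrow> bool" where
  "in_winding_segment p q \<longleftrightarrow> (- core \<le> p \<and> q \<le> core) \<or> rim \<le> p \<or> q \<le> - rim \<or>
     (\<exists>m<J. core + real m \<le> p \<and> q \<le> core + real m + 1) \<or> (\<exists>m<J. - core - real m - 1 \<le> p \<and> q \<le> - core - real m)"

lemma kink_free_affine:
  assumes "kink_free p q"
  shows "affine_on {p..q} (\<lambda>s. max 0 (core - \<bar>s\<bar>))"
    "affine_on {p..q} (\<lambda>s. max 0 (s - rim))" "affine_on {p..q} (\<lambda>s. max 0 (- rim - s))"
proof -
  have abs: "affine_on {p..q} (\<lambda>s. \<bar>s\<bar>)"
    using assms by (intro affine_on_abs affine_on_ident) (force simp: kink_free_def)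
  have "(\<forall>s\<in>{p..q}. core - \<bar>s\<bar> \<le> 0) \<or> (\<forall>s\<in>{p..q}. 0 \<le> core - \<bar>s\<bar>)"
    using assms unfolding kink_free_def by (elim conjE disjE) auto
  then show "affine_on {p..q} (\<lambda>s. max 0 (core - \<bar>s\<bar>))" using abs by (intro affine_on_positive_part affine_on_intros)
  show "affine_on {p..q} (\<lambda>s. max 0 (s - rim))" "affine_on {p..q} (\<lambda>s. max 0 (- rim - s))"
    using assms by (intro affine_on_positive_part affine_on_intros; force simp: kink_free_def)+
qed

lemma winding_affine:
  assumes "in_winding_segment p q"
  shows "affine_on {p..q} (\<lambda>s. winding_X (\<bar>s\<bar> - core))" "affine_on {p..q} (\<lambda>s. winding_Y (\<bar>s\<bar> - core))"
proof -
  have outside: "winding_X (\<bar>s\<bar> - core) = 0 \<and> winding_Y (\<bar>s\<bar> - core) = 0"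
    if "- core \<le> p \<and> q \<le> core \<or> rim \<le> p \<or> q \<le> - rim" "s \<in> {p..q}" for s
    using that by (intro winding_outside) auto
  have inside: "affine_on {p..q} (\<lambda>s. interpolate f J (\<bar>s\<bar> - core))"
    if "(\<exists>m<J. core + real m \<le> p \<and> q \<le> core + real m + 1) \<or> (\<exists>m<J. - core - real m - 1 \<le> p \<and> q \<le> - core - real m)" for f
    using that
  proof (elim disjE exE conjE)
    fix m assume m: "m < J" "core + real m \<le> p" "q \<le> core + real m + 1"
    then show ?thesis by (intro affine_on_compose[OF affine_on_interpolate[OF m(1)]] affine_on_intros affine_on_abs) auto
  next
    fix m assume m: "m < J" "- core - real m - 1 \<le> p" "q \<le> - core - real m"
    then show ?thesis by (intro affine_on_compose[OF affine_on_interpolate[OF m(1)]] affine_on_intros affine_on_abs) auto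
  qed
  consider "- core \<le> p \<and> q \<le> core \<or> rim \<le> p \<or> q \<le> - rim"
    | "(\<exists>m<J. core + real m \<le> p \<and> q \<le> core + real m + 1) \<or> (\<exists>m<J. - core - real m - 1 \<le> p \<and> q \<le> - core - real m)"
    using assms unfolding in_winding_segment_def by blast
  then show "affine_on {p..q} (\<lambda>s. winding_X (\<bar>s\<bar> - core))" "affine_on {p..q} (\<lambda>s. winding_Y (\<bar>s\<bar> - core))"
    using outside inside
    by (cases; auto simp: winding_X_def winding_Y_def intro: affine_on_cong[OF affine_on_const[of _ 0]])+
qed

lemma strand_affine:
  assumes "kink_free p q" "i < 4" "i = 1 \<Longrightarrow> in_winding_segment p q"
  shows "affine_on {p..q} (strand_X i)" "affine_on {p..q} (strand_Y i)"
proof -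
  note affine = kink_free_affine[OF assms(1)]
  consider "i = 0" | "i = 1" | "i = 2" | "i = 3" using assms(2) by linarith
  then show "affine_on {p..q} (strand_X i)" "affine_on {p..q} (strand_Y i)"
    using affine winding_affine[OF assms(3)]
    by (cases; simp add: strand_X_def[abs_def] strand_Y_def[abs_def]; intro affine_on_intros; simp)+
qed

lemma strand_X_variation:
  assumes "i < 4"
  shows "\<bar>strand_X i s - strand_X i s'\<bar> \<le> 4 + \<bar>s - s'\<bar>"
proof -
  define a a' where "a = max 0 (core - \<bar>s\<bar>)" and "a' = max 0 (core - \<bar>s'\<bar>)"
  have variation: "\<bar>a - a'\<bar> \<le> \<bar>s - s'\<bar>" unfolding a_def a'_def by linarith
  consider "i = 0" | "i = 1" | "i = 2 \<or> i = 3" using assms by linarith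
  then show ?thesis
  proof cases
    case 1
    then show ?thesis using variation by (simp add: strand_X_def flip: a_def a'_def)
  next
    case 2
    then have "strand_X i s = winding_X (\<bar>s\<bar> - core) - a" "strand_X i s' = winding_X (\<bar>s'\<bar> - core) - a'"
      by (simp_all add: strand_X_def a_def a'_def)
    then show ?thesis using variation winding_bounds(1)[of "\<bar>s\<bar> - core"] winding_bounds(1)[of "\<bar>s'\<bar> - core"] by linarith
  next
    case 3
    then have "strand_X i s = a" "strand_X i s' = a'" by (auto simp: strand_X_def a_def a'_def)
    then show ?thesis using variation by linarith
  qed
qed

text \<open>The linear map sending the slanted axis to the \<open>y\<close>-axis.\<close>

definition shear :: "real^3 \<Rightarrow> real^3" where
  "shear p = vector [p $ 1, p $ 2, p $ 3 - p $ 2]"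

lemma shear_nth [simp]: "shear p $ 1 = p $ 1" "shear p $ 2 = p $ 2" "shear p $ 3 = p $ 3 - p $ 2"
  by (simp_all add: shear_def)

lemma linear_shear: "linear shear"
  by (intro linearI) (simp_all add: vec_eq_iff forall_3 algebra_simps)

lemma inj_shear: "inj shear"
  by (rule injI) (auto simp: vec_eq_iff forall_3)

definition straight :: "real \<Rightarrow> real \<Rightarrow> bool" where
  "straight s t \<longleftrightarrow> s < t \<and> affine_on {s..t} (\<lambda>t. shear (param t)) \<and>
    dist (shear (param s)) (shear (param t)) \<le> 26 * (t - s)"

lemma straight_leg:
  assumes leg: "(i, c, \<epsilon>, a, b) \<in> legs" "a \<le> s" "s + 1 \<le> t" "t \<le> b"
    and free: "kink_free p q" "i = 1 \<Longrightarrow> in_winding_segment p q" and range: "\<And>u. u \<in> {s..t} \<Longrightarrow> c + \<epsilon> * u \<in> {p..q}"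
  shows "straight s t"
proof -
  have i: "i < 4" and live: "live i (c + \<epsilon> * s)" "live i (c + \<epsilon> * t)" using leg_live[OF leg(1)] assms(2-4) by auto
  have param: "param u = strand_point i (c + \<epsilon> * u)" if "u \<in> {s..t}" for u using param_leg[OF leg(1)] that assms by auto
  have height: "affine_on {s..t} (\<lambda>u. c + \<epsilon> * u)" by (intro affine_on_intros)
  have X: "affine_on {s..t} (\<lambda>u. strand_X i (c + \<epsilon> * u))" and Y: "affine_on {s..t} (\<lambda>u. strand_Y i (c + \<epsilon> * u))"
    using strand_affine[OF free(1) i free(2)] range by (auto intro: affine_on_compose[OF _ height])
  have "affine_on {s..t} (\<lambda>u. shear (strand_point i (c + \<epsilon> * u)))"
    by (rule affine_on_vec3) (simp_all add: X Y height affine_on_diff)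
  then have "affine_on {s..t} (\<lambda>u. shear (param u))" by (rule affine_on_cong) (simp add: param)
  moreover have "dist (shear (param s)) (shear (param t)) \<le> 26 * (t - s)"
  proof -
    define z z' where "z = c + \<epsilon> * s" and "z' = c + \<epsilon> * t"
    have "\<epsilon> = 1 \<or> \<epsilon> = - 1" using leg(1) by (auto simp: legs_def)
    then have z: "\<bar>z - z'\<bar> = t - s" using leg(3) by (auto simp: z_def z'_def)
    have Y: "\<bar>strand_Y i z - strand_Y i z'\<bar> \<le> 10"
      using strand_Y_bounds[OF i live(1)] strand_Y_bounds[OF i live(2)] unfolding z_def z'_def by linarith
    have "dist (shear (param s)) (shear (param t)) = norm (shear (strand_point i z) - shear (strand_point i z'))"
      using param[of s] param[of t] leg(3) by (simp add: dist_norm z_def z'_def)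
    also have "\<dots> \<le> \<bar>strand_X i z - strand_X i z'\<bar> + \<bar>strand_Y i z - strand_Y i z'\<bar> + \<bar>(z - strand_Y i z) - (z' - strand_Y i z')\<bar>"
      using norm_le_l1_cart[of "shear (strand_point i z) - shear (strand_point i z')"] by (simp add: sum_3)
    also have "\<dots> \<le> (4 + (t - s)) + 10 + ((t - s) + 10)" using strand_X_variation[OF i, of z z'] Y z by linarith
    also have "\<dots> \<le> 26 * (t - s)" using leg(3) by simp
    finally show ?thesis .
  qed
  ultimately show ?thesis using leg(3) by (simp add: straight_def)
qed

lemma straight_descent:
  assumes "(i, c, - 1, a, b) \<in> legs" "a \<le> s" "s + 1 \<le> t" "t \<le> b" "kink_free (c - t) (c - s)"
    "i = 1 \<Longrightarrow> in_winding_segment (c - t) (c - s)"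
  shows "straight s t"
  by (rule straight_leg[OF assms]) auto

lemma straight_ascent:
  assumes "(i, c, 1, a, b) \<in> legs" "a \<le> s" "s + 1 \<le> t" "t \<le> b" "kink_free (c + s) (c + t)"
    "i = 1 \<Longrightarrow> in_winding_segment (c + s) (c + t)"
  shows "straight s t"
  by (rule straight_leg[OF assms]) auto

lemma straight_first_leg:
  assumes "0 \<le> s" "s + 1 \<le> t" "t \<le> 2 * rim + 2" "kink_free (rim + 1 - t) (rim + 1 - s)"
    "in_winding_segment (rim + 1 - t) (rim + 1 - s)"
  shows "straight s t"
  by (rule straight_descent[where i = 1]) (use assms in \<open>auto simp: legs_def\<close>)

lemma straight_upper_winding:
  assumes "1 \<le> m" "m < J + 1"
  shows "straight (real m) (real (Suc m))"
proof (rule straight_first_leg)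
  have m: "1 \<le> real m" "real m \<le> core" using assms by auto
  show "0 \<le> real m" "real m + 1 \<le> real (Suc m)" "real (Suc m) \<le> 2 * rim + 2" using m by auto
  show "kink_free (rim + 1 - real (Suc m)) (rim + 1 - real m)" using m core_ge_12 by (auto simp: kink_free_def)
  have "J - m < J \<and> core + real (J - m) \<le> rim + 1 - real (Suc m) \<and> rim + 1 - real m \<le> core + real (J - m) + 1"
    using assms core_ge_12 by (auto simp: of_nat_diff)
  then show "in_winding_segment (rim + 1 - real (Suc m)) (rim + 1 - real m)" unfolding in_winding_segment_def by blast
qed

lemma straight_lower_winding:
  assumes "3 * J + 1 \<le> m" "m < 4 * J + 1"
  shows "straight (real m) (real (Suc m))"
proof (rule straight_first_leg)
  have m: "3 * core + 1 \<le> real m" "real m + 1 \<le> 4 * core + 1" using assms by linarith+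
  show "0 \<le> real m" "real m + 1 \<le> real (Suc m)" "real (Suc m) \<le> 2 * rim + 2" using m core_ge_12 by auto
  show "kink_free (rim + 1 - real (Suc m)) (rim + 1 - real m)" using m core_ge_12 by (auto simp: kink_free_def)
  define k where "k = m - (3 * J + 1)"
  have k: "k < J" "real k = real m - 3 * core - 1" using assms by (simp_all add: k_def of_nat_diff)
  have "- core - real k - 1 \<le> rim + 1 - real (Suc m) \<and> rim + 1 - real m \<le> - core - real k" unfolding k(2) by simp
  then show "in_winding_segment (rim + 1 - real (Suc m)) (rim + 1 - real m)"
    unfolding in_winding_segment_def using k(1) by blast
qed

lemma straight_outside_windings:
  "straight 0 1" "straight (1 + core) (1 + 2 * core)" "straight (1 + 2 * core) (1 + 3 * core)"
    "straight (1 + 4 * core) (2 + 4 * core)"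
  by (rule straight_first_leg; use core_ge_12 in \<open>simp add: kink_free_def in_winding_segment_def\<close>)+

lemma straight_second_leg:
  "straight (2 + 4 * core) (4 * core + 3)" "straight (4 * core + 3) (5 * core + 3)"
    "straight (5 * core + 3) (6 * core + 3)"
  "straight (6 * core + 3) (7 * core + 3)" "straight (7 * core + 3) (8 * core + 3)"
    "straight (8 * core + 3) (8 * core + 4)"
  by (rule straight_ascent[where i = 2 and c = "- (3 * rim + 3)" and a = "2 * rim + 2" and b = "4 * rim + 4"];
      use core_ge_12 in \<open>simp add: legs_def kink_free_def\<close>)+

lemma straight_third_leg:
  "straight (8 * core + 4) (8 * core + 5)" "straight (8 * core + 5) (9 * core + 5)"
    "straight (9 * core + 5) (10 * core + 5)"
  "straight (10 * core + 5) (11 * core + 5)" "straight (11 * core + 5) (12 * core + 5)"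
    "straight (12 * core + 5) (12 * core + 12)"
  by (rule straight_descent[where i = 3 and c = "5 * rim + 5" and a = "4 * rim + 4" and b = "6 * rim + 12"];
      use core_ge_12 in \<open>simp add: legs_def kink_free_def\<close>)+

lemma straight_fourth_leg:
  "straight (12 * core + 12) (12 * core + 19)" "straight (12 * core + 19) (13 * core + 19)"
    "straight (13 * core + 19) (14 * core + 19)"
  "straight (14 * core + 19) (15 * core + 19)" "straight (15 * core + 19) (16 * core + 19)"
    "straight (16 * core + 19) (16 * core + 20)"
  by (rule straight_ascent[where i = 0 and c = "- (7 * rim + 19)" and a = "6 * rim + 12" and b = perimeter];
      use core_ge_12 in \<open>simp add: legs_def kink_free_def perimeter_def\<close>)+

definition breakpoints :: "nat list" where
  "breakpoints = [0] @ [1..<J + 2] @ [2 * J + 1] @ [3 * J + 1..<4 * J + 2] @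
     [4 * J + 2, 4 * J + 3, 5 * J + 3, 6 * J + 3, 7 * J + 3, 8 * J + 3] @
     [8 * J + 4, 8 * J + 5, 9 * J + 5, 10 * J + 5, 11 * J + 5, 12 * J + 5] @
     [12 * J + 12, 12 * J + 19, 13 * J + 19, 14 * J + 19, 15 * J + 19, 16 * J + 19, 16 * J + 20]"

lemma length_breakpoints: "length breakpoints = 2 * J + 23"
  by (simp add: breakpoints_def)

lemma breakpoints_ends: "hd (map real breakpoints) = 0" "last (map real breakpoints) = perimeter"
  by (simp_all add: breakpoints_def perimeter_def)

lemma straight_breakpoints: "successively straight (map real breakpoints)"
proof -
  have upper: "successively (\<lambda>m n. straight (real m) (real n)) [1..<J + 2]"
    by (rule successively_upt) (rule straight_upper_winding; simp)
  have lower: "successively (\<lambda>m n. straight (real m) (real n)) [3 * J + 1..<4 * J + 2]"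
    by (rule successively_upt) (rule straight_lower_winding; simp)
  have ends: "hd [1..<J + 2] = 1" "last [1..<J + 2] = J + 1" "[1..<J + 2] \<noteq> []"
    "hd [3 * J + 1..<4 * J + 2] = 3 * J + 1" "last [3 * J + 1..<4 * J + 2] = 4 * J + 1" "[3 * J + 1..<4 * J + 2] \<noteq> []"
    by (simp_all del: upt_Suc)
  show ?thesis unfolding successively_map breakpoints_def successively_append_iff
    using upper lower straight_outside_windings straight_second_leg straight_third_leg straight_fourth_leg
    by (simp del: upt_Suc upt_conv_Cons add: ends successively_Cons)
qed

definition vertices :: "(real^3) list" where
  "vertices = map (\<lambda>t. shear (param t)) (butlast (map real breakpoints))"

lemma length_vertices: "length vertices = 2 * J + 22"
  by (simp add: vertices_def length_breakpoints)

lemma polygon_length_vertices: "0 < polygon_length vertices" "polygon_length vertices \<le> 26 * perimeter"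
proof -
  have length: "2 \<le> length (map real breakpoints)" by (simp add: length_breakpoints)
  have closed: "shear (param (last (map real breakpoints))) = shear (param (hd (map real breakpoints)))"
    by (simp only: breakpoints_ends param_closed)
  have lip: "successively (\<lambda>s t. dist (shear (param s)) (shear (param t)) \<le> 26 * (t - s)) (map real breakpoints)"
    by (rule successively_mono[OF straight_breakpoints]) (simp add: straight_def)
  have "param 0 \<noteq> param 1" using inj_onD[OF param_inj, of 0 1] core_ge_12 by (auto simp: perimeter_def)
  moreover have "map real breakpoints ! 0 = 0" "map real breakpoints ! 1 = 1"
    by (simp_all add: breakpoints_def nth_append)
  ultimately have "shear (param (map real breakpoints ! 0)) \<noteq> shear (param (map real breakpoints ! 1))"
    using inj_shear by (simp add: inj_eq)
  note bounds = polygon_length_bounds[where g = "\<lambda>t. shear (param t)", OF length closed lip this]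
  show "0 < polygon_length vertices" "polygon_length vertices \<le> 26 * perimeter"
    using bounds by (simp_all only: vertices_def breakpoints_ends diff_zero)
qed

lemma scaled_vertices:
  assumes "c > 0"
  shows "closed_polygonal_curve (map (\<lambda>p. c *\<^sub>R p) vertices)"
    "polygon_carrier (map (\<lambda>p. c *\<^sub>R p) vertices) = (\<lambda>p. c *\<^sub>R shear p) ` curve"
proof -
  let ?g = "\<lambda>t. c *\<^sub>R shear (param t)"
  have vertices: "map (\<lambda>p. c *\<^sub>R p) vertices = map ?g (butlast (map real breakpoints))" by (simp add: vertices_def)
  have length: "4 \<le> length (map real breakpoints)" by (simp add: length_breakpoints)
  have closed: "?g (last (map real breakpoints)) = ?g (hd (map real breakpoints))"
    by (simp only: breakpoints_ends param_closed)
  have "inj_on ?g {0..<perimeter}"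
  proof (rule inj_onI)
    fix s t assume "s \<in> {0..<perimeter}" "t \<in> {0..<perimeter}" "?g s = ?g t"
    then show "s = t" using assms inj_onD[OF param_inj, of s t] by (simp add: inj_eq[OF inj_shear])
  qed
  then have inj: "inj_on ?g {hd (map real breakpoints)..<last (map real breakpoints)}" by (simp only: breakpoints_ends)
  have "affine_on {s..t} ?g" if "straight s t" for s t
    using that by (auto simp: straight_def intro: affine_on_linear_compose[OF linear_scale_self])
  then have affine: "successively (\<lambda>s t. s < t \<and> affine_on {s..t} ?g) (map real breakpoints)"
    by (intro successively_mono[OF straight_breakpoints]) (auto simp: straight_def)
  have "?g ` {hd (map real breakpoints)..last (map real breakpoints)} = (\<lambda>p. c *\<^sub>R shear p) ` curve"
    unfolding breakpoints_ends param_image[symmetric] by (simp add: image_image)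
  with closed_polygon_parametrized[OF length affine inj closed]
  show "closed_polygonal_curve (map (\<lambda>p. c *\<^sub>R p) vertices)"
    "polygon_carrier (map (\<lambda>p. c *\<^sub>R p) vertices) = (\<lambda>p. c *\<^sub>R shear p) ` curve"
    unfolding vertices by simp_all
qed

lemma curve_far_from_slanted_axis:
  assumes "p \<in> curve"
  shows "core / 2 \<le> \<bar>p $ 1\<bar> + \<bar>p $ 3 - p $ 2\<bar>"
proof -
  obtain i where i: "i < 4" "live i (p $ 3)" "p $ 1 = strand_X i (p $ 3)" "p $ 2 = strand_Y i (p $ 3)"
    using assms by (auto simp: mem_curve)
  have "\<bar>p $ 2\<bar> \<le> 6" using strand_Y_bounds[OF i(1,2)] i(4) by linarith
  moreover have "\<bar>p $ 1\<bar> = core - \<bar>p $ 3\<bar>" if "\<bar>p $ 3\<bar> < core"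
    using i(1,3) that winding_outside[of "\<bar>p $ 3\<bar> - core"] by (auto simp: strand_X_def)
  ultimately show ?thesis using core_ge_12 by (cases "\<bar>p $ 3\<bar> < core") linarith+
qed

lemma scaled_curve_cylinder:
  assumes c: "c > 0" and r: "0 \<le> r" "r \<le> c * core / 4"
  shows "(\<lambda>p. c *\<^sub>R shear p) ` curve \<inter> Cyl r = {}"
proof (intro equals0I)
  fix z assume "z \<in> (\<lambda>p. c *\<^sub>R shear p) ` curve \<inter> Cyl r"
  then obtain p where p: "p \<in> curve" "z = c *\<^sub>R shear p" "z \<in> Cyl r" by blast
  define a b where "a = \<bar>p $ 1\<bar>" and "b = \<bar>p $ 3 - p $ 2\<bar>"
  have "(c * core / 2)\<^sup>2 \<le> (c * (a + b))\<^sup>2"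
    using curve_far_from_slanted_axis[OF p(1)] c core_ge_12
    by (intro power_mono) (auto simp: a_def b_def mult_left_mono)
  also have "\<dots> \<le> 2 * ((c * a)\<^sup>2 + (c * b)\<^sup>2)"
    using sum_squares_ge_zero[of "c * a - c * b" 0] by (simp add: power2_eq_square algebra_simps)
  also have "(c * a)\<^sup>2 + (c * b)\<^sup>2 \<le> r\<^sup>2" using p(2,3) by (simp add: Cyl_def a_def b_def power_mult_distrib)
  also have "r\<^sup>2 \<le> (c * core / 4)\<^sup>2" using r by (intro power_mono)
  finally have "(c * core)\<^sup>2 \<le> 0" by (simp add: power_divide)
  then show False using c core_ge_12 by simp
qed

end

section \<open>Counting triangles\<close>

lemma aff_dim_linear_image_collapse:
  fixes L :: "'a::euclidean_space \<Rightarrow> 'b::euclidean_space"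
  assumes "linear L" "p \<in> S" "q \<in> S" "p \<noteq> q" "L p = L q"
  shows "aff_dim (L ` S) < aff_dim S"
proof -
  have "\<not> affine_dependent {p, q}" by (rule affine_independent_2)
  then obtain B where B: "\<not> affine_dependent B" "{p, q} \<subseteq> B" "affine hull B = affine hull S"
    using extend_to_affine_basis_nonempty[of "{p, q}" S] assms by blast
  have finite: "finite B" using B(1) by (rule aff_independent_finite)
  have "L ` B = L ` (B - {p})" using B(2) assms(4,5) by (auto simp: image_iff)
  then have "card (L ` B) \<le> card (B - {p})" using finite by (simp add: card_image_le)
  also have "\<dots> < card B" using B(2) finite by (intro psubset_card_mono) auto
  finally have card: "card (L ` B) < card B" .
  have "aff_dim (L ` S) \<le> aff_dim (L ` (affine hull S))" by (intro aff_dim_subset image_mono hull_subset)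
  also have "\<dots> = aff_dim (affine hull (L ` B))"
    using assms(1) by (simp add: affine_hull_linear_image linear_conv_bounded_linear flip: B(3))
  also have "\<dots> \<le> int (card (L ` B)) - 1" using finite aff_dim_le_card[of "L ` B"] by simp
  also have "\<dots> < int (card B) - 1" using card by simp
  also have "\<dots> = aff_dim (affine hull S)" using aff_dim_affine_independent[OF B(1)] by (simp flip: B(3))
  finally show ?thesis by simp
qed

lemma interior_disk_empty:
  fixes D :: "'a::euclidean_space set"
  assumes "disk_bounded_by D K" "DIM('a) > 2"
  shows "interior D = {}"
proof (rule ccontr)
  assume nonempty: "interior D \<noteq> {}"
  obtain f g where hom: "homeomorphism (cball (0 :: real^2) 1) D f g" using assms(1) by (auto simp: disk_bounded_by_def)
  have g: "continuous_on D g" "inj_on g D" using hom by (auto simp: homeomorphism_def intro!: inj_on_inverseI[of D f g])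
  have "DIM('a) \<le> DIM(real^2)"
    using continuous_on_subset[OF g(1) interior_subset] inj_on_subset[OF g(2) interior_subset] nonempty open_interior
    by (intro invariance_of_dimension)
  then show False using assms(2) by simp
qed

definition project_xz :: "real^3 \<Rightarrow> real^2" where
  "project_xz p = vector [p $ 1, p $ 3]"

lemma project_xz_nth [simp]: "project_xz p $ 1 = p $ 1" "project_xz p $ 2 = p $ 3"
  by (simp_all add: project_xz_def)

lemma linear_project_xz: "linear project_xz"
  by (intro linearI) (simp_all add: vec_eq_iff forall_2)

lemma norm_project_xz_le: "norm (project_xz p) \<le> norm p"
  by (simp add: norm_vec_def L2_set_def sum_2 sum_3)

lemma mem_y_axis: "p \<in> y_axis \<longleftrightarrow> project_xz p = 0"
  by (simp add: y_axis_def vec_eq_iff forall_2)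

lemma mem_Cyl: "0 \<le> r \<Longrightarrow> p \<in> Cyl r \<longleftrightarrow> norm (project_xz p) \<le> r"
  by (simp add: Cyl_def norm_vec_2 real_sqrt_le_iff')

definition thin_shadows :: "(real^3) set set \<Rightarrow> (real^2) set" where
  "thin_shadows T = \<Union>((`) project_xz ` {S \<in> T. aff_dim (project_xz ` S) \<le> 1})"

lemma negligible_thin_shadows:
  assumes "simplicial_complex T"
  shows "negligible (thin_shadows T)"
  unfolding thin_shadows_def
proof (rule negligible_Union)
  show "finite ((`) project_xz ` {S \<in> T. aff_dim (project_xz ` S) \<le> 1})" using assms
    by (simp add: simplicial_complex_def)
  fix X assume "X \<in> (`) project_xz ` {S \<in> T. aff_dim (project_xz ` S) \<le> 1}"
  then obtain S where S: "X = project_xz ` S" "S \<in> T" "aff_dim (project_xz ` S) \<le> 1" by blast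
  then have "convex S" using assms by (auto simp: simplicial_complex_def dest: convex_simplex)
  then have "convex X" unfolding S(1) using linear_project_xz by (rule convex_linear_image[rotated])
  moreover have "interior X = {}" using S by (intro low_dim_interior) auto
  ultimately show "negligible X" by (simp add: negligible_convex_interior)
qed

lemma simplex_over_generic_point:
  assumes T: "simplicial_complex T" "interior (\<Union>T) = {}"
    and S: "S \<in> T" "p \<in> S" and generic: "project_xz p \<notin> thin_shadows T"
  shows "S \<in> triangles T"
proof -
  obtain n where n: "n simplex S" using T(1) S(1) by (auto simp: simplicial_complex_def)
  have dim: "aff_dim S = n" using n by (rule aff_dim_simplex)
  have "\<not> aff_dim (project_xz ` S) \<le> 1" using S generic unfolding thin_shadows_def by blast
  moreover have "aff_dim (project_xz ` S) \<le> aff_dim S" using linear_project_xz by (rule aff_dim_linear_image_le)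
  ultimately have "2 \<le> n" using dim by linarith
  moreover have "n \<noteq> 3"
  proof
    assume "n = 3"
    then have "affine hull S = UNIV" using dim by (subst aff_dim_eq_full[symmetric]) simp
    then have "interior S = rel_interior S" by (simp add: rel_interior_interior)
    moreover have "rel_interior S \<noteq> {}" using n S(2) by (auto simp: rel_interior_eq_empty convex_simplex)
    moreover have "interior S \<subseteq> interior (\<Union>T)" using S(1) by (intro interior_mono) auto
    ultimately show False using T(2) by simp
  qed
  moreover have "n \<le> 3" using aff_dim_le_DIM[of S] dim by simp
  ultimately have "n = 2" by linarith
  then show ?thesis using n S(1) by (simp add: triangles_def)
qed

lemma generic_line_meets_simplex_once:
  assumes T: "simplicial_complex T" "interior (\<Union>T) = {}" and S: "S \<in> T" "p \<in> S" "q \<in> S"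
    and generic: "project_xz p \<notin> thin_shadows T" and eq: "project_xz p = project_xz q"
  shows "p = q"
proof (rule ccontr)
  assume "p \<noteq> q"
  have "2 simplex S" using simplex_over_generic_point[OF T S(1,2) generic] by (simp add: triangles_def)
  then have "aff_dim (project_xz ` S) < 2"
    using aff_dim_linear_image_collapse[OF linear_project_xz S(2,3) \<open>p \<noteq> q\<close> eq] by (simp add: aff_dim_simplex)
  then have "project_xz p \<in> thin_shadows T" using S unfolding thin_shadows_def by auto
  then show False using generic by contradiction
qed

lemma generic_line_meets_few_triangles:
  assumes T: "simplicial_complex T" "interior (\<Union>T) = {}" and generic: "v \<notin> thin_shadows T"
  shows "finite {p \<in> \<Union>T. project_xz p = v}" "card {p \<in> \<Union>T. project_xz p = v} \<le> card (triangles T)"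
proof -
  let ?line = "{p \<in> \<Union>T. project_xz p = v}"
  have "\<forall>p\<in>?line. \<exists>S. S \<in> T \<and> p \<in> S" by auto
  from bchoice[OF this] obtain simplex_at where at: "\<And>p. p \<in> ?line \<Longrightarrow> simplex_at p \<in> T \<and> p \<in> simplex_at p" by blast
  have finite: "finite (triangles T)" using T(1) by (simp add: triangles_def simplicial_complex_def)
  have inj: "inj_on simplex_at ?line"
  proof (rule inj_onI)
    fix p q assume "p \<in> ?line" "q \<in> ?line" "simplex_at p = simplex_at q"
    then show "p = q" using at[of p] at[of q] generic generic_line_meets_simplex_once[OF T, of "simplex_at p" p q]
      by auto
  qed
  have image: "simplex_at ` ?line \<subseteq> triangles T" using simplex_over_generic_point[OF T] at generic by blast
  show "finite ?line" using inj image finite by (rule inj_on_finite)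
  show "card ?line \<le> card (triangles T)" using inj image finite by (rule card_inj_on_le)
qed

definition embed_xz :: "real^2 \<Rightarrow> real^3" where
  "embed_xz v = vector [v $ 1, 0, v $ 2]"

lemma embed_xz_nth [simp]: "embed_xz v $ 1 = v $ 1" "embed_xz v $ 2 = 0" "embed_xz v $ 3 = v $ 2"
  by (simp_all add: embed_xz_def)

lemma norm_embed_xz: "norm (embed_xz v) = norm v"
  by (simp add: norm_vec_def L2_set_def sum_2 sum_3)

lemma project_embed_xz: "project_xz (embed_xz v) = v"
  by (simp add: vec_eq_iff forall_2)

lemma linear_embed_xz: "linear embed_xz"
  by (intro linearI) (simp_all add: vec_eq_iff forall_3)

text \<open>A homeomorphism of space that moves the parallel of the \<open>y\<close>-axis over \<open>v\<close> to the \<open>y\<close>-axis and is the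
  identity outside the cylinder of radius \<open>\<rho>\<close> around that parallel.\<close>

definition cutoff :: "real \<Rightarrow> real^2 \<Rightarrow> real^3 \<Rightarrow> real" where
  "cutoff \<rho> v p = max 0 (1 - norm (project_xz p - v) / \<rho>)"

definition push :: "real \<Rightarrow> real^2 \<Rightarrow> real^3 \<Rightarrow> real^3" where
  "push \<rho> v p = p - cutoff \<rho> v p *\<^sub>R embed_xz v"

lemma continuous_push:
  assumes "\<rho> > 0"
  shows "continuous_on A (push \<rho> v)"
proof -
  have "continuous_on A project_xz" using linear_project_xz
    by (simp add: linear_continuous_on linear_conv_bounded_linear)
  then show ?thesis unfolding push_def cutoff_def using assms by (intro continuous_intros) auto
qed

lemma cutoff_lipschitz:
  assumes "\<rho> > 0"
  shows "\<bar>cutoff \<rho> v p - cutoff \<rho> v q\<bar> \<le> norm (p - q) / \<rho>"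
proof -
  have "\<bar>cutoff \<rho> v p - cutoff \<rho> v q\<bar> \<le> \<bar>norm (project_xz p - v) / \<rho> - norm (project_xz q - v) / \<rho>\<bar>"
    unfolding cutoff_def by linarith
  also have "\<dots> = \<bar>norm (project_xz p - v) - norm (project_xz q - v)\<bar> / \<rho>"
    using assms by (simp add: abs_divide flip: diff_divide_distrib)
  also have "\<bar>norm (project_xz p - v) - norm (project_xz q - v)\<bar> \<le> norm (project_xz (p - q))"
    using norm_triangle_ineq3[of "project_xz p - v" "project_xz q - v"] by (simp add: linear_diff[OF linear_project_xz])
  also have "\<dots> \<le> norm (p - q)" by (rule norm_project_xz_le)
  finally show ?thesis using assms by (simp add: divide_right_mono)
qed

lemma inj_push:
  assumes "norm v < \<rho>"
  shows "inj (push \<rho> v)"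
proof (rule injI)
  have \<rho>: "\<rho> > 0" using assms norm_ge_zero[of v] by linarith
  fix p q assume "push \<rho> v p = push \<rho> v q"
  then have eq: "p - q = (cutoff \<rho> v p - cutoff \<rho> v q) *\<^sub>R embed_xz v" by (simp add: push_def algebra_simps)
  have "norm (p - q) = \<bar>cutoff \<rho> v p - cutoff \<rho> v q\<bar> * norm v" unfolding eq by (simp add: norm_embed_xz)
  also have "\<dots> \<le> norm (p - q) / \<rho> * norm v" by (intro mult_right_mono cutoff_lipschitz \<rho>) simp
  finally have "\<rho> * norm (p - q) \<le> norm v * norm (p - q)" using \<rho> by (simp add: field_simps)
  then have "norm (p - q) = 0" using assms by (simp add: mult_le_cancel_right)
  then show "p = q" by simp
qed

lemma push_fixes:
  assumes "\<rho> > 0" "norm v + \<rho> \<le> norm (project_xz p)"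
  shows "push \<rho> v p = p"
proof -
  have "\<rho> \<le> norm (project_xz p - v)" using norm_triangle_ineq[of "project_xz p - v" v] assms(2) by simp
  then have "cutoff \<rho> v p = 0" using assms(1) by (simp add: cutoff_def)
  then show ?thesis by (simp add: push_def)
qed

lemma push_mem_y_axis:
  assumes "norm v < \<rho>"
  shows "push \<rho> v p \<in> y_axis \<longleftrightarrow> project_xz p = v"
proof -
  have project: "project_xz (push \<rho> v p) = project_xz p - cutoff \<rho> v p *\<^sub>R v" for p
    by (simp add: push_def linear_diff[OF linear_project_xz] linear_scale[OF linear_project_xz] project_embed_xz)
  have over_v: "push \<rho> v p = p - embed_xz v" if "project_xz p = v" for p using that by (simp add: push_def cutoff_def)
  show ?thesis
  proof
    assume "push \<rho> v p \<in> y_axis"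
    then have p: "project_xz p = cutoff \<rho> v p *\<^sub>R v" by (simp add: mem_y_axis project)
    define q where "q = p - embed_xz (project_xz p) + embed_xz v"
    have q: "project_xz q = v" unfolding q_def
      by (simp add: linear_add[OF linear_project_xz] linear_diff[OF linear_project_xz] project_embed_xz)
    have "push \<rho> v q = p - embed_xz (cutoff \<rho> v p *\<^sub>R v)" unfolding over_v[OF q] by (simp add: q_def p)
    also have "\<dots> = push \<rho> v p" by (simp add: push_def linear_scale[OF linear_embed_xz])
    finally show "project_xz p = v" using inj_push[OF assms] q by (simp add: inj_eq)
  next
    assume "project_xz p = v"
    then show "push \<rho> v p \<in> y_axis" using project[of p] by (simp add: mem_y_axis cutoff_def)
  qed
qed

theorem triangles_bound:
  assumes N: "\<And>D. disk_bounded_by D K \<Longrightarrow> finite (D \<inter> y_axis) \<Longrightarrow> N \<le> card (D \<inter> y_axis)"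
    and r: "r > 0" "K \<inter> Cyl r = {}" and "PL_triangulated_disk_bounded_by T K"
  shows "N \<le> card (triangles T)"
proof -
  have T: "simplicial_complex T" "disk_bounded_by (\<Union>T) K" using assms(4)
    by (auto simp: PL_triangulated_disk_bounded_by_def)
  then have empty: "interior (\<Union>T) = {}" by (intro interior_disk_empty) auto
  have "\<not> negligible (ball (0 :: real^2) (r / 2))" using r by (intro open_not_negligible) auto
  then have "\<not> ball 0 (r / 2) \<subseteq> thin_shadows T" using negligible_thin_shadows[OF T(1)] negligible_subset by blast
  then obtain v where v: "norm v < r / 2" "v \<notin> thin_shadows T" by (auto simp: subset_iff)
  let ?\<beta> = "push (r / 2) v"
  have inj: "inj_on ?\<beta> A" for A using inj_push[OF v(1)] by (rule inj_on_subset) simp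
  have "?\<beta> p = p" if "p \<in> K" for p
    using that r v(1) by (intro push_fixes) (auto simp: mem_Cyl disjoint_iff not_le)
  then have "?\<beta> ` K = K" by force
  then have disk: "disk_bounded_by (?\<beta> ` \<Union>T) K"
    using disk_bounded_by_image[OF T(2) continuous_push inj] r(1) by (metis half_gt_zero)
  define line where "line = {p \<in> \<Union>T. project_xz p = v}"
  have punctures: "?\<beta> ` \<Union>T \<inter> y_axis = ?\<beta> ` line" using push_mem_y_axis[OF v(1)] by (auto simp: line_def)
  note line = generic_line_meets_few_triangles[OF T(1) empty v(2), folded line_def]
  have "N \<le> card (?\<beta> ` \<Union>T \<inter> y_axis)" using disk line(1) by (intro N) (simp_all only: punctures finite_imageI)
  also have "\<dots> = card line" unfolding punctures by (rule card_image[OF inj])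
  also have "\<dots> \<le> card (triangles T)" by (rule line(2))
  finally show ?thesis .
qed

section \<open>The knots\<close>

context tangle
begin

definition knot :: "(real^3) list" where
  "knot = map (\<lambda>p. (1 / polygon_length vertices) *\<^sub>R p) vertices"

lemma scaled_puncture_bound:
  assumes c: "c > 0" and W: "disk_bounded_by W ((\<lambda>p. c *\<^sub>R shear p) ` curve)" "finite (W \<inter> y_axis)"
  shows "2 ^ (2 * j + 1) \<le> card (W \<inter> y_axis)"
proof -
  define unshear :: "real^3 \<Rightarrow> real^3" where "unshear q = vector [q $ 1 / c, q $ 2 / c, (q $ 3 + q $ 2) / c]" for q
  have nth: "unshear q $ 1 = q $ 1 / c" "unshear q $ 2 = q $ 2 / c" "unshear q $ 3 = (q $ 3 + q $ 2) / c" for q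
    by (simp_all add: unshear_def)
  have "linear unshear" by (intro linearI) (simp_all add: vec_eq_iff forall_3 nth add_divide_distrib distrib_left)
  then have continuous: "continuous_on W unshear" by (simp add: linear_continuous_on linear_conv_bounded_linear)
  have inj: "inj_on unshear A" for A by (rule inj_onI) (use c in \<open>auto simp: vec_eq_iff forall_3 nth\<close>)
  have inverse: "unshear (c *\<^sub>R shear p) = p" for p using c by (simp add: vec_eq_iff forall_3 nth right_diff_distrib)
  have disk: "disk_bounded_by (unshear ` W) curve"
    using disk_bounded_by_image[OF W(1) continuous inj] by (simp add: image_image inverse)
  have "unshear q \<in> slanted_axis \<longleftrightarrow> q \<in> y_axis" for q using c by (auto simp: slanted_axis_def y_axis_def nth)
  then have punctures: "unshear ` W \<inter> slanted_axis = unshear ` (W \<inter> y_axis)" by blast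
  have "2 ^ (2 * j + 1) \<le> card (unshear ` W \<inter> slanted_axis)" using disk W(2)
    by (intro puncture_bound) (simp_all add: punctures)
  also have "\<dots> = card (W \<inter> y_axis)" unfolding punctures by (rule card_image[OF inj])
  finally show ?thesis .
qed

lemma scale_pos: "1 / polygon_length vertices > 0"
  using polygon_length_vertices(1) by simp

lemma closed_polygonal_curve_knot: "closed_polygonal_curve knot"
  unfolding knot_def by (rule scaled_vertices(1)[OF scale_pos])

lemma polygon_carrier_knot: "polygon_carrier knot = (\<lambda>p. (1 / polygon_length vertices) *\<^sub>R shear p) ` curve"
  unfolding knot_def by (rule scaled_vertices(2)[OF scale_pos])

lemma unknotted_knot: "unknotted (polygon_carrier knot)"
  unfolding polygon_carrier_knot
proof (rule piecewise_affine_unknotted[OF curve_unknotted piecewise_affine_linear])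
  show "linear (\<lambda>p. (1 / polygon_length vertices) *\<^sub>R shear p)" using linear_shear by (rule linear_compose_scale_right)
  show "inj (\<lambda>p. (1 / polygon_length vertices) *\<^sub>R shear p)" using inj_shear scale_pos by (auto simp: inj_def)
qed

lemma length_polygon_edges_knot: "length (polygon_edges knot) = 24 * (2 * j + 1) + 22"
  by (simp add: polygon_edges_def knot_def length_vertices) (simp add: windings_def)

lemma knot_puncture_bound:
  "disk_bounded_by W (polygon_carrier knot) \<Longrightarrow> finite (W \<inter> y_axis) \<Longrightarrow> 2 ^ (2 * j + 1) \<le> card (W \<inter> y_axis)"
  unfolding polygon_carrier_knot by (rule scaled_puncture_bound[OF scale_pos])

lemma polygon_length_knot: "polygon_length knot = 1"
  unfolding knot_def polygon_length_scale[OF scale_pos] using polygon_length_vertices(1) by simp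

lemma knot_disjoint_Cyl: "polygon_carrier knot \<inter> Cyl (1 / 1872) = {}"
proof -
  have "polygon_length vertices \<le> 468 * core" using polygon_length_vertices(2) core_ge_12 by (simp add: perimeter_def)
  then have "1 / 1872 \<le> 1 / polygon_length vertices * core / 4" using polygon_length_vertices(1)
    by (simp add: field_simps)
  then show ?thesis unfolding polygon_carrier_knot by (intro scaled_curve_cylinder scale_pos) simp_all
qed

end

lemma piecewise_smooth_disk:
  assumes "piecewise_smooth_disk_bounded_by D K"
  shows "disk_bounded_by D K"
proof -
  obtain T B and f :: "real^2 \<Rightarrow> real^3" and g where D: "disk_bounded_by (\<Union>T) B" "homeomorphism (\<Union>T) D f g" "f ` B = K"
    using assms unfolding piecewise_smooth_disk_bounded_by_def PL_triangulated_disk_bounded_by_def by blast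
  have f: "f ` \<Union>T = D" "continuous_on (\<Union>T) f" using D(2) by (auto simp: homeomorphism_def)
  have "inj_on f (\<Union>T)" using D(2) by (intro inj_on_inverseI[of _ g]) (auto simp: homeomorphism_def)
  from disk_bounded_by_image[OF D(1) f(2) this] show ?thesis by (simp only: f(1) D(3))
qed

theorem theorem4p1:
  shows "\<exists>K :: nat \<Rightarrow> (real^3) list.
    (\<forall>n\<ge>1. closed_polygonal_curve (K n) \<and> unknotted (polygon_carrier (K n))) \<and>
    (\<forall>n\<ge>1. length (polygon_edges (K n)) \<le> 24 * n + 40) \<and>
    (\<forall>n\<ge>1. \<forall>D. piecewise_smooth_disk_bounded_by D (polygon_carrier (K n)) \<longrightarrow>
        infinite (D \<inter> y_axis) \<or> 2 ^ (n - 1) \<le> card (D \<inter> y_axis)) \<and>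
    (\<forall>n\<ge>1. \<forall>\<T>. PL_triangulated_disk_bounded_by \<T> (polygon_carrier (K n)) \<longrightarrow>
        2 ^ (n - 1) \<le> card (triangles \<T>)) \<and>
    (\<forall>n\<ge>1. polygon_length (K n) = 1) \<and>
    (\<exists>r\<^sub>0>0. \<forall>n\<ge>1. polygon_carrier (K n) \<inter> Cyl r\<^sub>0 = {})"
proof (rule exI[of _ "\<lambda>n. tangle.knot ((n - 1) div 2)"], intro conjI allI impI)
  have edges: "2 * ((n - 1) div 2) + 1 \<le> n" if "1 \<le> n" for n :: nat using that by linarith
  have punctures: "2 ^ (n - 1) \<le> card (D \<inter> y_axis)"
    if "disk_bounded_by D (polygon_carrier (tangle.knot ((n - 1) div 2)))" "finite (D \<inter> y_axis)" for n :: nat and D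
  proof -
    have "2 ^ (n - 1) \<le> (2 :: nat) ^ (2 * ((n - 1) div 2) + 1)" by (intro power_increasing) auto
    also have "\<dots> \<le> card (D \<inter> y_axis)" using that by (rule tangle.knot_puncture_bound)
    finally show ?thesis .
  qed
  fix n :: nat assume n: "1 \<le> n"
  let ?knot = "tangle.knot ((n - 1) div 2)"
  show "closed_polygonal_curve ?knot" by (rule tangle.closed_polygonal_curve_knot)
  show "unknotted (polygon_carrier ?knot)" by (rule tangle.unknotted_knot)
  show "length (polygon_edges ?knot) \<le> 24 * n + 40" using edges[OF n] by (simp add: tangle.length_polygon_edges_knot)
  show "infinite (D \<inter> y_axis) \<or> 2 ^ (n - 1) \<le> card (D \<inter> y_axis)"
    if "piecewise_smooth_disk_bounded_by D (polygon_carrier ?knot)" for D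
    using punctures[OF piecewise_smooth_disk[OF that]] by blast
  show "2 ^ (n - 1) \<le> card (triangles \<T>)" if "PL_triangulated_disk_bounded_by \<T> (polygon_carrier ?knot)" for \<T>
    using punctures tangle.knot_disjoint_Cyl that by (intro triangles_bound[of _ _ "1 / 1872"]) auto
  show "polygon_length ?knot = 1" by (rule tangle.polygon_length_knot)
next
  show "\<exists>r\<^sub>0>0. \<forall>n\<ge>1. polygon_carrier (tangle.knot ((n - 1) div 2)) \<inter> Cyl r\<^sub>0 = {}"
    using tangle.knot_disjoint_Cyl by (intro exI[of _ "1 / 1872"]) simp
qed

end
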